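(* Let $(X,\mathbb{P})$ be a spectrally positive Lévy process which is not a subordinator, with $\mathbb{P}(X_0=0)=1$, such that for all $t>0$ the law of $X_t$ is absolutely continuous with respect to the Lebesgue measure, with density $p_t(x)$. Let $\overline{X}_t=\sup_{u\le t}X_u$ and $\underline{X}_t=\inf_{u\le t}X_u$. Then the laws of $(\overline{X}_t,X_t)$ and $(\underline{X}_t,X_t)$, $t>0$, admit the following expressions: $$\mathbb{P}(\underline{X}_t<-x,\,X_t\in \mathrm{d}z)=\int_0^t\frac{x}{s}\,p_s(-x)\,p_{t-s}(x+z)\,\mathrm{d}s\,\mathrm{d}z,\qquad -x\le z,\ x>0,$$ $$\mathbb{P}(\overline{X}_t>x,\,X_t\in \mathrm{d}z)=\int_0^t\frac{x-z}{s}\,p_s(z-x)\,p_{t-s}(x)\,\mathrm{d}s\,\mathrm{d}z,\qquad x>z,\ x\ge0.$$ The process $(X,\mathbb{P})$ has bounded variation if and only if for all $t\ge0$, $\mathbb{P}(\overline{X}_t=0)>0$ and $\mathbb{P}(\underline{X}_t=X_t)>0$. In this case, the expressions above are completed by the following one, for $t>0$: $$\mathbb{P}(\overline{X}_t=0,\,X_t\in \mathrm{d}z)=\mathbb{P}(\underline{X}_t=X_t\in \mathrm{d}z)=-\frac{z}{ct}\,p_t(z)\,\mathrm{d}z,\qquad z<0,$$ where $-c$ is the drift of $X$.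
   Context: $X=(X_t)_{t\ge0}$ is a real-valued càdlàg Lévy process; spectrally positive means no negative jumps; a subordinator is a Lévy process with non-decreasing paths. When $X$ has bounded variation, it is of the form $X_t=Y_t-ct$ where $Y$ is a subordinator with no drift and $c>0$ is a constant; the drift of $X$ is then $-c$.
   Formalization: The density p_t(x) is taken jointly measurable in (t,x); the first two formulas are stated for almost every level x for an arbitrary such version, and for every x when p satisfies Chapman–Kolmogorov at every point, since changing p at one point breaks them otherwise. *)

theory Defs
  imports "HOL-Probability.Probability"
begin

definition cadlag :: "(real \<Rightarrow> real) \<Rightarrow> bool" where
  "cadlag f \<longleftrightarrow>
     (\<forall>t\<ge>0. continuous (at_right t) f) \<and> (\<forall>t>0. \<exists>l. (f \<longlongrightarrow> l) (at_left t))"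

text \<open>Time runs over \<open>[0, \<infinity>)\<close>; the values of \<open>X\<close> at negative times are irrelevant.
  A Levy process starts at 0 almost surely, and all its paths are cadlag, so that suprema and
  infima over \<open>[0, t]\<close> are finite and measurable without completing \<open>M\<close>.\<close>

definition levy_process :: "'a measure \<Rightarrow> (real \<Rightarrow> 'a \<Rightarrow> real) \<Rightarrow> bool" where
  "levy_process M X \<longleftrightarrow>
     prob_space M \<and>
     (\<forall>t\<ge>0. X t \<in> borel_measurable M) \<and>
     (AE \<omega> in M. X 0 \<omega> = 0) \<and>
     (\<forall>\<omega>\<in>space M. cadlag (\<lambda>t. X t \<omega>)) \<and>
     (\<forall>n u. incseq u \<and> u 0 \<ge> 0 \<longrightarrow>
        prob_space.indep_vars M (\<lambda>_. borel) (\<lambda>i \<omega>. X (u (Suc i)) \<omega> - X (u i) \<omega>) {..<n::nat}) \<and>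
     (\<forall>s\<ge>0. \<forall>h\<ge>0. distr M borel (\<lambda>\<omega>. X (s + h) \<omega> - X s \<omega>) = distr M borel (X h))"

definition jump :: "(real \<Rightarrow> real) \<Rightarrow> real \<Rightarrow> real" where
  "jump f t = f t - Lim (at_left t) f"

definition spectrally_positive :: "'a measure \<Rightarrow> (real \<Rightarrow> 'a \<Rightarrow> real) \<Rightarrow> bool" where
  "spectrally_positive M X \<longleftrightarrow> (AE \<omega> in M. \<forall>t>0. jump (\<lambda>u. X u \<omega>) t \<ge> 0)"

definition subordinator :: "'a measure \<Rightarrow> (real \<Rightarrow> 'a \<Rightarrow> real) \<Rightarrow> bool" where
  "subordinator M X \<longleftrightarrow> levy_process M X \<and> (AE \<omega> in M. mono_on {0..} (\<lambda>t. X t \<omega>))"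

text \<open>A subordinator has no drift when it is the sum of its jumps.\<close>

definition driftless_subordinator :: "'a measure \<Rightarrow> (real \<Rightarrow> 'a \<Rightarrow> real) \<Rightarrow> bool" where
  "driftless_subordinator M Y \<longleftrightarrow>
     subordinator M Y \<and>
     (AE \<omega> in M. \<forall>t\<ge>0. (jump (\<lambda>u. Y u \<omega>) has_sum Y t \<omega>) {0<..t})"

definition has_drift :: "'a measure \<Rightarrow> (real \<Rightarrow> 'a \<Rightarrow> real) \<Rightarrow> real \<Rightarrow> bool" where
  "has_drift M X d \<longleftrightarrow>
     (\<exists>Y. driftless_subordinator M Y \<and> (AE \<omega> in M. \<forall>t\<ge>0. X t \<omega> = Y t \<omega> + d * t))"

definition bounded_variation_on :: "real \<Rightarrow> real \<Rightarrow> (real \<Rightarrow> real) \<Rightarrow> bool" where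
  "bounded_variation_on a b f \<longleftrightarrow>
     (\<exists>K. \<forall>(n::nat) u. incseq u \<and> range u \<subseteq> {a..b} \<longrightarrow> (\<Sum>i<n. \<bar>f (u (Suc i)) - f (u i)\<bar>) \<le> K)"

definition bounded_variation :: "'a measure \<Rightarrow> (real \<Rightarrow> 'a \<Rightarrow> real) \<Rightarrow> bool" where
  "bounded_variation M X \<longleftrightarrow>
     (AE \<omega> in M. \<forall>t\<ge>0. bounded_variation_on 0 t (\<lambda>s. X s \<omega>))"

text \<open>Densities take values in \<open>[0, \<infinity>]\<close>: the version of the densities that satisfies the
  Chapman-Kolmogorov equation at every point can be infinite at some points.\<close>

definition transition_density ::
  "'a measure \<Rightarrow> (real \<Rightarrow> 'a \<Rightarrow> real) \<Rightarrow> (real \<Rightarrow> real \<Rightarrow> ennreal) \<Rightarrow> bool" where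
  "transition_density M X p \<longleftrightarrow>
     (\<forall>t>0. distributed M lborel (X t) (p t)) \<and>
     (\<lambda>(t, x). p t x) \<in> borel_measurable (restrict_space (borel \<Otimes>\<^sub>M borel) ({0<..} \<times> UNIV))"

definition chapman_kolmogorov :: "(real \<Rightarrow> real \<Rightarrow> ennreal) \<Rightarrow> bool" where
  "chapman_kolmogorov p \<longleftrightarrow>
     (\<forall>s>0. \<forall>t>0. \<forall>x. p (s + t) x = (\<integral>\<^sup>+ y. p s y * p t (x - y) \<partial>lborel))"

end

theory Submission
  imports Defs "HOL-Real_Asymp.Real_Asymp"
begin

text \<open>Write \<open>I\<close> and \<open>S\<close> for the running infimum and supremum. For a random walk, the cyclic lemma relates the
  expected amount by which step \<open>k\<close> lowers the running minimum to the negative part of the walk at time \<open>k\<close>,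
  divided by \<open>k\<close>, jointly with everything that happens from time \<open>k\<close> on. Without negative jumps, \<open>X\<close> passes
  downwards continuously, so refining the grid turns the accumulated descents into an integral over the
  levels passed: this gives Kendall's identity together with the Markov property at first passage times for almost
  every level, and hence the law of \<open>(I\<^sub>t, X\<^sub>t)\<close>. Reversing time gives the law of \<open>(S\<^sub>t, X\<^sub>t)\<close>. Under the
  Chapman-Kolmogorov equation every level is reached: one inequality comes from decomposing the passage at a
  nearby good level, the other one from comparing total masses.

  If \<open>X\<close> has drift \<open>-c\<close>, the last step of the same identity, reversed in time, compares \<open>E[X\<^sub>t\<^sup>-; X\<^sub>t \<in> B] / t\<close> with
  \<open>c P(S\<^sub>t = 0, X\<^sub>t \<in> B)\<close>. If \<open>S\<^sub>t = 0\<close> has positive probability, it also bounds the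
  expected truncated negative variation, which forces bounded variation. Conversely, for bounded variation the negative variation and the
  continuous part of the increments are limits of sums of small independent terms, hence deterministic and linear in
  time; this identifies the drift.\<close>

section \<open>Cadlag paths and dyadic grids\<close>

text \<open>The passage formulas use \<open>p s\<close> at single points, while a density is fixed
  only up to null sets: changing every \<open>p s\<close> at the point \<open>-x\<close> can change
  the right-hand side but not the process. Without a further condition a null set of levels must
  therefore be excepted. It arises because the discrete identity controls descents, that is, levels
  integrated over an interval, and isolating one level amounts to differentiating in
  \<open>x\<close>. The Chapman-Kolmogorov equation makes the densities rigid:
  \<open>q u (- (a + b))\<close> becomes an expectation of a density at an earlier time, so
  inequalities between laws yield inequalities at a point. For the infimum, a product of two passage
  densities is split by partial fractions, and the comparison of masses requires that the process
  enter the negative half-line at once; this is where subordinators are excluded. For the supremum,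
  a short initial run replaces the level by a random one with a density, which avoids every null
  set. The constant \<open>c\<close> enters as the limit of \<open>E[X_h^-] / h\<close> along dyadic
  \<open>h\<close>: no monotone process made of jumps alone compensates a positive proportion of a
  linear decrease over small times.\<close>

lemma cadlag_local:
  assumes "cadlag f" "x \<ge> 0" "e > 0"
  obtains l d where "d > 0" "\<And>u. x \<le> u \<Longrightarrow> u < x + d \<Longrightarrow> \<bar>f u - f x\<bar> < e"
    "\<And>u. 0 \<le> u \<Longrightarrow> x - d < u \<Longrightarrow> u < x \<Longrightarrow> \<bar>f u - l\<bar> < e" "x > 0 \<Longrightarrow> (f \<longlongrightarrow> l) (at_left x)"
proof -
  have "(f \<longlongrightarrow> f x) (at_right x)"
    using assms by (auto simp: cadlag_def continuous_within)
  then have "eventually (\<lambda>u. dist (f u) (f x) < e) (at_right x)"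
    using \<open>e > 0\<close> by (rule tendstoD)
  then obtain b where b: "b > x" "\<And>u. u > x \<Longrightarrow> u < b \<Longrightarrow> dist (f u) (f x) < e"
    by (auto simp: eventually_at_right_field)
  show ?thesis
  proof (cases "x > 0")
    case True
    then obtain l where l: "(f \<longlongrightarrow> l) (at_left x)"
      using assms by (auto simp: cadlag_def)
    then have "eventually (\<lambda>u. dist (f u) l < e) (at_left x)"
      using \<open>e > 0\<close> by (rule tendstoD)
    then obtain a where a: "a < x" "\<And>u. u > a \<Longrightarrow> u < x \<Longrightarrow> dist (f u) l < e"
      by (auto simp: eventually_at_left_field)
    show ?thesis
    proof (rule that[of "min (b - x) (x - a)" l])
      fix u assume "x \<le> u" "u < x + min (b - x) (x - a)"
      then show "\<bar>f u - f x\<bar> < e" using b(2)[of u] \<open>e > 0\<close> by (cases "u = x") (auto simp: dist_real_def)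
    next
      fix u assume "0 \<le> u" "x - min (b - x) (x - a) < u" "u < x"
      then show "\<bar>f u - l\<bar> < e" using a(2)[of u] by (auto simp: dist_real_def)
    qed (use a b l in auto)
  next
    case False
    show ?thesis
    \<comment> \<open>At \<open>x = 0\<close> no time lies to the left, so \<open>0\<close> is a
      dummy for the left limit.\<close>
    proof (rule that[of "b - x" 0])
      fix u assume "x \<le> u" "u < x + (b - x)"
      then show "\<bar>f u - f x\<bar> < e" using b(2)[of u] \<open>e > 0\<close> by (cases "u = x") (auto simp: dist_real_def)
    qed (use b False \<open>x \<ge> 0\<close> in auto)
  qed
qed

text \<open>Bisection: near every point the path stays within distance 1 of its value or of its left
  limit, and bounds on adjacent intervals combine.\<close>

lemma cadlag_bounded:
  assumes "cadlag f"
  obtains K where "\<And>u. 0 \<le> u \<Longrightarrow> u \<le> t \<Longrightarrow> \<bar>f u\<bar> \<le> K"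
proof (cases "t \<ge> 0")
  case True
  \<comment> \<open>The guard \<open>0 \<le> u\<close> is there because the local condition of
    \<open>Bolzano\<close> also admits intervals reaching below 0, where \<open>cadlag\<close> says
    nothing.\<close>
  define P where "P a b \<longleftrightarrow> (\<exists>K. \<forall>u. 0 \<le> u \<and> a \<le> u \<and> u \<le> b \<longrightarrow> \<bar>f u\<bar> \<le> K)" for a b
  have "P 0 t"
  proof (rule Bolzano[of 0 t P])
    fix a b c assume "P a b" "P b c"
    then obtain K L where "\<forall>u. 0 \<le> u \<and> a \<le> u \<and> u \<le> b \<longrightarrow> \<bar>f u\<bar> \<le> K"
      "\<forall>u. 0 \<le> u \<and> b \<le> u \<and> u \<le> c \<longrightarrow> \<bar>f u\<bar> \<le> L" by (auto simp: P_def)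
    then have "\<forall>u. 0 \<le> u \<and> a \<le> u \<and> u \<le> c \<longrightarrow> \<bar>f u\<bar> \<le> max K L"
      by (metis max.coboundedI1 max.coboundedI2 nle_le)
    then show "P a c" unfolding P_def by blast
  next
    fix x :: real assume "0 \<le> x"
    then obtain l d where d: "d > 0" "\<And>u. x \<le> u \<Longrightarrow> u < x + d \<Longrightarrow> \<bar>f u - f x\<bar> < 1"
      "\<And>u. 0 \<le> u \<Longrightarrow> x - d < u \<Longrightarrow> u < x \<Longrightarrow> \<bar>f u - l\<bar> < 1"
      using cadlag_local[OF assms, of x 1] by (metis zero_less_one)
    have "P a b" if ab: "a \<le> x" "x \<le> b" "b - a < d" for a b
      unfolding P_def
    proof (intro exI allI impI)
      fix u assume u: "0 \<le> u \<and> a \<le> u \<and> u \<le> b"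
      show "\<bar>f u\<bar> \<le> \<bar>f x\<bar> + \<bar>l\<bar> + 1"
      proof (cases "x \<le> u")
        case True then show ?thesis using d(2)[of u] u ab by linarith
      next
        case False then show ?thesis using d(3)[of u] u ab by linarith
      qed
    qed
    then show "\<exists>d>0. \<forall>a b. a \<le> x \<and> x \<le> b \<and> b - a < d \<longrightarrow> P a b" using d(1) by blast
  qed (use True in auto)
  then show ?thesis using that by (auto simp: P_def)
qed (use that in force)

lemma cadlag_bdd:
  assumes "cadlag f"
  shows "bdd_below (f ` {0..t})" "bdd_above (f ` {0..t})"
proof -
  obtain K where "\<And>u. 0 \<le> u \<Longrightarrow> u \<le> t \<Longrightarrow> \<bar>f u\<bar> \<le> K"
    using cadlag_bounded[OF assms] by metis
  then show "bdd_below (f ` {0..t})" "bdd_above (f ` {0..t})"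
    by (auto intro!: bdd_belowI2[of _ "-K"] bdd_aboveI2[of _ _ K] simp: abs_le_iff minus_le_iff)
qed

text \<open>Close to any time the path stays within \<open>e/2\<close> of its one-sided limits, and
  crossing that time adds only its jump, which is not negative. A Lebesgue number of the resulting
  cover makes the step size uniform on \<open>[0, t]\<close>.\<close>

lemma no_negative_jump_imp_small_drops:
  assumes f: "cadlag f" and jmp: "\<And>s. 0 < s \<Longrightarrow> s \<le> t \<Longrightarrow> jump f s \<ge> 0" and e: "e > 0"
  obtains d where "d > 0" "\<And>s u. 0 \<le> s \<Longrightarrow> s \<le> u \<Longrightarrow> u \<le> t \<Longrightarrow> u - s < d \<Longrightarrow> f s - e \<le> f u"
proof (cases "t \<ge> 0")
  case True
  have "\<exists>d>0. \<forall>s u. 0 \<le> s \<longrightarrow> s \<le> u \<longrightarrow> x - d < s \<longrightarrow> u < x + d \<longrightarrow> f s - e \<le> f u"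
    if x: "x \<in> {0..t}" for x
  proof -
    obtain l d where d: "d > 0" "\<And>u. x \<le> u \<Longrightarrow> u < x + d \<Longrightarrow> \<bar>f u - f x\<bar> < e/2"
      "\<And>u. 0 \<le> u \<Longrightarrow> x - d < u \<Longrightarrow> u < x \<Longrightarrow> \<bar>f u - l\<bar> < e/2"
      and l: "x > 0 \<Longrightarrow> (f \<longlongrightarrow> l) (at_left x)"
      using cadlag_local[OF f, of x "e/2"] x e by (smt (verit) atLeastAtMost_iff half_gt_zero)
    have lx: "x > 0 \<Longrightarrow> l \<le> f x"
      using jmp[of x] tendsto_Lim[OF _ l] x by (auto simp: jump_def trivial_limit_at_left_real)
    show ?thesis
    proof (intro exI[of _ d] conjI allI impI d(1))
      fix s u assume su: "0 \<le> s" "s \<le> u" "x - d < s" "u < x + d"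
      consider "x \<le> s" | "s < x" "x \<le> u" | "u < x" by linarith
      then show "f s - e \<le> f u"
      proof cases
        case 1 then show ?thesis using d(2)[of s] d(2)[of u] su by linarith
      next
        case 2 then show ?thesis using d(3)[of s] d(2)[of u] su lx by linarith
      next
        case 3 then show ?thesis using d(3)[of s] d(3)[of u] su by linarith
      qed
    qed
  qed
  then obtain d where d: "\<And>x. x \<in> {0..t} \<Longrightarrow> d x > 0"
    "\<And>x s u. x \<in> {0..t} \<Longrightarrow> 0 \<le> s \<Longrightarrow> s \<le> u \<Longrightarrow> x - d x < s \<Longrightarrow> u < x + d x \<Longrightarrow> f s - e \<le> f u"
    by metis
  obtain \<delta> where \<delta>: "0 < \<delta>"
    "\<And>T. \<lbrakk>T \<subseteq> {0..t}; diameter T < \<delta>\<rbrakk> \<Longrightarrow> \<exists>B \<in> (\<lambda>x. ball x (d x)) ` {0..t}. T \<subseteq> B"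
  proof (rule Lebesgue_number_lemma[of "{0..t}" "(\<lambda>x. ball x (d x)) ` {0..t}"])
    show "{0..t} \<subseteq> \<Union> ((\<lambda>x. ball x (d x)) ` {0..t})"
      using d(1) by force
  qed (use True in auto)
  show ?thesis
  proof (rule that[OF \<delta>(1)])
    fix s u assume su: "0 \<le> s" "s \<le> u" "u \<le> t" "u - s < \<delta>"
    have "diameter {s..u} < \<delta>" using su by (simp add: diameter_closed_interval)
    then obtain x where x: "x \<in> {0..t}" "{s..u} \<subseteq> ball x (d x)"
      using \<delta>(2)[of "{s..u}"] su by auto
    then have "s \<in> ball x (d x)" "u \<in> ball x (d x)" using su by auto
    then show "f s - e \<le> f u"
      using d(2)[OF x(1) su(1,2)] by (auto simp: dist_real_def)
  qed
qed (use that[of 1] in auto)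

section \<open>Infima along dyadic grids\<close>

lemma dyadic_dense:
  fixes a b t :: real
  assumes "0 \<le> a" "a < b" "0 < t"
  obtains m k :: nat where "a < real k * t / 2 ^ m" "real k * t / 2 ^ m < b"
proof -
  obtain m where m: "t / (b - a) < 2 ^ m"
    using real_arch_pow[of 2 "t / (b - a)"] by auto
  define k where "k = nat \<lfloor>a * 2 ^ m / t\<rfloor> + 1"
  have nn: "0 \<le> a * 2 ^ m / t" using assms by simp
  have k: "a * 2 ^ m / t < real k" "real k \<le> a * 2 ^ m / t + 1"
    unfolding k_def using nn by (linarith, linarith)
  have "a < real k * t / 2 ^ m" using k(1) assms by (simp add: field_simps)
  moreover have "real k * t / 2 ^ m \<le> a + t / 2 ^ m" using k(2) assms by (simp add: field_simps)
  moreover have "t / 2 ^ m < b - a" using m assms by (simp add: field_simps)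
  ultimately show ?thesis using that[of k m] by linarith
qed

lemma dyadic_refine:
  assumes "m \<le> m'"
  shows "real k * t / 2 ^ m = real (k * 2 ^ (m' - m)) * t / 2 ^ m'"
proof -
  have "(2::real) ^ m' = 2 ^ m * 2 ^ (m' - m)" using assms by (simp flip: power_add)
  then show ?thesis by simp
qed

lemma cadlag_less_near:
  assumes "cadlag f" "0 \<le> u" "u < v" "f u < a"
  obtains w where "u < w" "w < v" "\<And>r. u \<le> r \<Longrightarrow> r < w \<Longrightarrow> f r < a"
proof -
  obtain d l where d: "d > 0" "\<And>r. u \<le> r \<Longrightarrow> r < u + d \<Longrightarrow> \<bar>f r - f u\<bar> < a - f u"
    using cadlag_local[OF assms(1,2), of "a - f u"] assms(4) by (metis diff_gt_0_iff_gt)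
  show ?thesis
  proof (rule that[of "min (u + d) ((u+v)/2)"])
    fix r assume "u \<le> r" "r < min (u + d) ((u+v)/2)"
    then show "f r < a" using d(2)[of r] by (simp add: abs_less_iff)
  qed (use d(1) assms(3) in \<open>auto simp: min_less_iff_disj\<close>)
qed

text \<open>Right continuity moves a witness to a dyadic point strictly to its right. Only the end
  point \<open>t\<close> admits no such move, but it lies on every grid.\<close>

lemma cadlag_dyadic_less:
  assumes f: "cadlag f" and t: "0 \<le> t" and ex: "\<exists>u\<in>{s..t}. f u < a" and s: "0 \<le> s"
  obtains m k :: nat where "k \<le> 2 ^ m" "s \<le> real k * t / 2 ^ m"
    "real k * t / 2 ^ m = t \<or> s < real k * t / 2 ^ m" "f (real k * t / 2 ^ m) < a"
proof -
  obtain u where u: "s \<le> u" "u \<le> t" "f u < a" using ex by auto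
  show ?thesis
  proof (cases "u = t")
    case True then show ?thesis using that[of 1 0] u by simp
  next
    case False
    then have "u < t" using u by simp
    obtain w where w: "u < w" "w < t" "\<And>r. u \<le> r \<Longrightarrow> r < w \<Longrightarrow> f r < a"
      using cadlag_less_near[OF f _ \<open>u < t\<close> u(3)] s u(1) by (metis order_trans)
    obtain m k where mk: "u < real k * t / 2 ^ m" "real k * t / 2 ^ m < w"
      using dyadic_dense[of u w t] w s u by (metis \<open>u < t\<close> order_trans order_le_less_trans)
    have "real k * t / 2 ^ m < t" using mk w by linarith
    then have "real k < 2 ^ m" using \<open>u < t\<close> s u by (simp add: field_simps)
    then have "k \<le> 2 ^ m" by (metis less_imp_le of_nat_less_iff of_nat_numeral of_nat_power)
    then show ?thesis using that[of k m] mk w(3) u by auto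
  qed
qed

text \<open>Open half-lines and right continuity make a countable set of times sufficient. This
  serves two purposes: the countable union gives measurability, and along refining grids it lets
  laws of infima be computed from finitely many increments.\<close>

lemma INF_less_dyadic_iff:
  assumes f: "cadlag f" and t: "0 \<le> t"
  shows "(INF u\<in>{0..t}. f u) < a \<longleftrightarrow> (\<exists>m. \<exists>k\<le>2 ^ m. f (real k * t / 2 ^ m) < a)"
proof -
  have "(INF u\<in>{0..t}. f u) < a \<longleftrightarrow> (\<exists>u\<in>{0..t}. f u < a)"
    using cINF_less_iff[of "{0..t}" f a] cadlag_bdd(1)[OF f] t by auto
  also have "\<dots> \<longleftrightarrow> (\<exists>m. \<exists>k\<le>2 ^ m. f (real k * t / 2 ^ m) < a)"
  proof
    assume "\<exists>u\<in>{0..t}. f u < a"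
    then show "\<exists>m. \<exists>k\<le>2 ^ m. f (real k * t / 2 ^ m) < a"
      using cadlag_dyadic_less[OF f t, of 0 a] by (metis order_refl)
  next
    assume "\<exists>m. \<exists>k\<le>2 ^ m. f (real k * t / 2 ^ m) < a"
    then obtain m k where k: "k \<le> 2 ^ m" "f (real k * t / 2 ^ m) < a" by auto
    have "real k \<le> 2 ^ m" using k(1) by (metis of_nat_le_iff of_nat_numeral of_nat_power)
    then have "real k * t / 2 ^ m \<in> {0..t}"
      using t by (auto simp: field_simps intro: mult_left_mono)
    then show "\<exists>u\<in>{0..t}. f u < a" using k by auto
  qed
  finally show ?thesis .
qed

text \<open>The grids are nested, so the events they define increase with \<open>m\<close> and
  continuity from below applies.\<close>

lemma dyadic_less_mono:
  assumes "m \<le> m'" "\<exists>k\<le>2 ^ m. P (real k * t / 2 ^ m)"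
  shows "\<exists>k\<le>2 ^ m'. P (real k * t / 2 ^ m')"
proof -
  obtain k where k: "k \<le> 2 ^ m" "P (real k * t / 2 ^ m)" using assms(2) by auto
  have "k * 2 ^ (m' - m) \<le> 2 ^ m * 2 ^ (m' - m)" using k by simp
  also have "\<dots> = 2 ^ m'" using assms(1) by (simp flip: power_add)
  finally show ?thesis using k(2) dyadic_refine[OF assms(1), of k t] by metis
qed

section \<open>Descents of a sequence and the cyclic lemma\<close>

definition descent :: "(nat \<Rightarrow> real) \<Rightarrow> nat \<Rightarrow> real" where
  "descent S k = max 0 (Min (S ` {..<k}) - S k)"

text \<open>Indices from \<open>k\<close> on stay fixed, hence partial sums of length at least
  \<open>k\<close> are unchanged by the rotation. This is what allows everything from time
  \<open>k\<close> on to be carried along as a weight.\<close>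

definition rot :: "nat \<Rightarrow> nat \<Rightarrow> nat \<Rightarrow> nat" where
  "rot k r i = (if i < k then (i + r) mod k else i)"

lemma descent_nonneg [simp]: "0 \<le> descent S k"
  by (simp add: descent_def)

text \<open>The cyclic lemma: extend the increments periodically. If the sum \<open>P k\<close> over a period is
  negative, the minimum over the last period before time \<open>r + k\<close> is the minimum of the whole past,
  so the descents of the rotated walks telescope.\<close>

lemma sum_descent_rot:
  fixes v :: "nat \<Rightarrow> real"
  assumes k: "0 < k"
  shows "(\<Sum>r<k. descent (\<lambda>j. \<Sum>i<j. v (rot k r i)) k) = max 0 (- (\<Sum>i<k. v i))"
proof -
  define P where "P j = (\<Sum>i<j. v (i mod k))" for j
  define Mn where "Mn r = Min (P ` {r..<r + k})" for r
  have Pk: "P k = (\<Sum>i<k. v i)" unfolding P_def by (rule sum.cong) auto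
  have part: "(\<Sum>i<j. v (rot k r i)) = P (r + j) - P r" if "j \<le> k" for r j
    using that
  proof (induction j)
    case (Suc j)
    then show ?case by (simp add: P_def rot_def add.commute)
  qed simp
  have per: "P (r + k) = P r + P k" for r
  proof (induction r)
    case (Suc r)
    then show ?case by (simp add: P_def)
  qed (simp add: P_def)
  have desc: "descent (\<lambda>j. \<Sum>i<j. v (rot k r i)) k = max 0 (Mn r - P (r + k))" for r
  proof -
    have "(\<lambda>j. \<Sum>i<j. v (rot k r i)) ` {..<k} = (\<lambda>j. P (r + j) - P r) ` {..<k}"
      using part by (intro image_cong) auto
    also have "\<dots> = (\<lambda>y. y - P r) ` (P ` {r..<r + k})"
    proof -
      have "{r..<r + k} = (+) r ` {..<k}" by (simp add: lessThan_atLeast0 add.commute)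
      then show ?thesis by (simp add: image_image)
    qed
    finally have "Min ((\<lambda>j. \<Sum>i<j. v (rot k r i)) ` {..<k}) = Min ((\<lambda>y. y - P r) ` (P ` {r..<r + k}))"
      by simp
    also have "\<dots> = Mn r - P r"
      unfolding Mn_def
      by (rule mono_Min_commute[symmetric]) (use k in \<open>auto simp: mono_def\<close>)
    finally show ?thesis
      using part[of k r] by (simp add: descent_def)
  qed
  show ?thesis
  \<comment> \<open>If the sum over a period is not negative, the value at \<open>r + k\<close> is
    not below the value at \<open>r\<close>, which belongs to the window, so no rotation has a
    descent.\<close>
  proof (cases "P k \<ge> 0")
    case True
    have "max 0 (Mn r - P (r + k)) = 0" for r
    proof -
      have "Mn r \<le> P r" unfolding Mn_def using k by (intro Min_le) auto
      then show ?thesis using True per[of r] by simp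
    qed
    then show ?thesis using True Pk by (simp add: desc)
  next
    case False
    \<comment> \<open>Consider the window from \<open>r\<close> to \<open>r + k\<close> inclusive.
      Splitting off its last point, its minimum is \<open>min (P (r + k)) (Mn r)\<close>; splitting
      off its first point, it is \<open>Mn (Suc r)\<close>, because
      \<open>P r > P (r + k)\<close>.\<close>
    have step: "max 0 (Mn r - P (r + k)) = Mn r - Mn (Suc r)" for r
    proof -
      have 1: "P ` {r..<Suc r + k} = insert (P r) (P ` {Suc r..<Suc r + k})"
      proof -
        have "{r..<Suc r + k} = insert r {Suc r..<Suc r + k}" by auto
        then show ?thesis by (metis image_insert)
      qed
      have 2: "P ` {r..<Suc r + k} = insert (P (r + k)) (P ` {r..<r + k})"
      proof -
        have "{r..<Suc r + k} = insert (r + k) {r..<r + k}" by auto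
        then show ?thesis by (metis image_insert)
      qed
      have "Mn (Suc r) \<le> P (r + k)" unfolding Mn_def using k by (intro Min_le) auto
      then have "Mn (Suc r) < P r" using False per[of r] by simp
      moreover have "min (P r) (Mn (Suc r)) = min (P (r + k)) (Mn r)"
      proof -
        have "Min (insert (P r) (P ` {Suc r..<Suc r + k})) = Min (insert (P (r + k)) (P ` {r..<r + k}))"
          using 1 2 by simp
        then show ?thesis using k unfolding Mn_def by (subst (asm) (1 2) Min_insert) auto
      qed
      ultimately show ?thesis by (simp add: min_def max_def split: if_splits)
    qed
    \<comment> \<open>One period shifts every value of \<open>P\<close> by \<open>P k\<close>, which
      evaluates the telescoping sum.\<close>
    have "Mn k = Mn 0 + P k"
    proof -
      have "P ` {k..<k + k} = (\<lambda>y. y + P k) ` (P ` {0..<0 + k})"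
      proof -
        have "{k..<k + k} = (\<lambda>i. i + k) ` {0..<0 + k}" by (simp add: image_add_atLeastLessThan')
        then have "P ` {k..<k + k} = P ` ((\<lambda>i. i + k) ` {0..<0 + k})" by (rule arg_cong)
        then show ?thesis unfolding image_image per .
      qed
      then have "Mn k = Min ((\<lambda>y. y + P k) ` (P ` {0..<0 + k}))" unfolding Mn_def by simp
      also have "\<dots> = Mn 0 + P k"
        unfolding Mn_def by (rule mono_Min_commute[symmetric]) (use k in \<open>auto simp: mono_def\<close>)
      finally show ?thesis .
    qed
    moreover have "(\<Sum>r<k. Mn r - Mn (Suc r)) = Mn 0 - Mn k" by (rule sum_lessThan_telescope')
    ultimately show ?thesis using False by (simp add: desc step Pk)
  qed
qed

text \<open>Descents are the decrements of the running minimum, so they telescope;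
  \<open>descent S k\<close> is also the length of the set of levels first crossed at step
  \<open>k\<close>. Index 0 is excluded because it would involve the minimum of the empty
  set.\<close>

lemma descent_eq_Min_diff:
  assumes "0 < k"
  shows "descent S k = Min (S ` {..k - 1}) - Min (S ` {..k})"
proof -
  have "{..k} = insert k {..<k}" "{..k - 1} = {..<k}" using assms by auto
  then have "Min (S ` {..k}) = min (S k) (Min (S ` {..<k}))" "{..k - 1} = {..<k}"
    using assms by (simp_all, subst Min_insert, auto)
  then show ?thesis unfolding descent_def by (simp add: min_def max_def)
qed

text \<open>Keeping only the steps that end above \<open>c\<close> almost amounts to stopping the
  running minimum at \<open>c\<close>. A descent ending above \<open>c\<close> is counted in full,
  and one that ends at or below \<open>c\<close> is dropped. As no descent exceeds \<open>e\<close>,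
  a dropped one starts at or below \<open>c + e\<close>, so no level above \<open>c + e\<close> is
  lost.\<close>

lemma sum_descent_bounds:
  fixes S :: "nat \<Rightarrow> real"
  defines "m \<equiv> \<lambda>k. Min (S ` {..k})"
  assumes "a \<le> n" and e: "\<And>k. a < k \<Longrightarrow> k \<le> n \<Longrightarrow> descent S k \<le> e"
  shows "(\<Sum>k\<in>{a<..n}. if S k > c then descent S k else 0) \<le> max (m a) c - max (m n) c"
    and "max (m a) (c + e) - max (m n) (c + e) \<le> (\<Sum>k\<in>{a<..n}. if S k > c then descent S k else 0)"
proof -
  have *: "(\<Sum>k\<in>{a<..n}. if S k > c then descent S k else 0) \<le> max (m a) c - max (m n) c \<and>
    max (m a) (c + e) - max (m n) (c + e) \<le> (\<Sum>k\<in>{a<..n}. if S k > c then descent S k else 0)"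
    using \<open>a \<le> n\<close> e
  proof (induction n rule: dec_induct)
    case (step n)
    have d: "descent S (Suc n) = m n - m (Suc n)"
      unfolding m_def by (subst descent_eq_Min_diff) auto
    have le: "descent S (Suc n) \<le> e" using step by simp
    have nn: "0 \<le> descent S (Suc n)" by simp
    have ms: "m (Suc n) \<le> S (Suc n)" unfolding m_def by (intro Min_le) auto
    have pos: "m (Suc n) = S (Suc n)" if "descent S (Suc n) > 0"
    proof -
      have "m (Suc n) = min (S (Suc n)) (m n)"
        unfolding m_def by (simp add: atMost_Suc Min_insert)
      then show ?thesis using that d by linarith
    qed
    have ih: "(\<Sum>k\<in>{a<..n}. if S k > c then descent S k else 0) \<le> max (m a) c - max (m n) c"
      "max (m a) (c + e) - max (m n) (c + e) \<le> (\<Sum>k\<in>{a<..n}. if S k > c then descent S k else 0)"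
      using step by auto
    have "{a<..Suc n} = insert (Suc n) {a<..n}" using step(1) by auto
    then have s: "(\<Sum>k\<in>{a<..Suc n}. if S k > c then descent S k else 0) =
      (if S (Suc n) > c then descent S (Suc n) else 0) + (\<Sum>k\<in>{a<..n}. if S k > c then descent S k else 0)"
      by simp
    have 1: "(if S (Suc n) > c then descent S (Suc n) else 0) \<le> max (m n) c - max (m (Suc n)) c"
      using pos d nn by (cases "descent S (Suc n) > 0") (auto simp: max_def)
    have 2: "max (m n) (c + e) - max (m (Suc n)) (c + e) \<le> (if S (Suc n) > c then descent S (Suc n) else 0)"
      using pos d nn le by (cases "descent S (Suc n) > 0") (auto simp: max_def)
    show ?case using ih s 1 2 by linarith
  qed simp
  show "(\<Sum>k\<in>{a<..n}. if S k > c then descent S k else 0) \<le> max (m a) c - max (m n) c"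
    and "max (m a) (c + e) - max (m n) (c + e) \<le> (\<Sum>k\<in>{a<..n}. if S k > c then descent S k else 0)"
    using * by auto
qed

lemma Min_dyadic_tendsto:
  assumes f: "cadlag f" and t: "0 \<le> t"
  shows "(\<lambda>m. Min ((\<lambda>j. f (real j * t / 2 ^ m)) ` {..2 ^ m})) \<longlonglongrightarrow> (INF u\<in>{0..t}. f u)"
proof (rule order_tendstoI)
  fix a assume a: "a < (INF u\<in>{0..t}. f u)"
  have "a < Min ((\<lambda>j. f (real j * t / 2 ^ m)) ` {..2 ^ m})" for m
  proof (subst Min_gr_iff; (intro ballI)?)
    fix y assume "y \<in> (\<lambda>j. f (real j * t / 2 ^ m)) ` {..2 ^ m}"
    then obtain j where j: "j \<le> 2 ^ m" "y = f (real j * t / 2 ^ m)" by auto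
    have "\<not> (INF u\<in>{0..t}. f u) < (INF u\<in>{0..t}. f u)" by simp
    then have "\<not> f (real j * t / 2 ^ m) < (INF u\<in>{0..t}. f u)"
      using INF_less_dyadic_iff[OF f t] j(1) by blast
    then show "a < y" using a j by simp
  qed auto
  then show "\<forall>\<^sub>F m in sequentially. a < Min ((\<lambda>j. f (real j * t / 2 ^ m)) ` {..2 ^ m})"
    by simp
next
  fix a assume "(INF u\<in>{0..t}. f u) < a"
  then obtain m where m: "\<exists>k\<le>2 ^ m. f (real k * t / 2 ^ m) < a"
    using INF_less_dyadic_iff[OF f t] by auto
  have "Min ((\<lambda>j. f (real j * t / 2 ^ m')) ` {..2 ^ m'}) < a" if "m \<le> m'" for m'
    using dyadic_less_mono[OF that, of "\<lambda>x. f x < a" t] m by (subst Min_less_iff) auto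
  then show "\<forall>\<^sub>F m in sequentially. Min ((\<lambda>j. f (real j * t / 2 ^ m)) ` {..2 ^ m}) < a"
    using eventually_sequentially by blast
qed

text \<open>Without negative jumps the descents on fine grids are uniformly small, and the two
  bounds of \<open>sum_descent_bounds\<close> meet. Summation starts at time
  \<open>t / 2 ^ l\<close> because the identity to be applied to the summands divides by the time,
  which is singular at 0.\<close>

lemma sum_descent_tendsto:
  assumes f: "cadlag f" and jmp: "\<And>s. 0 < s \<Longrightarrow> s \<le> t \<Longrightarrow> jump f s \<ge> 0" and t: "0 < t"
  shows "(\<lambda>m. \<Sum>k\<in>{2 ^ (m - l)<..2 ^ m}. if f (real k * t / 2 ^ m) > c
             then descent (\<lambda>j. f (real j * t / 2 ^ m)) k else 0)
    \<longlonglongrightarrow> max (INF u\<in>{0..t / 2 ^ l}. f u) c - max (INF u\<in>{0..t}. f u) c"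
proof (rule LIMSEQ_I)
  fix r :: real assume "0 < r"
  \<comment> \<open>Each of the two minima is approximated up to \<open>e\<close> and the threshold
    is moved by \<open>e\<close>; a seventh of \<open>r\<close> leaves ample room for these
    errors.\<close>
  define e where "e = r / 7"
  have e: "e > 0" using \<open>0 < r\<close> by (simp add: e_def)
  define S where "S m j = f (real j * t / 2 ^ m)" for m j
  define A B where "A = (INF u\<in>{0..t / 2 ^ l}. f u)" and "B = (INF u\<in>{0..t}. f u)"
  define a b where "a m = Min (S m ` {..2 ^ (m - l)})" and "b m = Min (S m ` {..2 ^ m})" for m
  have b: "b \<longlonglongrightarrow> B"
    unfolding b_def B_def S_def using Min_dyadic_tendsto[OF f] t by simp
  have "(\<lambda>m. Min ((\<lambda>j. f (real j * (t / 2 ^ l) / 2 ^ (m - l))) ` {..2 ^ (m - l)})) \<longlonglongrightarrow> A"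
    unfolding A_def
    by (rule filterlim_compose[OF Min_dyadic_tendsto[OF f] filterlim_minus_const_nat_at_top]) (use t in simp)
  moreover have "\<forall>\<^sub>F m in sequentially. Min ((\<lambda>j. f (real j * (t / 2 ^ l) / 2 ^ (m - l))) ` {..2 ^ (m - l)}) = a m"
    using eventually_ge_at_top[of l]
  proof eventually_elim
    case (elim m)
    have "(2::real) ^ m = 2 ^ l * 2 ^ (m - l)" using elim by (simp flip: power_add)
    then show ?case by (simp add: a_def S_def)
  qed
  ultimately have a: "a \<longlonglongrightarrow> A" using Lim_transform_eventually by fast
  obtain d where d: "d > 0" "\<And>s u. 0 \<le> s \<Longrightarrow> s \<le> u \<Longrightarrow> u \<le> t \<Longrightarrow> u - s < d \<Longrightarrow> f s - e \<le> f u"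
    using no_negative_jump_imp_small_drops[OF f jmp e] by metis
  have "(\<lambda>m. t / 2 ^ m) \<longlonglongrightarrow> 0" by (rule LIMSEQ_divide_realpow_zero) simp
  then have "\<forall>\<^sub>F m in sequentially. t / 2 ^ m < d" using d(1) by (rule order_tendstoD)
  moreover have "\<forall>\<^sub>F m in sequentially. \<bar>a m - A\<bar> < e" using tendstoD[OF a e] by (simp add: dist_real_def)
  moreover have "\<forall>\<^sub>F m in sequentially. \<bar>b m - B\<bar> < e" using tendstoD[OF b e] by (simp add: dist_real_def)
  ultimately have "\<forall>\<^sub>F m in sequentially. norm ((\<Sum>k\<in>{2 ^ (m - l)<..2 ^ m}. if S m k > c
             then descent (S m) k else 0) - (max A c - max B c)) < r"
  proof eventually_elim
    case (elim m)
    \<comment> \<open>The grid point just before \<open>k\<close> is among the earlier values, so a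
      descent is at most the drop over a single step.\<close>
    have dle: "descent (S m) k \<le> e" if k: "2 ^ (m - l) < k" "k \<le> 2 ^ m" for k
    proof -
      obtain k' where k': "k = Suc k'" using k by (cases k) auto
      have "real k \<le> 2 ^ m" using k(2) by (metis of_nat_le_iff of_nat_numeral of_nat_power)
      then have kt: "real k * t / 2 ^ m \<le> t" using t by (simp add: field_simps mult_left_mono)
      have "real k * t / 2 ^ m - real k' * t / 2 ^ m = t / 2 ^ m"
        using k' by (simp add: field_simps)
      then have "S m k' - e \<le> S m k"
        unfolding S_def using elim(1) t k' kt by (intro d(2)) (auto simp: divide_right_mono)
      moreover have "Min (S m ` {..<k}) \<le> S m k'" using k' by (intro Min_le) auto
      ultimately show ?thesis using e unfolding descent_def by linarith
    qed
    have le: "(2::nat) ^ (m - l) \<le> 2 ^ m" by simp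
    note bd = sum_descent_bounds[of "2 ^ (m - l)" "2 ^ m" "S m" e c, OF le dle, folded a_def b_def]
    show ?case using bd e elim(2,3) \<open>0 < r\<close> unfolding real_norm_def e_def by linarith
  qed
  then show "\<exists>no. \<forall>m\<ge>no. norm ((\<Sum>k\<in>{2 ^ (m - l)<..2 ^ m}. if f (real k * t / 2 ^ m) > c
             then descent (\<lambda>j. f (real j * t / 2 ^ m)) k else 0)
      - (max (INF u\<in>{0..t / 2 ^ l}. f u) c - max (INF u\<in>{0..t}. f u) c)) < r"
    unfolding S_def A_def B_def eventually_sequentially .
qed

lemma cadlag_right_tendsto:
  assumes f: "cadlag f" and r: "0 \<le> r" and a: "a \<longlonglongrightarrow> r" "\<And>m. r \<le> a m"
  shows "(\<lambda>m. f (a m :: real)) \<longlonglongrightarrow> f r"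
proof (rule LIMSEQ_I)
  fix e :: real assume "0 < e"
  obtain d l where d: "d > 0" "\<And>u. r \<le> u \<Longrightarrow> u < r + d \<Longrightarrow> \<bar>f u - f r\<bar> < e"
    using cadlag_local[OF f r \<open>0 < e\<close>] by metis
  have "\<forall>\<^sub>F m in sequentially. a m < r + d" using a(1) d(1) by (intro order_tendstoD) auto
  then have "\<forall>\<^sub>F m in sequentially. norm (f (a m) - f r) < e"
    by eventually_elim (use d a(2) in simp)
  then show "\<exists>no. \<forall>m\<ge>no. norm (f (a m) - f r) < e" unfolding eventually_sequentially .
qed

lemma cadlag_shift:
  assumes "cadlag f" "0 \<le> s"
  shows "cadlag (\<lambda>u. f (s + u) - c)"
  unfolding cadlag_def
proof (intro conjI allI impI)
  fix t :: real assume "0 \<le> t"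
  then have "(f \<longlongrightarrow> f (s + t)) (at_right (s + t))"
    using assms by (auto simp: cadlag_def continuous_within)
  then have "((\<lambda>u. f (u + s)) \<longlongrightarrow> f (s + t)) (at_right t)"
    using filterlim_at_right_to_0[of f "nhds (f (s+t))" "s+t"]
      filterlim_at_right_to_0[of "\<lambda>u. f (u + s)" "nhds (f (s+t))" t] by (simp add: ac_simps)
  then show "continuous (at_right t) (\<lambda>u. f (s + u) - c)"
    unfolding continuous_within by (intro tendsto_diff tendsto_const) (simp add: add.commute)
next
  fix t :: real assume "0 < t"
  then have "0 < s + t" using assms by simp
  then obtain l where "(f \<longlongrightarrow> l) (at_left (s + t))"
    using assms unfolding cadlag_def by blast
  then have "((\<lambda>u. f (u + s)) \<longlongrightarrow> l) (at_left t)"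
    using filterlim_at_left_to_right[of f "nhds l" "s+t"] filterlim_at_left_to_right[of "\<lambda>u. f (u + s)" "nhds l" t]
      filterlim_at_right_to_0[of "\<lambda>x. f (- x)" "nhds l" "-(s+t)"]
      filterlim_at_right_to_0[of "\<lambda>x. f (- x + s)" "nhds l" "-t"] by (simp add: ac_simps)
  then have "((\<lambda>u. f (s + u) - c) \<longlongrightarrow> l - c) (at_left t)"
    by (intro tendsto_diff tendsto_const) (simp add: add.commute)
  then show "\<exists>l. ((\<lambda>u. f (s + u) - c) \<longlongrightarrow> l) (at_left t)" by blast
qed

lemma cadlag_uminus: "cadlag f \<Longrightarrow> cadlag (\<lambda>t. - f t)"
  unfolding cadlag_def continuous_within by (blast intro: tendsto_minus)

section \<open>Measures determined by half-lines\<close>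

lemma measure_eqI_lessThan':
  fixes \<mu> \<nu> :: "real measure"
  assumes sets: "sets \<mu> = sets borel" "sets \<nu> = sets borel"
    and fin: "\<And>a. emeasure \<mu> {..<a} < \<infinity>" and eq: "\<And>a. emeasure \<mu> {..<a} = emeasure \<nu> {..<a}"
  shows "\<mu> = \<nu>"
proof (rule measure_eqI_generator_eq[where E = "range lessThan" and A = "\<lambda>n::nat. {..<real n}"])
  show "Int_stable (range (lessThan :: real \<Rightarrow> _))"
  proof (rule Int_stableI)
    fix A B :: "real set" assume "A \<in> range lessThan" "B \<in> range lessThan"
    then obtain a b where "A = {..<a}" "B = {..<b}" by auto
    then have "A \<inter> B = {..<min a b}" by auto
    then show "A \<inter> B \<in> range lessThan" by auto
  qed
  show "sets \<mu> = sigma_sets UNIV (range lessThan)" "sets \<nu> = sigma_sets UNIV (range lessThan)"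
    using sets by (auto simp: borel_Iio)
  show "(\<Union>n. {..<real n}) = UNIV" using reals_Archimedean2 by auto
  show "emeasure \<mu> {..<real n} \<noteq> \<infinity>" for n using fin by (metis less_irrefl)
qed (use eq in auto)

text \<open>For a fixed \<open>B\<close> both sides are finite measures in the first coordinate.
  Only this coordinate is reduced to half-lines: \<open>inf < a\<close> can be read off from grids,
  whereas the final position may be tested on any Borel set directly.\<close>

lemma measure_eqI_lessThan_times:
  fixes \<mu> \<nu> :: "(real \<times> real) measure"
  assumes sets: "sets \<mu> = sets (borel \<Otimes>\<^sub>M borel)" "sets \<nu> = sets (borel \<Otimes>\<^sub>M borel)"
    and fin: "finite_measure \<mu>"
    and eq: "\<And>a B. B \<in> sets borel \<Longrightarrow> emeasure \<mu> ({..<a} \<times> B) = emeasure \<nu> ({..<a} \<times> B)"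
  shows "\<mu> = \<nu>"
proof (rule measure_eqI_generator_eq[where \<Omega> = UNIV and A = "\<lambda>n::nat. UNIV"
    and E = "{a \<times> b |a b. a \<in> sets (borel :: real measure) \<and> b \<in> sets (borel :: real measure)}"])
  note sets[measurable_cong]
  show "Int_stable {a \<times> b |a b. a \<in> sets (borel :: real measure) \<and> b \<in> sets (borel :: real measure)}"
    by (rule Int_stable_pair_measure_generator)
  show "sets \<mu> = sigma_sets UNIV {a \<times> b |a b. a \<in> sets borel \<and> b \<in> sets borel}"
    "sets \<nu> = sigma_sets UNIV {a \<times> b |a b. a \<in> sets borel \<and> b \<in> sets borel}"
    using sets by (auto simp: sets_pair_measure)
  show "emeasure \<mu> UNIV \<noteq> \<infinity>" using fin by (simp add: finite_measure.emeasure_finite)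
  show "range (\<lambda>n. UNIV) \<subseteq> {a \<times> b |a b. a \<in> sets (borel :: real measure) \<and> b \<in> sets (borel :: real measure)}"
    by (auto intro!: exI[of _ UNIV])
  fix C assume "C \<in> {a \<times> b |a b. a \<in> sets (borel :: real measure) \<and> b \<in> sets (borel :: real measure)}"
  then obtain A B where C: "C = A \<times> B" and [measurable]: "A \<in> sets borel" "B \<in> sets borel" by auto
  define m1 where "m1 = distr (density \<mu> (indicator (UNIV \<times> B))) borel fst"
  define m2 where "m2 = distr (density \<nu> (indicator (UNIV \<times> B))) borel fst"
  have sp: "space \<mu> = UNIV" "space \<nu> = UNIV"
    using sets[THEN sets_eq_imp_space_eq] by (auto simp: space_pair_measure)
  have e: "emeasure m1 A = emeasure \<mu> (A \<times> B)" "emeasure m2 A = emeasure \<nu> (A \<times> B)"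
    if [measurable]: "A \<in> sets borel" for A
  proof -
    have v: "fst -` A = A \<times> UNIV" by auto
    have *: "emeasure (distr (density L (indicator (UNIV \<times> B))) borel fst) A = emeasure L (A \<times> B)"
      if [measurable_cong]: "sets L = sets (borel \<Otimes>\<^sub>M borel)" for L :: "(real \<times> real) measure"
    proof -
      have sp: "space L = UNIV" using that[THEN sets_eq_imp_space_eq] by (auto simp: space_pair_measure)
      have "emeasure (distr (density L (indicator (UNIV \<times> B))) borel fst) A =
          emeasure (density L (indicator (UNIV \<times> B))) (A \<times> UNIV)"
        by (subst emeasure_distr) (auto simp: sp v)
      also have "\<dots> = (\<integral>\<^sup>+x. indicator (UNIV \<times> B) x * indicator (A \<times> UNIV) x \<partial>L)"
        by (subst emeasure_density) auto
      also have "\<dots> = (\<integral>\<^sup>+x. indicator (A \<times> B) x \<partial>L)"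
        by (intro nn_integral_cong) (auto simp: indicator_def)
      also have "\<dots> = emeasure L (A \<times> B)" by (subst nn_integral_indicator) auto
      finally show ?thesis .
    qed
    show "emeasure m1 A = emeasure \<mu> (A \<times> B)" "emeasure m2 A = emeasure \<nu> (A \<times> B)"
      unfolding m1_def m2_def using * sets by auto
  qed
  have "m1 = m2"
  proof (rule measure_eqI_lessThan')
    show "emeasure m1 {..<a} < \<infinity>" for a
      using finite_measure.emeasure_finite[OF fin] by (simp add: e top.not_eq_extremum)
    show "emeasure m1 {..<a} = emeasure m2 {..<a}" for a by (simp add: e eq)
  qed (auto simp: m1_def m2_def)
  then show "emeasure \<mu> C = emeasure \<nu> C" using e(1)[of A] e(2)[of A] C by simp
qed auto

section \<open>Levy processes\<close>

lemma INF_uminus_real: "(INF u\<in>A. - f u) = - (SUP u\<in>A. f u :: real)"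
  by (simp add: Inf_real_def image_image)

locale levy =
  fixes M :: "'a measure" and X :: "real \<Rightarrow> 'a \<Rightarrow> real"
  assumes levy: "levy_process M X"

sublocale levy \<subseteq> prob_space M
  using levy by (simp add: levy_process_def)

context levy
begin

lemma X_measurable [measurable (raw)]: "0 \<le> t \<Longrightarrow> X t \<in> borel_measurable M"
  using levy by (simp add: levy_process_def)

lemma X_0: "AE \<omega> in M. X 0 \<omega> = 0"
  using levy by (simp add: levy_process_def)

lemma path: "\<omega> \<in> space M \<Longrightarrow> cadlag (\<lambda>t. X t \<omega>)"
  using levy by (simp add: levy_process_def)

lemma stationary: "0 \<le> s \<Longrightarrow> 0 \<le> h \<Longrightarrow> distr M borel (\<lambda>\<omega>. X (s + h) \<omega> - X s \<omega>) = distr M borel (X h)"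
  using levy by (simp add: levy_process_def)

lemma indep_increments:
  "incseq u \<Longrightarrow> 0 \<le> u 0 \<Longrightarrow> indep_vars (\<lambda>_. borel) (\<lambda>i \<omega>. X (u (Suc i)) \<omega> - X (u i) \<omega>) {..<n::nat}"
  using levy by (simp add: levy_process_def)

section \<open>Laws of vectors of increments\<close>

abbreviation seqs :: "nat \<Rightarrow> (nat \<Rightarrow> real) measure" where
  "seqs n \<equiv> PiM {..<n} (\<lambda>_. borel)"

text \<open>Extensional on \<open>{..<n}\<close>, so that the vector is a point of
  \<open>seqs n\<close> and its law can be compared with a product measure.\<close>

definition incs :: "real \<Rightarrow> real \<Rightarrow> nat \<Rightarrow> 'a \<Rightarrow> nat \<Rightarrow> real" where
  "incs s h n \<omega> = (\<lambda>k\<in>{..<n}. X (s + real (Suc k) * h) \<omega> - X (s + real k * h) \<omega>)"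

lemma incs_measurable [measurable]:
  assumes [simp]: "0 \<le> s" "0 \<le> h"
  shows "incs s h n \<in> M \<rightarrow>\<^sub>M seqs n"
  unfolding incs_def by (intro measurable_restrict borel_measurable_diff X_measurable) auto

lemma sum_incs:
  assumes "k \<le> n"
  shows "(\<Sum>i<k. incs s h n \<omega> i) = X (s + real k * h) \<omega> - X s \<omega>"
proof -
  have "(\<Sum>i<k. incs s h n \<omega> i) = (\<Sum>i<k. X (s + real (Suc i) * h) \<omega> - X (s + real i * h) \<omega>)"
    using assms by (intro sum.cong) (auto simp: incs_def)
  also have "\<dots> = X (s + real k * h) \<omega> - X (s + real 0 * h) \<omega>"
    by (rule sum_lessThan_telescope)
  finally show ?thesis by simp
qed

lemma indep_incs:
  assumes "0 \<le> s" "0 \<le> h"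
  shows "indep_vars (\<lambda>_. borel) (\<lambda>k \<omega>. X (s + real (Suc k) * h) \<omega> - X (s + real k * h) \<omega>) {..<n}"
proof -
  have "incseq (\<lambda>k. s + real k * h)" using assms by (auto simp: incseq_def mult_right_mono)
  then show ?thesis using assms indep_increments[of "\<lambda>k. s + real k * h" n] by simp
qed

lemma incs_law:
  assumes "0 \<le> s" "0 \<le> h" "0 < n"
  shows "distr M (seqs n) (incs s h n) = PiM {..<n} (\<lambda>_. distr M borel (X h))"
proof -
  have inc: "distr M borel (\<lambda>\<omega>. X (s + real (Suc k) * h) \<omega> - X (s + real k * h) \<omega>) = distr M borel (X h)" for k
    using stationary[of "s + real k * h" h] assms by (simp add: algebra_simps)
  have "distr M (seqs n) (incs s h n) =
      PiM {..<n} (\<lambda>k. distr M borel (\<lambda>\<omega>. X (s + real (Suc k) * h) \<omega> - X (s + real k * h) \<omega>))"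
    unfolding incs_def
    using indep_incs[OF assms(1,2), of n] assms
    by (subst (asm) indep_vars_iff_distr_eq_PiM') (auto intro!: borel_measurable_diff X_measurable)
  then show ?thesis by (simp only: inc)
qed

text \<open>Exchangeability: a power of one measure is invariant under permutation of the factors.
  Cyclic rotations and time reversal both rest on this.\<close>

lemma nn_integral_incs_perm:
  assumes "0 \<le> s" "0 \<le> h" "0 < n" and \<pi>: "bij_betw \<pi> {..<n} {..<n}"
    and F [measurable]: "F \<in> borel_measurable (seqs n)"
  shows "(\<integral>\<^sup>+\<omega>. F (\<lambda>k\<in>{..<n}. incs s h n \<omega> (\<pi> k)) \<partial>M) = (\<integral>\<^sup>+\<omega>. F (incs s h n \<omega>) \<partial>M)"
proof -
  define Q where "Q = PiM {..<n} (\<lambda>_. distr M borel (X h))"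
  have [measurable_cong]: "sets Q = sets (seqs n)" unfolding Q_def by (intro sets_PiM_cong) auto
  have \<pi>n: "\<pi> k < n" if "k < n" for k using \<pi> that by (auto simp: bij_betw_def)
  have [measurable]: "(\<lambda>v. \<lambda>k\<in>{..<n}. v (\<pi> k)) \<in> seqs n \<rightarrow>\<^sub>M seqs n"
    using \<pi>n by (intro measurable_restrict measurable_component_singleton) auto
  note [measurable] = incs_measurable[OF assms(1,2)]
  have D: "distr Q Q (\<lambda>v. \<lambda>k\<in>{..<n}. v (\<pi> k)) = Q"
    unfolding Q_def using \<pi>
    by (intro distr_PiM_reindex) (auto simp: bij_betw_def intro!: prob_space_distr X_measurable assms)
  have Q: "Q = distr M (seqs n) (incs s h n)" unfolding Q_def using incs_law[OF assms(1-3)] by simp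
  have "(\<integral>\<^sup>+\<omega>. F (incs s h n \<omega>) \<partial>M) = (\<integral>\<^sup>+v. F v \<partial>Q)"
    unfolding Q by (subst nn_integral_distr) auto
  also have "\<dots> = (\<integral>\<^sup>+v. F v \<partial>distr Q Q (\<lambda>v. \<lambda>k\<in>{..<n}. v (\<pi> k)))" by (simp only: D)
  also have "\<dots> = (\<integral>\<^sup>+v. F (\<lambda>k\<in>{..<n}. v (\<pi> k)) \<partial>Q)" by (subst nn_integral_distr) auto
  also have "\<dots> = (\<integral>\<^sup>+\<omega>. F (\<lambda>k\<in>{..<n}. incs s h n \<omega> (\<pi> k)) \<partial>M)"
    unfolding Q by (subst nn_integral_distr) auto
  finally show ?thesis by simp
qed

text \<open>The present value and the later increments are functions of disjoint blocks of
  independent increments. As \<open>X 0\<close> vanishes only almost surely, \<open>X s\<close> is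
  first replaced by \<open>X s - X 0\<close>.\<close>

lemma incs_pair_law:
  assumes s: "0 \<le> s" and h: "0 \<le> h" and n: "0 < n"
  shows "distr M (borel \<Otimes>\<^sub>M seqs n) (\<lambda>\<omega>. (X s \<omega>, incs s h n \<omega>)) =
    distr M borel (X s) \<Otimes>\<^sub>M PiM {..<n} (\<lambda>_. distr M borel (X h))"
proof -
  note [measurable] = incs_measurable[OF s h] X_measurable[OF s] X_measurable[OF order.refl]
  \<comment> \<open>An uneven partition: the first step has length \<open>s\<close>, all later ones
    have length \<open>h\<close>.\<close>
  define u where "u k = (if k = 0 then 0 else s + real (k - 1) * h)" for k
  have u: "incseq u" unfolding u_def incseq_Suc_iff using s h
    by (auto simp: algebra_simps of_nat_diff)
  define Z where "Z i \<omega> = X (u (Suc i)) \<omega> - X (u i) \<omega>" for i \<omega>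
  have ind: "indep_vars (\<lambda>_. borel) Z {..<Suc n}"
    unfolding Z_def by (rule indep_increments[OF u]) (simp add: u_def)
  define U where "U \<omega> = restrict (\<lambda>i. Z i \<omega>) {0}" for \<omega>
  define V where "V \<omega> = restrict (\<lambda>i. Z i \<omega>) {Suc 0..n}" for \<omega>
  have "indep_var (PiM {0} (\<lambda>_. borel)) U (PiM {Suc 0..n} (\<lambda>_. borel)) V"
    unfolding U_def V_def by (rule indep_var_restrict[OF ind]) auto
  then have [measurable]: "U \<in> M \<rightarrow>\<^sub>M PiM {0} (\<lambda>_. borel)" "V \<in> M \<rightarrow>\<^sub>M PiM {Suc 0..n} (\<lambda>_. borel)"
    and eq: "distr M (PiM {0} (\<lambda>_. borel)) U \<Otimes>\<^sub>M distr M (PiM {Suc 0..n} (\<lambda>_. borel)) V =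
      distr M (PiM {0} (\<lambda>_. borel) \<Otimes>\<^sub>M PiM {Suc 0..n} (\<lambda>_. borel)) (\<lambda>\<omega>. (U \<omega>, V \<omega>))"
    by (auto simp: indep_var_distribution_eq)
  define f :: "(nat \<Rightarrow> real) \<Rightarrow> real" where "f v = v 0" for v
  define g :: "(nat \<Rightarrow> real) \<Rightarrow> (nat \<Rightarrow> real)" where "g v = (\<lambda>k\<in>{..<n}. v (Suc k))" for v
  have [measurable]: "f \<in> borel_measurable (PiM {0} (\<lambda>_. borel))" "g \<in> PiM {Suc 0..n} (\<lambda>_. borel) \<rightarrow>\<^sub>M seqs n"
    unfolding f_def g_def by (auto intro!: measurable_component_singleton measurable_restrict)
  have fU: "f \<circ> U = (\<lambda>\<omega>. X s \<omega> - X 0 \<omega>)"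
    by (auto simp: Z_def u_def f_def U_def)
  have gV: "g \<circ> V = incs s h n"
    by (auto simp: Z_def u_def incs_def fun_eq_iff restrict_def g_def V_def)
  have "distr M borel (f \<circ> U) \<Otimes>\<^sub>M distr M (seqs n) (g \<circ> V) =
      distr (distr M (PiM {0} (\<lambda>_. borel)) U) borel f \<Otimes>\<^sub>M distr (distr M (PiM {Suc 0..n} (\<lambda>_. borel)) V) (seqs n) g"
    by (simp add: distr_distr)
  also have "\<dots> = distr (distr M (PiM {0} (\<lambda>_. borel)) U \<Otimes>\<^sub>M distr M (PiM {Suc 0..n} (\<lambda>_. borel)) V)
      (borel \<Otimes>\<^sub>M seqs n) (\<lambda>(x, y). (f x, g y))"
    by (intro pair_measure_distr prob_space_imp_sigma_finite prob_space.prob_space_distr[OF prob_space_distr]) measurable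
  also have "\<dots> = distr M (borel \<Otimes>\<^sub>M seqs n) ((\<lambda>(x, y). (f x, g y)) \<circ> (\<lambda>\<omega>. (U \<omega>, V \<omega>)))"
    unfolding eq by (rule distr_distr) measurable
  also have "(\<lambda>(x, y). (f x, g y)) \<circ> (\<lambda>\<omega>. (U \<omega>, V \<omega>)) = (\<lambda>\<omega>. ((f \<circ> U) \<omega>, (g \<circ> V) \<omega>))"
    by (simp add: comp_def)
  finally have "distr M borel (\<lambda>\<omega>. X s \<omega> - X 0 \<omega>) \<Otimes>\<^sub>M distr M (seqs n) (incs s h n) =
      distr M (borel \<Otimes>\<^sub>M seqs n) (\<lambda>\<omega>. (X s \<omega> - X 0 \<omega>, incs s h n \<omega>))"
    unfolding fU gV .
  moreover have "distr M borel (\<lambda>\<omega>. X s \<omega> - X 0 \<omega>) = distr M borel (X s)"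
    using X_0 by (intro distr_cong_AE) (auto elim: AE_mp)
  moreover have "distr M (borel \<Otimes>\<^sub>M seqs n) (\<lambda>\<omega>. (X s \<omega> - X 0 \<omega>, incs s h n \<omega>)) =
     distr M (borel \<Otimes>\<^sub>M seqs n) (\<lambda>\<omega>. (X s \<omega>, incs s h n \<omega>))"
    using X_0 by (intro distr_cong_AE) (auto elim: AE_mp)
  ultimately show ?thesis using incs_law[OF assms] by simp
qed

section \<open>The Markov property for the running infimum\<close>

definition low_event :: "nat \<Rightarrow> real \<Rightarrow> real set \<Rightarrow> (nat \<Rightarrow> real) set" where
  "low_event n a B = {v \<in> space (seqs n). (\<exists>k\<in>{..n}. (\<Sum>i<k. v i) < a) \<and> (\<Sum>i<n. v i) \<in> B}"

lemma psum_measurable: "k \<le> n \<Longrightarrow> (\<lambda>v. \<Sum>i<k. v i) \<in> borel_measurable (seqs n)"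
  by (intro borel_measurable_sum measurable_component_singleton) auto

lemma low_event_measurable [measurable]:
  assumes [measurable]: "B \<in> sets borel"
  shows "low_event n a B \<in> sets (seqs n)"
proof -
  have [measurable]: "(\<lambda>v. \<Sum>i<n. v i) \<in> borel_measurable (seqs n)" by (rule psum_measurable) simp
  have "low_event n a B = (\<Union>k\<in>{..n}. {v \<in> space (seqs n). (\<Sum>i<k. v i) < a}) \<inter> {v \<in> space (seqs n). (\<Sum>i<n. v i) \<in> B}"
    by (auto simp: low_event_def)
  also have "\<dots> \<in> sets (seqs n)"
    by (intro sets.Int sets.finite_UN) (auto intro!: borel_measurable_less psum_measurable)
  finally show ?thesis .
qed

lemma incs_low_event_iff:
  assumes "\<omega> \<in> space M"
  shows "incs s h n \<omega> \<in> low_event n a B \<longleftrightarrow>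
    (\<exists>k\<le>n. X (s + real k * h) \<omega> - X s \<omega> < a) \<and> X (s + real n * h) \<omega> - X s \<omega> \<in> B"
proof -
  have "incs s h n \<omega> \<in> space (seqs n)" by (auto simp: space_PiM incs_def)
  then show ?thesis
    by (auto simp: low_event_def sum_incs Bex_def)
qed

lemma INF_measurable [measurable (raw)]:
  assumes "0 \<le> t"
  shows "(\<lambda>\<omega>. INF u\<in>{0..t}. X u \<omega>) \<in> borel_measurable M"
proof (rule borel_measurableI_less)
  fix a
  have "{\<omega>\<in>space M. (INF u\<in>{0..t}. X u \<omega>) < a} = (\<Union>m. \<Union>k\<in>{..2 ^ m}. {\<omega>\<in>space M. X (real k * t / 2 ^ m) \<omega> < a})"
    by (auto simp: INF_less_dyadic_iff[OF path assms]) blast+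
  also have "\<dots> \<in> sets M"
    using assms by (intro sets.countable_UN sets.finite_UN) (auto intro!: borel_measurable_less X_measurable)
  finally show "{\<omega>\<in>space M. (INF u\<in>{0..t}. X u \<omega>) < a} \<in> sets M" .
qed

lemma INF_shift_measurable [measurable (raw)]:
  assumes "0 \<le> s" "0 \<le> t"
  shows "(\<lambda>\<omega>. INF u\<in>{0..t}. X (s + u) \<omega> - X s \<omega>) \<in> borel_measurable M"
proof (rule borel_measurableI_less)
  fix a
  have "{\<omega>\<in>space M. (INF u\<in>{0..t}. X (s + u) \<omega> - X s \<omega>) < a} =
    (\<Union>m. \<Union>k\<in>{..2 ^ m}. {\<omega>\<in>space M. X (s + real k * t / 2 ^ m) \<omega> - X s \<omega> < a})"
    by (auto simp: INF_less_dyadic_iff[OF cadlag_shift[OF path assms(1)] assms(2)]) blast+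
  also have "\<dots> \<in> sets M"
    using assms by (intro sets.countable_UN sets.finite_UN)
      (auto intro!: borel_measurable_less borel_measurable_diff X_measurable)
  finally show "{\<omega>\<in>space M. (INF u\<in>{0..t}. X (s + u) \<omega> - X s \<omega>) < a} \<in> sets M" .
qed

text \<open>Statements about suprema are obtained by applying those about infima to
  \<open>-X\<close>.\<close>

lemma uminus: "levy M (\<lambda>t \<omega>. - X t \<omega>)"
proof
  show "levy_process M (\<lambda>t \<omega>. - X t \<omega>)"
    unfolding levy_process_def
  proof (intro conjI allI impI ballI)
    show "prob_space M" by (rule prob_space_axioms)
    show "AE \<omega> in M. - X 0 \<omega> = 0" using X_0 by simp
    show "cadlag (\<lambda>t. - X t \<omega>)" if "\<omega> \<in> space M" for \<omega> using path[OF that] by (rule cadlag_uminus)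
    show "(\<lambda>\<omega>. - X t \<omega>) \<in> borel_measurable M" if "0 \<le> t" for t using that by measurable
  next
    fix n and u :: "nat \<Rightarrow> real" assume u: "incseq u \<and> 0 \<le> u 0"
    have "indep_vars (\<lambda>_. borel) (\<lambda>i. uminus \<circ> (\<lambda>\<omega>. X (u (Suc i)) \<omega> - X (u i) \<omega>)) {..<n}"
      using u by (intro indep_vars_compose[OF indep_increments]) auto
    then show "indep_vars (\<lambda>_. borel) (\<lambda>i \<omega>. - X (u (Suc i)) \<omega> - - X (u i) \<omega>) {..<n}"
      by (simp add: comp_def)
  next
    fix s h :: real assume sh: "0 \<le> s" "0 \<le> h"
    have [measurable]: "X (s + h) \<in> borel_measurable M" "X s \<in> borel_measurable M" "X h \<in> borel_measurable M"
      using sh by (auto intro!: X_measurable)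
    have "distr M borel (\<lambda>\<omega>. - X (s + h) \<omega> - - X s \<omega>) = distr (distr M borel (\<lambda>\<omega>. X (s + h) \<omega> - X s \<omega>)) borel uminus"
      by (subst distr_distr) (auto simp: comp_def)
    also have "\<dots> = distr (distr M borel (X h)) borel uminus" by (simp only: stationary[OF sh])
    also have "\<dots> = distr M borel (\<lambda>\<omega>. - X h \<omega>)" by (subst distr_distr) (auto simp: comp_def)
    finally show "distr M borel (\<lambda>\<omega>. - X (s + h) \<omega> - - X s \<omega>) = distr M borel (\<lambda>\<omega>. - X h \<omega>)" .
  qed
qed

lemma SUP_measurable [measurable (raw)]:
  assumes "0 \<le> t"
  shows "(\<lambda>\<omega>. SUP u\<in>{0..t}. X u \<omega>) \<in> borel_measurable M"
proof -
  interpret N: levy M "\<lambda>t \<omega>. - X t \<omega>" by (rule uminus)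
  have "(\<lambda>\<omega>. - (INF u\<in>{0..t}. - X u \<omega>)) \<in> borel_measurable M"
    using N.INF_measurable[OF assms] by measurable
  then show ?thesis by (simp add: INF_uminus_real)
qed

text \<open>On every grid the pair of \<open>X s\<close> and the later increments has a product law.
  Refining the grid, continuity from below carries the factorisation to the events
  \<open>inf < a\<close> joint with any event for the final increment, and these determine the
  law.\<close>

lemma markov_INF:
  assumes s: "0 \<le> s" and r: "0 \<le> r"
  shows "distr M (borel \<Otimes>\<^sub>M (borel \<Otimes>\<^sub>M borel)) (\<lambda>\<omega>. (X s \<omega>, (INF u\<in>{0..r}. X (s + u) \<omega> - X s \<omega>, X (s + r) \<omega> - X s \<omega>)))
    = distr M borel (X s) \<Otimes>\<^sub>M distr M (borel \<Otimes>\<^sub>M borel) (\<lambda>\<omega>. (INF u\<in>{0..r}. X u \<omega>, X r \<omega>))"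
    (is "distr M _ (\<lambda>\<omega>. (_, ?J \<omega>, ?E \<omega>)) = ?D \<Otimes>\<^sub>M ?R")
proof (rule pair_measure_eqI[symmetric])
  note [measurable] = X_measurable[OF s] X_measurable[OF r] INF_measurable[OF r] INF_shift_measurable[OF s r]
  have [measurable]: "X (s + r) \<in> borel_measurable M" using s r by (intro X_measurable) auto
  interpret D: prob_space ?D by (rule prob_space_distr) measurable
  interpret R: prob_space ?R by (rule prob_space_distr) measurable
  show "sigma_finite_measure ?D" "sigma_finite_measure ?R"
    by unfold_locales
  show "sets (?D \<Otimes>\<^sub>M ?R) = sets (distr M (borel \<Otimes>\<^sub>M (borel \<Otimes>\<^sub>M borel)) (\<lambda>\<omega>. (X s \<omega>, ?J \<omega>, ?E \<omega>)))"
    by (simp cong: sets_pair_measure_cong)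
  fix A C assume "A \<in> sets ?D" "C \<in> sets ?R"
  then have [measurable]: "A \<in> sets borel" and C [measurable]: "C \<in> sets (borel \<Otimes>\<^sub>M borel)" by auto
  define p where "p = emeasure ?D A"
  \<comment> \<open>With \<open>A\<close> fixed, both sides are measures in \<open>C\<close>, so it
    is enough to compare them on the products of \<open>{..<a}\<close> and Borel sets.\<close>
  define m1 where "m1 = density ?R (\<lambda>_. p)"
  define m2 where "m2 = distr (density M (indicator (X s -` A \<inter> space M))) (borel \<Otimes>\<^sub>M borel) (\<lambda>\<omega>. (?J \<omega>, ?E \<omega>))"
  have m1: "emeasure m1 C = p * emeasure ?R C" if "C \<in> sets (borel \<Otimes>\<^sub>M borel)" for C
    unfolding m1_def using that by (subst emeasure_density_const) auto
  have m2: "emeasure m2 C = emeasure M {\<omega>\<in>space M. X s \<omega> \<in> A \<and> (?J \<omega>, ?E \<omega>) \<in> C}"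
    if [measurable]: "C \<in> sets (borel \<Otimes>\<^sub>M borel)" for C
  proof -
    have "emeasure m2 C = emeasure (density M (indicator (X s -` A \<inter> space M))) ((\<lambda>\<omega>. (?J \<omega>, ?E \<omega>)) -` C \<inter> space M)"
      unfolding m2_def by (subst emeasure_distr) auto
    also have "\<dots> = (\<integral>\<^sup>+\<omega>. indicator (X s -` A \<inter> space M) \<omega> * indicator ((\<lambda>\<omega>. (?J \<omega>, ?E \<omega>)) -` C \<inter> space M) \<omega> \<partial>M)"
      by (subst emeasure_density) auto
    also have "\<dots> = (\<integral>\<^sup>+\<omega>. indicator {\<omega>\<in>space M. X s \<omega> \<in> A \<and> (?J \<omega>, ?E \<omega>) \<in> C} \<omega> \<partial>M)"
      by (intro nn_integral_cong) (auto simp: indicator_def)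
    also have "\<dots> = emeasure M {\<omega>\<in>space M. X s \<omega> \<in> A \<and> (?J \<omega>, ?E \<omega>) \<in> C}"
      by (subst nn_integral_indicator) auto
    finally show ?thesis .
  qed
  have "m1 = m2"
  proof (rule measure_eqI_lessThan_times)
    show "sets m1 = sets (borel \<Otimes>\<^sub>M borel)" "sets m2 = sets (borel \<Otimes>\<^sub>M borel)" by (auto simp: m1_def m2_def)
    show "finite_measure m1"
    proof
      have "p \<le> 1" unfolding p_def by (rule D.emeasure_le_1)
      then have "p * emeasure ?R (space ?R) \<le> 1" using R.emeasure_space_1 by simp
      moreover have "space m1 = UNIV" "space ?R = UNIV" by (auto simp: m1_def space_pair_measure)
      moreover have "UNIV \<in> sets (borel \<Otimes>\<^sub>M borel :: (real \<times> real) measure)"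
        by (metis sets.top space_borel space_pair_measure UNIV_Times_UNIV)
      ultimately show "emeasure m1 (space m1) \<noteq> \<infinity>" using m1[of UNIV] by (auto simp: top_unique)
    qed
    fix a and B :: "real set" assume B [measurable]: "B \<in> sets borel"
    define E1 where "E1 m = {\<omega>\<in>space M. (\<exists>k\<in>{..2 ^ m}. X (real k * r / 2 ^ m) \<omega> < a) \<and> X r \<omega> \<in> B}" for m :: nat
    define E2 where "E2 m = {\<omega>\<in>space M. X s \<omega> \<in> A \<and> (\<exists>k\<in>{..2 ^ m}. X (s + real k * r / 2 ^ m) \<omega> - X s \<omega> < a) \<and> ?E \<omega> \<in> B}" for m :: nat
    have [measurable]: "X (s + real k * r / 2 ^ m) \<in> borel_measurable M" "X (real k * r / 2 ^ m) \<in> borel_measurable M" for k m :: nat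
      using s r by (auto intro!: X_measurable)
    have E1m [measurable]: "E1 m \<in> sets M" for m unfolding E1_def by measurable
    have E2m [measurable]: "E2 m \<in> sets M" for m unfolding E2_def by measurable
    have E1: "emeasure ?R ({..<a} \<times> B) = (SUP m. emeasure M (E1 m))"
    proof -
      have "emeasure ?R ({..<a} \<times> B) = emeasure M {\<omega>\<in>space M. (INF u\<in>{0..r}. X u \<omega>) < a \<and> X r \<omega> \<in> B}"
        by (subst emeasure_distr) (auto intro!: arg_cong[where f = "emeasure M"])
      also have "{\<omega>\<in>space M. (INF u\<in>{0..r}. X u \<omega>) < a \<and> X r \<omega> \<in> B} = (\<Union>m. E1 m)"
        by (auto simp: E1_def INF_less_dyadic_iff[OF path r]) blast+
      also have "emeasure M (\<Union>m. E1 m) = (SUP m. emeasure M (E1 m))"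
        using dyadic_less_mono[of _ _ "\<lambda>u. X u _ < a"]
        by (intro SUP_emeasure_incseq[symmetric]) (auto simp: incseq_def E1_def Bex_def subset_eq)
      finally show ?thesis .
    qed
    have E2: "emeasure m2 ({..<a} \<times> B) = (SUP m. emeasure M (E2 m))"
    proof -
      have "emeasure m2 ({..<a} \<times> B) = emeasure M (\<Union>m. E2 m)"
      proof (subst m2, simp, rule arg_cong[where f = "emeasure M"])
        show "{\<omega>\<in>space M. X s \<omega> \<in> A \<and> (?J \<omega>, ?E \<omega>) \<in> {..<a} \<times> B} = (\<Union>m. E2 m)"
          by (auto simp: E2_def INF_less_dyadic_iff[OF cadlag_shift[OF path s] r]) blast+
      qed
      also have "emeasure M (\<Union>m. E2 m) = (SUP m. emeasure M (E2 m))"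
        using dyadic_less_mono[of _ _ "\<lambda>u. X (s + u) _ - X s _ < a"]
        by (intro SUP_emeasure_incseq[symmetric]) (auto simp: incseq_def E2_def Bex_def subset_eq)
      finally show ?thesis .
    qed
    have "emeasure M (E2 m) = p * emeasure M (E1 m)" for m
    proof -
      define n :: nat where "n = 2 ^ m"
      define h where "h = r / n"
      have n: "0 < n" "0 \<le> h" "real n * h = r" using r by (auto simp: n_def h_def)
      note [measurable] = incs_measurable[OF s n(2)] incs_measurable[OF order.refl n(2)]
      let ?Q = "PiM {..<n} (\<lambda>_. distr M borel (X h))"
      have [measurable_cong]: "sets ?Q = sets (seqs n)" by (intro sets_PiM_cong) auto
      interpret Q: prob_space ?Q by (intro prob_space_PiM prob_space_distr X_measurable n)
      have "emeasure M (E2 m) = emeasure M ((\<lambda>\<omega>. (X s \<omega>, incs s h n \<omega>)) -` (A \<times> low_event n a B) \<inter> space M)"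
        unfolding E2_def using n by (intro arg_cong[where f = "emeasure M"])
          (auto simp: incs_low_event_iff n_def h_def mult.commute)
      also have "\<dots> = emeasure (distr M (borel \<Otimes>\<^sub>M seqs n) (\<lambda>\<omega>. (X s \<omega>, incs s h n \<omega>))) (A \<times> low_event n a B)"
        by (subst emeasure_distr) auto
      also have "\<dots> = p * emeasure ?Q (low_event n a B)"
        unfolding incs_pair_law[OF s n(2,1)] p_def by (subst Q.emeasure_pair_measure_Times) auto
      also have "?Q = distr M (seqs n) (incs 0 h n)" using incs_law[of 0 h n] n by simp
      also have "emeasure \<dots> (low_event n a B) = emeasure M (incs 0 h n -` low_event n a B \<inter> space M)"
        by (subst emeasure_distr) auto
      also have "\<dots> = emeasure M (E1 m)"
      proof (rule emeasure_eq_AE)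
        show "AE \<omega> in M. (\<omega> \<in> incs 0 h n -` low_event n a B \<inter> space M) = (\<omega> \<in> E1 m)"
          using X_0 AE_space
        proof eventually_elim
          case (elim \<omega>)
          then show ?case using n by (auto simp: incs_low_event_iff E1_def n_def h_def mult.commute)
        qed
      qed auto
      finally show ?thesis .
    qed
    then show "emeasure m1 ({..<a} \<times> B) = emeasure m2 ({..<a} \<times> B)"
      by (subst m1) (auto simp: E1 E2 SUP_mult_left_ennreal)
  qed
  then have "emeasure m1 C = emeasure m2 C" by simp
  then show "emeasure ?D A * emeasure ?R C = emeasure (distr M (borel \<Otimes>\<^sub>M (borel \<Otimes>\<^sub>M borel)) (\<lambda>\<omega>. (X s \<omega>, ?J \<omega>, ?E \<omega>))) (A \<times> C)"
    unfolding m1[OF C] m2[OF C] p_def[symmetric]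
    by (subst (2) emeasure_distr) (auto intro!: arg_cong[where f = "emeasure M"])
qed

section \<open>Time reversal\<close>

lemma sum_reversed:
  fixes v :: "nat \<Rightarrow> real"
  assumes "k \<le> n"
  shows "(\<Sum>i<k. v (n - 1 - i)) = (\<Sum>i<n. v i) - (\<Sum>i<n - k. v i)"
  using assms
proof (induction k)
  case (Suc k)
  have "{..<n - k} = insert (n - Suc k) {..<n - Suc k}" using Suc.prems by auto
  then have "(\<Sum>i<n - k. v i) = v (n - Suc k) + (\<Sum>i<n - Suc k. v i)" by simp
  then show ?case using Suc by simp
qed simp

lemma bij_betw_reverse: "bij_betw (\<lambda>i. n - 1 - i) {..<n} {..<n::nat}"
  by (rule bij_betwI[where g = "\<lambda>i. n - 1 - i"]) auto

text \<open>Reversing the order of the increments preserves their law and turns the partial sum over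
  \<open>k\<close> steps into the final value minus the partial sum over \<open>n - k\<close> steps;
  hence the supremum becomes \<open>X t\<close> minus the infimum. The first coordinate carries a
  minus sign during the proof so that the events are of the form \<open>< a\<close>, which are
  unions over grids.\<close>

lemma time_reversal:
  assumes t: "0 \<le> t"
  shows "distr M (borel \<Otimes>\<^sub>M borel) (\<lambda>\<omega>. (SUP u\<in>{0..t}. X u \<omega>, X t \<omega>)) =
    distr M (borel \<Otimes>\<^sub>M borel) (\<lambda>\<omega>. (X t \<omega> - (INF u\<in>{0..t}. X u \<omega>), X t \<omega>))"
proof -
  interpret N: levy M "\<lambda>t \<omega>. - X t \<omega>" by (rule uminus)
  note [measurable] = X_measurable[OF t] INF_measurable[OF t] SUP_measurable[OF t]
  define m1 where "m1 = distr M (borel \<Otimes>\<^sub>M borel) (\<lambda>\<omega>. (- (SUP u\<in>{0..t}. X u \<omega>), X t \<omega>))"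
  define m2 where "m2 = distr M (borel \<Otimes>\<^sub>M borel) (\<lambda>\<omega>. ((INF u\<in>{0..t}. X u \<omega>) - X t \<omega>, X t \<omega>))"
  have "m1 = m2"
  proof (rule measure_eqI_lessThan_times)
    show "finite_measure m1" unfolding m1_def by (intro finite_measure_distr) measurable
    show "sets m1 = sets (borel \<Otimes>\<^sub>M borel)" "sets m2 = sets (borel \<Otimes>\<^sub>M borel)" by (auto simp: m1_def m2_def)
    fix a and B :: "real set" assume B [measurable]: "B \<in> sets borel"
    define E1 where "E1 m = {\<omega>\<in>space M. (\<exists>k\<in>{..2 ^ m}. - X (real k * t / 2 ^ m) \<omega> < a) \<and> X t \<omega> \<in> B}" for m :: nat
    define E2 where "E2 m = {\<omega>\<in>space M. (\<exists>k\<in>{..2 ^ m}. X (real k * t / 2 ^ m) \<omega> - X t \<omega> < a) \<and> X t \<omega> \<in> B}" for m :: nat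
    have [measurable]: "X (real k * t / 2 ^ m) \<in> borel_measurable M" for k m :: nat
      using t by (auto intro!: X_measurable)
    have E1m [measurable]: "E1 m \<in> sets M" for m unfolding E1_def by measurable
    have E2m [measurable]: "E2 m \<in> sets M" for m unfolding E2_def by measurable
    have "emeasure m1 ({..<a} \<times> B) = emeasure M {\<omega>\<in>space M. (INF u\<in>{0..t}. - X u \<omega>) < a \<and> X t \<omega> \<in> B}"
      unfolding m1_def INF_uminus_real by (subst emeasure_distr) (auto intro!: arg_cong[where f = "emeasure M"])
    also have "{\<omega>\<in>space M. (INF u\<in>{0..t}. - X u \<omega>) < a \<and> X t \<omega> \<in> B} = (\<Union>m. E1 m)"
      by (auto simp: E1_def INF_less_dyadic_iff[OF cadlag_uminus[OF path] t]) blast+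
    also have "emeasure M (\<Union>m. E1 m) = (SUP m. emeasure M (E1 m))"
      using dyadic_less_mono[of _ _ "\<lambda>u. - X u _ < a"]
      by (intro SUP_emeasure_incseq[symmetric]) (auto simp: incseq_def E1_def Bex_def subset_eq)
    finally have E1: "emeasure m1 ({..<a} \<times> B) = (SUP m. emeasure M (E1 m))" .
    have "emeasure m2 ({..<a} \<times> B) = emeasure M {\<omega>\<in>space M. (INF u\<in>{0..t}. X u \<omega>) < X t \<omega> + a \<and> X t \<omega> \<in> B}"
      unfolding m2_def by (subst emeasure_distr) (auto intro!: arg_cong[where f = "emeasure M"])
    also have "{\<omega>\<in>space M. (INF u\<in>{0..t}. X u \<omega>) < X t \<omega> + a \<and> X t \<omega> \<in> B} = (\<Union>m. E2 m)"
      by (auto simp: E2_def INF_less_dyadic_iff[OF path t] diff_less_eq add.commute) blast+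
    also have "emeasure M (\<Union>m. E2 m) = (SUP m. emeasure M (E2 m))"
      using dyadic_less_mono[of _ _ "\<lambda>u. X u _ - X t _ < a"]
      by (intro SUP_emeasure_incseq[symmetric]) (auto simp: incseq_def E2_def Bex_def subset_eq)
    finally have E2: "emeasure m2 ({..<a} \<times> B) = (SUP m. emeasure M (E2 m))" .
    have "emeasure M (E1 m) = emeasure M (E2 m)" for m
    proof -
      define n :: nat where "n = 2 ^ m"
      define h where "h = t / n"
      have n: "0 < n" "0 \<le> h" "real n * h = t" using t by (auto simp: n_def h_def)
      note [measurable] = incs_measurable[OF order.refl n(2)]
      define C where "C = {v \<in> space (seqs n). (\<exists>k\<in>{..n}. (\<Sum>i<k. v i) - (\<Sum>i<n. v i) < a) \<and> (\<Sum>i<n. v i) \<in> B}"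
      have [measurable]: "(\<lambda>v. \<Sum>i<n. v i) \<in> borel_measurable (seqs n)" by (rule psum_measurable) simp
      have "C = (\<Union>k\<in>{..n}. {v \<in> space (seqs n). (\<Sum>i<k. v i) - (\<Sum>i<n. v i) < a}) \<inter> {v \<in> space (seqs n). (\<Sum>i<n. v i) \<in> B}"
        by (auto simp: C_def)
      also have "\<dots> \<in> sets (seqs n)"
        by (intro sets.Int sets.finite_UN) (auto intro!: borel_measurable_less borel_measurable_diff psum_measurable)
      finally have [measurable]: "C \<in> sets (seqs n)" .
      define R where "R \<omega> = (\<lambda>k\<in>{..<n}. incs 0 h n \<omega> (n - 1 - k))" for \<omega>
      have "R \<omega> \<in> C \<longleftrightarrow> (\<exists>k\<le>n. X 0 \<omega> - X (real k * h) \<omega> < a) \<and> X (real n * h) \<omega> - X 0 \<omega> \<in> B" for \<omega>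
      proof -
        have ps: "(\<Sum>i<k. R \<omega> i) = X (real n * h) \<omega> - X (real (n - k) * h) \<omega>" if "k \<le> n" for k
        proof -
          have "(\<Sum>i<k. R \<omega> i) = (\<Sum>i<k. incs 0 h n \<omega> (n - 1 - i))"
            using that by (intro sum.cong) (auto simp: R_def)
          then show ?thesis
            using sum_reversed[OF that, of "incs 0 h n \<omega>"] sum_incs[of n n 0 h \<omega>] sum_incs[of "n - k" n 0 h \<omega>]
            by simp
        qed
        have "(\<exists>k\<in>{..n}. (\<Sum>i<k. R \<omega> i) - (\<Sum>i<n. R \<omega> i) < a) \<longleftrightarrow> (\<exists>k\<in>{..n}. X 0 \<omega> - X (real (n - k) * h) \<omega> < a)"
          by (intro bex_cong) (auto simp: ps)
        also have "\<dots> \<longleftrightarrow> (\<exists>k\<le>n. X 0 \<omega> - X (real k * h) \<omega> < a)"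
          by (metis atMost_iff diff_diff_cancel diff_le_self)
        finally show ?thesis by (simp add: C_def ps) (simp add: R_def space_PiM)
      qed
      note R = this
      have "emeasure M (E1 m) = (\<integral>\<^sup>+\<omega>. indicator (E1 m) \<omega> \<partial>M)" by simp
      also have "\<dots> = (\<integral>\<^sup>+\<omega>. indicator C (R \<omega>) \<partial>M)"
      proof (rule nn_integral_cong_AE)
        show "AE \<omega> in M. indicator (E1 m) \<omega> = (indicator C (R \<omega>) :: ennreal)"
          using X_0 AE_space
        proof eventually_elim
          case (elim \<omega>)
          then show ?case using n by (auto simp: indicator_def R E1_def n_def h_def mult.commute)
        qed
      qed
      also have "\<dots> = (\<integral>\<^sup>+\<omega>. indicator C (incs 0 h n \<omega>) \<partial>M)"
        unfolding R_def by (rule nn_integral_incs_perm) (use n bij_betw_reverse in auto)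
      also have "\<dots> = (\<integral>\<^sup>+\<omega>. indicator (E2 m) \<omega> \<partial>M)"
      proof (rule nn_integral_cong_AE)
        show "AE \<omega> in M. indicator C (incs 0 h n \<omega>) = (indicator (E2 m) \<omega> :: ennreal)"
          using X_0 AE_space
        proof eventually_elim
          case (elim \<omega>)
          have "incs 0 h n \<omega> \<in> space (seqs n)" by (auto simp: space_PiM incs_def)
          then have "incs 0 h n \<omega> \<in> C \<longleftrightarrow> \<omega> \<in> E2 m"
            using elim n by (auto simp: C_def sum_incs E2_def n_def h_def mult.commute)
          then show ?case by (simp add: indicator_def)
        qed
      qed
      also have "\<dots> = emeasure M (E2 m)" by simp
      finally show ?thesis .
    qed
    then show "emeasure m1 ({..<a} \<times> B) = emeasure m2 ({..<a} \<times> B)" by (simp add: E1 E2)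
  qed
  then have "distr m1 (borel \<Otimes>\<^sub>M borel) (\<lambda>(a, b). (- a, b)) = distr m2 (borel \<Otimes>\<^sub>M borel) (\<lambda>(a, b). (- a, b))"
    by simp
  then show ?thesis
    unfolding m1_def m2_def by (subst (asm) (1 2) distr_distr) (auto simp: comp_def)
qed

section \<open>Joint measurability in time and path\<close>

lemma X_joint_measurable: "(\<lambda>(r, \<omega>). X (max 0 r) \<omega>) \<in> borel_measurable (borel \<Otimes>\<^sub>M M)"
proof (rule borel_measurable_LIMSEQ_metric)
  \<comment> \<open>Rounding up to the grid approaches the time from the right, where the path is
    continuous. Each approximation takes countably many time values and is therefore jointly
    measurable. Negative times are sent to 0, since nothing is known of \<open>X\<close>
    there.\<close>
  define a where "a m r = real (nat \<lceil>max 0 r * 2 ^ m\<rceil>) / 2 ^ m" for m :: nat and r :: real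
  show "(\<lambda>(r, \<omega>). X (a m r) \<omega>) \<in> borel_measurable (borel \<Otimes>\<^sub>M M)" for m
  proof -
    have "(\<lambda>x. X (real k / 2 ^ m) (snd x)) \<in> borel_measurable (borel \<Otimes>\<^sub>M M)" for k
      by (rule measurable_compose[OF measurable_snd X_measurable]) simp
    then have "(\<lambda>x. X (real (nat \<lceil>max 0 (fst x) * (2 ^ m :: real)\<rceil>) / 2 ^ m) (snd x)) \<in> borel_measurable (borel \<Otimes>\<^sub>M M)"
      by (rule measurable_compose_countable[where f = "\<lambda>k x. X (real k / 2 ^ m) (snd x)"
            and g = "\<lambda>x. nat \<lceil>max 0 (fst x) * (2 ^ m :: real)\<rceil>"]) measurable
    then show ?thesis by (simp add: a_def case_prod_beta')
  qed
  fix x :: "real \<times> 'a" assume "x \<in> space (borel \<Otimes>\<^sub>M M)"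
  then obtain r \<omega> where x: "x = (r, \<omega>)" "\<omega> \<in> space M" by (auto simp: space_pair_measure)
  have ge: "max 0 r \<le> a m r" for m
  proof -
    have "max 0 r * 2 ^ m / 2 ^ m \<le> a m r"
      unfolding a_def by (rule divide_right_mono[OF real_nat_ceiling_ge]) simp
    then show ?thesis by simp
  qed
  have le: "a m r \<le> max 0 r + 1 / 2 ^ m" for m
  proof -
    have "real (nat \<lceil>max 0 r * 2 ^ m\<rceil>) \<le> max 0 r * 2 ^ m + 1"
      using of_int_ceiling_le_add_one[of "max 0 r * 2 ^ m"] by simp
    then have "a m r \<le> (max 0 r * 2 ^ m + 1) / 2 ^ m"
      unfolding a_def by (rule divide_right_mono) simp
    then show ?thesis by (simp add: add_divide_distrib)
  qed
  have "(\<lambda>m. max 0 r + 1 / 2 ^ m) \<longlonglongrightarrow> max 0 r + 0"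
    by (intro tendsto_add tendsto_const LIMSEQ_divide_realpow_zero) simp
  then have "(\<lambda>m. a m r) \<longlonglongrightarrow> max 0 r"
    by (intro tendsto_sandwich[of "\<lambda>_. max 0 r" "\<lambda>m. a m r" sequentially "\<lambda>m. max 0 r + 1 / 2 ^ m"])
      (use ge le in auto)
  then have "(\<lambda>m. X (a m r) \<omega>) \<longlonglongrightarrow> X (max 0 r) \<omega>"
    using ge by (intro cadlag_right_tendsto[OF path[OF x(2)]]) auto
  then show "(\<lambda>m. case x of (r, \<omega>) \<Rightarrow> X (a m r) \<omega>) \<longlonglongrightarrow> (case x of (r, \<omega>) \<Rightarrow> X (max 0 r) \<omega>)"
    by (simp add: x)
qed

lemma INF_joint_measurable: "(\<lambda>(r, \<omega>). INF u\<in>{0..max 0 r}. X u \<omega>) \<in> borel_measurable (borel \<Otimes>\<^sub>M M)"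
proof (rule borel_measurableI_less)
  fix a
  have "{x\<in>space (borel \<Otimes>\<^sub>M M). (case x of (r, \<omega>) \<Rightarrow> INF u\<in>{0..max 0 r}. X u \<omega>) < a} =
    (\<Union>m. \<Union>k\<in>{..2 ^ m}. {x\<in>space (borel \<Otimes>\<^sub>M M). X (real k * max 0 (fst x) / 2 ^ m) (snd x) < a})"
    by (auto simp: space_pair_measure INF_less_dyadic_iff[OF path]) blast+
  also have "\<dots> \<in> sets (borel \<Otimes>\<^sub>M M)"
  proof -
    have "{x\<in>space (borel \<Otimes>\<^sub>M M). X (real k * max 0 (fst x) / 2 ^ m) (snd x) < a} \<in> sets (borel \<Otimes>\<^sub>M M)"
      for m k :: nat
    proof -
      have "(\<lambda>x. (\<lambda>(r, \<omega>). X (max 0 r) \<omega>) (real k * max 0 (fst x) / 2 ^ m, snd x)) \<in> borel_measurable (borel \<Otimes>\<^sub>M M)"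
        by (rule measurable_compose[OF _ X_joint_measurable]) measurable
      moreover have "max 0 (real k * max 0 r / 2 ^ m) = real k * max 0 r / 2 ^ m" for r by simp
      ultimately have [measurable]: "(\<lambda>x. X (real k * max 0 (fst x) / 2 ^ m) (snd x)) \<in> borel_measurable (borel \<Otimes>\<^sub>M M)"
        by (simp add: case_prod_beta')
      show ?thesis by measurable
    qed
    then show ?thesis by (intro sets.countable_UN sets.finite_UN) auto
  qed
  finally show "{x\<in>space (borel \<Otimes>\<^sub>M M). (case x of (r, \<omega>) \<Rightarrow> INF u\<in>{0..max 0 r}. X u \<omega>) < a} \<in> sets (borel \<Otimes>\<^sub>M M)" .
qed

end

section \<open>Expected descents\<close>

lemma bij_betw_rot: "bij_betw (rot k r) {..<k} {..<k}"
proof (cases "k = 0")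
  case False
  have "rot k r ` {..<k} \<subseteq> {..<k}" using False by (auto simp: rot_def)
  moreover have "inj_on (rot k r) {..<k}"
  proof (rule inj_onI)
    fix x y assume xy: "x \<in> {..<k}" "y \<in> {..<k}" "rot k r x = rot k r y"
    then have m: "(x + r) mod k = (y + r) mod k" by (auto simp: rot_def)
    show "x = y"
    proof (cases "x \<le> y")
      case True
      then have "k dvd y - x" using m mod_eq_dvd_iff_nat[of "x + r" "y + r" k] by simp
      then show ?thesis using True xy by (auto dest: dvd_imp_le)
    next
      case False
      then have "k dvd x - y" using m mod_eq_dvd_iff_nat[of "y + r" "x + r" k] by simp
      then show ?thesis using False xy by (auto dest: dvd_imp_le)
    qed
  qed
  ultimately show ?thesis by (simp add: bij_betw_def endo_inj_surj)
qed (simp add: bij_betw_def)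

lemma bij_betw_rot':
  assumes "k \<le> n"
  shows "bij_betw (rot k r) {..<n} {..<n}"
proof -
  have "bij_betw (rot k r) ({..<k} \<union> {k..<n}) ({..<k} \<union> {k..<n})"
  proof (rule bij_betw_combine[OF bij_betw_rot])
    show "bij_betw (rot k r) {k..<n} {k..<n}"
      by (rule bij_betw_cong[THEN iffD1, OF _ bij_betw_id]) (auto simp: rot_def)
  qed auto
  moreover have "{..<k} \<union> {k..<n} = {..<n}" using assms by auto
  ultimately show ?thesis by simp
qed

lemma sum_rot:
  assumes "k \<le> j"
  shows "(\<Sum>i<j. v (rot k r i)) = (\<Sum>i<j. v i)"
  by (rule sum.reindex_bij_betw[OF bij_betw_rot'[OF assms]])

context levy
begin

text \<open>Averaging over the rotations of the first \<open>k\<close> increments gives a continuous-time analogue of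
  the ballot theorem. It is exact for every random walk, before any limit is taken.\<close>

lemma nn_integral_descent:
  fixes G :: "(nat \<Rightarrow> real) \<Rightarrow> ennreal"
  assumes k: "0 < k" "k \<le> n" and h: "0 \<le> h"
    and G [measurable]: "(\<lambda>v. G (\<lambda>j. \<Sum>i<j. v i)) \<in> borel_measurable (seqs n)"
    and inv: "\<And>S S'. (\<And>j. k \<le> j \<Longrightarrow> j \<le> n \<Longrightarrow> S j = S' j) \<Longrightarrow> G S = G S'"
  shows "(\<integral>\<^sup>+\<omega>. ennreal (descent (\<lambda>j. X (real j * h) \<omega>) k) * G (\<lambda>j. X (real j * h) \<omega>) \<partial>M) =
    (\<integral>\<^sup>+\<omega>. ennreal (max 0 (- X (real k * h) \<omega>) / real k) * G (\<lambda>j. X (real j * h) \<omega>) \<partial>M)"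
proof -
  define P where "P v j = (\<Sum>i<j. v i :: real)" for v and j :: nat
  have dcong: "descent S k = descent S' k" if "\<And>j. j \<le> k \<Longrightarrow> S j = S' j" for S S'
  proof -
    have "S ` {..<k} = S' ` {..<k}" using that by (intro image_cong) auto
    then show ?thesis using that[of k] by (simp add: descent_def)
  qed
  have n: "0 < n" using k by simp
  note [measurable] = incs_measurable[OF order.refl h]
  have [measurable]: "(\<lambda>v. P v j) \<in> borel_measurable (seqs n)" if "j \<le> n" for j
    unfolding P_def using that by (rule psum_measurable)
  have [measurable]: "(\<lambda>v. Min ((\<lambda>j. P v j) ` {..<k})) \<in> borel_measurable (seqs n)"
    using k by (intro borel_measurable_Min) auto
  have [measurable]: "(\<lambda>v. P v k) \<in> borel_measurable (seqs n)" using k by simp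
  have Dm [measurable]: "(\<lambda>v. descent (P v) k) \<in> borel_measurable (seqs n)"
    unfolding descent_def by measurable
  have Gm [measurable]: "(\<lambda>v. G (P v)) \<in> borel_measurable (seqs n)"
    using G by (simp add: P_def[abs_def])
  define F where "F v = ennreal (descent (P v) k) * G (P v)" for v
  have [measurable]: "F \<in> borel_measurable (seqs n)" unfolding F_def by measurable
  define V where "V = incs 0 h n"
  define R where "R r \<omega> = (\<lambda>i\<in>{..<n}. V \<omega> (rot k r i))" for r \<omega>
  have P_R: "P (R r \<omega>) j = (\<Sum>i<j. V \<omega> (rot k r i))" if "j \<le> n" for r j \<omega>
    unfolding P_def R_def using that by (intro sum.cong) auto
  have "P (R r \<omega>) j = P (V \<omega>) j" if "k \<le> j" "j \<le> n" for r j \<omega>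
    using P_R[OF that(2), of r \<omega>] sum_rot[OF that(1), of "V \<omega>" r] by (simp add: P_def)
  then have G_R: "G (P (R r \<omega>)) = G (P (V \<omega>))" for r \<omega> by (intro inv)
  \<comment> \<open>The weight \<open>G\<close> does not see the order of the first \<open>k\<close>
    increments, so it factors out of the sum over rotations and the cyclic lemma applies path by
    path.\<close>
  have sumF: "(\<Sum>r<k. F (R r \<omega>)) = ennreal (max 0 (- P (V \<omega>) k)) * G (P (V \<omega>))" for \<omega>
  proof -
    have "(\<Sum>r<k. F (R r \<omega>)) = (\<Sum>r<k. ennreal (descent (\<lambda>j. \<Sum>i<j. V \<omega> (rot k r i)) k) * G (P (V \<omega>)))"
      unfolding F_def G_R using k P_R by (intro sum.cong arg_cong2[where f = "(*)"] arg_cong[where f = ennreal] dcong) auto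
    also have "\<dots> = (\<Sum>r<k. ennreal (descent (\<lambda>j. \<Sum>i<j. V \<omega> (rot k r i)) k)) * G (P (V \<omega>))"
      by (rule sum_distrib_right[symmetric])
    also have "(\<Sum>r<k. ennreal (descent (\<lambda>j. \<Sum>i<j. V \<omega> (rot k r i)) k)) = ennreal (max 0 (- P (V \<omega>) k))"
      unfolding P_def sum_descent_rot[OF k(1), symmetric] by (rule sum_ennreal) simp
    finally show ?thesis .
  qed
  have RM [measurable]: "R r \<in> M \<rightarrow>\<^sub>M seqs n" for r
  proof -
    have "rot k r i < n" if "i < n" for i
      using bij_betw_rot'[OF k(2), of r] that by (auto simp: bij_betw_def)
    then show ?thesis unfolding R_def V_def
      by (intro measurable_restrict measurable_compose[OF incs_measurable[OF order.refl h] measurable_component_singleton]) auto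
  qed
  \<comment> \<open>All \<open>k\<close> rotated vectors have the same law, so the expected descent
    is the \<open>k\<close>-th part of the sum. This is the origin of the factor
    \<open>1 / s\<close> in Kendall's identity.\<close>
  have "of_nat k * (\<integral>\<^sup>+\<omega>. F (V \<omega>) \<partial>M) = (\<Sum>r<k. \<integral>\<^sup>+\<omega>. F (R r \<omega>) \<partial>M)"
    unfolding R_def V_def using nn_integral_incs_perm[OF order.refl h n bij_betw_rot'[OF k(2)]] by simp
  also have "\<dots> = (\<integral>\<^sup>+\<omega>. ennreal (max 0 (- P (V \<omega>) k)) * G (P (V \<omega>)) \<partial>M)"
    by (subst nn_integral_sum[symmetric]) (auto simp: sumF)
  also have "\<dots> = (\<integral>\<^sup>+\<omega>. of_nat k * (ennreal (max 0 (- P (V \<omega>) k) / real k) * G (P (V \<omega>))) \<partial>M)"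
  proof (intro nn_integral_cong)
    fix \<omega>
    have "ennreal (max 0 (- P (V \<omega>) k)) = ennreal (real k) * ennreal (max 0 (- P (V \<omega>) k) / real k)"
      using k by (subst ennreal_mult'[symmetric]) auto
    then show "ennreal (max 0 (- P (V \<omega>) k)) * G (P (V \<omega>)) = of_nat k * (ennreal (max 0 (- P (V \<omega>) k) / real k) * G (P (V \<omega>)))"
      by (simp add: ennreal_of_nat_eq_real_of_nat mult.assoc)
  qed
  also have "\<dots> = of_nat k * (\<integral>\<^sup>+\<omega>. ennreal (max 0 (- P (V \<omega>) k) / real k) * G (P (V \<omega>)) \<partial>M)"
    unfolding V_def by (rule nn_integral_cmult) measurable
  finally have "(\<integral>\<^sup>+\<omega>. F (V \<omega>) \<partial>M) = (\<integral>\<^sup>+\<omega>. ennreal (max 0 (- P (V \<omega>) k) / real k) * G (P (V \<omega>)) \<partial>M)"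
    using k by (simp add: ennreal_mult_cancel_left)
  moreover have PV: "AE \<omega> in M. \<forall>j\<le>n. P (V \<omega>) j = X (real j * h) \<omega>"
    using X_0
  proof eventually_elim
    case (elim \<omega>)
    then show ?case using sum_incs[of _ n 0 h \<omega>] by (simp add: P_def V_def)
  qed
  moreover have "(\<integral>\<^sup>+\<omega>. F (V \<omega>) \<partial>M) = (\<integral>\<^sup>+\<omega>. ennreal (descent (\<lambda>j. X (real j * h) \<omega>) k) * G (\<lambda>j. X (real j * h) \<omega>) \<partial>M)"
  proof (rule nn_integral_cong_AE)
    show "AE \<omega> in M. F (V \<omega>) = ennreal (descent (\<lambda>j. X (real j * h) \<omega>) k) * G (\<lambda>j. X (real j * h) \<omega>)"
      using PV
    proof eventually_elim
      case (elim \<omega>)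
      then show ?case unfolding F_def using k
        by (intro arg_cong2[where f = "(*)"] arg_cong[where f = ennreal] dcong inv) auto
    qed
  qed
  moreover have "(\<integral>\<^sup>+\<omega>. ennreal (max 0 (- P (V \<omega>) k) / real k) * G (P (V \<omega>)) \<partial>M) =
     (\<integral>\<^sup>+\<omega>. ennreal (max 0 (- X (real k * h) \<omega>) / real k) * G (\<lambda>j. X (real j * h) \<omega>) \<partial>M)"
  proof (rule nn_integral_cong_AE)
    show "AE \<omega> in M. ennreal (max 0 (- P (V \<omega>) k) / real k) * G (P (V \<omega>)) =
        ennreal (max 0 (- X (real k * h) \<omega>) / real k) * G (\<lambda>j. X (real j * h) \<omega>)"
      using PV
    proof eventually_elim
      case (elim \<omega>)
      then have "G (P (V \<omega>)) = G (\<lambda>j. X (real j * h) \<omega>)" by (intro inv) auto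
      then show ?case using elim k by simp
    qed
  qed
  ultimately show ?thesis by simp
qed

text \<open>Pathwise the sums converge by \<open>sum_descent_tendsto\<close>. The descents that end
  above \<open>-x\<close> add up to at most \<open>x\<close> for a path starting at 0, which
  dominates.\<close>

lemma nn_integral_sum_descent_limit:
  assumes jmp: "AE \<omega> in M. \<forall>t>0. jump (\<lambda>u. X u \<omega>) t \<ge> 0"
    and t: "0 < t" and x: "0 \<le> x" and B [measurable]: "B \<in> sets borel"
  shows "(\<lambda>m. \<Sum>k\<in>{2 ^ (m - l)<..2 ^ m}.
      \<integral>\<^sup>+\<omega>. ennreal (descent (\<lambda>j. X (real j * t / 2 ^ m) \<omega>) k) *
        (if X (real k * t / 2 ^ m) \<omega> > - x \<and> (\<exists>j\<in>{k..2 ^ m}. X (real j * t / 2 ^ m) \<omega> < c) \<and> X t \<omega> \<in> B then 1 else 0) \<partial>M)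
    \<longlonglongrightarrow> (\<integral>\<^sup>+\<omega>. ennreal (max (INF u\<in>{0..t / 2 ^ l}. X u \<omega>) (- x) - max (INF u\<in>{0..t}. X u \<omega>) (- x)) *
        indicator {\<omega>\<in>space M. (INF u\<in>{0..t}. X u \<omega>) < c \<and> X t \<omega> \<in> B} \<omega> \<partial>M)"
proof -
  define S where "S m \<omega> j = X (real j * t / 2 ^ m) \<omega>" for m :: nat and \<omega> and j :: nat
  have tm: "0 \<le> real j * t / 2 ^ m" for j m :: nat using t by simp
  have [measurable]: "(\<lambda>\<omega>. S m \<omega> j) \<in> borel_measurable M" for m j
    unfolding S_def by (rule X_measurable[OF tm])
  have [measurable]: "X t \<in> borel_measurable M" using t by (simp add: X_measurable)
  have [measurable]: "(\<lambda>\<omega>. INF u\<in>{0..t}. X u \<omega>) \<in> borel_measurable M"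
    "(\<lambda>\<omega>. INF u\<in>{0..t / 2 ^ l}. X u \<omega>) \<in> borel_measurable M"
    using t by (auto intro!: INF_measurable)
  have [measurable]: "(\<lambda>\<omega>. descent (S m \<omega>) k) \<in> borel_measurable M" for m k
    unfolding descent_def by measurable
  define g where "g m \<omega> = (\<Sum>k\<in>{2 ^ (m - l)<..2 ^ m}. if S m \<omega> k > - x then descent (S m \<omega>) k else 0)" for m \<omega>
  define w where "w m \<omega> = ennreal (g m \<omega>) * indicator {\<omega>\<in>space M. (\<exists>j\<in>{..2 ^ m}. S m \<omega> j < c) \<and> X t \<omega> \<in> B} \<omega>" for m \<omega>
  have gm [measurable]: "g m \<in> borel_measurable M" for m unfolding g_def by measurable
  have wm [measurable]: "w m \<in> borel_measurable M" for m unfolding w_def by measurable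
  have 1: "(\<Sum>k\<in>{2 ^ (m - l)<..2 ^ m}.
      \<integral>\<^sup>+\<omega>. ennreal (descent (S m \<omega>) k) *
        (if S m \<omega> k > - x \<and> (\<exists>j\<in>{k..2 ^ m}. S m \<omega> j < c) \<and> X t \<omega> \<in> B then 1 else 0) \<partial>M) = (\<integral>\<^sup>+\<omega>. w m \<omega> \<partial>M)" for m
  proof (subst nn_integral_sum[symmetric], measurable, rule nn_integral_cong)
    fix \<omega> assume \<omega>: "\<omega> \<in> space M"
    \<comment> \<open>The weight may look only at indices from \<open>k\<close> on, yet the limit
      concerns the whole path. At a step with a descent, \<open>S k\<close> is a new strict minimum,
      so if the walk was below \<open>c\<close> earlier it is below \<open>c\<close> at
      \<open>k\<close> as well.\<close>
    have eq: "(\<exists>j\<in>{k..2 ^ m}. S m \<omega> j < c) \<longleftrightarrow> (\<exists>j\<in>{..2 ^ m}. S m \<omega> j < c)"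
      if k: "2 ^ (m - l) < k" "k \<le> 2 ^ m" and d: "descent (S m \<omega>) k > 0" for k
    proof
      assume "\<exists>j\<in>{..2 ^ m}. S m \<omega> j < c"
      then obtain j where j: "j \<le> 2 ^ m" "S m \<omega> j < c" by auto
      show "\<exists>j\<in>{k..2 ^ m}. S m \<omega> j < c"
      proof (cases "j < k")
        case True
        have "S m \<omega> k < Min (S m \<omega> ` {..<k})" using d by (auto simp: descent_def max_def split: if_splits)
        also have "\<dots> \<le> S m \<omega> j" using True by (intro Min_le) auto
        finally show ?thesis using j k by (intro bexI[of _ k]) auto
      qed (use j in auto)
    qed auto
    have "(\<Sum>k\<in>{2 ^ (m - l)<..2 ^ m}. ennreal (descent (S m \<omega>) k) *
        (if S m \<omega> k > - x \<and> (\<exists>j\<in>{k..2 ^ m}. S m \<omega> j < c) \<and> X t \<omega> \<in> B then 1 else 0)) =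
      (\<Sum>k\<in>{2 ^ (m - l)<..2 ^ m}. ennreal (if S m \<omega> k > - x then descent (S m \<omega>) k else 0) *
        indicator {\<omega>\<in>space M. (\<exists>j\<in>{..2 ^ m}. S m \<omega> j < c) \<and> X t \<omega> \<in> B} \<omega>)"
    proof (intro sum.cong refl)
      fix k :: nat assume "k \<in> {2 ^ (m - l)<..2 ^ m}"
      then have k: "2 ^ (m - l) < k" "k \<le> 2 ^ m" by auto
      show "ennreal (descent (S m \<omega>) k) *
        (if S m \<omega> k > - x \<and> (\<exists>j\<in>{k..2 ^ m}. S m \<omega> j < c) \<and> X t \<omega> \<in> B then 1 else 0) =
       ennreal (if S m \<omega> k > - x then descent (S m \<omega>) k else 0) *
        indicator {\<omega>\<in>space M. (\<exists>j\<in>{..2 ^ m}. S m \<omega> j < c) \<and> X t \<omega> \<in> B} \<omega>"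
      proof (cases "descent (S m \<omega>) k > 0")
        case True
        then show ?thesis using eq[OF k True] \<omega> by (auto simp: indicator_def)
      next
        case False
        then have "descent (S m \<omega>) k = 0" using descent_nonneg[of "S m \<omega>" k] by linarith
        then show ?thesis by simp
      qed
    qed
    also have "\<dots> = w m \<omega>"
      unfolding w_def g_def sum_distrib_right[symmetric]
      by (intro arg_cong2[where f = "(*)"] refl sum_ennreal) auto
    finally show "(\<Sum>k\<in>{2 ^ (m - l)<..2 ^ m}. ennreal (descent (S m \<omega>) k) *
        (if S m \<omega> k > - x \<and> (\<exists>j\<in>{k..2 ^ m}. S m \<omega> j < c) \<and> X t \<omega> \<in> B then 1 else 0)) = w m \<omega>" .
  qed
  have bd: "AE \<omega> in M. w m \<omega> \<le> ennreal x" for m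
    using X_0
  proof eventually_elim
    case (elim \<omega>)
    have "Min (S m \<omega> ` {..2 ^ (m - l)}) \<le> S m \<omega> 0" by (intro Min_le) auto
    also have "\<dots> = 0" using elim by (simp add: S_def)
    finally have m0: "Min (S m \<omega> ` {..2 ^ (m - l)}) \<le> 0" .
    define e where "e = Max (descent (S m \<omega>) ` {..2 ^ m})"
    have "descent (S m \<omega>) k \<le> e" if "k \<le> 2 ^ m" for k unfolding e_def using that by (intro Max_ge) auto
    then have "g m \<omega> \<le> max (Min (S m \<omega> ` {..2 ^ (m - l)})) (- x) - max (Min (S m \<omega> ` {..2 ^ m})) (- x)"
      unfolding g_def by (intro sum_descent_bounds(1)[of _ _ _ e]) auto
    also have "\<dots> \<le> x" using m0 x by linarith
    finally have "ennreal (g m \<omega>) \<le> ennreal x" by (rule ennreal_leI)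
    then show ?case unfolding w_def by (simp add: indicator_def)
  qed
  define W where "W \<omega> = ennreal (max (INF u\<in>{0..t / 2 ^ l}. X u \<omega>) (- x) - max (INF u\<in>{0..t}. X u \<omega>) (- x)) *
        indicator {\<omega>\<in>space M. (INF u\<in>{0..t}. X u \<omega>) < c \<and> X t \<omega> \<in> B} \<omega>" for \<omega>
  have Wm [measurable]: "W \<in> borel_measurable M" unfolding W_def by measurable
  have lim: "AE \<omega> in M. (\<lambda>m. w m \<omega>) \<longlonglongrightarrow> W \<omega>"
    using jmp AE_space
  proof eventually_elim
    case (elim \<omega>)
    have 1: "(\<lambda>m. g m \<omega>) \<longlonglongrightarrow> max (INF u\<in>{0..t / 2 ^ l}. X u \<omega>) (- x) - max (INF u\<in>{0..t}. X u \<omega>) (- x)"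
      unfolding g_def S_def by (rule sum_descent_tendsto[OF path]) (use elim t in auto)
    have 2: "(\<lambda>m. indicator {\<omega>\<in>space M. (\<exists>j\<in>{..2 ^ m}. S m \<omega> j < c) \<and> X t \<omega> \<in> B} \<omega>) \<longlonglongrightarrow>
       (indicator {\<omega>\<in>space M. (INF u\<in>{0..t}. X u \<omega>) < c \<and> X t \<omega> \<in> B} \<omega> :: ennreal)"
    proof (cases "(INF u\<in>{0..t}. X u \<omega>) < c")
      case True
      then obtain m where m: "\<exists>k\<le>2 ^ m. X (real k * t / 2 ^ m) \<omega> < c"
        using INF_less_dyadic_iff[OF path[OF elim(2)], of t c] t by auto
      have "\<exists>k\<in>{..2 ^ m'}. S m' \<omega> k < c" if "m \<le> m'" for m'
        using dyadic_less_mono[OF that, of "\<lambda>u. X u \<omega> < c"] m by (auto simp: S_def Bex_def)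
      then have "\<forall>\<^sub>F m' in sequentially. indicator {\<omega>\<in>space M. (INF u\<in>{0..t}. X u \<omega>) < c \<and> X t \<omega> \<in> B} \<omega> =
         (indicator {\<omega>\<in>space M. (\<exists>j\<in>{..2 ^ m'}. S m' \<omega> j < c) \<and> X t \<omega> \<in> B} \<omega> :: ennreal)"
        unfolding eventually_sequentially using True by (intro exI[of _ m]) (auto simp: indicator_def)
      then show ?thesis by (rule Lim_transform_eventually[OF tendsto_const])
    next
      case False
      then have "\<not> (\<exists>k\<in>{..2 ^ m}. S m \<omega> k < c)" for m
        using INF_less_dyadic_iff[OF path[OF elim(2)], of t c] t by (auto simp: S_def)
      then show ?thesis using False by simp
    qed
    show ?case unfolding w_def W_def
      by (rule tendsto_mult_ennreal[OF tendsto_ennrealI[OF 1] 2]) (auto simp: indicator_def)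
  qed
  have "(\<lambda>m. \<integral>\<^sup>+\<omega>. w m \<omega> \<partial>M) \<longlonglongrightarrow> (\<integral>\<^sup>+\<omega>. W \<omega> \<partial>M)"
    by (rule nn_integral_dominated_convergence[where w = "\<lambda>_. ennreal x"])
      (use bd lim in \<open>auto simp: emeasure_space_1\<close>)
  then show ?thesis unfolding 1[symmetric] W_def S_def .
qed

end

section \<open>From sums over grids to integrals over time\<close>

lemma measurable_nat_fun: "(\<lambda>s::real. f (nat \<lceil>s / h\<rceil>)) \<in> borel_measurable borel"
  by (rule measurable_compose_countable[where f = "\<lambda>k _. f k" and g = "\<lambda>s. nat \<lceil>s / h\<rceil>"]) measurable

text \<open>A Riemann sum written as the integral of a step function, each cell taking the value of
  its right end point, so that convergence theorems for integrals apply.\<close>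

lemma sum_eq_nn_integral_step:
  fixes f :: "nat \<Rightarrow> ennreal"
  assumes h: "0 < h" and "a \<le> n"
  shows "(\<Sum>k\<in>{a<..n}. ennreal h * f k) =
    (\<integral>\<^sup>+s. indicator {real a * h<..real n * h} s * f (nat \<lceil>s / h\<rceil>) \<partial>lborel)"
  using \<open>a \<le> n\<close>
proof (induction n rule: dec_induct)
  case (step n)
  note [measurable] = measurable_nat_fun[of f h]
  have "{a<..Suc n} = insert (Suc n) {a<..n}" using step(1) by auto
  then have "(\<Sum>k\<in>{a<..Suc n}. ennreal h * f k) = ennreal h * f (Suc n) + (\<Sum>k\<in>{a<..n}. ennreal h * f k)"
    by simp
  also have "ennreal h * f (Suc n) = (\<integral>\<^sup>+s. f (Suc n) * indicator {real n * h<..real (Suc n) * h} s \<partial>lborel)"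
    using h by (subst nn_integral_cmult_indicator) (auto simp: algebra_simps)
  also have "\<dots> = (\<integral>\<^sup>+s. indicator {real n * h<..real (Suc n) * h} s * f (nat \<lceil>s / h\<rceil>) \<partial>lborel)"
  proof (intro nn_integral_cong)
    fix s
    have "nat \<lceil>s / h\<rceil> = Suc n" if "real n * h < s" "s \<le> real (Suc n) * h"
    proof -
      have "real n < s / h" "s / h \<le> real (Suc n)" using that h by (auto simp: field_simps)
      then have "\<lceil>s / h\<rceil> = int (Suc n)" by (intro ceiling_unique) auto
      then show ?thesis by simp
    qed
    then show "f (Suc n) * indicator {real n * h<..real (Suc n) * h} s = indicator {real n * h<..real (Suc n) * h} s * f (nat \<lceil>s / h\<rceil>)"
      by (auto simp: indicator_def)
  qed
  also have "\<dots> + (\<Sum>k\<in>{a<..n}. ennreal h * f k) = (\<integral>\<^sup>+s. indicator {real n * h<..real (Suc n) * h} s * f (nat \<lceil>s / h\<rceil>) +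
      indicator {real a * h<..real n * h} s * f (nat \<lceil>s / h\<rceil>) \<partial>lborel)"
    unfolding step.IH by (subst nn_integral_add) auto
  also have "\<dots> = (\<integral>\<^sup>+s. indicator {real a * h<..real (Suc n) * h} s * f (nat \<lceil>s / h\<rceil>) \<partial>lborel)"
  proof (intro nn_integral_cong)
    fix s
    have "real a * h \<le> real n * h" "real n * h \<le> real (Suc n) * h" using step(1) h by (auto intro!: mult_right_mono)
    then have "(indicator {real n * h<..real (Suc n) * h} s + indicator {real a * h<..real n * h} s :: ennreal) =
       indicator {real a * h<..real (Suc n) * h} s"
      by (auto simp: indicator_def)
    then show "indicator {real n * h<..real (Suc n) * h} s * f (nat \<lceil>s / h\<rceil>) +
      indicator {real a * h<..real n * h} s * f (nat \<lceil>s / h\<rceil>) =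
      indicator {real a * h<..real (Suc n) * h} s * f (nat \<lceil>s / h\<rceil>)"
      by (metis distrib_right)
  qed
  finally show ?case .
qed simp

text \<open>This takes the place of differentiating with respect to the level, and is the point at
  which statements about all levels turn into statements about almost every level.\<close>

lemma AE_eq_of_integrals_eq:
  fixes u v :: "real \<Rightarrow> ennreal"
  assumes [measurable]: "u \<in> borel_measurable borel" "v \<in> borel_measurable borel"
    and eq: "\<And>x. 0 < x \<Longrightarrow> (\<integral>\<^sup>+y. indicator {0<..<x} y * u y \<partial>lborel) = (\<integral>\<^sup>+y. indicator {0<..<x} y * v y \<partial>lborel)"
    and fin: "\<And>x. 0 < x \<Longrightarrow> (\<integral>\<^sup>+y. indicator {0<..<x} y * u y \<partial>lborel) < \<infinity>"
  shows "AE y in lborel. 0 < y \<longrightarrow> u y = v y"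
proof -
  define U where "U y = indicator {0<..} y * u y" for y :: real
  define V where "V y = indicator {0<..} y * v y" for y :: real
  have [measurable]: "U \<in> borel_measurable borel" "V \<in> borel_measurable borel"
    unfolding U_def V_def by measurable
  have U: "emeasure (density lborel U) {..<a} = (\<integral>\<^sup>+y. indicator {0<..<a} y * u y \<partial>lborel)" for a
    by (subst emeasure_density) (auto simp: U_def indicator_def intro!: nn_integral_cong)
  have V: "emeasure (density lborel V) {..<a} = (\<integral>\<^sup>+y. indicator {0<..<a} y * v y \<partial>lborel)" for a
    by (subst emeasure_density) (auto simp: V_def indicator_def intro!: nn_integral_cong)
  have "density lborel U = density lborel V"
  proof (rule measure_eqI_lessThan')
    fix a
    show "emeasure (density lborel U) {..<a} < \<infinity>" using fin[of a] unfolding U by (cases "0 < a") auto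
    show "emeasure (density lborel U) {..<a} = emeasure (density lborel V) {..<a}"
      using eq[of a] unfolding U V by (cases "0 < a") auto
  qed auto
  then have "AE y in lborel. U y = V y"
    by (intro sigma_finite_measure.density_unique[OF sigma_finite_lborel]) auto
  then show ?thesis by eventually_elim (auto simp: U_def V_def)
qed

context levy
begin

lemma nn_integral_markov_INF:
  assumes s: "0 \<le> s" and r: "0 \<le> r"
    and [measurable]: "f \<in> borel_measurable (borel \<Otimes>\<^sub>M (borel \<Otimes>\<^sub>M borel))"
  shows "(\<integral>\<^sup>+\<omega>. f (X s \<omega>, (INF u\<in>{0..r}. X (s + u) \<omega> - X s \<omega>, X (s + r) \<omega> - X s \<omega>)) \<partial>M) =
    (\<integral>\<^sup>+\<omega>. \<integral>\<^sup>+\<omega>'. f (X s \<omega>, (INF u\<in>{0..r}. X u \<omega>', X r \<omega>')) \<partial>M \<partial>M)"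
proof -
  note [measurable] = X_measurable[OF s] X_measurable[OF r] INF_measurable[OF r] INF_shift_measurable[OF s r]
  have [measurable]: "X (s + r) \<in> borel_measurable M" using s r by (intro X_measurable) auto
  define R where "R = distr M (borel \<Otimes>\<^sub>M borel) (\<lambda>\<omega>. (INF u\<in>{0..r}. X u \<omega>, X r \<omega>))"
  have [measurable_cong]: "sets R = sets (borel \<Otimes>\<^sub>M borel)" by (simp add: R_def)
  interpret R: prob_space R unfolding R_def by (rule prob_space_distr) measurable
  have "(\<integral>\<^sup>+\<omega>. f (X s \<omega>, (INF u\<in>{0..r}. X (s + u) \<omega> - X s \<omega>, X (s + r) \<omega> - X s \<omega>)) \<partial>M) =
    (\<integral>\<^sup>+x. f x \<partial>distr M (borel \<Otimes>\<^sub>M (borel \<Otimes>\<^sub>M borel)) (\<lambda>\<omega>. (X s \<omega>, (INF u\<in>{0..r}. X (s + u) \<omega> - X s \<omega>, X (s + r) \<omega> - X s \<omega>))))"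
    by (subst nn_integral_distr) auto
  also have "\<dots> = (\<integral>\<^sup>+x. f x \<partial>(distr M borel (X s) \<Otimes>\<^sub>M R))"
    unfolding markov_INF[OF s r] R_def ..
  also have "\<dots> = (\<integral>\<^sup>+x. \<integral>\<^sup>+y. f (x, y) \<partial>R \<partial>distr M borel (X s))"
    by (rule R.nn_integral_fst[symmetric]) (simp cong: measurable_cong_sets sets_pair_measure_cong)
  also have "\<dots> = (\<integral>\<^sup>+\<omega>. \<integral>\<^sup>+y. f (X s \<omega>, y) \<partial>R \<partial>M)"
    by (subst nn_integral_distr) auto
  also have "\<dots> = (\<integral>\<^sup>+\<omega>. \<integral>\<^sup>+\<omega>'. f (X s \<omega>, (INF u\<in>{0..r}. X u \<omega>', X r \<omega>')) \<partial>M \<partial>M)"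
    unfolding R_def by (subst nn_integral_distr) auto
  finally show ?thesis .
qed

text \<open>For a process started at \<open>y\<close>: the probability of having been below
  \<open>c\<close> by time \<open>r\<close> and of being in \<open>B\<close> at time
  \<open>r\<close>. The cut-off \<open>max 0 r\<close> makes it measurable in \<open>(r, y)\<close>
  on the whole plane.\<close>

definition low_prob :: "real \<Rightarrow> real set \<Rightarrow> real \<Rightarrow> real \<Rightarrow> ennreal" where
  "low_prob c B r y =
    (\<integral>\<^sup>+\<omega>. (if (INF u\<in>{0..max 0 r}. X u \<omega>) + y < c \<and> X (max 0 r) \<omega> + y \<in> B then 1 else 0) \<partial>M)"

lemma low_prob_measurable:
  assumes [measurable]: "B \<in> sets borel"
  shows "(\<lambda>(r, y). low_prob c B r y) \<in> borel_measurable (borel \<Otimes>\<^sub>M borel)"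
proof -
  have [measurable]: "(\<lambda>x. INF u\<in>{0..max 0 (fst (fst x))}. X u (snd x)) \<in> borel_measurable ((borel \<Otimes>\<^sub>M borel) \<Otimes>\<^sub>M M)"
    "(\<lambda>x. X (max 0 (fst (fst x))) (snd x)) \<in> borel_measurable ((borel \<Otimes>\<^sub>M borel) \<Otimes>\<^sub>M M)"
    using measurable_compose[of "\<lambda>x. (fst (fst x), snd x)" "(borel \<Otimes>\<^sub>M borel) \<Otimes>\<^sub>M M" "borel \<Otimes>\<^sub>M M", OF _ INF_joint_measurable]
      measurable_compose[of "\<lambda>x. (fst (fst x), snd x)" "(borel \<Otimes>\<^sub>M borel) \<Otimes>\<^sub>M M" "borel \<Otimes>\<^sub>M M", OF _ X_joint_measurable]
    by (auto simp: case_prod_beta')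
  show ?thesis
    unfolding low_prob_def case_prod_beta'
    by (rule borel_measurable_nn_integral) (simp add: case_prod_beta', measurable)
qed

lemma low_prob_eq:
  assumes r: "0 \<le> r" and [measurable]: "B \<in> sets borel"
  shows "low_prob c B r y = emeasure M {\<omega>\<in>space M. (INF u\<in>{0..r}. X u \<omega>) + y < c \<and> X r \<omega> + y \<in> B}"
proof -
  note [measurable] = X_measurable[OF r] INF_measurable[OF r]
  have "low_prob c B r y = (\<integral>\<^sup>+\<omega>. indicator {\<omega>\<in>space M. (INF u\<in>{0..r}. X u \<omega>) + y < c \<and> X r \<omega> + y \<in> B} \<omega> \<partial>M)"
    unfolding low_prob_def using r by (intro nn_integral_cong) (auto simp: indicator_def max_def)
  then show ?thesis by (subst (asm) nn_integral_indicator) auto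
qed

lemma ex_less_iff_INF_shift:
  assumes \<omega>: "\<omega> \<in> space M" and s: "0 \<le> s" "s \<le> t"
  shows "(\<exists>u\<in>{s..t}. X u \<omega> < c) \<longleftrightarrow> X s \<omega> + (INF u\<in>{0..t - s}. X (s + u) \<omega> - X s \<omega>) < c"
proof -
  have "X s \<omega> + (INF u\<in>{0..t - s}. X (s + u) \<omega> - X s \<omega>) < c \<longleftrightarrow> (INF u\<in>{0..t - s}. X (s + u) \<omega> - X s \<omega>) < c - X s \<omega>"
    by auto
  also have "\<dots> \<longleftrightarrow> (\<exists>u\<in>{0..t - s}. X (s + u) \<omega> - X s \<omega> < c - X s \<omega>)"
    using s by (intro cINF_less_iff cadlag_bdd cadlag_shift path \<omega>) auto
  also have "\<dots> \<longleftrightarrow> (\<exists>u\<in>{s..t}. X u \<omega> < c)"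
  proof
    assume "\<exists>u\<in>{s..t}. X u \<omega> < c"
    then obtain u where "u \<in> {s..t}" "X u \<omega> < c" by auto
    then show "\<exists>u\<in>{0..t - s}. X (s + u) \<omega> - X s \<omega> < c - X s \<omega>"
      by (intro bexI[of _ "u - s"]) auto
  qed (use s in force)
  finally show ?thesis by simp
qed

text \<open>The grid point next to \<open>s\<close> on its right converges to \<open>s\<close>, so
  right continuity gives the limit of the integrand; as \<open>X s\<close> has no atom at
  \<open>-x\<close>, the condition \<open>X > -x\<close> passes to the limit. The integrand is
  bounded by \<open>x / s\<close>.\<close>

lemma nn_integral_grid_limit:
  assumes t: "0 < t" and s: "0 < s" "s < t" and x: "0 \<le> x" and B [measurable]: "B \<in> sets borel"
    and atom: "AE \<omega> in M. X s \<omega> \<noteq> - x"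
  defines "k \<equiv> \<lambda>m. nat \<lceil>s / (t / 2 ^ m)\<rceil>"
  shows "(\<lambda>m. \<integral>\<^sup>+\<omega>. ennreal (max 0 (- X (real (k m) * t / 2 ^ m) \<omega>) / (real (k m) * t / 2 ^ m)) *
        (if X (real (k m) * t / 2 ^ m) \<omega> > - x \<and> (\<exists>j\<in>{k m..2 ^ m}. X (real j * t / 2 ^ m) \<omega> < c) \<and> X t \<omega> \<in> B then 1 else 0) \<partial>M)
    \<longlonglongrightarrow> (\<integral>\<^sup>+\<omega>. (if X s \<omega> > - x then ennreal (max 0 (- X s \<omega>) / s) * low_prob c B (t - s) (X s \<omega>) else 0) \<partial>M)"
proof -
  define r where "r m = real (k m) * t / 2 ^ m" for m
  have rs: "s \<le> r m" "r m \<le> s + t / 2 ^ m" for m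
  proof -
    have n: "0 \<le> s / (t / 2 ^ m)" using s t by simp
    have "s / (t / 2 ^ m) \<le> real (k m)" "real (k m) \<le> s / (t / 2 ^ m) + 1"
      unfolding k_def using n real_nat_ceiling_ge[of "s / (t / 2 ^ m)"] of_int_ceiling_le_add_one[of "s / (t / 2 ^ m)"]
      by (simp_all del: divide_divide_eq_right)
    then have "s * 2 ^ m / t \<le> real (k m)" "real (k m) - 1 \<le> s * 2 ^ m / t" by auto
    then have "s * 2 ^ m \<le> real (k m) * t" "(real (k m) - 1) * t \<le> s * 2 ^ m"
      using t by (simp_all only: pos_divide_le_eq pos_le_divide_eq)
    then show "s \<le> r m" "r m \<le> s + t / 2 ^ m" unfolding r_def by (auto simp: field_simps)
  qed
  have r0: "0 < r m" for m using rs(1)[of m] s by linarith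
  have rlim: "r \<longlonglongrightarrow> s"
  proof (rule tendsto_sandwich[of "\<lambda>_. s" r sequentially "\<lambda>m. s + t / 2 ^ m"])
    have "(\<lambda>m. s + t / 2 ^ m) \<longlonglongrightarrow> s + 0"
      by (intro tendsto_add tendsto_const LIMSEQ_divide_realpow_zero) simp
    then show "(\<lambda>m. s + t / 2 ^ m) \<longlonglongrightarrow> s" by simp
  qed (use rs in auto)
  \<comment> \<open>The indices from \<open>k m\<close> on are exactly the grid points at or after
    \<open>s\<close>, so the condition over them approximates the one over
    \<open>[s, t]\<close>.\<close>
  have kle: "k m \<le> j \<longleftrightarrow> s \<le> real j * t / 2 ^ m" for j m :: nat
  proof -
    have "k m \<le> j \<longleftrightarrow> s / (t / 2 ^ m) \<le> real j" unfolding k_def by (simp add: ceiling_le_iff nat_le_iff)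
    also have "\<dots> \<longleftrightarrow> s \<le> real j * t / 2 ^ m" using t by (simp add: field_simps)
    finally show ?thesis .
  qed
  have [measurable]: "X (r m) \<in> borel_measurable M" "X (real j * t / 2 ^ m) \<in> borel_measurable M" for m j :: nat
    using r0[of m] t by (auto intro!: X_measurable)
  have [measurable]: "X t \<in> borel_measurable M" "X s \<in> borel_measurable M" "X (s + (t - s)) \<in> borel_measurable M"
    using t s by (auto intro!: X_measurable)
  have [measurable]: "(\<lambda>\<omega>. INF u\<in>{0..t - s}. X (s + u) \<omega> - X s \<omega>) \<in> borel_measurable M"
    using s by (intro INF_shift_measurable) auto
  define w where "w m \<omega> = ennreal (max 0 (- X (r m) \<omega>) / r m) *
      (if X (r m) \<omega> > - x \<and> (\<exists>j\<in>{k m..2 ^ m}. X (real j * t / 2 ^ m) \<omega> < c) \<and> X t \<omega> \<in> B then 1 else 0)" for m \<omega>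
  define W where "W \<omega> = ennreal (max 0 (- X s \<omega>) / s) *
      (if X s \<omega> > - x \<and> X s \<omega> + (INF u\<in>{0..t - s}. X (s + u) \<omega> - X s \<omega>) < c \<and> X s \<omega> + (X (s + (t - s)) \<omega> - X s \<omega>) \<in> B then 1 else 0)" for \<omega>
  have [measurable]: "w m \<in> borel_measurable M" for m unfolding w_def by measurable
  have [measurable]: "W \<in> borel_measurable M" unfolding W_def by measurable
  have "(\<lambda>m. \<integral>\<^sup>+\<omega>. w m \<omega> \<partial>M) \<longlonglongrightarrow> (\<integral>\<^sup>+\<omega>. W \<omega> \<partial>M)"
  proof (rule nn_integral_dominated_convergence[where w = "\<lambda>_. ennreal (x / s)"])
    show "AE \<omega> in M. w m \<omega> \<le> ennreal (x / s)" for m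
    proof (intro AE_I2)
      fix \<omega>
      have "max 0 (- X (r m) \<omega>) / r m \<le> x / s" if "X (r m) \<omega> > - x"
        using that x s rs(1)[of m] by (intro frac_le) auto
      then show "w m \<omega> \<le> ennreal (x / s)" unfolding w_def by (auto intro!: ennreal_leI)
    qed
    show "AE \<omega> in M. (\<lambda>m. w m \<omega>) \<longlonglongrightarrow> W \<omega>"
      using atom AE_space
    proof eventually_elim
      case (elim \<omega>)
      have lim: "(\<lambda>m. X (r m) \<omega>) \<longlonglongrightarrow> X s \<omega>"
        using cadlag_right_tendsto[OF path[OF elim(2)] _ rlim rs(1)] s by simp
      have 1: "(\<lambda>m. ennreal (max 0 (- X (r m) \<omega>) / r m)) \<longlonglongrightarrow> ennreal (max 0 (- X s \<omega>) / s)"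
        using s by (intro tendsto_ennrealI tendsto_divide tendsto_max tendsto_const tendsto_minus lim rlim) auto
      have 2: "\<forall>\<^sub>F m in sequentially. X (r m) \<omega> > - x \<longleftrightarrow> X s \<omega> > - x"
      proof (cases "X s \<omega> > - x")
        case True
        with order_tendstoD(1)[OF lim] show ?thesis by (auto elim: eventually_mono)
      next
        case False
        then have "X s \<omega> < - x" using elim by simp
        from order_tendstoD(2)[OF lim this] show ?thesis
          by eventually_elim (use False in auto)
      qed
      have 3: "\<forall>\<^sub>F m in sequentially. (\<exists>j\<in>{k m..2 ^ m}. X (real j * t / 2 ^ m) \<omega> < c) \<longleftrightarrow> (\<exists>u\<in>{s..t}. X u \<omega> < c)"
      proof (cases "\<exists>u\<in>{s..t}. X u \<omega> < c")
        case True
        obtain m0 k0 :: nat where mk: "k0 \<le> 2 ^ m0" "s \<le> real k0 * t / 2 ^ m0" "X (real k0 * t / 2 ^ m0) \<omega> < c"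
          using cadlag_dyadic_less[OF path[OF elim(2)] _ True] t s by (metis less_imp_le)
        have "\<exists>j\<in>{k m..2 ^ m}. X (real j * t / 2 ^ m) \<omega> < c" if m: "m0 \<le> m" for m
        proof -
          obtain j where "j \<le> 2 ^ m" "X (real j * t / 2 ^ m) \<omega> < c \<and> s \<le> real j * t / 2 ^ m"
            using dyadic_less_mono[OF m, of "\<lambda>u. X u \<omega> < c \<and> s \<le> u" t] mk by auto
          then show ?thesis using kle by auto
        qed
        then show ?thesis using True unfolding eventually_sequentially by auto
      next
        case False
        have "\<not> (\<exists>j\<in>{k m..2 ^ m}. X (real j * t / 2 ^ m) \<omega> < c)" for m
        proof
          assume "\<exists>j\<in>{k m..2 ^ m}. X (real j * t / 2 ^ m) \<omega> < c"
          then obtain j where j: "k m \<le> j" "j \<le> 2 ^ m" "X (real j * t / 2 ^ m) \<omega> < c" by auto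
          have "real j \<le> 2 ^ m" using j(2) by (metis of_nat_le_iff of_nat_numeral of_nat_power)
          then have "real j * t / 2 ^ m \<le> t" using t by (simp add: field_simps mult_left_mono)
          then show False using False j kle by auto
        qed
        then show ?thesis using False by auto
      qed
      have A1: "\<forall>\<^sub>F m in sequentially. ennreal (max 0 (- X (r m) \<omega>) / r m) *
        (if X s \<omega> > - x \<and> (\<exists>u\<in>{s..t}. X u \<omega> < c) \<and> X t \<omega> \<in> B then 1 else 0) = w m \<omega>"
        using 2 3 by eventually_elim (simp add: w_def)
      have A2: "(\<lambda>m. ennreal (max 0 (- X (r m) \<omega>) / r m) *
        (if X s \<omega> > - x \<and> (\<exists>u\<in>{s..t}. X u \<omega> < c) \<and> X t \<omega> \<in> B then 1 else 0)) \<longlonglongrightarrow>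
        ennreal (max 0 (- X s \<omega>) / s) * (if X s \<omega> > - x \<and> (\<exists>u\<in>{s..t}. X u \<omega> < c) \<and> X t \<omega> \<in> B then 1 else 0)"
        by (rule tendsto_mult_ennreal[OF 1 tendsto_const]) auto
      have A3: "ennreal (max 0 (- X s \<omega>) / s) * (if X s \<omega> > - x \<and> (\<exists>u\<in>{s..t}. X u \<omega> < c) \<and> X t \<omega> \<in> B then 1 else 0) = W \<omega>"
        unfolding W_def using s by (subst ex_less_iff_INF_shift[OF elim(2)]) auto
      show ?case using Lim_transform_eventually[OF A2 A1] unfolding A3 .
    qed
  qed (auto simp: emeasure_space_1)
  \<comment> \<open>The Markov property at time \<open>s\<close> replaces the later path by an
    independent copy, whose integral is \<open>low_prob\<close>.\<close>
  also have "(\<integral>\<^sup>+\<omega>. W \<omega> \<partial>M) = (\<integral>\<^sup>+\<omega>. \<integral>\<^sup>+\<omega>'. ennreal (max 0 (- X s \<omega>) / s) *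
      (if X s \<omega> > - x \<and> X s \<omega> + (INF u\<in>{0..t - s}. X u \<omega>') < c \<and> X s \<omega> + X (t - s) \<omega>' \<in> B then 1 else 0) \<partial>M \<partial>M)"
  proof -
    define f where "f = (\<lambda>(y, i, e). ennreal (max 0 (- y) / s) * (if y > - x \<and> y + i < c \<and> y + e \<in> B then 1 else 0))"
    have "f \<in> borel_measurable (borel \<Otimes>\<^sub>M (borel \<Otimes>\<^sub>M borel))" unfolding f_def by measurable
    from nn_integral_markov_INF[OF _ _ this, of s "t - s"] show ?thesis
      using s unfolding W_def f_def prod.case by simp
  qed
  also have "\<dots> = (\<integral>\<^sup>+\<omega>. (if X s \<omega> > - x then ennreal (max 0 (- X s \<omega>) / s) * low_prob c B (t - s) (X s \<omega>) else 0) \<partial>M)"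
  proof (intro nn_integral_cong)
    fix \<omega>
    have [measurable]: "X (t - s) \<in> borel_measurable M" "(\<lambda>\<omega>'. INF u\<in>{0..t - s}. X u \<omega>') \<in> borel_measurable M"
      using s by (auto intro!: X_measurable INF_measurable)
    have "(\<integral>\<^sup>+\<omega>'. ennreal (max 0 (- X s \<omega>) / s) *
      (if X s \<omega> > - x \<and> X s \<omega> + (INF u\<in>{0..t - s}. X u \<omega>') < c \<and> X s \<omega> + X (t - s) \<omega>' \<in> B then 1 else 0) \<partial>M) =
      ennreal (max 0 (- X s \<omega>) / s) * (\<integral>\<^sup>+\<omega>'.
      (if X s \<omega> > - x \<and> X s \<omega> + (INF u\<in>{0..t - s}. X u \<omega>') < c \<and> X s \<omega> + X (t - s) \<omega>' \<in> B then 1 else 0) \<partial>M)"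
      by (rule nn_integral_cmult) measurable
    then show "(\<integral>\<^sup>+\<omega>'. ennreal (max 0 (- X s \<omega>) / s) *
      (if X s \<omega> > - x \<and> X s \<omega> + (INF u\<in>{0..t - s}. X u \<omega>') < c \<and> X s \<omega> + X (t - s) \<omega>' \<in> B then 1 else 0) \<partial>M) =
      (if X s \<omega> > - x then ennreal (max 0 (- X s \<omega>) / s) * low_prob c B (t - s) (X s \<omega>) else 0)"
      using s by (simp add: low_prob_def add.commute)
  qed
  finally show ?thesis unfolding w_def r_def .
qed

end

section \<open>First passage of spectrally positive processes\<close>

locale spectrally_positive_levy = levy M X for M :: "'a measure" and X +
  fixes p :: "real \<Rightarrow> real \<Rightarrow> ennreal"
  assumes spectrally_positive: "spectrally_positive M X"
    and density: "transition_density M X p"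
begin

lemma jumps: "AE \<omega> in M. \<forall>t>0. jump (\<lambda>u. X u \<omega>) t \<ge> 0"
  using spectrally_positive by (simp add: spectrally_positive_def)

text \<open>The densities are jointly measurable on positive times only; the extension by 0 is
  measurable everywhere.\<close>

definition q :: "real \<Rightarrow> real \<Rightarrow> ennreal" where
  "q t x = (if 0 < t then p t x else 0)"

lemma q_measurable': "(\<lambda>(t, x). q t x) \<in> borel_measurable (borel \<Otimes>\<^sub>M borel)"
proof -
  have "(\<lambda>(t, x). p t x) \<in> borel_measurable (restrict_space (borel \<Otimes>\<^sub>M borel) ({0<..} \<times> UNIV))"
    using density by (simp add: transition_density_def)
  then have "(\<lambda>x. (case x of (t, x) \<Rightarrow> p t x) * indicator ({0<..} \<times> UNIV) x) \<in> borel_measurable (borel \<Otimes>\<^sub>M borel)"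
    by (subst (asm) borel_measurable_restrict_space_iff_ennreal) auto
  moreover have "(\<lambda>x. (case x of (t, x) \<Rightarrow> p t x) * indicator ({0<..} \<times> UNIV) x) = (\<lambda>(t, x). q t x)"
    by (auto simp: fun_eq_iff q_def indicator_def)
  ultimately show ?thesis by simp
qed

lemma q_measurable [measurable (raw)]:
  assumes [measurable]: "f \<in> borel_measurable N" "g \<in> borel_measurable N"
  shows "(\<lambda>x. q (f x) (g x)) \<in> borel_measurable N"
  using measurable_compose[OF _ q_measurable', of "\<lambda>x. (f x, g x)" N] by simp

lemma low_prob_measurable' [measurable (raw)]:
  assumes "B \<in> sets borel" and [measurable]: "f \<in> borel_measurable N" "g \<in> borel_measurable N"
  shows "(\<lambda>x. low_prob c B (f x) (g x)) \<in> borel_measurable N"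
proof -
  have "(\<lambda>x. (\<lambda>(r, y). low_prob c B r y) (f x, g x)) \<in> borel_measurable N"
    by (rule measurable_compose[OF _ low_prob_measurable[OF assms(1)]]) measurable
  then show ?thesis by simp
qed

lemma nn_integral_X:
  assumes t: "0 < t" and [measurable]: "f \<in> borel_measurable borel"
  shows "(\<integral>\<^sup>+\<omega>. f (X t \<omega>) \<partial>M) = (\<integral>\<^sup>+y. q t y * f y \<partial>lborel)"
proof -
  have "distributed M lborel (X t) (p t)" using density t by (simp add: transition_density_def)
  from distributed_nn_integral[OF this, of f] show ?thesis using t by (simp add: q_def)
qed

lemma X_ne: "0 < t \<Longrightarrow> AE \<omega> in M. X t \<omega> \<noteq> y"
proof -
  assume t: "0 < t"
  have [measurable]: "X t \<in> borel_measurable M" using t by (simp add: X_measurable)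
  have "(\<integral>\<^sup>+\<omega>. indicator {y} (X t \<omega>) \<partial>M) = (\<integral>\<^sup>+z. q t z * indicator {y} z \<partial>lborel)"
    by (rule nn_integral_X[OF t]) auto
  also have "\<dots> = (\<integral>\<^sup>+z. 0 \<partial>(lborel :: real measure))"
  proof (rule nn_integral_cong_AE)
    show "AE z in lborel. q t z * indicator {y} z = 0"
      using AE_lborel_singleton[of y] by eventually_elim simp
  qed
  finally have 0: "(\<integral>\<^sup>+\<omega>. indicator {y} (X t \<omega>) \<partial>M) = 0" by simp
  have "(\<lambda>\<omega>. indicator {y} (X t \<omega>) :: ennreal) \<in> borel_measurable M" by measurable
  from nn_integral_0_iff_AE[OF this] 0 have "AE \<omega> in M. indicator {y} (X t \<omega>) = (0::ennreal)" by simp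
  then show "AE \<omega> in M. X t \<omega> \<noteq> y" by eventually_elim (auto simp: indicator_def split: if_splits)
qed

lemma INF_le_0: "AE \<omega> in M. \<forall>r\<ge>0. (INF u\<in>{0..r}. X u \<omega>) \<le> 0"
  using X_0 AE_space
proof eventually_elim
  case (elim \<omega>)
  show ?case
    using cINF_lower[OF cadlag_bdd(1)[OF path[OF elim(2)]], of 0] elim by fastforce
qed

section \<open>The descent identity in continuous time\<close>

context
  fixes t c :: real and B :: "real set"
  assumes t: "0 < t" and B [measurable]: "B \<in> sets borel"
begin

text \<open>The density in \<open>s\<close> of the expected decrease of the running infimum at
  levels above \<open>-x\<close>: \<open>max 0 (- y) / s\<close> is what the discrete identity
  yields per unit of time, and \<open>low_prob\<close> accounts for the path after \<open>s\<close>.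
  The second level \<open>c\<close> makes it possible to follow a path through two successive
  levels.\<close>

definition flux :: "real \<Rightarrow> real \<Rightarrow> ennreal" where
  "flux x s = (\<integral>\<^sup>+y. q s y * (if y > - x then ennreal (max 0 (- y) / s) * low_prob c B (t - s) y else 0) \<partial>lborel)"

lemma flux_measurable [measurable]: "flux x \<in> borel_measurable borel"
proof -
  note [measurable] = low_prob_measurable'[OF B]
  have "(\<lambda>z. q (fst z) (snd z) * (if snd z > - x then ennreal (max 0 (- snd z) / fst z) * low_prob c B (t - fst z) (snd z) else 0))
    \<in> borel_measurable (borel \<Otimes>\<^sub>M lborel)"
    by measurable
  then show ?thesis
    unfolding flux_def by (intro lborel.borel_measurable_nn_integral) (simp add: case_prod_beta')
qed

text \<open>The discrete identity turns the sum of expected descents into a Riemann sum in the time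
  of descent. After \<open>t / 2 ^ l\<close> the integrand is bounded by \<open>x\<close> divided by
  that time, so both the sum and the expectation converge by domination.\<close>

lemma flux_identity_away_from_0:
  assumes x: "0 \<le> x"
  shows "(\<integral>\<^sup>+\<omega>. ennreal (max (INF u\<in>{0..t / 2 ^ l}. X u \<omega>) (- x) - max (INF u\<in>{0..t}. X u \<omega>) (- x)) *
        indicator {\<omega>\<in>space M. (INF u\<in>{0..t}. X u \<omega>) < c \<and> X t \<omega> \<in> B} \<omega> \<partial>M) =
     (\<integral>\<^sup>+s. indicator {t / 2 ^ l<..t} s * flux x s \<partial>lborel)"
proof -
  define \<Psi> where "\<Psi> m k = (\<integral>\<^sup>+\<omega>. ennreal (max 0 (- X (real k * t / 2 ^ m) \<omega>) / (real k * t / 2 ^ m)) *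
        (if X (real k * t / 2 ^ m) \<omega> > - x \<and> (\<exists>j\<in>{k..2 ^ m}. X (real j * t / 2 ^ m) \<omega> < c) \<and> X t \<omega> \<in> B then 1 else 0) \<partial>M)"
    for m k :: nat
  have [measurable]: "X t \<in> borel_measurable M" "X (real j * t / 2 ^ m) \<in> borel_measurable M" for m j :: nat
    using t by (auto intro!: X_measurable)
  have 1: "(\<integral>\<^sup>+\<omega>. ennreal (descent (\<lambda>j. X (real j * t / 2 ^ m) \<omega>) k) *
        (if X (real k * t / 2 ^ m) \<omega> > - x \<and> (\<exists>j\<in>{k..2 ^ m}. X (real j * t / 2 ^ m) \<omega> < c) \<and> X t \<omega> \<in> B then 1 else 0) \<partial>M)
      = ennreal (t / 2 ^ m) * \<Psi> m k"
    if k: "k \<in> {2 ^ (m - l)<..2 ^ m}" for m k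
  proof -
    have k0: "0 < k" "k \<le> 2 ^ m" using k by auto
    \<comment> \<open>This weight looks at indices from \<open>k\<close> on only, so it is
      unaffected by the rotations.\<close>
    define G :: "(nat \<Rightarrow> real) \<Rightarrow> ennreal" where
      "G S = (if S k > - x \<and> (\<exists>j\<in>{k..2 ^ m}. S j < c) \<and> S (2 ^ m) \<in> B then 1 else 0)" for S
    have [measurable]: "(\<lambda>v. \<Sum>i<2 ^ m. v i) \<in> borel_measurable (seqs (2 ^ m))" "(\<lambda>v. \<Sum>i<k. v i) \<in> borel_measurable (seqs (2 ^ m))"
      using k0 by (auto intro!: psum_measurable)
    have [measurable]: "Measurable.pred (seqs (2 ^ m)) (\<lambda>v. \<exists>j\<in>{k..2 ^ m}. (\<Sum>i<j. v i) < c)"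
    proof (intro pred_intros_finite)
      fix j assume "j \<in> {k..2 ^ m}"
      then have [measurable]: "(\<lambda>v. \<Sum>i<j. v i) \<in> borel_measurable (seqs (2 ^ m))" by (intro psum_measurable) auto
      show "Measurable.pred (seqs (2 ^ m)) (\<lambda>v. (\<Sum>i<j. v i) < c)" by measurable
    qed simp
    have Gm: "(\<lambda>v. G (\<lambda>j. \<Sum>i<j. v i)) \<in> borel_measurable (seqs (2 ^ m))"
      unfolding G_def by measurable
    have Ginv: "G S = G S'" if "\<And>j. k \<le> j \<Longrightarrow> j \<le> 2 ^ m \<Longrightarrow> S j = S' j" for S S'
      unfolding G_def using that k0 by (auto intro!: bexI)
    have "(\<integral>\<^sup>+\<omega>. ennreal (descent (\<lambda>j. X (real j * (t / 2 ^ m)) \<omega>) k) * G (\<lambda>j. X (real j * (t / 2 ^ m)) \<omega>) \<partial>M) =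
      (\<integral>\<^sup>+\<omega>. ennreal (max 0 (- X (real k * (t / 2 ^ m)) \<omega>) / real k) * G (\<lambda>j. X (real j * (t / 2 ^ m)) \<omega>) \<partial>M)"
      by (rule nn_integral_descent[OF k0 _ Gm Ginv]) (use t in auto)
    also have "\<dots> = (\<integral>\<^sup>+\<omega>. ennreal (t / 2 ^ m) * (ennreal (max 0 (- X (real k * t / 2 ^ m) \<omega>) / (real k * t / 2 ^ m)) *
      (if X (real k * t / 2 ^ m) \<omega> > - x \<and> (\<exists>j\<in>{k..2 ^ m}. X (real j * t / 2 ^ m) \<omega> < c) \<and> X t \<omega> \<in> B then 1 else 0)) \<partial>M)"
    proof (intro nn_integral_cong)
      fix \<omega>
      have "max 0 (- X (real k * t / 2 ^ m) \<omega>) / real k = t / 2 ^ m * (max 0 (- X (real k * t / 2 ^ m) \<omega>) / (real k * t / 2 ^ m))"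
        using t k0 by simp
      then have "ennreal (max 0 (- X (real k * t / 2 ^ m) \<omega>) / real k) = ennreal (t / 2 ^ m) * ennreal (max 0 (- X (real k * t / 2 ^ m) \<omega>) / (real k * t / 2 ^ m))"
        using t by (subst ennreal_mult'[symmetric]) auto
      then show "ennreal (max 0 (- X (real k * (t / 2 ^ m)) \<omega>) / real k) * G (\<lambda>j. X (real j * (t / 2 ^ m)) \<omega>) =
         ennreal (t / 2 ^ m) * (ennreal (max 0 (- X (real k * t / 2 ^ m) \<omega>) / (real k * t / 2 ^ m)) *
        (if X (real k * t / 2 ^ m) \<omega> > - x \<and> (\<exists>j\<in>{k..2 ^ m}. X (real j * t / 2 ^ m) \<omega> < c) \<and> X t \<omega> \<in> B then 1 else 0))"
        by (simp add: G_def mult.assoc)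
    qed
    also have "\<dots> = ennreal (t / 2 ^ m) * \<Psi> m k" unfolding \<Psi>_def by (rule nn_integral_cmult) measurable
    finally show ?thesis by (simp add: G_def)
  qed
  have 2: "(\<Sum>k\<in>{2 ^ (m - l)<..2 ^ m}. ennreal (t / 2 ^ m) * \<Psi> m k) =
      (\<integral>\<^sup>+s. indicator {t / 2 ^ l<..t} s * \<Psi> m (nat \<lceil>s / (t / 2 ^ m)\<rceil>) \<partial>lborel)" if "l \<le> m" for m
  proof -
    have "(2::real) ^ m = 2 ^ l * 2 ^ (m - l)" using that by (simp flip: power_add)
    then have "real (2 ^ (m - l)) * (t / 2 ^ m) = t / 2 ^ l" "real (2 ^ m) * (t / 2 ^ m) = t" by auto
    then show ?thesis
      using sum_eq_nn_integral_step[of "t / 2 ^ m" "2 ^ (m - l)" "2 ^ m" "\<Psi> m"] t by (simp del: divide_divide_eq_right)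
  qed
  define u where "u m s = indicator {t / 2 ^ l<..t} s * \<Psi> m (nat \<lceil>s / (t / 2 ^ m)\<rceil>)" for m s
  have "(\<lambda>m. \<integral>\<^sup>+s. u m s \<partial>lborel) \<longlonglongrightarrow> (\<integral>\<^sup>+s. indicator {t / 2 ^ l<..t} s * flux x s \<partial>lborel)"
  proof (rule nn_integral_dominated_convergence[where w = "\<lambda>s. ennreal (x / (t / 2 ^ l)) * indicator {t / 2 ^ l<..t} s"])
    show "u m \<in> borel_measurable lborel" for m
      using measurable_nat_fun[of "\<Psi> m" "t / 2 ^ m"] unfolding u_def by measurable
    show "(\<lambda>s. ennreal (x / (t / 2 ^ l)) * indicator {t / 2 ^ l<..t} s) \<in> borel_measurable lborel" by measurable
    show "(\<integral>\<^sup>+s. ennreal (x / (t / 2 ^ l)) * indicator {t / 2 ^ l<..t} s \<partial>lborel) < \<infinity>"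
    proof -
      have "t / 2 ^ l \<le> t" using t by (simp add: pos_divide_le_eq)
      then show ?thesis by (subst nn_integral_cmult_indicator) (auto simp: ennreal_mult_less_top)
    qed
    show "AE s in lborel. u m s \<le> ennreal (x / (t / 2 ^ l)) * indicator {t / 2 ^ l<..t} s" for m
    proof (intro AE_I2)
      fix s
      show "u m s \<le> ennreal (x / (t / 2 ^ l)) * indicator {t / 2 ^ l<..t} s"
      proof (cases "s \<in> {t / 2 ^ l<..t}")
        case True
        define k where "k = nat \<lceil>s / (t / 2 ^ m)\<rceil>"
        have "s / (t / 2 ^ m) \<le> real k" unfolding k_def by (rule real_nat_ceiling_ge)
        then have "s \<le> real k * t / 2 ^ m" using t by (simp add: field_simps)
        then have kt: "t / 2 ^ l \<le> real k * t / 2 ^ m" using True by simp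
        have tl: "0 < t / 2 ^ l" using t by simp
        have "\<Psi> m k \<le> (\<integral>\<^sup>+\<omega>. ennreal (x / (t / 2 ^ l)) \<partial>M)"
          unfolding \<Psi>_def
        proof (intro nn_integral_mono)
          fix \<omega>
          have "max 0 (- X (real k * t / 2 ^ m) \<omega>) / (real k * t / 2 ^ m) \<le> x / (t / 2 ^ l)" if "X (real k * t / 2 ^ m) \<omega> > - x"
            by (rule frac_le) (use that x kt tl in linarith)+
          then show "ennreal (max 0 (- X (real k * t / 2 ^ m) \<omega>) / (real k * t / 2 ^ m)) *
             (if X (real k * t / 2 ^ m) \<omega> > - x \<and> (\<exists>j\<in>{k..2 ^ m}. X (real j * t / 2 ^ m) \<omega> < c) \<and> X t \<omega> \<in> B then 1 else 0)
             \<le> ennreal (x / (t / 2 ^ l))"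
            by (auto intro!: ennreal_leI simp del: divide_divide_eq_right)
        qed
        also have "\<dots> = ennreal (x / (t / 2 ^ l))" by (simp add: emeasure_space_1)
        finally show ?thesis using True unfolding u_def k_def by simp
      qed (simp add: u_def)
    qed
    show "AE s in lborel. (\<lambda>m. u m s) \<longlonglongrightarrow> indicator {t / 2 ^ l<..t} s * flux x s"
      using AE_lborel_singleton[of t]
    proof eventually_elim
      case (elim s)
      show ?case
      proof (cases "s \<in> {t / 2 ^ l<..t}")
        case True
        have "0 < t / 2 ^ l" using t by simp
        then have s: "0 < s" "s < t" using True elim by auto
        have "(\<lambda>m. \<Psi> m (nat \<lceil>s / (t / 2 ^ m)\<rceil>)) \<longlonglongrightarrow>
          (\<integral>\<^sup>+\<omega>. (if X s \<omega> > - x then ennreal (max 0 (- X s \<omega>) / s) * low_prob c B (t - s) (X s \<omega>) else 0) \<partial>M)"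
          unfolding \<Psi>_def by (rule nn_integral_grid_limit[OF t s x B X_ne[OF s(1)]])
        also have "(\<integral>\<^sup>+\<omega>. (if X s \<omega> > - x then ennreal (max 0 (- X s \<omega>) / s) * low_prob c B (t - s) (X s \<omega>) else 0) \<partial>M) = flux x s"
          unfolding flux_def by (rule nn_integral_X[OF s(1)]) measurable
        finally show ?thesis using True by (simp add: u_def)
      qed (simp add: u_def)
    qed
  qed measurable
  moreover have "\<forall>\<^sub>F m in sequentially. (\<integral>\<^sup>+s. u m s \<partial>lborel) =
    (\<Sum>k\<in>{2 ^ (m - l)<..2 ^ m}. \<integral>\<^sup>+\<omega>. ennreal (descent (\<lambda>j. X (real j * t / 2 ^ m) \<omega>) k) *
        (if X (real k * t / 2 ^ m) \<omega> > - x \<and> (\<exists>j\<in>{k..2 ^ m}. X (real j * t / 2 ^ m) \<omega> < c) \<and> X t \<omega> \<in> B then 1 else 0) \<partial>M)"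
    using eventually_ge_at_top[of l] by eventually_elim (simp add: 1 2 u_def)
  ultimately have "(\<lambda>m. \<Sum>k\<in>{2 ^ (m - l)<..2 ^ m}. \<integral>\<^sup>+\<omega>. ennreal (descent (\<lambda>j. X (real j * t / 2 ^ m) \<omega>) k) *
        (if X (real k * t / 2 ^ m) \<omega> > - x \<and> (\<exists>j\<in>{k..2 ^ m}. X (real j * t / 2 ^ m) \<omega> < c) \<and> X t \<omega> \<in> B then 1 else 0) \<partial>M)
      \<longlonglongrightarrow> (\<integral>\<^sup>+s. indicator {t / 2 ^ l<..t} s * flux x s \<partial>lborel)"
    by (rule Lim_transform_eventually)
  with nn_integral_sum_descent_limit[OF jumps t x B] show ?thesis by (rule LIMSEQ_unique)
qed

lemma INF_small_time:
  assumes \<omega>: "\<omega> \<in> space M" "X 0 \<omega> = 0"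
  shows "(\<lambda>l. INF u\<in>{0..t / 2 ^ l}. X u \<omega>) \<longlonglongrightarrow> 0"
proof (rule LIMSEQ_I)
  fix e :: real assume e: "0 < e"
  obtain d l where d: "d > 0" "\<And>u. 0 \<le> u \<Longrightarrow> u < 0 + d \<Longrightarrow> \<bar>X u \<omega> - X 0 \<omega>\<bar> < e / 2"
    using cadlag_local[OF path[OF \<omega>(1)], of 0 "e / 2"] e by (metis half_gt_zero order_refl)
  have "(\<lambda>m. t / 2 ^ m) \<longlonglongrightarrow> 0" by (rule LIMSEQ_divide_realpow_zero) simp
  then have "\<forall>\<^sub>F m in sequentially. t / 2 ^ m < d" using d(1) by (rule order_tendstoD)
  then have "\<forall>\<^sub>F m in sequentially. norm ((INF u\<in>{0..t / 2 ^ m}. X u \<omega>) - 0) < e"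
  proof eventually_elim
    case (elim m)
    have "- (e / 2) \<le> (INF u\<in>{0..t / 2 ^ m}. X u \<omega>)"
    proof (rule cINF_greatest)
      fix u assume "u \<in> {0..t / 2 ^ m}"
      then show "- (e / 2) \<le> X u \<omega>" using d(2)[of u] elim \<omega> by auto
    qed (use t in auto)
    moreover have "(INF u\<in>{0..t / 2 ^ m}. X u \<omega>) \<le> X 0 \<omega>"
      using cadlag_bdd(1)[OF path[OF \<omega>(1)]] t by (intro cINF_lower) auto
    ultimately show ?case using \<omega>(2) e by simp
  qed
  then show "\<exists>no. \<forall>m\<ge>no. norm ((INF u\<in>{0..t / 2 ^ m}. X u \<omega>) - 0) < e" unfolding eventually_sequentially .
qed

text \<open>The limit as the starting time tends to 0: the left-hand side is bounded by
  \<open>x\<close> and the right-hand side is monotone. Note that \<open>min x (- I)\<close> is the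
  amount by which the infimum decreases above \<open>-x\<close>.\<close>

lemma flux_identity:
  assumes x: "0 \<le> x"
  shows "(\<integral>\<^sup>+\<omega>. ennreal (min x (- (INF u\<in>{0..t}. X u \<omega>))) *
        indicator {\<omega>\<in>space M. (INF u\<in>{0..t}. X u \<omega>) < c \<and> X t \<omega> \<in> B} \<omega> \<partial>M) =
     (\<integral>\<^sup>+s. indicator {0<..t} s * flux x s \<partial>lborel)"
proof -
  have [measurable]: "X t \<in> borel_measurable M" using t by (auto intro!: X_measurable)
  have [measurable]: "(\<lambda>\<omega>. INF u\<in>{0..t}. X u \<omega>) \<in> borel_measurable M"
    "(\<lambda>\<omega>. INF u\<in>{0..t / 2 ^ l}. X u \<omega>) \<in> borel_measurable M" for l
    using t by (auto intro!: INF_measurable)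
  define E where "E = {\<omega>\<in>space M. (INF u\<in>{0..t}. X u \<omega>) < c \<and> X t \<omega> \<in> B}"
  have [measurable]: "E \<in> sets M" unfolding E_def by measurable
  have L: "(\<lambda>l. \<integral>\<^sup>+\<omega>. ennreal (max (INF u\<in>{0..t / 2 ^ l}. X u \<omega>) (- x) - max (INF u\<in>{0..t}. X u \<omega>) (- x)) * indicator E \<omega> \<partial>M)
     \<longlonglongrightarrow> (\<integral>\<^sup>+\<omega>. ennreal (min x (- (INF u\<in>{0..t}. X u \<omega>))) * indicator E \<omega> \<partial>M)"
  proof (rule nn_integral_dominated_convergence[where w = "\<lambda>_. ennreal x"])
    show "AE \<omega> in M. ennreal (max (INF u\<in>{0..t / 2 ^ l}. X u \<omega>) (- x) - max (INF u\<in>{0..t}. X u \<omega>) (- x)) * indicator E \<omega> \<le> ennreal x" for l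
      using INF_le_0
    proof eventually_elim
      case (elim \<omega>)
      have "(INF u\<in>{0..t / 2 ^ l}. X u \<omega>) \<le> 0" using elim t by simp
      then have "max (INF u\<in>{0..t / 2 ^ l}. X u \<omega>) (- x) - max (INF u\<in>{0..t}. X u \<omega>) (- x) \<le> x"
        using x by linarith
      then show ?case by (auto simp: indicator_def intro!: ennreal_leI)
    qed
    show "AE \<omega> in M. (\<lambda>l. ennreal (max (INF u\<in>{0..t / 2 ^ l}. X u \<omega>) (- x) - max (INF u\<in>{0..t}. X u \<omega>) (- x)) * indicator E \<omega>)
       \<longlonglongrightarrow> ennreal (min x (- (INF u\<in>{0..t}. X u \<omega>))) * indicator E \<omega>"
      using X_0 AE_space INF_le_0
    proof eventually_elim
      case (elim \<omega>)
      have le: "(INF u\<in>{0..t}. X u \<omega>) \<le> 0" using elim(3) t by simp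
      have "(\<lambda>l. max (INF u\<in>{0..t / 2 ^ l}. X u \<omega>) (- x) - max (INF u\<in>{0..t}. X u \<omega>) (- x))
        \<longlonglongrightarrow> max 0 (- x) - max (INF u\<in>{0..t}. X u \<omega>) (- x)"
        by (intro tendsto_diff tendsto_max tendsto_const INF_small_time elim)
      also have "max 0 (- x) - max (INF u\<in>{0..t}. X u \<omega>) (- x) = min x (- (INF u\<in>{0..t}. X u \<omega>))"
        using x le by (simp add: min_def max_def)
      finally show ?case
        by (intro tendsto_mult_ennreal[OF tendsto_ennrealI tendsto_const]) (auto simp: indicator_def)
    qed
  qed (auto simp: emeasure_space_1)
  have R: "(\<lambda>l. \<integral>\<^sup>+s. indicator {t / 2 ^ l<..t} s * flux x s \<partial>lborel) \<longlonglongrightarrow> (\<integral>\<^sup>+s. indicator {0<..t} s * flux x s \<partial>lborel)"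
  proof (rule nn_integral_LIMSEQ)
    show "incseq (\<lambda>l s. indicator {t / 2 ^ l<..t} s * flux x s)"
    proof (rule incseq_SucI, rule le_funI)
      fix l s
      have "t / 2 ^ Suc l \<le> t / 2 ^ l" using t by (simp add: field_simps)
      then have "indicator {t / 2 ^ l<..t} s \<le> (indicator {t / 2 ^ Suc l<..t} s :: ennreal)"
        by (intro indicator_leI) auto
      then show "indicator {t / 2 ^ l<..t} s * flux x s \<le> indicator {t / 2 ^ Suc l<..t} s * flux x s"
        by (rule mult_right_mono) simp
    qed
    fix s
    show "(\<lambda>l. indicator {t / 2 ^ l<..t} s * flux x s) \<longlonglongrightarrow> indicator {0<..t} s * flux x s"
    proof (cases "0 < s")
      case True
      have "(\<lambda>m. t / 2 ^ m) \<longlonglongrightarrow> 0" by (rule LIMSEQ_divide_realpow_zero) simp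
      then have "\<forall>\<^sub>F m in sequentially. t / 2 ^ m < s" using True by (rule order_tendstoD)
      then have "\<forall>\<^sub>F l in sequentially. indicator {0<..t} s * flux x s = indicator {t / 2 ^ l<..t} s * flux x s"
        by eventually_elim (use True in \<open>auto simp: indicator_def\<close>)
      then show ?thesis by (rule Lim_transform_eventually[OF tendsto_const])
    next
      case False
      have "0 < t / 2 ^ l" for l using t by simp
      then have "s \<notin> {t / 2 ^ l<..t}" for l using False by (metis greaterThanAtMost_iff less_trans)
      then show ?thesis using False by simp
    qed
  qed measurable
  show ?thesis
    using LIMSEQ_unique[OF L[unfolded E_def, unfolded flux_identity_away_from_0[OF x]] R] unfolding E_def .
qed

text \<open>The strong Markov property at the first passage time below \<open>-y\<close>, together with Kendall's
  identity for its law, for almost every level \<open>y\<close>.\<close>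

theorem first_passage_AE:
  "AE y in lborel. 0 < y \<longrightarrow>
     emeasure M {\<omega>\<in>space M. (INF u\<in>{0..t}. X u \<omega>) < c \<and> (INF u\<in>{0..t}. X u \<omega>) < - y \<and> X t \<omega> \<in> B} =
     (\<integral>\<^sup>+s. indicator {0<..<t} s * (ennreal (y / s) * q s (- y) * low_prob c B (t - s) (- y)) \<partial>lborel)"
proof -
  have [measurable]: "X t \<in> borel_measurable M" "(\<lambda>\<omega>. INF u\<in>{0..t}. X u \<omega>) \<in> borel_measurable M"
    using t by (auto intro!: X_measurable INF_measurable)
  define U where "U y = (\<integral>\<^sup>+\<omega>. (if (INF u\<in>{0..t}. X u \<omega>) < c \<and> (INF u\<in>{0..t}. X u \<omega>) < - y \<and> X t \<omega> \<in> B then 1 else 0) \<partial>M)" for y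
  define V where "V y = (\<integral>\<^sup>+s. indicator {0<..<t} s * (ennreal (y / s) * q s (- y) * low_prob c B (t - s) (- y)) \<partial>lborel)" for y
  have [measurable]: "U \<in> borel_measurable borel" "V \<in> borel_measurable borel"
    unfolding U_def V_def by measurable
  have U: "U y = emeasure M {\<omega>\<in>space M. (INF u\<in>{0..t}. X u \<omega>) < c \<and> (INF u\<in>{0..t}. X u \<omega>) < - y \<and> X t \<omega> \<in> B}" for y
  proof -
    have "U y = (\<integral>\<^sup>+\<omega>. indicator {\<omega>\<in>space M. (INF u\<in>{0..t}. X u \<omega>) < c \<and> (INF u\<in>{0..t}. X u \<omega>) < - y \<and> X t \<omega> \<in> B} \<omega> \<partial>M)"
      unfolding U_def by (intro nn_integral_cong) (auto simp: indicator_def)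
    then show ?thesis by (subst (asm) nn_integral_indicator) auto
  qed
  have eq: "(\<integral>\<^sup>+y. indicator {0<..<x} y * U y \<partial>lborel) = (\<integral>\<^sup>+y. indicator {0<..<x} y * V y \<partial>lborel)" if x: "0 < x" for x
  proof -
    have "(\<integral>\<^sup>+y. indicator {0<..<x} y * U y \<partial>lborel) = (\<integral>\<^sup>+y. \<integral>\<^sup>+\<omega>. indicator {0<..<x} y *
        (if (INF u\<in>{0..t}. X u \<omega>) < c \<and> (INF u\<in>{0..t}. X u \<omega>) < - y \<and> X t \<omega> \<in> B then 1 else 0) \<partial>M \<partial>lborel)"
      unfolding U_def by (intro nn_integral_cong nn_integral_cmult[symmetric]) measurable
    also have "\<dots> = (\<integral>\<^sup>+\<omega>. \<integral>\<^sup>+y. indicator {0<..<x} y *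
        (if (INF u\<in>{0..t}. X u \<omega>) < c \<and> (INF u\<in>{0..t}. X u \<omega>) < - y \<and> X t \<omega> \<in> B then 1 else 0) \<partial>lborel \<partial>M)"
    proof -
      interpret pair_sigma_finite M lborel ..
      show ?thesis by (rule Fubini') measurable
    qed
    \<comment> \<open>The levels in \<open>(0, x)\<close> that the path has passed form the interval
      below \<open>min x (- I)\<close>, whose length is the left-hand side of
      \<open>flux_identity\<close>.\<close>
    also have "\<dots> = (\<integral>\<^sup>+\<omega>. ennreal (min x (- (INF u\<in>{0..t}. X u \<omega>))) *
        indicator {\<omega>\<in>space M. (INF u\<in>{0..t}. X u \<omega>) < c \<and> X t \<omega> \<in> B} \<omega> \<partial>M)"
    proof (rule nn_integral_cong_AE)
      show "AE \<omega> in M. (\<integral>\<^sup>+y. indicator {0<..<x} y *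
        (if (INF u\<in>{0..t}. X u \<omega>) < c \<and> (INF u\<in>{0..t}. X u \<omega>) < - y \<and> X t \<omega> \<in> B then 1 else 0) \<partial>lborel) =
        ennreal (min x (- (INF u\<in>{0..t}. X u \<omega>))) * indicator {\<omega>\<in>space M. (INF u\<in>{0..t}. X u \<omega>) < c \<and> X t \<omega> \<in> B} \<omega>"
        using INF_le_0 AE_space
      proof eventually_elim
        case (elim \<omega>)
        have le: "(INF u\<in>{0..t}. X u \<omega>) \<le> 0" using elim t by simp
        have "(\<integral>\<^sup>+y. indicator {0<..<x} y *
          (if (INF u\<in>{0..t}. X u \<omega>) < c \<and> (INF u\<in>{0..t}. X u \<omega>) < - y \<and> X t \<omega> \<in> B then 1 else 0) \<partial>lborel) =
          (\<integral>\<^sup>+y. indicator {\<omega>\<in>space M. (INF u\<in>{0..t}. X u \<omega>) < c \<and> X t \<omega> \<in> B} \<omega> * indicator {0<..<min x (- (INF u\<in>{0..t}. X u \<omega>))} y \<partial>lborel)"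
          using elim by (intro nn_integral_cong) (auto simp: indicator_def)
        also have "\<dots> = indicator {\<omega>\<in>space M. (INF u\<in>{0..t}. X u \<omega>) < c \<and> X t \<omega> \<in> B} \<omega> * ennreal (min x (- (INF u\<in>{0..t}. X u \<omega>)))"
          using le x by (subst nn_integral_cmult_indicator) auto
        finally show ?case by (simp only: mult.commute)
      qed
    qed
    also have "\<dots> = (\<integral>\<^sup>+s. indicator {0<..t} s * flux x s \<partial>lborel)" by (rule flux_identity) (use x in simp)
    also have "\<dots> = (\<integral>\<^sup>+s. indicator {0<..<t} s * flux x s \<partial>lborel)"
    proof (rule nn_integral_cong_AE)
      show "AE s in lborel. indicator {0<..t} s * flux x s = indicator {0<..<t} s * flux x s"
        using AE_lborel_singleton[of t] by eventually_elim (auto simp: indicator_def)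
    qed
    also have "\<dots> = (\<integral>\<^sup>+s. \<integral>\<^sup>+y. indicator {0<..<x} y * (indicator {0<..<t} s * (ennreal (y / s) * q s (- y) * low_prob c B (t - s) (- y))) \<partial>lborel \<partial>lborel)"
    proof (intro nn_integral_cong)
      fix s
      show "indicator {0<..<t} s * flux x s = (\<integral>\<^sup>+y. indicator {0<..<x} y * (indicator {0<..<t} s * (ennreal (y / s) * q s (- y) * low_prob c B (t - s) (- y))) \<partial>lborel)"
      proof (cases "s \<in> {0<..<t}")
        case True
        have "flux x s = (\<integral>\<^sup>+y. q s (- y) * (if - y > - x then ennreal (max 0 (- (- y)) / s) * low_prob c B (t - s) (- y) else 0) \<partial>lborel)"
          unfolding flux_def by (subst nn_integral_real_affine[where c = "-1" and t = 0]) (auto cong: if_cong)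
        also have "\<dots> = (\<integral>\<^sup>+y. indicator {0<..<x} y * (ennreal (y / s) * q s (- y) * low_prob c B (t - s) (- y)) \<partial>lborel)"
          by (intro nn_integral_cong) (auto simp: indicator_def max_def mult_ac)
        finally show ?thesis using True by simp
      qed simp
    qed
    also have "\<dots> = (\<integral>\<^sup>+y. \<integral>\<^sup>+s. indicator {0<..<x} y * (indicator {0<..<t} s * (ennreal (y / s) * q s (- y) * low_prob c B (t - s) (- y))) \<partial>lborel \<partial>lborel)"
      by (rule lborel_pair.Fubini') measurable
    also have "\<dots> = (\<integral>\<^sup>+y. indicator {0<..<x} y * V y \<partial>lborel)"
      unfolding V_def by (intro nn_integral_cong nn_integral_cmult) measurable
    finally show ?thesis .
  qed
  have "AE y in lborel. 0 < y \<longrightarrow> U y = V y"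
  proof (rule AE_eq_of_integrals_eq[OF _ _ eq])
    fix x :: real assume "0 < x"
    have "(\<integral>\<^sup>+y. indicator {0<..<x} y * U y \<partial>lborel) \<le> (\<integral>\<^sup>+y. indicator {0<..<x} y \<partial>lborel)"
      by (intro nn_integral_mono) (auto simp: indicator_def U emeasure_le_1)
    also have "\<dots> < \<infinity>" using \<open>0 < x\<close> by simp
    finally show "(\<integral>\<^sup>+y. indicator {0<..<x} y * U y \<partial>lborel) < \<infinity>" .
  qed auto
  then show ?thesis unfolding U V_def .
qed

end

end

section \<open>The joint laws at almost every level\<close>

lemma ex_of_AE_lborel:
  fixes x :: real
  assumes "AE y in lborel. P y" "0 < x"
  obtains y where "0 < y" "y < x" "P y"
proof -
  have "\<exists>y. 0 < y \<and> y < x \<and> P y"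
  proof (rule ccontr)
    assume *: "\<not> ?thesis"
    have "AE y in lborel. \<not> (0 < y \<and> y < x)"
      using assms(1) by eventually_elim (use * in auto)
    then have "emeasure lborel {0<..<x} = 0"
      by (subst (asm) AE_iff_measurable[OF _ refl]) (auto simp: greaterThanLessThan_def greaterThan_def lessThan_def Int_def)
    then show False using assms(2) by simp
  qed
  then show ?thesis using that by blast
qed

section \<open>Laws tested on rational half-lines\<close>

lemma sets_borel_rat: "sets borel = sigma_sets UNIV (range (\<lambda>r::rat. {..<of_rat r :: real}))"
proof -
  have "sigma_sets UNIV (range lessThan) = sigma_sets UNIV (range (\<lambda>r::rat. {..<of_rat r :: real}))"
  proof (rule sigma_sets_eqI)
    fix A :: "real set" assume "A \<in> range lessThan"
    then obtain a where a: "A = {..<a}" by auto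
    interpret sigma_algebra UNIV "sigma_sets UNIV (range (\<lambda>r::rat. {..<of_rat r :: real}))"
      by (rule sigma_algebra_sigma_sets) simp
    have "A = (\<Union>r\<in>{r::rat. of_rat r < a}. {..<of_rat r})"
    proof (rule set_eqI)
      fix x
      show "x \<in> A \<longleftrightarrow> x \<in> (\<Union>r\<in>{r::rat. of_rat r < a}. {..<of_rat r})"
      proof
        assume "x \<in> A"
        then obtain r where "x < of_rat r" "of_rat r < a" using of_rat_dense[of x a] a by auto
        then show "x \<in> (\<Union>r\<in>{r::rat. of_rat r < a}. {..<of_rat r})" by auto
      qed (use a in auto)
    qed
    also have "\<dots> \<in> sigma_sets UNIV (range (\<lambda>r::rat. {..<of_rat r :: real}))"
      by (rule countable_UN') (auto intro: sigma_sets.Basic)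
    finally show "A \<in> sigma_sets UNIV (range (\<lambda>r::rat. {..<of_rat r :: real}))" .
  qed (auto intro: sigma_sets.Basic)
  then show ?thesis by (simp add: borel_Iio)
qed

lemma measure_eqI_lessThan_rat:
  fixes \<mu> \<nu> :: "real measure"
  assumes sets: "sets \<mu> = sets borel" "sets \<nu> = sets borel"
    and fin: "emeasure \<mu> UNIV < \<infinity>" and eq: "\<And>r::rat. emeasure \<mu> {..<of_rat r} = emeasure \<nu> {..<of_rat r}"
  shows "\<mu> = \<nu>"
proof (rule measure_eqI_generator_eq[where E = "range (\<lambda>r::rat. {..<of_rat r :: real})" and A = "\<lambda>n::nat. {..<of_rat (of_nat n)}"])
  show "Int_stable (range (\<lambda>r::rat. {..<of_rat r :: real}))"
  proof (rule Int_stableI)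
    fix A B :: "real set" assume "A \<in> range (\<lambda>r::rat. {..<of_rat r :: real})" "B \<in> range (\<lambda>r::rat. {..<of_rat r :: real})"
    then obtain a b :: rat where "A = {..<of_rat a}" "B = {..<of_rat b}" by auto
    then have "A \<inter> B = {..<of_rat (min a b)}" by (auto simp: min_def of_rat_less_eq not_le dest: of_rat_less[THEN iffD2] elim: order_less_le_trans)
    then show "A \<inter> B \<in> range (\<lambda>r::rat. {..<of_rat r :: real})" by auto
  qed
  show "sets \<mu> = sigma_sets UNIV (range (\<lambda>r::rat. {..<of_rat r :: real}))"
    "sets \<nu> = sigma_sets UNIV (range (\<lambda>r::rat. {..<of_rat r :: real}))"
    using sets sets_borel_rat by auto
  show "(\<Union>n. {..<of_rat (of_nat n) :: real}) = UNIV" using reals_Archimedean2 by auto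
  show "emeasure \<mu> {..<of_rat (of_nat n)} \<noteq> \<infinity>" for n
    using fin emeasure_mono[of "{..<of_rat (of_nat n)}" UNIV \<mu>] sets by (auto simp: top_unique)
  show "range (\<lambda>n. {..<of_rat (of_nat n) :: real}) \<subseteq> range (\<lambda>r::rat. {..<of_rat r})" by blast
qed (use eq in auto)

text \<open>Countably many tests determine the law of \<open>Z\<close> on the event
  \<open>P\<close>. Thus an identity that holds off a null set of levels for each test holds off one
  null set for all test functions at once.\<close>

lemma (in prob_space) nn_integral_eq_density_rat:
  fixes Z :: "'a \<Rightarrow> real"
  assumes [measurable]: "{\<omega>\<in>space M. P \<omega>} \<in> sets M" "Z \<in> borel_measurable M" "D \<in> borel_measurable borel" "f \<in> borel_measurable borel"
    and eq: "\<And>r::rat. (\<integral>\<^sup>+\<omega>. (if P \<omega> \<and> Z \<omega> < of_rat r then 1 else 0) \<partial>M) = (\<integral>\<^sup>+z. D z * indicator {..<of_rat r} z \<partial>lborel)"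
  shows "(\<integral>\<^sup>+\<omega>. (if P \<omega> then f (Z \<omega>) else 0) \<partial>M) = (\<integral>\<^sup>+z. D z * f z \<partial>lborel)"
proof -
  define \<mu> where "\<mu> = distr (density M (\<lambda>\<omega>. if P \<omega> then 1 else 0)) borel Z"
  have int: "(\<integral>\<^sup>+z. g z \<partial>\<mu>) = (\<integral>\<^sup>+\<omega>. (if P \<omega> then g (Z \<omega>) else 0) \<partial>M)"
    if [measurable]: "g \<in> borel_measurable borel" for g :: "real \<Rightarrow> ennreal"
    unfolding \<mu>_def by (subst nn_integral_distr, simp, simp, subst nn_integral_density) (auto intro!: nn_integral_cong)
  have em: "emeasure \<mu> A = (\<integral>\<^sup>+\<omega>. (if P \<omega> \<and> Z \<omega> \<in> A then 1 else 0) \<partial>M)" if [measurable]: "A \<in> sets borel" for A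
  proof -
    have "emeasure \<mu> A = (\<integral>\<^sup>+z. indicator A z \<partial>\<mu>)" using that by (simp add: \<mu>_def)
    also have "\<dots> = (\<integral>\<^sup>+\<omega>. (if P \<omega> \<and> Z \<omega> \<in> A then 1 else 0) \<partial>M)"
      by (subst int) (auto intro!: nn_integral_cong simp: indicator_def)
    finally show ?thesis .
  qed
  have "\<mu> = density lborel D"
  proof (rule measure_eqI_lessThan_rat)
    have "emeasure \<mu> UNIV \<le> (\<integral>\<^sup>+\<omega>. 1 \<partial>M)" by (subst em, simp, intro nn_integral_mono) auto
    then show "emeasure \<mu> UNIV < \<infinity>" by (simp add: emeasure_space_1 order_le_less_trans)
    show "emeasure \<mu> {..<of_rat r} = emeasure (density lborel D) {..<of_rat r}" for r
      by (subst em, simp, subst emeasure_density) (use eq[of r] in auto)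
  qed (auto simp: \<mu>_def)
  then have "(\<integral>\<^sup>+z. f z \<partial>\<mu>) = (\<integral>\<^sup>+z. D z * f z \<partial>lborel)"
    by (simp add: nn_integral_density)
  then show ?thesis by (subst (asm) int) auto
qed

text \<open>Both times are approached from the right by grid points, and rounding up to a grid
  preserves their order.\<close>

lemma mono_on_of_dyadic:
  assumes f: "cadlag f" and t: "0 < t" and inc: "\<And>k m::nat. f (real k * t / 2 ^ m) \<le> f (real (Suc k) * t / 2 ^ m)"
  shows "mono_on {0..} f"
proof (rule mono_onI)
  fix u v :: real assume u: "u \<in> {0..}" and v: "v \<in> {0..}" and uv: "u \<le> v"
  define a where "a x m = real (nat \<lceil>x / (t / 2 ^ m)\<rceil>) * t / 2 ^ m" for x and m :: nat
  have lim: "(\<lambda>m. f (a x m)) \<longlonglongrightarrow> f x" if x: "0 \<le> x" for x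
  proof (rule cadlag_right_tendsto[OF f x])
    have b: "x \<le> a x m \<and> a x m \<le> x + t / 2 ^ m" for m
    proof -
      define k where "k = nat \<lceil>x / (t / 2 ^ m)\<rceil>"
      have n: "0 \<le> x / (t / 2 ^ m)" using x t by simp
      have "x / (t / 2 ^ m) \<le> real k" "real k \<le> x / (t / 2 ^ m) + 1"
        unfolding k_def using n real_nat_ceiling_ge[of "x / (t / 2 ^ m)"] of_int_ceiling_le_add_one[of "x / (t / 2 ^ m)"]
        by (simp_all del: divide_divide_eq_right)
      then have "x * 2 ^ m / t \<le> real k" "real k - 1 \<le> x * 2 ^ m / t" by auto
      then have "x * 2 ^ m \<le> real k * t" "(real k - 1) * t \<le> x * 2 ^ m"
        using t by (simp_all only: pos_divide_le_eq pos_le_divide_eq)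
      then show ?thesis unfolding a_def k_def[symmetric] by (auto simp: field_simps)
    qed
    show "x \<le> a x m" for m using b by simp
    have "(\<lambda>m. x + t / 2 ^ m) \<longlonglongrightarrow> x + 0"
      by (intro tendsto_add tendsto_const LIMSEQ_divide_realpow_zero) simp
    then show "a x \<longlonglongrightarrow> x"
      by (intro tendsto_sandwich[of "\<lambda>_. x" "a x" sequentially "\<lambda>m. x + t / 2 ^ m"]) (use b in auto)
  qed
  have mono: "f (real i * t / 2 ^ m) \<le> f (real j * t / 2 ^ m)" if "i \<le> j" for i j m :: nat
    using that
  proof (induction j rule: dec_induct)
    case (step n)
    then show ?case using inc[of n m] by linarith
  qed simp
  have "f (a u m) \<le> f (a v m)" for m
    unfolding a_def using uv t by (intro mono nat_mono ceiling_mono divide_right_mono) auto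
  then show "f u \<le> f v"
    using lim[of u] lim[of v] u v by (intro LIMSEQ_le[of "\<lambda>m. f (a u m)" _ "\<lambda>m. f (a v m)"]) auto
qed

section \<open>Levels at which the formulas hold\<close>

context spectrally_positive_levy
begin

text \<open>The path passes \<open>-y\<close> for the first time at \<open>s\<close>, with Kendall's
  density \<open>y / s * q s (- y)\<close>, and then goes from \<open>-y\<close> to \<open>z\<close>
  in the remaining time.\<close>

definition low_density :: "real \<Rightarrow> real \<Rightarrow> real \<Rightarrow> ennreal" where
  "low_density r y z = (\<integral>\<^sup>+s. indicator {0<..<r} s * (ennreal (y / s) * q s (- y) * q (r - s) (y + z)) \<partial>lborel)"

lemma low_density_measurable [measurable (raw)]:
  assumes [measurable]: "f \<in> borel_measurable N" "g \<in> borel_measurable N" "k \<in> borel_measurable N"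
  shows "(\<lambda>x. low_density (f x) (g x) (k x)) \<in> borel_measurable N"
proof -
  have [measurable]: "Measurable.pred (N \<Otimes>\<^sub>M lborel) (\<lambda>z. snd z \<in> {0<..<f (fst z)})"
    unfolding greaterThanLessThan_iff by measurable
  have "(\<lambda>z. indicator {0<..<f (fst z)} (snd z) * (ennreal (g (fst z) / snd z) * q (snd z) (- g (fst z)) * q (f (fst z) - snd z) (g (fst z) + k (fst z))))
     \<in> borel_measurable (N \<Otimes>\<^sub>M lborel)"
    unfolding indicator_def of_bool_def by measurable
  then show ?thesis unfolding low_density_def
    by (intro lborel.borel_measurable_nn_integral) (simp add: case_prod_beta')
qed

lemma nn_integral_q: "0 < t \<Longrightarrow> (\<integral>\<^sup>+y. q t y \<partial>lborel) = 1"
  using nn_integral_X[of t "\<lambda>_. 1"] by (simp add: emeasure_space_1)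

lemma nn_integral_q_shift: "0 < t \<Longrightarrow> (\<integral>\<^sup>+z. q t (y + z) \<partial>lborel) = 1"
  using nn_integral_q[of t] nn_integral_real_affine[of "q t" 1 y] by simp

lemma nn_integral_low_density:
  assumes [measurable]: "f \<in> borel_measurable borel"
  shows "(\<integral>\<^sup>+z. low_density r y z * f z \<partial>lborel) =
    (\<integral>\<^sup>+s. indicator {0<..<r} s * (ennreal (y / s) * q s (- y) * (\<integral>\<^sup>+z. q (r - s) (y + z) * f z \<partial>lborel)) \<partial>lborel)"
proof -
  have "(\<integral>\<^sup>+z. low_density r y z * f z \<partial>lborel) =
    (\<integral>\<^sup>+z. \<integral>\<^sup>+s. indicator {0<..<r} s * (ennreal (y / s) * q s (- y) * q (r - s) (y + z)) * f z \<partial>lborel \<partial>lborel)"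
    unfolding low_density_def by (intro nn_integral_cong nn_integral_multc[symmetric]) measurable
  also have "\<dots> = (\<integral>\<^sup>+s. \<integral>\<^sup>+z. indicator {0<..<r} s * (ennreal (y / s) * q s (- y) * q (r - s) (y + z)) * f z \<partial>lborel \<partial>lborel)"
    by (rule lborel_pair.Fubini') measurable
  also have "\<dots> = (\<integral>\<^sup>+s. indicator {0<..<r} s * (ennreal (y / s) * q s (- y) * (\<integral>\<^sup>+z. q (r - s) (y + z) * f z \<partial>lborel)) \<partial>lborel)"
  proof (rule nn_integral_cong)
    fix s
    have "(\<integral>\<^sup>+z. indicator {0<..<r} s * (ennreal (y / s) * q s (- y) * q (r - s) (y + z)) * f z \<partial>lborel) =
      (\<integral>\<^sup>+z. indicator {0<..<r} s * (ennreal (y / s) * q s (- y)) * (q (r - s) (y + z) * f z) \<partial>lborel)"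
      by (simp only: mult.assoc)
    also have "\<dots> = indicator {0<..<r} s * (ennreal (y / s) * q s (- y)) * (\<integral>\<^sup>+z. q (r - s) (y + z) * f z \<partial>lborel)"
      by (rule nn_integral_cmult) measurable
    finally show "(\<integral>\<^sup>+z. indicator {0<..<r} s * (ennreal (y / s) * q s (- y) * q (r - s) (y + z)) * f z \<partial>lborel) =
      indicator {0<..<r} s * (ennreal (y / s) * q s (- y) * (\<integral>\<^sup>+z. q (r - s) (y + z) * f z \<partial>lborel))"
      by (simp only: mult.assoc)
  qed
  finally show ?thesis .
qed

text \<open>The second leg has mass 1 from every starting point, so what is left is the law of the
  first passage time. For regular levels this is the probability of passing \<open>-y\<close> by
  time \<open>r\<close>.\<close>

lemma nn_integral_low_density_UNIV:
  "(\<integral>\<^sup>+z. low_density r y z \<partial>lborel) = (\<integral>\<^sup>+s. indicator {0<..<r} s * (ennreal (y / s) * q s (- y)) \<partial>lborel)"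
  using nn_integral_low_density[of "\<lambda>_. 1" r y]
  by (auto intro!: nn_integral_cong simp: nn_integral_q_shift indicator_def)

text \<open>\<open>regular r y\<close>: the formula for the law of \<open>(I\<^sub>r, X\<^sub>r)\<close> holds at level \<open>-y\<close>. It is tested on countably
  many half-lines to make the exceptional set measurable in \<open>(r, y)\<close>.\<close>

definition regular :: "real \<Rightarrow> real \<Rightarrow> bool" where
  "regular r y \<longleftrightarrow> (\<forall>a::rat.
     (\<integral>\<^sup>+\<omega>. (if (INF u\<in>{0..max 0 r}. X u \<omega>) < - y \<and> X (max 0 r) \<omega> < of_rat a then 1 else 0) \<partial>M) =
     (\<integral>\<^sup>+z. low_density r y z * indicator {..<of_rat a} z \<partial>lborel))"

lemma regular_measurable [measurable (raw)]:
  assumes [measurable]: "f \<in> borel_measurable N" "g \<in> borel_measurable N"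
  shows "Measurable.pred N (\<lambda>x. regular (f x) (g x))"
proof -
  have [measurable]: "(\<lambda>x. INF u\<in>{0..max 0 (f (fst x))}. X u (snd x)) \<in> borel_measurable (N \<Otimes>\<^sub>M M)"
    "(\<lambda>x. X (max 0 (f (fst x))) (snd x)) \<in> borel_measurable (N \<Otimes>\<^sub>M M)"
    using measurable_compose[of "\<lambda>x. (f (fst x), snd x)" "N \<Otimes>\<^sub>M M" "borel \<Otimes>\<^sub>M M", OF _ INF_joint_measurable]
      measurable_compose[of "\<lambda>x. (f (fst x), snd x)" "N \<Otimes>\<^sub>M M" "borel \<Otimes>\<^sub>M M", OF _ X_joint_measurable]
    by (auto simp: case_prod_beta')
  have [measurable]: "(\<lambda>x. \<integral>\<^sup>+\<omega>. (if (INF u\<in>{0..max 0 (f x)}. X u \<omega>) < - g x \<and> X (max 0 (f x)) \<omega> < of_rat a then 1 else 0) \<partial>M) \<in> borel_measurable N"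
    for a :: rat
    by (rule borel_measurable_nn_integral) (simp add: case_prod_beta', measurable)
  have [measurable]: "(\<lambda>x. \<integral>\<^sup>+z. low_density (f x) (g x) z * indicator {..<of_rat a} z \<partial>lborel) \<in> borel_measurable N"
    for a :: rat
    by measurable
  show ?thesis unfolding regular_def by measurable
qed

lemma nn_integral_regular:
  assumes "regular r y" and r: "0 < r" and [measurable]: "f \<in> borel_measurable borel"
  shows "(\<integral>\<^sup>+\<omega>. (if (INF u\<in>{0..r}. X u \<omega>) < - y then f (X r \<omega>) else 0) \<partial>M) = (\<integral>\<^sup>+z. low_density r y z * f z \<partial>lborel)"
proof -
  have [measurable]: "X r \<in> borel_measurable M" "(\<lambda>\<omega>. INF u\<in>{0..r}. X u \<omega>) \<in> borel_measurable M"
    using r by (auto intro!: X_measurable INF_measurable)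
  show ?thesis
    by (rule nn_integral_eq_density_rat) (use assms in \<open>auto simp: regular_def max_def\<close>)
qed

lemma regular_emeasure:
  assumes "regular r y" and r: "0 < r" and B [measurable]: "B \<in> sets borel"
  shows "emeasure M {\<omega>\<in>space M. (INF u\<in>{0..r}. X u \<omega>) < - y \<and> X r \<omega> \<in> B} = (\<integral>\<^sup>+z. low_density r y z * indicator B z \<partial>lborel)"
proof -
  have [measurable]: "X r \<in> borel_measurable M" "(\<lambda>\<omega>. INF u\<in>{0..r}. X u \<omega>) \<in> borel_measurable M"
    using r by (auto intro!: X_measurable INF_measurable)
  have "emeasure M {\<omega>\<in>space M. (INF u\<in>{0..r}. X u \<omega>) < - y \<and> X r \<omega> \<in> B} =
    (\<integral>\<^sup>+\<omega>. indicator {\<omega>\<in>space M. (INF u\<in>{0..r}. X u \<omega>) < - y \<and> X r \<omega> \<in> B} \<omega> \<partial>M)"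
    by (rule nn_integral_indicator[symmetric]) measurable
  also have "\<dots> = (\<integral>\<^sup>+\<omega>. (if (INF u\<in>{0..r}. X u \<omega>) < - y then indicator B (X r \<omega>) else 0) \<partial>M)"
    by (intro nn_integral_cong) (auto simp: indicator_def)
  also have "\<dots> = (\<integral>\<^sup>+z. low_density r y z * indicator B z \<partial>lborel)"
    using assms by (intro nn_integral_regular) auto
  finally show ?thesis .
qed

lemma AE_regular:
  assumes t: "0 < t"
  shows "AE y in lborel. 0 < y \<longrightarrow> regular t y"
proof -
  have [measurable]: "X t \<in> borel_measurable M" "(\<lambda>\<omega>. INF u\<in>{0..t}. X u \<omega>) \<in> borel_measurable M"
    using t by (auto intro!: X_measurable INF_measurable)
  have "AE y in lborel. 0 < y \<longrightarrow>
     (\<integral>\<^sup>+\<omega>. (if (INF u\<in>{0..max 0 t}. X u \<omega>) < - y \<and> X (max 0 t) \<omega> < of_rat a then 1 else 0) \<partial>M) =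
     (\<integral>\<^sup>+z. low_density t y z * indicator {..<of_rat a} z \<partial>lborel)" for a :: rat
    \<comment> \<open>With \<open>c = 0\<close> the condition on the second level holds
      automatically: a path standing at \<open>-y < 0\<close> is already below 0.\<close>
    using first_passage_AE[OF t, where B = "{..<of_rat a}" and c = 0, OF lessThan_borel] unfolding lessThan_iff
  proof (eventually_elim, intro impI)
    fix y :: real assume y: "0 < y"
      and "0 < y \<longrightarrow> emeasure M {\<omega>\<in>space M. (INF u\<in>{0..t}. X u \<omega>) < 0 \<and> (INF u\<in>{0..t}. X u \<omega>) < - y \<and> X t \<omega> < of_rat a} =
        (\<integral>\<^sup>+s. indicator {0<..<t} s * (ennreal (y / s) * q s (- y) * low_prob 0 {..<of_rat a} (t - s) (- y)) \<partial>lborel)"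
    then have "emeasure M {\<omega>\<in>space M. (INF u\<in>{0..t}. X u \<omega>) < 0 \<and> (INF u\<in>{0..t}. X u \<omega>) < - y \<and> X t \<omega> < of_rat a} =
        (\<integral>\<^sup>+s. indicator {0<..<t} s * (ennreal (y / s) * q s (- y) * low_prob 0 {..<of_rat a} (t - s) (- y)) \<partial>lborel)" (is "?L = ?R")
      by simp
    moreover have "(\<integral>\<^sup>+\<omega>. (if (INF u\<in>{0..max 0 t}. X u \<omega>) < - y \<and> X (max 0 t) \<omega> < of_rat a then 1 else 0) \<partial>M) = ?L"
    proof -
      have "(\<integral>\<^sup>+\<omega>. (if (INF u\<in>{0..max 0 t}. X u \<omega>) < - y \<and> X (max 0 t) \<omega> < of_rat a then 1 else 0) \<partial>M) =
        (\<integral>\<^sup>+\<omega>. indicator {\<omega>\<in>space M. (INF u\<in>{0..t}. X u \<omega>) < 0 \<and> (INF u\<in>{0..t}. X u \<omega>) < - y \<and> X t \<omega> < of_rat a} \<omega> \<partial>M)"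
        using t y by (intro nn_integral_cong) (auto simp: indicator_def max_def)
      then show ?thesis by (subst (asm) nn_integral_indicator) auto
    qed
    moreover have "?R = (\<integral>\<^sup>+z. low_density t y z * indicator {..<of_rat a} z \<partial>lborel)"
      unfolding nn_integral_low_density[of "indicator {..<of_rat a}", simplified]
    proof (rule nn_integral_cong)
      fix s
      show "indicator {0<..<t} s * (ennreal (y / s) * q s (- y) * low_prob 0 {..<of_rat a} (t - s) (- y)) =
        indicator {0<..<t} s * (ennreal (y / s) * q s (- y) * (\<integral>\<^sup>+z. q (t - s) (y + z) * indicator {..<of_rat a} z \<partial>lborel))"
      proof (cases "s \<in> {0<..<t}")
        case True
        then have s: "0 < t - s" by simp
        have "low_prob 0 {..<of_rat a} (t - s) (- y) = (\<integral>\<^sup>+\<omega>. indicator {..<of_rat a} (X (t - s) \<omega> - y) \<partial>M)"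
          unfolding low_prob_def
        proof (rule nn_integral_cong_AE)
          show "AE \<omega> in M. (if (INF u\<in>{0..max 0 (t - s)}. X u \<omega>) + - y < 0 \<and> X (max 0 (t - s)) \<omega> + - y \<in> {..<of_rat a} then 1 else 0) =
             (indicator {..<of_rat a} (X (t - s) \<omega> - y) :: ennreal)"
            using INF_le_0
          proof eventually_elim
            case (elim \<omega>)
            have "(INF u\<in>{0..t - s}. X u \<omega>) \<le> 0" using elim s by simp
            then show ?case using y s by (auto simp: indicator_def max_def)
          qed
        qed
        also have "\<dots> = (\<integral>\<^sup>+w. q (t - s) w * indicator {..<of_rat a} (w - y) \<partial>lborel)"
          by (rule nn_integral_X[OF s]) measurable
        also have "\<dots> = (\<integral>\<^sup>+z. q (t - s) (y + z) * indicator {..<of_rat a} z \<partial>lborel)"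
          by (subst nn_integral_real_affine[where c = 1 and t = y]) auto
        finally show ?thesis by simp
      qed simp
    qed
    ultimately show "(\<integral>\<^sup>+\<omega>. (if (INF u\<in>{0..max 0 t}. X u \<omega>) < - y \<and> X (max 0 t) \<omega> < of_rat a then 1 else 0) \<partial>M) =
     (\<integral>\<^sup>+z. low_density t y z * indicator {..<of_rat a} z \<partial>lborel)" by simp
  qed
  then have "AE y in lborel. \<forall>a::rat. 0 < y \<longrightarrow>
     (\<integral>\<^sup>+\<omega>. (if (INF u\<in>{0..max 0 t}. X u \<omega>) < - y \<and> X (max 0 t) \<omega> < of_rat a then 1 else 0) \<partial>M) =
     (\<integral>\<^sup>+z. low_density t y z * indicator {..<of_rat a} z \<partial>lborel)"
    unfolding AE_all_countable by blast
  then show ?thesis by eventually_elim (auto simp: regular_def)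
qed

text \<open>\<open>regular' r x\<close>: the same formula in the coordinates \<open>x = y + z\<close>, that is, for the reflected process
  \<open>X - I\<close>, which has the law of the supremum by time reversal.\<close>

definition regular' :: "real \<Rightarrow> real \<Rightarrow> bool" where
  "regular' r x \<longleftrightarrow> (\<forall>f\<in>borel_measurable borel.
     (\<integral>\<^sup>+\<omega>. (if X r \<omega> - (INF u\<in>{0..r}. X u \<omega>) > x \<and> X r \<omega> < x then f (X r \<omega>) else 0) \<partial>M) =
     (\<integral>\<^sup>+z. (if z < x then low_density r (x - z) z * f z else 0) \<partial>lborel))"

text \<open>The level \<open>y = x - X t\<close> depends on the final position, so the statement for
  almost every \<open>y\<close> cannot simply be evaluated there. Both sides are integrated over a
  set \<open>A\<close> of values of \<open>x\<close>; after exchanging integrals and substituting,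
  the statement is needed only under an integral over \<open>y\<close>.\<close>

lemma AE_regular':
  assumes t: "0 < t"
  shows "AE x in lborel. regular' t x"
proof -
  have [measurable]: "X t \<in> borel_measurable M" "(\<lambda>\<omega>. INF u\<in>{0..t}. X u \<omega>) \<in> borel_measurable M"
    using t by (auto intro!: X_measurable INF_measurable)
  let ?P = "\<lambda>x \<omega>. X t \<omega> - (INF u\<in>{0..t}. X u \<omega>) > x \<and> X t \<omega> < x"
  have "AE x in lborel. (\<integral>\<^sup>+\<omega>. (if ?P x \<omega> \<and> X t \<omega> < of_rat a then 1 else 0) \<partial>M) =
     (\<integral>\<^sup>+z. (if z < x then low_density t (x - z) z else 0) * indicator {..<of_rat a} z \<partial>lborel)" for a :: rat
  proof -
    define F where "F x = (\<integral>\<^sup>+\<omega>. (if ?P x \<omega> \<and> X t \<omega> < of_rat a then 1 else 0) \<partial>M)" for x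
    define G where "G x = (\<integral>\<^sup>+z. (if z < x then low_density t (x - z) z else 0) * indicator {..<of_rat a} z \<partial>lborel)" for x
    have [measurable]: "F \<in> borel_measurable borel" "G \<in> borel_measurable borel"
      unfolding F_def G_def by measurable
    have "density lborel F = density lborel G"
    proof (rule measure_eqI)
      fix A assume "A \<in> sets (density lborel F)"
      then have [measurable]: "A \<in> sets borel" by simp
      have "emeasure (density lborel F) A = (\<integral>\<^sup>+x. F x * indicator A x \<partial>lborel)" by (subst emeasure_density) auto
      also have "\<dots> = (\<integral>\<^sup>+x. \<integral>\<^sup>+\<omega>. (if ?P x \<omega> \<and> X t \<omega> < of_rat a then 1 else 0) * indicator A x \<partial>M \<partial>lborel)"
        unfolding F_def by (intro nn_integral_cong nn_integral_multc[symmetric]) measurable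
      also have "\<dots> = (\<integral>\<^sup>+\<omega>. \<integral>\<^sup>+x. (if ?P x \<omega> \<and> X t \<omega> < of_rat a then 1 else 0) * indicator A x \<partial>lborel \<partial>M)"
      proof -
        interpret pair_sigma_finite M lborel ..
        show ?thesis by (rule Fubini') measurable
      qed
      \<comment> \<open>With \<open>x = y + X t\<close>, the condition \<open>X t - I > x\<close>
        becomes \<open>I < -y\<close>, and \<open>X t < x\<close> becomes
        \<open>0 < y\<close>.\<close>
      also have "\<dots> = (\<integral>\<^sup>+\<omega>. \<integral>\<^sup>+y. (if 0 < y \<and> (INF u\<in>{0..t}. X u \<omega>) < - y then indicator {..<of_rat a} (X t \<omega>) * indicator A (y + X t \<omega>) else 0) \<partial>lborel \<partial>M)"
      proof (rule nn_integral_cong)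
        fix \<omega>
        show "(\<integral>\<^sup>+x. (if ?P x \<omega> \<and> X t \<omega> < of_rat a then 1 else 0) * indicator A x \<partial>lborel) =
          (\<integral>\<^sup>+y. (if 0 < y \<and> (INF u\<in>{0..t}. X u \<omega>) < - y then indicator {..<of_rat a} (X t \<omega>) * indicator A (y + X t \<omega>) else 0) \<partial>lborel)"
          by (subst nn_integral_real_affine[where c = 1 and t = "X t \<omega>"])
            (auto intro!: nn_integral_cong simp: indicator_def add.commute)
      qed
      also have "\<dots> = (\<integral>\<^sup>+y. \<integral>\<^sup>+\<omega>. (if 0 < y \<and> (INF u\<in>{0..t}. X u \<omega>) < - y then indicator {..<of_rat a} (X t \<omega>) * indicator A (y + X t \<omega>) else 0) \<partial>M \<partial>lborel)"
      proof -
        interpret pair_sigma_finite lborel M ..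
        show ?thesis by (rule Fubini') measurable
      qed
      also have "\<dots> = (\<integral>\<^sup>+y. (if 0 < y then (\<integral>\<^sup>+z. low_density t y z * (indicator {..<of_rat a} z * indicator A (y + z)) \<partial>lborel) else 0) \<partial>lborel)"
      proof (rule nn_integral_cong_AE)
        show "AE y in lborel. (\<integral>\<^sup>+\<omega>. (if 0 < y \<and> (INF u\<in>{0..t}. X u \<omega>) < - y then indicator {..<of_rat a} (X t \<omega>) * indicator A (y + X t \<omega>) else 0) \<partial>M) =
           (if 0 < y then (\<integral>\<^sup>+z. low_density t y z * (indicator {..<of_rat a} z * indicator A (y + z)) \<partial>lborel) else 0)"
          using AE_regular[OF t]
        proof eventually_elim
          case (elim y)
          show ?case
          proof (cases "0 < y")
            case True
            then show ?thesis
              using nn_integral_regular[OF elim[rule_format, OF True] t, of "\<lambda>z. indicator {..<of_rat a} z * indicator A (y + z)"] by simp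
          qed simp
        qed
      qed
      also have "\<dots> = (\<integral>\<^sup>+y. \<integral>\<^sup>+z. (if 0 < y then low_density t y z * (indicator {..<of_rat a} z * indicator A (y + z)) else 0) \<partial>lborel \<partial>lborel)"
        by (intro nn_integral_cong) auto
      also have "\<dots> = (\<integral>\<^sup>+z. \<integral>\<^sup>+y. (if 0 < y then low_density t y z * (indicator {..<of_rat a} z * indicator A (y + z)) else 0) \<partial>lborel \<partial>lborel)"
        by (rule lborel_pair.Fubini') measurable
      also have "\<dots> = (\<integral>\<^sup>+z. \<integral>\<^sup>+x. (if z < x then low_density t (x - z) z else 0) * indicator {..<of_rat a} z * indicator A x \<partial>lborel \<partial>lborel)"
      proof (rule nn_integral_cong)
        fix z :: real
        show "(\<integral>\<^sup>+y. (if 0 < y then low_density t y z * (indicator {..<of_rat a} z * indicator A (y + z)) else 0) \<partial>lborel) =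
          (\<integral>\<^sup>+x. (if z < x then low_density t (x - z) z else 0) * indicator {..<of_rat a} z * indicator A x \<partial>lborel)"
        proof -
          define g where "g y = (if 0 < y then low_density t y z * (indicator {..<of_rat a} z * indicator A (y + z)) else 0)" for y
          have [measurable]: "g \<in> borel_measurable borel" unfolding g_def by measurable
          have "(\<integral>\<^sup>+y. g y \<partial>lborel) = (\<integral>\<^sup>+x. g (x - z) \<partial>lborel)"
            using nn_integral_real_affine[of g 1 "- z"] by simp
          also have "\<dots> = (\<integral>\<^sup>+x. (if z < x then low_density t (x - z) z else 0) * indicator {..<of_rat a} z * indicator A x \<partial>lborel)"
            by (rule nn_integral_cong) (auto simp: g_def mult.assoc)
          finally show ?thesis unfolding g_def .
        qed
      qed
      also have "\<dots> = (\<integral>\<^sup>+x. \<integral>\<^sup>+z. (if z < x then low_density t (x - z) z else 0) * indicator {..<of_rat a} z * indicator A x \<partial>lborel \<partial>lborel)"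
        by (rule lborel_pair.Fubini') measurable
      also have "\<dots> = (\<integral>\<^sup>+x. G x * indicator A x \<partial>lborel)"
        unfolding G_def by (intro nn_integral_cong nn_integral_multc) measurable
      also have "\<dots> = emeasure (density lborel G) A" by (subst emeasure_density) auto
      finally show "emeasure (density lborel F) A = emeasure (density lborel G) A" .
    qed simp
    then have "AE x in lborel. F x = G x"
      by (intro sigma_finite_measure.density_unique[OF sigma_finite_lborel]) auto
    then show ?thesis unfolding F_def G_def .
  qed
  then have "AE x in lborel. \<forall>a::rat. (\<integral>\<^sup>+\<omega>. (if ?P x \<omega> \<and> X t \<omega> < of_rat a then 1 else 0) \<partial>M) =
     (\<integral>\<^sup>+z. (if z < x then low_density t (x - z) z else 0) * indicator {..<of_rat a} z \<partial>lborel)"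
    by (simp add: AE_all_countable)
  then show ?thesis
  proof eventually_elim
    case (elim x)
    show ?case unfolding regular'_def
    proof
      fix f :: "real \<Rightarrow> ennreal" assume [measurable]: "f \<in> borel_measurable borel"
      have "(\<integral>\<^sup>+\<omega>. (if ?P x \<omega> then f (X t \<omega>) else 0) \<partial>M) = (\<integral>\<^sup>+z. (if z < x then low_density t (x - z) z else 0) * f z \<partial>lborel)"
        by (rule nn_integral_eq_density_rat) (use elim in auto)
      also have "\<dots> = (\<integral>\<^sup>+z. (if z < x then low_density t (x - z) z * f z else 0) \<partial>lborel)"
        by (intro nn_integral_cong) auto
      finally show "(\<integral>\<^sup>+\<omega>. (if ?P x \<omega> then f (X t \<omega>) else 0) \<partial>M) = (\<integral>\<^sup>+z. (if z < x then low_density t (x - z) z * f z else 0) \<partial>lborel)" .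
    qed
  qed
qed

section \<open>Immediate entrance into the negative half-line\<close>

lemma emeasure_INF_neg:
  assumes t: "0 < t"
  shows "emeasure M {\<omega>\<in>space M. (INF u\<in>{0..t}. X u \<omega>) < 0} =
    (SUP n. emeasure M {\<omega>\<in>space M. (INF u\<in>{0..t}. X u \<omega>) < - (1 / real (Suc n))})"
proof -
  have [measurable]: "(\<lambda>\<omega>. INF u\<in>{0..t}. X u \<omega>) \<in> borel_measurable M"
    using t by (auto intro!: INF_measurable)
  have "{\<omega>\<in>space M. (INF u\<in>{0..t}. X u \<omega>) < 0} = (\<Union>n. {\<omega>\<in>space M. (INF u\<in>{0..t}. X u \<omega>) < - (1 / real (Suc n))})"
  proof safe
    fix \<omega> assume "\<omega> \<in> space M" "(INF u\<in>{0..t}. X u \<omega>) < 0"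
    then obtain n where "1 / real (Suc n) < - (INF u\<in>{0..t}. X u \<omega>)"
      using nat_approx_posE[of "- (INF u\<in>{0..t}. X u \<omega>)"] by auto
    then show "\<omega> \<in> (\<Union>n. {\<omega>\<in>space M. (INF u\<in>{0..t}. X u \<omega>) < - (1 / real (Suc n))})"
      using \<open>\<omega> \<in> space M\<close> by (intro UN_I[of n]) auto
  next
    fix \<omega> n assume "(INF u\<in>{0..t}. X u \<omega>) < - (1 / real (Suc n))"
    moreover have "0 < 1 / real (Suc n)" by simp
    ultimately show "(INF u\<in>{0..t}. X u \<omega>) < 0" by linarith
  qed
  moreover have "incseq (\<lambda>n. {\<omega>\<in>space M. (INF u\<in>{0..t}. X u \<omega>) < - (1 / real (Suc n))})"
  proof (rule incseq_SucI, safe)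
    fix \<omega> n assume "(INF u\<in>{0..t}. X u \<omega>) < - (1 / real (Suc n))"
    moreover have "1 / real (Suc (Suc n)) \<le> 1 / real (Suc n)" by (simp add: field_simps)
    ultimately show "(INF u\<in>{0..t}. X u \<omega>) < - (1 / real (Suc (Suc n)))" by linarith
  qed
  ultimately show ?thesis by (subst SUP_emeasure_incseq) auto
qed

text \<open>To get below \<open>-x\<close> the process has to start afresh from a negative level, so \<open>P(I\<^sub>t < 0)\<close> is at most
  its own square.\<close>

lemma AE_INF_neg:
  assumes nsub: "\<not> subordinator M X" and t: "0 < t"
  shows "AE \<omega> in M. (INF u\<in>{0..t}. X u \<omega>) < 0"
proof -
  have [measurable]: "X t \<in> borel_measurable M" "(\<lambda>\<omega>. INF u\<in>{0..t}. X u \<omega>) \<in> borel_measurable M"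
    using t by (auto intro!: X_measurable INF_measurable)
  define \<theta> where "\<theta> = emeasure M {\<omega>\<in>space M. (INF u\<in>{0..t}. X u \<omega>) < 0}"
  have le: "emeasure M {\<omega>\<in>space M. (INF u\<in>{0..t}. X u \<omega>) < - x} \<le> \<theta> * \<theta>" if x: "0 < x" for x
  proof -
    \<comment> \<open>Almost every level satisfies both the law and the decomposition, so a suitable
      one lies strictly between 0 and \<open>x\<close>.\<close>
    obtain y where y': "0 < y" "y < x" and r: "(0 < y \<longrightarrow> regular t y) \<and> (0 < y \<longrightarrow>
       emeasure M {\<omega>\<in>space M. (INF u\<in>{0..t}. X u \<omega>) < - x \<and> (INF u\<in>{0..t}. X u \<omega>) < - y \<and> X t \<omega> \<in> UNIV} =
       (\<integral>\<^sup>+s. indicator {0<..<t} s * (ennreal (y / s) * q s (- y) * low_prob (- x) UNIV (t - s) (- y)) \<partial>lborel))"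
      by (rule ex_of_AE_lborel[OF AE_conjI[OF AE_regular[OF t] first_passage_AE[OF t sets.top[of borel, unfolded space_borel], of "- x"]] x])
    note y = y' mp[OF conjunct1[OF r] y'(1)] and fp = mp[OF conjunct2[OF r] y'(1)]
    have "emeasure M {\<omega>\<in>space M. (INF u\<in>{0..t}. X u \<omega>) < - x} =
      emeasure M {\<omega>\<in>space M. (INF u\<in>{0..t}. X u \<omega>) < - x \<and> (INF u\<in>{0..t}. X u \<omega>) < - y \<and> X t \<omega> \<in> UNIV}"
      using y by (intro arg_cong[where f = "emeasure M"]) auto
    also have "\<dots> \<le> (\<integral>\<^sup>+s. indicator {0<..<t} s * (ennreal (y / s) * q s (- y)) * \<theta> \<partial>lborel)"
      unfolding fp
    proof (intro nn_integral_mono)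
      fix s
      show "indicator {0<..<t} s * (ennreal (y / s) * q s (- y) * low_prob (- x) UNIV (t - s) (- y))
        \<le> indicator {0<..<t} s * (ennreal (y / s) * q s (- y)) * \<theta>"
      proof (cases "s \<in> {0<..<t}")
        case True
        have "low_prob (- x) UNIV (t - s) (- y) = emeasure M {\<omega>\<in>space M. (INF u\<in>{0..t - s}. X u \<omega>) + - y < - x \<and> X (t - s) \<omega> + - y \<in> UNIV}"
          using True by (intro low_prob_eq) auto
        \<comment> \<open>From \<open>-y\<close> the path must still fall by
          \<open>x - y > 0\<close>, within a time shorter than \<open>t\<close>.\<close>
        also have "\<dots> \<le> \<theta>" unfolding \<theta>_def
        proof (intro emeasure_mono)
          show "{\<omega>\<in>space M. (INF u\<in>{0..t - s}. X u \<omega>) + - y < - x \<and> X (t - s) \<omega> + - y \<in> UNIV} \<subseteq> {\<omega>\<in>space M. (INF u\<in>{0..t}. X u \<omega>) < 0}"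
          proof safe
            fix \<omega> assume \<omega>: "\<omega> \<in> space M" "(INF u\<in>{0..t - s}. X u \<omega>) + - y < - x"
            have "(INF u\<in>{0..t}. X u \<omega>) \<le> (INF u\<in>{0..t - s}. X u \<omega>)"
              using True cadlag_bdd(1)[OF path[OF \<omega>(1)]] by (intro cINF_superset_mono) auto
            then show "(INF u\<in>{0..t}. X u \<omega>) < 0" using \<omega> y by linarith
          qed
        qed measurable
        finally show ?thesis using True by (simp add: mult_left_mono)
      qed simp
    qed
    also have "\<dots> = (\<integral>\<^sup>+z. low_density t y z \<partial>lborel) * \<theta>"
      unfolding nn_integral_low_density_UNIV by (rule nn_integral_multc) measurable
    also have "(\<integral>\<^sup>+z. low_density t y z \<partial>lborel) = emeasure M {\<omega>\<in>space M. (INF u\<in>{0..t}. X u \<omega>) < - y \<and> X t \<omega> \<in> UNIV}"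
      using regular_emeasure[OF y(3) t, of UNIV] by simp
    also have "\<dots> \<le> \<theta>"
      unfolding \<theta>_def using y by (intro emeasure_mono) auto
    finally show ?thesis by (simp add: mult_right_mono)
  qed
  have "\<theta> = (SUP n. emeasure M {\<omega>\<in>space M. (INF u\<in>{0..t}. X u \<omega>) < - (1 / real (Suc n))})"
    unfolding \<theta>_def by (rule emeasure_INF_neg[OF t])
  also have "\<dots> \<le> \<theta> * \<theta>" by (intro SUP_least le) simp
  finally have sq: "\<theta> \<le> \<theta> * \<theta>" .
  define c where "c = enn2real \<theta>"
  have c: "\<theta> = ennreal c" "0 \<le> c" "c \<le> 1"
    unfolding c_def \<theta>_def by (auto simp: emeasure_eq_measure)
  have "c \<le> c * c" using sq c by (simp flip: ennreal_mult)
  \<comment> \<open>A zero-one law: a number in \<open>[0, 1]\<close> not exceeding its own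
    square.\<close>
  then have "c = 0 \<or> c = 1" using c by (metis antisym mult.right_neutral mult_le_cancel_left order_le_less)
  \<comment> \<open>If the infimum were almost surely nonnegative, stationarity would make all
    dyadic increments nonnegative, and by right continuity \<open>X\<close> would be a
    subordinator.\<close>
  moreover have "c \<noteq> 0"
  proof
    assume "c = 0"
    then have "\<theta> = 0" using c by simp
    then have nn: "AE \<omega> in M. 0 \<le> (INF u\<in>{0..t}. X u \<omega>)"
      unfolding \<theta>_def by (subst AE_iff_measurable[OF _ refl]) (auto simp: not_le)
    have inc: "AE \<omega> in M. X (real k * t / 2 ^ m) \<omega> \<le> X (real (Suc k) * t / 2 ^ m) \<omega>" for k m :: nat
    proof -
      have h: "0 \<le> t / 2 ^ m" "t / 2 ^ m \<le> t" using t by (auto simp: field_simps)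
      have [measurable]: "X (t / 2 ^ m) \<in> borel_measurable M" "X (real k * t / 2 ^ m + t / 2 ^ m) \<in> borel_measurable M" "X (real k * t / 2 ^ m) \<in> borel_measurable M"
        using t by (auto intro!: X_measurable)
      have "AE \<omega> in M. 0 \<le> X (t / 2 ^ m) \<omega>"
        using nn AE_space
      proof eventually_elim
        case (elim \<omega>)
        have "(INF u\<in>{0..t}. X u \<omega>) \<le> X (t / 2 ^ m) \<omega>"
          using h cadlag_bdd(1)[OF path[OF elim(2)]] by (intro cINF_lower) auto
        then show ?case using elim by simp
      qed
      then have "AE x in distr M borel (X (t / 2 ^ m)). 0 \<le> x"
        by (subst AE_distr_iff) auto
      moreover have "distr M borel (X (t / 2 ^ m)) = distr M borel (\<lambda>\<omega>. X (real k * t / 2 ^ m + t / 2 ^ m) \<omega> - X (real k * t / 2 ^ m) \<omega>)"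
        using t by (intro stationary[symmetric]) auto
      ultimately have "AE x in distr M borel (\<lambda>\<omega>. X (real k * t / 2 ^ m + t / 2 ^ m) \<omega> - X (real k * t / 2 ^ m) \<omega>). 0 \<le> x" by (simp only:)
      then have "AE \<omega> in M. 0 \<le> X (real k * t / 2 ^ m + t / 2 ^ m) \<omega> - X (real k * t / 2 ^ m) \<omega>"
        by (subst (asm) AE_distr_iff) auto
      moreover have "real k * t / 2 ^ m + t / 2 ^ m = real (Suc k) * t / 2 ^ m" by (simp add: field_simps)
      ultimately show ?thesis by simp
    qed
    have "AE \<omega> in M. \<forall>k m::nat. X (real k * t / 2 ^ m) \<omega> \<le> X (real (Suc k) * t / 2 ^ m) \<omega>"
      unfolding AE_all_countable using inc by blast
    then have "AE \<omega> in M. mono_on {0..} (\<lambda>t. X t \<omega>)"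
      using AE_space by eventually_elim (rule mono_on_of_dyadic[OF path t], auto)
    then show False using nsub levy by (simp add: subordinator_def)
  qed
  ultimately have "\<theta> = 1" using c by simp
  then have "prob {\<omega>\<in>space M. (INF u\<in>{0..t}. X u \<omega>) < 0} = 1" by (simp add: \<theta>_def emeasure_eq_measure)
  then show ?thesis by (subst (asm) prob_Collect_eq_1) auto
qed

end

section \<open>The joint laws under the Chapman-Kolmogorov equation\<close>

lemma AE_lborel_reflect:
  fixes x :: real
  assumes "AE y in lborel. P y"
  shows "AE y in lborel. P (x - y)"
proof -
  obtain N where N: "{y\<in>space lborel. \<not> P y} \<subseteq> N" "N \<in> null_sets lborel"
    using assms by (auto elim!: AE_E simp: null_sets_def)
  have [measurable]: "N \<in> sets borel" using N(2) by (auto simp: null_sets_def)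
  have "AE y in lborel. y \<notin> N" using N(2) by (rule AE_not_in)
  then have "AE y in lborel. x + (- 1) * y \<notin> N"
    by (intro AE_borel_affine) auto
  then show ?thesis by eventually_elim (use N(1) in auto)
qed

lemma nn_integral_reflect_interval:
  fixes f :: "real \<Rightarrow> ennreal"
  assumes [measurable]: "f \<in> borel_measurable borel"
  shows "(\<integral>\<^sup>+s. indicator {0<..<u} s * f (u - s) \<partial>lborel) = (\<integral>\<^sup>+s. indicator {0<..<u} s * f s \<partial>lborel)"
proof -
  have "(\<integral>\<^sup>+s. indicator {0<..<u} s * f s \<partial>lborel) = (\<integral>\<^sup>+s. indicator {0<..<u} (u - s) * f (u - s) \<partial>lborel)"
    using nn_integral_real_affine[of "\<lambda>s. indicator {0<..<u} s * f s" "-1" u] by simp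
  also have "\<dots> = (\<integral>\<^sup>+s. indicator {0<..<u} s * f (u - s) \<partial>lborel)"
    by (rule nn_integral_cong) (auto simp: indicator_def)
  finally show ?thesis by simp
qed

lemma nn_integral_shift_interval:
  fixes f :: "real \<Rightarrow> ennreal"
  assumes [measurable]: "f \<in> borel_measurable borel"
  shows "(\<integral>\<^sup>+u. indicator {s<..<t} u * f (u - s) \<partial>lborel) = (\<integral>\<^sup>+r. indicator {0<..<t - s} r * f r \<partial>lborel)"
proof -
  have "(\<integral>\<^sup>+r. indicator {0<..<t - s} r * f r \<partial>lborel) = (\<integral>\<^sup>+u. indicator {0<..<t - s} (u - s) * f (u - s) \<partial>lborel)"
    using nn_integral_real_affine[of "\<lambda>r. indicator {0<..<t - s} r * f r" 1 "- s"] by simp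
  also have "\<dots> = (\<integral>\<^sup>+u. indicator {s<..<t} u * f (u - s) \<partial>lborel)"
    by (rule nn_integral_cong) (auto simp: indicator_def)
  finally show ?thesis by simp
qed

lemma nn_integral_triangle:
  fixes f :: "real \<Rightarrow> real \<Rightarrow> ennreal"
  assumes [measurable]: "(\<lambda>x. f (fst x) (snd x)) \<in> borel_measurable (borel \<Otimes>\<^sub>M borel)"
  shows "(\<integral>\<^sup>+s. indicator {0<..<t} s * (\<integral>\<^sup>+u. indicator {s<..<t} u * f s u \<partial>lborel) \<partial>lborel) =
    (\<integral>\<^sup>+u. indicator {0<..<t} u * (\<integral>\<^sup>+s. indicator {0<..<u} s * f s u \<partial>lborel) \<partial>lborel)"
proof -
  define g where "g s u = (if 0 < s \<and> s < u \<and> u < t then f s u else 0)" for s u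
  have fm [measurable]: "(\<lambda>x. f (h x) (k x)) \<in> borel_measurable N"
    if [measurable]: "h \<in> borel_measurable N" "k \<in> borel_measurable N" for h k and N :: "'b measure"
    using measurable_compose[OF _ assms, of "\<lambda>x. (h x, k x)" N] by simp
  have fm2 [measurable]: "(\<lambda>x. f (fst x) (snd x)) \<in> borel_measurable (lborel \<Otimes>\<^sub>M lborel)"
    using measurable_compose[OF _ assms, of "\<lambda>x. x" "lborel \<Otimes>\<^sub>M lborel"] by simp
  have fs [measurable]: "(\<lambda>u. f s u) \<in> borel_measurable borel" "(\<lambda>s. f s u) \<in> borel_measurable borel" for s u
    using measurable_compose[OF _ assms, of "\<lambda>u. (s, u)" borel] measurable_compose[OF _ assms, of "\<lambda>s. (s, u)" borel] by auto
  have "(\<integral>\<^sup>+s. indicator {0<..<t} s * (\<integral>\<^sup>+u. indicator {s<..<t} u * f s u \<partial>lborel) \<partial>lborel) =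
    (\<integral>\<^sup>+s. \<integral>\<^sup>+u. g s u \<partial>lborel \<partial>lborel)"
  proof (rule nn_integral_cong)
    fix s
    have "indicator {0<..<t} s * (\<integral>\<^sup>+u. indicator {s<..<t} u * f s u \<partial>lborel) =
      (\<integral>\<^sup>+u. indicator {0<..<t} s * (indicator {s<..<t} u * f s u) \<partial>lborel)"
      by (rule nn_integral_cmult[symmetric]) measurable
    also have "\<dots> = (\<integral>\<^sup>+u. g s u \<partial>lborel)"
      by (rule nn_integral_cong) (auto simp: g_def indicator_def)
    finally show "indicator {0<..<t} s * (\<integral>\<^sup>+u. indicator {s<..<t} u * f s u \<partial>lborel) = (\<integral>\<^sup>+u. g s u \<partial>lborel)" .
  qed
  also have "\<dots> = (\<integral>\<^sup>+u. \<integral>\<^sup>+s. g s u \<partial>lborel \<partial>lborel)"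
  proof (rule lborel_pair.Fubini')
    have "(\<lambda>x. g (snd x) (fst x)) \<in> borel_measurable (lborel \<Otimes>\<^sub>M lborel)"
      unfolding g_def using measurable_compose[OF _ assms, of "\<lambda>x. (snd x, fst x)" "lborel \<Otimes>\<^sub>M lborel"] by simp
    then show "(\<lambda>(u, s). g s u) \<in> borel_measurable (lborel \<Otimes>\<^sub>M lborel)" by (simp add: case_prod_beta')
  qed
  also have "\<dots> = (\<integral>\<^sup>+u. indicator {0<..<t} u * (\<integral>\<^sup>+s. indicator {0<..<u} s * f s u \<partial>lborel) \<partial>lborel)"
  proof (rule nn_integral_cong)
    fix u
    have "indicator {0<..<t} u * (\<integral>\<^sup>+s. indicator {0<..<u} s * f s u \<partial>lborel) =
      (\<integral>\<^sup>+s. indicator {0<..<t} u * (indicator {0<..<u} s * f s u) \<partial>lborel)"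
      by (rule nn_integral_cmult[symmetric]) measurable
    also have "\<dots> = (\<integral>\<^sup>+s. g s u \<partial>lborel)"
      by (rule nn_integral_cong) (auto simp: g_def indicator_def)
    finally show "(\<integral>\<^sup>+s. g s u \<partial>lborel) = indicator {0<..<t} u * (\<integral>\<^sup>+s. indicator {0<..<u} s * f s u \<partial>lborel)" by simp
  qed
  finally show ?thesis .
qed

context spectrally_positive_levy
begin

text \<open>For each time almost every level is regular; Tonelli exchanges the two quantifiers,
  which is why \<open>regular\<close> has to be jointly measurable. The times
  \<open>u - 1 / (n + 1)\<close> approach \<open>u\<close> from below and are countably many, so
  they share one null set.\<close>

lemma AE_regular_before:
  "AE y in lborel. 0 < y \<longrightarrow> (AE u in lborel. \<forall>n. 1 / real (Suc n) < u \<longrightarrow> regular (u - 1 / real (Suc n)) y)"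
proof -
  define P where "P u y \<longleftrightarrow> 0 < y \<longrightarrow> (\<forall>n. 1 / real (Suc n) < u \<longrightarrow> regular (u - 1 / real (Suc n)) y)" for u y
  have "AE y in lborel. P u y" for u
  proof -
    have "AE y in lborel. 1 / real (Suc n) < u \<longrightarrow> 0 < y \<longrightarrow> regular (u - 1 / real (Suc n)) y" for n
      using AE_regular[of "u - 1 / real (Suc n)"] by (cases "1 / real (Suc n) < u") auto
    then have "AE y in lborel. \<forall>n. 1 / real (Suc n) < u \<longrightarrow> 0 < y \<longrightarrow> regular (u - 1 / real (Suc n)) y"
      unfolding AE_all_countable by blast
    then show ?thesis by eventually_elim (auto simp: P_def)
  qed
  then have "AE u in lborel. AE y in lborel. P u y" by simp
  then have "AE y in lborel. AE u in lborel. P u y"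
    by (subst (asm) lborel_pair.AE_commute) (unfold P_def, measurable)
  then show ?thesis
  proof eventually_elim
    case (elim y)
    show ?case
    proof
      assume "0 < y"
      with elim show "AE u in lborel. \<forall>n. 1 / real (Suc n) < u \<longrightarrow> regular (u - 1 / real (Suc n)) y" by (auto simp: P_def elim!: eventually_mono)
    qed
  qed
qed

lemma AE_regular_remaining:
  "AE y in lborel. 0 < y \<longrightarrow> (AE s in lborel. s < t \<longrightarrow> regular (t - s) y)"
proof -
  define P where "P s y \<longleftrightarrow> 0 < y \<longrightarrow> s < t \<longrightarrow> regular (t - s) y" for s y
  have "AE y in lborel. P s y" for s
    using AE_regular[of "t - s"] by (cases "s < t") (auto simp: P_def)
  then have "AE s in lborel. AE y in lborel. P s y" by simp
  then have "AE y in lborel. AE s in lborel. P s y"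
    by (subst (asm) lborel_pair.AE_commute) (unfold P_def, measurable)
  then show ?thesis
  proof eventually_elim
    case (elim y)
    show ?case
    proof
      assume "0 < y"
      with elim show "AE s in lborel. s < t \<longrightarrow> regular (t - s) y" by (auto simp: P_def elim!: eventually_mono)
    qed
  qed
qed

section \<open>An upper bound for the law of the infimum at every level\<close>

context
  assumes ck: "chapman_kolmogorov p"
begin

lemma q_chapman_kolmogorov:
  "0 < s \<Longrightarrow> 0 < t \<Longrightarrow> q (s + t) x = (\<integral>\<^sup>+y. q s y * q t (x - y) \<partial>lborel)"
proof -
  assume st: "0 < s" "0 < t"
  then have "p (s + t) x = (\<integral>\<^sup>+y. p s y * p t (x - y) \<partial>lborel)"
    using ck unfolding chapman_kolmogorov_def by blast
  then show ?thesis using st by (simp add: q_def)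
qed

lemma q_chapman_kolmogorov_shift:
  assumes "0 < s" "0 < t"
  shows "q (s + t) x = (\<integral>\<^sup>+z. q s (a + z) * q t (x - a - z) \<partial>lborel)"
  unfolding q_chapman_kolmogorov[OF assms]
proof -
  have [measurable]: "(\<lambda>y. q s y * q t (x - y)) \<in> borel_measurable borel" by measurable
  show "(\<integral>\<^sup>+y. q s y * q t (x - y) \<partial>lborel) = (\<integral>\<^sup>+z. q s (a + z) * q t (x - a - z) \<partial>lborel)"
    by (subst nn_integral_real_affine[where c = 1 and t = a]) (simp_all add: diff_diff_eq)
qed

text \<open>Decomposing at the first passage below \<open>-a\<close> on the way to \<open>-(a + b)\<close>.\<close>

lemma passage_density_le:
  assumes u: "0 < u" and reg: "\<And>n. 1 / real (Suc n) < u \<Longrightarrow> regular (u - 1 / real (Suc n)) a"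
  shows "(\<integral>\<^sup>+s. indicator {0<..<u} s * (ennreal (a / s) * q s (- a) * q (u - s) (- b)) \<partial>lborel) \<le> q u (- (a + b))"
proof -
  define f where "f s = ennreal (a / s) * q s (- a) * q (u - s) (- b)" for s
  have [measurable]: "f \<in> borel_measurable borel" unfolding f_def by measurable
  \<comment> \<open>A law does not determine a density at one point. Stopping at time
    \<open>u - e\<close> and averaging \<open>q e\<close> over the position reached there gives the
    value at the point \<open>- (a + b)\<close> exactly, and the formula for the law at the regular
    level \<open>a\<close> can be tested with this function.\<close>
  have le: "(\<integral>\<^sup>+s. indicator {0<..<u - 1 / real (Suc n)} s * f s \<partial>lborel) \<le> q u (- (a + b))" for n
  proof (cases "1 / real (Suc n) < u")
    case True
    define e where "e = 1 / real (Suc n)"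
    have e: "0 < e" "e < u" using True by (auto simp: e_def)
    have r: "0 < u - e" using e by simp
    have [measurable]: "X (u - e) \<in> borel_measurable M" using r by (intro X_measurable) simp
    have "(\<integral>\<^sup>+s. indicator {0<..<u - e} s * f s \<partial>lborel) =
      (\<integral>\<^sup>+s. indicator {0<..<u - e} s * (ennreal (a / s) * q s (- a) * (\<integral>\<^sup>+z. q (u - e - s) (a + z) * q e (- b - a - z) \<partial>lborel)) \<partial>lborel)"
    proof (rule nn_integral_cong)
      fix s
      show "indicator {0<..<u - e} s * f s =
        indicator {0<..<u - e} s * (ennreal (a / s) * q s (- a) * (\<integral>\<^sup>+z. q (u - e - s) (a + z) * q e (- b - a - z) \<partial>lborel))"
      proof (cases "s \<in> {0<..<u - e}")
        case True
        then have "0 < u - e - s" by simp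
        from q_chapman_kolmogorov_shift[OF this e(1), of "- b" a]
        have "q (u - s) (- b) = (\<integral>\<^sup>+z. q (u - e - s) (a + z) * q e (- b - a - z) \<partial>lborel)" by simp
        then show ?thesis by (simp only: f_def)
      qed simp
    qed
    also have "\<dots> = (\<integral>\<^sup>+z. low_density (u - e) a z * q e (- b - a - z) \<partial>lborel)"
      by (rule nn_integral_low_density[symmetric]) measurable
    also have "\<dots> = (\<integral>\<^sup>+\<omega>. (if (INF r\<in>{0..u - e}. X r \<omega>) < - a then q e (- b - a - X (u - e) \<omega>) else 0) \<partial>M)"
      using reg[OF True] r by (intro nn_integral_regular[symmetric]) (auto simp: e_def)
    also have "\<dots> \<le> (\<integral>\<^sup>+\<omega>. q e (- b - a - X (u - e) \<omega>) \<partial>M)"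
      by (intro nn_integral_mono) auto
    also have "\<dots> = (\<integral>\<^sup>+y. q (u - e) y * q e (- b - a - y) \<partial>lborel)"
      by (rule nn_integral_X[OF r]) measurable
    also have "\<dots> = q u (- (a + b))"
    proof -
      have "- (a + b) = - b - a" by simp
      then show ?thesis using q_chapman_kolmogorov[OF r e(1), of "- b - a"] by (simp only: diff_add_cancel)
    qed
    finally show ?thesis by (simp add: e_def)
  next
    case False
    then have "{0<..<u - 1 / real (Suc n)} = {}" by auto
    then show ?thesis by simp
  qed
  have "(\<lambda>n. \<integral>\<^sup>+s. indicator {0<..<u - 1 / real (Suc n)} s * f s \<partial>lborel) \<longlonglongrightarrow> (\<integral>\<^sup>+s. indicator {0<..<u} s * f s \<partial>lborel)"
  proof (rule nn_integral_LIMSEQ)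
    show "incseq (\<lambda>n s. indicator {0<..<u - 1 / real (Suc n)} s * f s)"
    proof (rule incseq_SucI, rule le_funI)
      fix n s
      have "1 / real (Suc (Suc n)) \<le> 1 / real (Suc n)" by (simp add: field_simps)
      then have "indicator {0<..<u - 1 / real (Suc n)} s \<le> (indicator {0<..<u - 1 / real (Suc (Suc n))} s :: ennreal)"
        by (intro indicator_leI) auto
      then show "indicator {0<..<u - 1 / real (Suc n)} s * f s \<le> indicator {0<..<u - 1 / real (Suc (Suc n))} s * f s"
        by (rule mult_right_mono) simp
    qed
    fix s
    show "(\<lambda>n. indicator {0<..<u - 1 / real (Suc n)} s * f s) \<longlonglongrightarrow> indicator {0<..<u} s * f s"
    proof (cases "s < u")
      case True
      have "\<forall>\<^sub>F n in sequentially. 1 / real (Suc n) < u - s"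
        using order_tendstoD(2)[OF LIMSEQ_inverse_real_of_nat, of "u - s"] True by (simp add: inverse_eq_divide)
      then have "\<forall>\<^sub>F n in sequentially. indicator {0<..<u} s * f s = indicator {0<..<u - 1 / real (Suc n)} s * f s"
        by eventually_elim (use True in \<open>auto simp: indicator_def\<close>)
      then show ?thesis by (rule Lim_transform_eventually[OF tendsto_const])
    next
      case False
      have "0 < 1 / real (Suc n)" for n by simp
      then have "s \<notin> {0<..<u - 1 / real (Suc n)}" for n
        using False by (smt (verit, best) greaterThanLessThan_iff)
      then show ?thesis using False by simp
    qed
  qed measurable
  from LIMSEQ_le_const2[OF this, of "q u (- (a + b))"] le show ?thesis unfolding f_def by blast
qed

text \<open>The reflection \<open>s\<close> to \<open>u - s\<close> exchanges the two legs, so the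
  factor of Kendall's density may stand on the second one.\<close>

lemma passage_density_le':
  assumes u: "0 < u" and reg: "\<And>n. 1 / real (Suc n) < u \<Longrightarrow> regular (u - 1 / real (Suc n)) b"
  shows "(\<integral>\<^sup>+s. indicator {0<..<u} s * (ennreal (b / (u - s)) * q s (- a) * q (u - s) (- b)) \<partial>lborel) \<le> q u (- (a + b))"
proof -
  have "(\<integral>\<^sup>+s. indicator {0<..<u} s * (ennreal (b / (u - s)) * q s (- a) * q (u - s) (- b)) \<partial>lborel) =
    (\<integral>\<^sup>+s. indicator {0<..<u} s * (ennreal (b / (u - s)) * q (u - s) (- b) * q (u - (u - s)) (- a)) \<partial>lborel)"
    by (rule nn_integral_cong) (simp add: mult_ac)
  also have "\<dots> = (\<integral>\<^sup>+s. indicator {0<..<u} s * (ennreal (b / s) * q s (- b) * q (u - s) (- a)) \<partial>lborel)"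
    by (rule nn_integral_reflect_interval) measurable
  also have "\<dots> \<le> q u (- (b + a))" by (rule passage_density_le[OF u reg])
  finally show ?thesis by (simp add: add.commute)
qed

text \<open>To pass \<open>-x\<close> the path passes \<open>-y\<close> at some time
  \<open>s\<close> and then falls by \<open>b = x - y\<close>, arriving at time \<open>u\<close>.
  The two passage densities contribute \<open>y / s * (b / (u - s))\<close>, which partial fractions
  turn into a combination of \<open>y / s\<close> and \<open>b / (u - s)\<close>. Each term is
  bounded by \<open>passage_density_le\<close> or its reflection, and the coefficients
  \<open>b / u\<close> and \<open>y / u\<close> add up to \<open>x / u\<close>, the factor for level
  \<open>x\<close>.\<close>

lemma low_prob_le_density:
  assumes t: "0 < t" and x: "0 < x" and B [measurable]: "B \<in> sets borel"
  shows "emeasure M {\<omega>\<in>space M. (INF u\<in>{0..t}. X u \<omega>) < - x \<and> X t \<omega> \<in> B} \<le> (\<integral>\<^sup>+z. low_density t x z * indicator B z \<partial>lborel)"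
proof -
  \<comment> \<open>Both parts of the split, \<open>y\<close> and \<open>x - y\<close>, have to
    avoid exceptional sets; reflection preserves null sets, so a common choice exists.\<close>
  obtain y where y: "0 < y" "y < x" and
    fp: "emeasure M {\<omega>\<in>space M. (INF u\<in>{0..t}. X u \<omega>) < - x \<and> (INF u\<in>{0..t}. X u \<omega>) < - y \<and> X t \<omega> \<in> B} =
       (\<integral>\<^sup>+s. indicator {0<..<t} s * (ennreal (y / s) * q s (- y) * low_prob (- x) B (t - s) (- y)) \<partial>lborel)" and
    r1: "AE s in lborel. s < t \<longrightarrow> regular (t - s) (x - y)" and
    r2: "AE u in lborel. \<forall>n. 1 / real (Suc n) < u \<longrightarrow> regular (u - 1 / real (Suc n)) y" and
    r3: "AE u in lborel. \<forall>n. 1 / real (Suc n) < u \<longrightarrow> regular (u - 1 / real (Suc n)) (x - y)"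
  proof -
    define P1 where "P1 y \<longleftrightarrow> (0 < y \<longrightarrow> emeasure M {\<omega>\<in>space M. (INF u\<in>{0..t}. X u \<omega>) < - x \<and> (INF u\<in>{0..t}. X u \<omega>) < - y \<and> X t \<omega> \<in> B} =
       (\<integral>\<^sup>+s. indicator {0<..<t} s * (ennreal (y / s) * q s (- y) * low_prob (- x) B (t - s) (- y)) \<partial>lborel))" for y
    define P2 where "P2 y \<longleftrightarrow> (0 < y \<longrightarrow> (AE s in lborel. s < t \<longrightarrow> regular (t - s) y))" for y
    define P3 where "P3 y \<longleftrightarrow> (0 < y \<longrightarrow> (AE u in lborel. \<forall>n. 1 / real (Suc n) < u \<longrightarrow> regular (u - 1 / real (Suc n)) y))" for y
    have "AE y in lborel. P1 y" unfolding P1_def by (rule first_passage_AE[OF t B])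
    moreover have "AE y in lborel. P2 (x - y)" unfolding P2_def by (rule AE_lborel_reflect[OF AE_regular_remaining])
    moreover have "AE y in lborel. P3 y" unfolding P3_def by (rule AE_regular_before)
    moreover have "AE y in lborel. P3 (x - y)" unfolding P3_def by (rule AE_lborel_reflect[OF AE_regular_before])
    ultimately have AE: "AE y in lborel. P1 y \<and> P2 (x - y) \<and> P3 y \<and> P3 (x - y)" by eventually_elim simp
    obtain y where y: "0 < y" "y < x" and P: "P1 y \<and> P2 (x - y) \<and> P3 y \<and> P3 (x - y)"
      by (rule ex_of_AE_lborel[OF AE x])
    have "0 < x - y" using y by simp
    then show ?thesis
      using P y by (intro that[of y]) (simp_all only: P1_def P2_def P3_def simp_thms)
  qed
  define b where "b = x - y"
  have b: "0 < b" "y + b = x" using y by (auto simp: b_def)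
  define F where "F z s u = ennreal (y / s) * q s (- y) * (ennreal (b / (u - s)) * q (u - s) (- b) * q (t - u) (x + z))" for z s u
  have [measurable]: "(\<lambda>x. F (f1 x) (f2 x) (f3 x)) \<in> borel_measurable N"
    if [measurable]: "f1 \<in> borel_measurable N" "f2 \<in> borel_measurable N" "f3 \<in> borel_measurable N" for f1 f2 f3 and N :: "'b measure"
    unfolding F_def by measurable
  have "emeasure M {\<omega>\<in>space M. (INF u\<in>{0..t}. X u \<omega>) < - x \<and> X t \<omega> \<in> B} =
    emeasure M {\<omega>\<in>space M. (INF u\<in>{0..t}. X u \<omega>) < - x \<and> (INF u\<in>{0..t}. X u \<omega>) < - y \<and> X t \<omega> \<in> B}"
    using y by (intro arg_cong[where f = "emeasure M"]) auto
  also have "\<dots> = (\<integral>\<^sup>+s. indicator {0<..<t} s * (ennreal (y / s) * q s (- y) * (\<integral>\<^sup>+z. indicator B z * low_density (t - s) b (z + y) \<partial>lborel)) \<partial>lborel)"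
    unfolding fp
  proof (rule nn_integral_cong_AE)
    show "AE s in lborel. indicator {0<..<t} s * (ennreal (y / s) * q s (- y) * low_prob (- x) B (t - s) (- y)) =
      indicator {0<..<t} s * (ennreal (y / s) * q s (- y) * (\<integral>\<^sup>+z. indicator B z * low_density (t - s) b (z + y) \<partial>lborel))"
      using r1
    proof eventually_elim
      case (elim s)
      show ?case
      proof (cases "s \<in> {0<..<t}")
        case True
        then have s: "0 < t - s" by simp
        have "low_prob (- x) B (t - s) (- y) = emeasure M {\<omega>\<in>space M. (INF u\<in>{0..t - s}. X u \<omega>) < - b \<and> X (t - s) \<omega> \<in> (\<lambda>z. z - y) -` B}"
          using s by (subst low_prob_eq) (auto simp: b_def intro!: arg_cong[where f = "emeasure M"])
        also have "\<dots> = (\<integral>\<^sup>+z. low_density (t - s) b z * indicator ((\<lambda>z. z - y) -` B) z \<partial>lborel)"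
          using elim True s by (intro regular_emeasure) (auto simp: b_def intro!: measurable_sets_borel[of _ borel])
        also have "\<dots> = (\<integral>\<^sup>+z. low_density (t - s) b z * indicator B (z - y) \<partial>lborel)"
          by (rule nn_integral_cong) (auto simp: indicator_def)
        also have "\<dots> = (\<integral>\<^sup>+z. indicator B z * low_density (t - s) b (z + y) \<partial>lborel)"
          using nn_integral_real_affine[of "\<lambda>z. low_density (t - s) b z * indicator B (z - y)" 1 y]
          by (simp add: add.commute mult.commute)
        finally show ?thesis by simp
      qed simp
    qed
  qed
  also have "\<dots> = (\<integral>\<^sup>+s. \<integral>\<^sup>+z. indicator B z * (indicator {0<..<t} s * (ennreal (y / s) * q s (- y) * low_density (t - s) b (z + y))) \<partial>lborel \<partial>lborel)"
  proof (rule nn_integral_cong)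
    fix s
    have "indicator {0<..<t} s * (ennreal (y / s) * q s (- y) * (\<integral>\<^sup>+z. indicator B z * low_density (t - s) b (z + y) \<partial>lborel)) =
      indicator {0<..<t} s * (ennreal (y / s) * q s (- y)) * (\<integral>\<^sup>+z. indicator B z * low_density (t - s) b (z + y) \<partial>lborel)"
      by (simp only: mult.assoc)
    also have "\<dots> = (\<integral>\<^sup>+z. indicator {0<..<t} s * (ennreal (y / s) * q s (- y)) * (indicator B z * low_density (t - s) b (z + y)) \<partial>lborel)"
      by (rule nn_integral_cmult[symmetric]) measurable
    finally show "indicator {0<..<t} s * (ennreal (y / s) * q s (- y) * (\<integral>\<^sup>+z. indicator B z * low_density (t - s) b (z + y) \<partial>lborel)) =
      (\<integral>\<^sup>+z. indicator B z * (indicator {0<..<t} s * (ennreal (y / s) * q s (- y) * low_density (t - s) b (z + y))) \<partial>lborel)"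
      by (simp only: mult_ac)
  qed
  also have "\<dots> = (\<integral>\<^sup>+z. \<integral>\<^sup>+s. indicator B z * (indicator {0<..<t} s * (ennreal (y / s) * q s (- y) * low_density (t - s) b (z + y))) \<partial>lborel \<partial>lborel)"
    by (rule lborel_pair.Fubini') measurable
  also have "\<dots> \<le> (\<integral>\<^sup>+z. low_density t x z * indicator B z \<partial>lborel)"
  proof (rule nn_integral_mono)
    fix z :: real
    have "(\<integral>\<^sup>+s. indicator {0<..<t} s * (ennreal (y / s) * q s (- y) * low_density (t - s) b (z + y)) \<partial>lborel) =
      (\<integral>\<^sup>+s. indicator {0<..<t} s * (\<integral>\<^sup>+u. indicator {s<..<t} u * F z s u \<partial>lborel) \<partial>lborel)"
    proof (rule nn_integral_cong)
      fix s
      have "low_density (t - s) b (z + y) = (\<integral>\<^sup>+r. indicator {0<..<t - s} r * (ennreal (b / r) * q r (- b) * q (t - s - r) (x + z)) \<partial>lborel)"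
      proof -
        have "b + (z + y) = x + z" using b by simp
        then show ?thesis unfolding low_density_def by (simp only:)
      qed
      also have "\<dots> = (\<integral>\<^sup>+u. indicator {s<..<t} u * (ennreal (b / (u - s)) * q (u - s) (- b) * q (t - s - (u - s)) (x + z)) \<partial>lborel)"
        by (rule nn_integral_shift_interval[symmetric]) measurable
      finally have "ennreal (y / s) * q s (- y) * low_density (t - s) b (z + y) =
        (\<integral>\<^sup>+u. ennreal (y / s) * q s (- y) * (indicator {s<..<t} u * (ennreal (b / (u - s)) * q (u - s) (- b) * q (t - u) (x + z))) \<partial>lborel)"
        by (subst nn_integral_cmult) auto
      also have "\<dots> = (\<integral>\<^sup>+u. indicator {s<..<t} u * F z s u \<partial>lborel)"
        unfolding F_def by (rule nn_integral_cong) (simp only: mult_ac)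
      finally show "indicator {0<..<t} s * (ennreal (y / s) * q s (- y) * low_density (t - s) b (z + y)) =
        indicator {0<..<t} s * (\<integral>\<^sup>+u. indicator {s<..<t} u * F z s u \<partial>lborel)" by simp
    qed
    also have "\<dots> = (\<integral>\<^sup>+u. indicator {0<..<t} u * (\<integral>\<^sup>+s. indicator {0<..<u} s * F z s u \<partial>lborel) \<partial>lborel)"
      by (rule nn_integral_triangle) (unfold F_def, measurable)
    also have "\<dots> \<le> (\<integral>\<^sup>+u. indicator {0<..<t} u * (ennreal (x / u) * q u (- x) * q (t - u) (x + z)) \<partial>lborel)"
    proof (rule nn_integral_mono_AE)
      show "AE u in lborel. indicator {0<..<t} u * (\<integral>\<^sup>+s. indicator {0<..<u} s * F z s u \<partial>lborel) \<le>
        indicator {0<..<t} u * (ennreal (x / u) * q u (- x) * q (t - u) (x + z))"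
        using r2 r3
      proof eventually_elim
        case (elim u)
        show ?case
        proof (cases "u \<in> {0<..<t}")
          case True
          then have u: "0 < u" by simp
          define A1 where "A1 s = indicator {0<..<u} s * (ennreal (y / s) * q s (- y) * q (u - s) (- b))" for s
          define A2 where "A2 s = indicator {0<..<u} s * (ennreal (b / (u - s)) * q s (- y) * q (u - s) (- b))" for s
          have [measurable]: "A1 \<in> borel_measurable borel" "A2 \<in> borel_measurable borel"
            unfolding A1_def A2_def by measurable
          have "(\<integral>\<^sup>+s. indicator {0<..<u} s * F z s u \<partial>lborel) =
            (\<integral>\<^sup>+s. q (t - u) (x + z) * (ennreal (b / u) * A1 s + ennreal (y / u) * A2 s) \<partial>lborel)"
          proof (rule nn_integral_cong)
            fix s
            show "indicator {0<..<u} s * F z s u = q (t - u) (x + z) * (ennreal (b / u) * A1 s + ennreal (y / u) * A2 s)"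
            proof (cases "s \<in> {0<..<u}")
              case True
              \<comment> \<open>The partial fraction
                \<open>1 / (s * (u - s)) = (1 / s + 1 / (u - s)) / u\<close>.\<close>
              have "y / s * (b / (u - s)) = b / u * (y / s) + y / u * (b / (u - s))"
                using True u by (simp add: divide_simps) (simp add: algebra_simps)
              then have "ennreal (y / s) * ennreal (b / (u - s)) = ennreal (b / u) * ennreal (y / s) + ennreal (y / u) * ennreal (b / (u - s))"
                using True u y b by (simp flip: ennreal_mult ennreal_plus)
              then have "q (t - u) (x + z) * q s (- y) * q (u - s) (- b) * (ennreal (y / s) * ennreal (b / (u - s))) =
                 q (t - u) (x + z) * q s (- y) * q (u - s) (- b) * (ennreal (b / u) * ennreal (y / s) + ennreal (y / u) * ennreal (b / (u - s)))"
                by simp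
              then show ?thesis using True by (simp add: F_def A1_def A2_def distrib_left mult_ac)
            qed (simp add: A1_def A2_def)
          qed
          also have "\<dots> = q (t - u) (x + z) * (ennreal (b / u) * (\<integral>\<^sup>+s. A1 s \<partial>lborel) + ennreal (y / u) * (\<integral>\<^sup>+s. A2 s \<partial>lborel))"
            by (simp add: nn_integral_cmult nn_integral_add)
          also have "\<dots> \<le> q (t - u) (x + z) * (ennreal (b / u) * q u (- x) + ennreal (y / u) * q u (- x))"
          proof (intro mult_left_mono add_mono)
            show "(\<integral>\<^sup>+s. A1 s \<partial>lborel) \<le> q u (- x)"
              using passage_density_le[OF u, of y b] elim(1) b unfolding A1_def by simp
            show "(\<integral>\<^sup>+s. A2 s \<partial>lborel) \<le> q u (- x)"
              using passage_density_le'[OF u, of b y] elim(2) b unfolding A2_def b_def by simp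
          qed auto
          also have "ennreal (b / u) * q u (- x) + ennreal (y / u) * q u (- x) = ennreal (x / u) * q u (- x)"
          proof -
            have "ennreal (x / u) = ennreal (b / u) + ennreal (y / u)"
              using b y u by (simp add: add_divide_distrib[symmetric] add.commute flip: ennreal_plus)
            then show ?thesis by (simp add: distrib_right)
          qed
          finally show ?thesis using True by (simp add: mult_ac)
        qed simp
      qed
    qed
    finally have le: "(\<integral>\<^sup>+s. indicator {0<..<t} s * (ennreal (y / s) * q s (- y) * low_density (t - s) b (z + y)) \<partial>lborel)
      \<le> low_density t x z"
      unfolding low_density_def .
    have "(\<integral>\<^sup>+s. indicator B z * (indicator {0<..<t} s * (ennreal (y / s) * q s (- y) * low_density (t - s) b (z + y))) \<partial>lborel) =
      indicator B z * (\<integral>\<^sup>+s. indicator {0<..<t} s * (ennreal (y / s) * q s (- y) * low_density (t - s) b (z + y)) \<partial>lborel)"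
      by (rule nn_integral_cmult) measurable
    also have "\<dots> \<le> indicator B z * low_density t x z" by (rule mult_left_mono[OF le]) simp
    finally show "(\<integral>\<^sup>+s. indicator B z * (indicator {0<..<t} s * (ennreal (y / s) * q s (- y) * low_density (t - s) b (z + y))) \<partial>lborel)
      \<le> low_density t x z * indicator B z" by (simp only: mult.commute)
  qed
  finally show ?thesis .
qed

end

end

section \<open>Equality at every level, for the infimum and for the supremum\<close>

lemma indicator_shrinking_LIMSEQ:
  fixes a :: real
  assumes "0 < t"
  shows "(\<lambda>n. indicator {0<..<a - t / 2 ^ Suc n} s) \<longlonglongrightarrow> (indicator {0<..<a} s :: ennreal)"
proof (cases "s < a")
  case True
  have "(\<lambda>n. t / 2 ^ Suc n) \<longlonglongrightarrow> 0"
    by (rule LIMSEQ_Suc) (rule LIMSEQ_divide_realpow_zero, simp)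
  then have "\<forall>\<^sub>F n in sequentially. t / 2 ^ Suc n < a - s" using True by (intro order_tendstoD) auto
  then have "\<forall>\<^sub>F n in sequentially. indicator {0<..<a} s = (indicator {0<..<a - t / 2 ^ Suc n} s :: ennreal)"
    by eventually_elim (use True in \<open>auto simp: indicator_def\<close>)
  then show ?thesis by (rule Lim_transform_eventually[OF tendsto_const])
next
  case False
  have "s \<notin> {0<..<a - t / 2 ^ Suc n}" for n
  proof -
    have "0 < t / 2 ^ Suc n" using assms by simp
    then show ?thesis using False by (auto simp del: power_Suc)
  qed
  then show ?thesis using False by simp
qed

lemma indicator_shrinking_mono:
  fixes a :: real
  assumes "0 < t"
  shows "indicator {0<..<a - t / 2 ^ Suc n} s \<le> (indicator {0<..<a - t / 2 ^ Suc (Suc n)} s :: ennreal)"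
proof -
  have "t / 2 ^ Suc (Suc n) \<le> t / 2 ^ Suc n" using assms by (simp add: field_simps)
  then show ?thesis by (intro indicator_leI) auto
qed

context levy
begin

lemma nn_integral_markov_SUP:
  assumes s: "0 \<le> s" and r: "0 \<le> r"
    and [measurable]: "f \<in> borel_measurable (borel \<Otimes>\<^sub>M (borel \<Otimes>\<^sub>M borel))"
  shows "(\<integral>\<^sup>+\<omega>. f (X s \<omega>, (SUP u\<in>{0..r}. X (s + u) \<omega> - X s \<omega>, X (s + r) \<omega> - X s \<omega>)) \<partial>M) =
    (\<integral>\<^sup>+\<omega>. \<integral>\<^sup>+\<omega>'. f (X s \<omega>, (SUP u\<in>{0..r}. X u \<omega>', X r \<omega>')) \<partial>M \<partial>M)"
proof -
  interpret N: levy M "\<lambda>t \<omega>. - X t \<omega>" by (rule uminus)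
  note [measurable] = X_measurable[OF s] X_measurable[OF r] SUP_measurable[OF r]
  have [measurable]: "X (s + r) \<in> borel_measurable M" using s r by (intro X_measurable) auto
  define g where "g = (\<lambda>(y, i, e). f (- y, (- i, - e)))"
  have gm: "g \<in> borel_measurable (borel \<Otimes>\<^sub>M (borel \<Otimes>\<^sub>M borel))" unfolding g_def by measurable
  have "- (X (s + u) \<omega> - X s \<omega>) = - X (s + u) \<omega> - - X s \<omega>" for u \<omega> by simp
  then have e: "(SUP u\<in>{0..r}. X (s + u) \<omega> - X s \<omega>) = - (INF u\<in>{0..r}. - X (s + u) \<omega> - - X s \<omega>)" for \<omega>
    using INF_uminus_real[of "\<lambda>u. X (s + u) \<omega> - X s \<omega>" "{0..r}"] by simp
  show ?thesis
    using N.nn_integral_markov_INF[OF s r gm] by (simp add: g_def INF_uminus_real e)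
qed

end

context spectrally_positive_levy
begin

lemma nn_integral_SUP_reversal:
  assumes t: "0 \<le> t" and [measurable]: "f \<in> borel_measurable (borel \<Otimes>\<^sub>M borel)"
  shows "(\<integral>\<^sup>+\<omega>. f (SUP u\<in>{0..t}. X u \<omega>, X t \<omega>) \<partial>M) = (\<integral>\<^sup>+\<omega>. f (X t \<omega> - (INF u\<in>{0..t}. X u \<omega>), X t \<omega>) \<partial>M)"
proof -
  note [measurable] = X_measurable[OF t] INF_measurable[OF t] SUP_measurable[OF t]
  have "(\<integral>\<^sup>+\<omega>. f (SUP u\<in>{0..t}. X u \<omega>, X t \<omega>) \<partial>M) =
    (\<integral>\<^sup>+x. f x \<partial>distr M (borel \<Otimes>\<^sub>M borel) (\<lambda>\<omega>. (SUP u\<in>{0..t}. X u \<omega>, X t \<omega>)))"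
    by (rule nn_integral_distr[symmetric]) measurable
  also have "\<dots> = (\<integral>\<^sup>+\<omega>. f (X t \<omega> - (INF u\<in>{0..t}. X u \<omega>), X t \<omega>) \<partial>M)"
    unfolding time_reversal[OF t] by (rule nn_integral_distr) measurable
  finally show ?thesis .
qed

lemma regular'_SUP:
  assumes reg: "regular' t x" and t: "0 < t" and B [measurable]: "B \<in> sets borel" and Bx: "B \<subseteq> {..<x}"
  shows "(\<integral>\<^sup>+\<omega>. (if (SUP u\<in>{0..t}. X u \<omega>) > x \<and> X t \<omega> \<in> B then 1 else 0) \<partial>M) =
    (\<integral>\<^sup>+z. indicator B z * low_density t (x - z) z \<partial>lborel)"
proof -
  define f where "f = (\<lambda>(m, e). if m > x \<and> e \<in> B then 1 else (0::ennreal))"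
  have fm: "f \<in> borel_measurable (borel \<Otimes>\<^sub>M borel)" unfolding f_def by measurable
  have "(\<integral>\<^sup>+\<omega>. (if (SUP u\<in>{0..t}. X u \<omega>) > x \<and> X t \<omega> \<in> B then 1 else 0) \<partial>M) =
    (\<integral>\<^sup>+\<omega>. (if X t \<omega> - (INF u\<in>{0..t}. X u \<omega>) > x \<and> X t \<omega> \<in> B then 1 else 0) \<partial>M)"
    using nn_integral_SUP_reversal[OF _ fm, of t] t unfolding f_def by simp
  also have "\<dots> = (\<integral>\<^sup>+\<omega>. (if X t \<omega> - (INF u\<in>{0..t}. X u \<omega>) > x \<and> X t \<omega> < x then indicator B (X t \<omega>) else 0) \<partial>M)"
    using Bx by (intro nn_integral_cong) (auto simp: indicator_def)
  also have "\<dots> = (\<integral>\<^sup>+z. (if z < x then low_density t (x - z) z * indicator B z else 0) \<partial>lborel)"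
    using reg unfolding regular'_def by auto
  also have "\<dots> = (\<integral>\<^sup>+z. indicator B z * low_density t (x - z) z \<partial>lborel)"
    using Bx by (intro nn_integral_cong) (auto simp: indicator_def)
  finally show ?thesis .
qed

context
  assumes ck: "chapman_kolmogorov p"
begin

text \<open>A first fall by \<open>\<delta>\<close> completed before time \<open>\<eta>\<close> is
  followed by a fall by \<open>x\<close>. The convolution of the passage density for
  \<open>\<delta>\<close> with \<open>q\<close> at \<open>-x\<close> is at most \<open>q\<close> at
  \<open>- (x + \<delta>)\<close>. Since \<open>x + \<delta>\<close> is regular, the result
  integrates to a probability that level \<open>- (x + \<delta>)\<close> is passed, and passing it
  entails passing \<open>-x\<close>.\<close>

lemma mass_bound:
  assumes \<eta>: "0 < \<eta>" "\<eta> < t" and x: "0 < x" and \<delta>: "0 < \<delta>"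
    and r1: "regular t (x + \<delta>)" and r2: "regular \<eta> \<delta>"
    and r3: "AE u in lborel. \<forall>n. 1 / real (Suc n) < u \<longrightarrow> regular (u - 1 / real (Suc n)) \<delta>"
  shows "emeasure M {\<omega>\<in>space M. (INF u\<in>{0..\<eta>}. X u \<omega>) < - \<delta>} *
     (\<integral>\<^sup>+r. indicator {0<..<t - \<eta>} r * (ennreal (x / (r + \<eta>)) * q r (- x)) \<partial>lborel) \<le>
     emeasure M {\<omega>\<in>space M. (INF u\<in>{0..t}. X u \<omega>) < - x}"
proof -
  have t: "0 < t" using \<eta> by simp
  have [measurable]: "(\<lambda>\<omega>. INF u\<in>{0..t}. X u \<omega>) \<in> borel_measurable M" using t by (auto intro!: INF_measurable)
  define K where "K = (\<integral>\<^sup>+r. indicator {0<..<t - \<eta>} r * (ennreal (x / (r + \<eta>)) * q r (- x)) \<partial>lborel)"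
  define G where "G s u = ennreal ((x + \<delta>) / u) * q (u - s) (- x)" for s u
  have [measurable]: "(\<lambda>x. G (f1 x) (f2 x)) \<in> borel_measurable N"
    if [measurable]: "f1 \<in> borel_measurable N" "f2 \<in> borel_measurable N" for f1 f2 and N :: "'b measure"
    unfolding G_def by measurable
  define F where "F s u = ennreal (\<delta> / s) * q s (- \<delta>) * G s u" for s u
  have "emeasure M {\<omega>\<in>space M. (INF u\<in>{0..\<eta>}. X u \<omega>) < - \<delta>} = (\<integral>\<^sup>+z. low_density \<eta> \<delta> z \<partial>lborel)"
    using regular_emeasure[OF r2 \<eta>(1), of UNIV] by simp
  also have "\<dots> = (\<integral>\<^sup>+s. indicator {0<..<\<eta>} s * (ennreal (\<delta> / s) * q s (- \<delta>)) \<partial>lborel)"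
    by (rule nn_integral_low_density_UNIV)
  finally have "emeasure M {\<omega>\<in>space M. (INF u\<in>{0..\<eta>}. X u \<omega>) < - \<delta>} * K =
    (\<integral>\<^sup>+s. indicator {0<..<\<eta>} s * (ennreal (\<delta> / s) * q s (- \<delta>)) * K \<partial>lborel)"
    by (simp add: nn_integral_multc)
  also have "\<dots> \<le> (\<integral>\<^sup>+s. indicator {0<..<t} s * (\<integral>\<^sup>+u. indicator {s<..<t} u * F s u \<partial>lborel) \<partial>lborel)"
  proof (rule nn_integral_mono)
    fix s
    show "indicator {0<..<\<eta>} s * (ennreal (\<delta> / s) * q s (- \<delta>)) * K \<le>
      indicator {0<..<t} s * (\<integral>\<^sup>+u. indicator {s<..<t} u * F s u \<partial>lborel)"
    proof (cases "s \<in> {0<..<\<eta>}")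
      case True
      \<comment> \<open>The final time is \<open>u = r + s\<close> with \<open>s < \<eta>\<close>,
        so the weight \<open>x / (r + \<eta>)\<close> stays below \<open>(x + \<delta>) / u\<close>,
        and \<open>r < t - \<eta>\<close> keeps \<open>u\<close> below \<open>t\<close>.\<close>
      have "K \<le> (\<integral>\<^sup>+r. indicator {0<..<t - s} r * G s (r + s) \<partial>lborel)"
        unfolding K_def
      proof (rule nn_integral_mono)
        fix r
        have "x / (r + \<eta>) \<le> (x + \<delta>) / (r + s)" if "0 < r"
          using that True x \<delta> by (intro frac_le) auto
        then show "indicator {0<..<t - \<eta>} r * (ennreal (x / (r + \<eta>)) * q r (- x)) \<le> indicator {0<..<t - s} r * G s (r + s)"
          using True unfolding G_def by (auto simp: indicator_def intro!: mult_right_mono ennreal_leI)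
      qed
      also have "\<dots> = (\<integral>\<^sup>+u. indicator {s<..<t} u * G s (u - s + s) \<partial>lborel)"
        by (rule nn_integral_shift_interval[symmetric]) measurable
      finally have "ennreal (\<delta> / s) * q s (- \<delta>) * K \<le> ennreal (\<delta> / s) * q s (- \<delta>) * (\<integral>\<^sup>+u. indicator {s<..<t} u * G s u \<partial>lborel)"
        by (intro mult_left_mono) simp_all
      also have "\<dots> = (\<integral>\<^sup>+u. ennreal (\<delta> / s) * q s (- \<delta>) * (indicator {s<..<t} u * G s u) \<partial>lborel)"
        by (rule nn_integral_cmult[symmetric]) measurable
      also have "\<dots> = (\<integral>\<^sup>+u. indicator {s<..<t} u * F s u \<partial>lborel)"
        unfolding F_def by (rule nn_integral_cong) (simp only: mult_ac)
      finally show ?thesis using True \<eta> by simp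
    qed simp
  qed
  also have "\<dots> = (\<integral>\<^sup>+u. indicator {0<..<t} u * (\<integral>\<^sup>+s. indicator {0<..<u} s * F s u \<partial>lborel) \<partial>lborel)"
    by (rule nn_integral_triangle) (unfold F_def, measurable)
  also have "\<dots> \<le> (\<integral>\<^sup>+u. indicator {0<..<t} u * (ennreal ((x + \<delta>) / u) * q u (- (x + \<delta>))) \<partial>lborel)"
  proof (rule nn_integral_mono_AE)
    show "AE u in lborel. indicator {0<..<t} u * (\<integral>\<^sup>+s. indicator {0<..<u} s * F s u \<partial>lborel) \<le>
       indicator {0<..<t} u * (ennreal ((x + \<delta>) / u) * q u (- (x + \<delta>)))"
      using r3
    proof eventually_elim
      case (elim u)
      show ?case
      proof (cases "u \<in> {0<..<t}")
        case True
        then have u: "0 < u" by simp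
        have "(\<integral>\<^sup>+s. indicator {0<..<u} s * F s u \<partial>lborel) =
          (\<integral>\<^sup>+s. ennreal ((x + \<delta>) / u) * (indicator {0<..<u} s * (ennreal (\<delta> / s) * q s (- \<delta>) * q (u - s) (- x))) \<partial>lborel)"
          unfolding F_def G_def by (rule nn_integral_cong) (simp only: mult_ac)
        also have "\<dots> = ennreal ((x + \<delta>) / u) * (\<integral>\<^sup>+s. indicator {0<..<u} s * (ennreal (\<delta> / s) * q s (- \<delta>) * q (u - s) (- x)) \<partial>lborel)"
          by (rule nn_integral_cmult) measurable
        also have "\<dots> \<le> ennreal ((x + \<delta>) / u) * q u (- (\<delta> + x))"
          by (intro mult_left_mono passage_density_le[OF ck u]) (use elim in auto)
        finally show ?thesis using True by (simp add: add.commute)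
      qed simp
    qed
  qed
  also have "\<dots> = (\<integral>\<^sup>+z. low_density t (x + \<delta>) z \<partial>lborel)"
    by (rule nn_integral_low_density_UNIV[symmetric])
  also have "\<dots> = emeasure M {\<omega>\<in>space M. (INF u\<in>{0..t}. X u \<omega>) < - (x + \<delta>)}"
    using regular_emeasure[OF r1 t, of UNIV] by simp
  also have "\<dots> \<le> emeasure M {\<omega>\<in>space M. (INF u\<in>{0..t}. X u \<omega>) < - x}"
    using \<delta> by (intro emeasure_mono) auto
  finally show ?thesis unfolding K_def .
qed

text \<open>In \<open>mass_bound\<close> let \<open>\<delta>\<close> tend to 0: the first factor
  becomes the probability of having been negative before \<open>\<eta>\<close>, which is 1 as
  \<open>X\<close> is not a subordinator. Then let \<open>\<eta>\<close> tend to 0; the weights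
  \<open>x / (r + \<eta>)\<close> increase to \<open>x / r\<close>.\<close>

lemma low_density_mass_le:
  assumes nsub: "\<not> subordinator M X" and t: "0 < t" and x: "0 < x"
  shows "(\<integral>\<^sup>+z. low_density t x z \<partial>lborel) \<le> emeasure M {\<omega>\<in>space M. (INF u\<in>{0..t}. X u \<omega>) < - x}"
proof -
  define P where "P = emeasure M {\<omega>\<in>space M. (INF u\<in>{0..t}. X u \<omega>) < - x}"
  define K where "K \<eta> = (\<integral>\<^sup>+r. indicator {0<..<t - \<eta>} r * (ennreal (x / (r + \<eta>)) * q r (- x)) \<partial>lborel)" for \<eta>
  have K: "K \<eta> \<le> P" if \<eta>: "0 < \<eta>" "\<eta> < t" for \<eta>
  proof -
    have [measurable]: "(\<lambda>\<omega>. INF u\<in>{0..\<eta>}. X u \<omega>) \<in> borel_measurable M" using \<eta> by (auto intro!: INF_measurable)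
    have le: "emeasure M {\<omega>\<in>space M. (INF u\<in>{0..\<eta>}. X u \<omega>) < - (1 / real (Suc n))} * K \<eta> \<le> P" for n
    proof -
      have "AE \<delta> in lborel. 0 < x + \<delta> \<longrightarrow> regular t (x + \<delta>)"
      proof -
        have "AE y in lborel. (\<lambda>y. 0 < y \<longrightarrow> regular t y) (x + 1 * y)"
          using AE_regular[OF t] by (intro AE_borel_affine) auto
        then show ?thesis by simp
      qed
      then have AE: "AE \<delta> in lborel. (0 < x + \<delta> \<longrightarrow> regular t (x + \<delta>)) \<and> (0 < \<delta> \<longrightarrow> regular \<eta> \<delta>) \<and>
         (0 < \<delta> \<longrightarrow> (AE u in lborel. \<forall>n. 1 / real (Suc n) < u \<longrightarrow> regular (u - 1 / real (Suc n)) \<delta>))"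
        using AE_regular[OF \<eta>(1)] AE_regular_before by eventually_elim blast
      obtain \<delta> where \<delta>: "0 < \<delta>" "\<delta> < 1 / real (Suc n)" and r: "(0 < x + \<delta> \<longrightarrow> regular t (x + \<delta>)) \<and> (0 < \<delta> \<longrightarrow> regular \<eta> \<delta>) \<and>
         (0 < \<delta> \<longrightarrow> (AE u in lborel. \<forall>n. 1 / real (Suc n) < u \<longrightarrow> regular (u - 1 / real (Suc n)) \<delta>))"
        by (rule ex_of_AE_lborel[OF AE, of "1 / real (Suc n)"]) auto
      have "emeasure M {\<omega>\<in>space M. (INF u\<in>{0..\<eta>}. X u \<omega>) < - (1 / real (Suc n))} * K \<eta> \<le>
        emeasure M {\<omega>\<in>space M. (INF u\<in>{0..\<eta>}. X u \<omega>) < - \<delta>} * K \<eta>"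
        using \<delta> by (intro mult_right_mono emeasure_mono) auto
      also have "\<dots> \<le> P"
        unfolding K_def P_def using r \<delta> x by (intro mass_bound[OF \<eta> x \<delta>(1)]) auto
      finally show ?thesis .
    qed
    have "1 = emeasure M {\<omega>\<in>space M. (INF u\<in>{0..\<eta>}. X u \<omega>) < 0}"
      using AE_INF_neg[OF nsub \<eta>(1)] by (intro emeasure_eq_1_AE[symmetric]) auto
    also have "\<dots> = (SUP n. emeasure M {\<omega>\<in>space M. (INF u\<in>{0..\<eta>}. X u \<omega>) < - (1 / real (Suc n))})"
      by (rule emeasure_INF_neg[OF \<eta>(1)])
    finally have "K \<eta> = (SUP n. emeasure M {\<omega>\<in>space M. (INF u\<in>{0..\<eta>}. X u \<omega>) < - (1 / real (Suc n))}) * K \<eta>"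
      by simp
    also have "\<dots> = (SUP n. emeasure M {\<omega>\<in>space M. (INF u\<in>{0..\<eta>}. X u \<omega>) < - (1 / real (Suc n))} * K \<eta>)"
      by (rule SUP_mult_right_ennreal)
    also have "\<dots> \<le> P" by (intro SUP_least le)
    finally show ?thesis .
  qed
  have "(\<lambda>n. K (t / 2 ^ Suc n)) \<longlonglongrightarrow> (\<integral>\<^sup>+r. indicator {0<..<t} r * (ennreal (x / r) * q r (- x)) \<partial>lborel)"
    unfolding K_def
  proof (rule nn_integral_LIMSEQ)
    show "incseq (\<lambda>n r. indicator {0<..<t - t / 2 ^ Suc n} r * (ennreal (x / (r + t / 2 ^ Suc n)) * q r (- x)))"
    proof (rule incseq_SucI, rule le_funI)
      fix n r
      have pos: "0 < t / 2 ^ Suc (Suc n)" "t / 2 ^ Suc (Suc n) \<le> t / 2 ^ Suc n" using t by (auto simp: field_simps)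
      show "indicator {0<..<t - t / 2 ^ Suc n} r * (ennreal (x / (r + t / 2 ^ Suc n)) * q r (- x)) \<le>
        indicator {0<..<t - t / 2 ^ Suc (Suc n)} r * (ennreal (x / (r + t / 2 ^ Suc (Suc n))) * q r (- x))"
      proof (cases "0 < r")
        case True
        have "x / (r + t / 2 ^ Suc n) \<le> x / (r + t / 2 ^ Suc (Suc n))"
          by (rule frac_le) (use True x pos in linarith)+
        then show ?thesis
          by (intro mult_mono indicator_shrinking_mono[OF t] ennreal_leI) auto
      qed simp
    qed
    fix r
    show "(\<lambda>n. indicator {0<..<t - t / 2 ^ Suc n} r * (ennreal (x / (r + t / 2 ^ Suc n)) * q r (- x)))
      \<longlonglongrightarrow> indicator {0<..<t} r * (ennreal (x / r) * q r (- x))"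
    proof (cases "r \<in> {0<..<t}")
      case True
      have "(\<lambda>n. t / 2 ^ Suc n) \<longlonglongrightarrow> 0"
        by (rule LIMSEQ_Suc) (rule LIMSEQ_divide_realpow_zero, simp)
      then have "(\<lambda>n. x / (r + t / 2 ^ Suc n)) \<longlonglongrightarrow> x / (r + 0)"
        using True by (intro tendsto_divide tendsto_add tendsto_const) auto
      then have 1: "(\<lambda>n. ennreal (x / (r + t / 2 ^ Suc n))) \<longlonglongrightarrow> ennreal (x / r)"
        by (intro tendsto_ennrealI) simp
      have "(\<lambda>n. indicator {0<..<t - t / 2 ^ Suc n} r * ennreal (x / (r + t / 2 ^ Suc n)))
         \<longlonglongrightarrow> indicator {0<..<t} r * ennreal (x / r)"
        by (rule tendsto_mult_ennreal[OF indicator_shrinking_LIMSEQ[OF t] 1]) (auto simp: indicator_def)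
      then have "(\<lambda>n. indicator {0<..<t - t / 2 ^ Suc n} r * ennreal (x / (r + t / 2 ^ Suc n)) * q r (- x))
         \<longlonglongrightarrow> indicator {0<..<t} r * ennreal (x / r) * q r (- x)"
        by (rule tendsto_mult_ennreal[OF _ tendsto_const]) (use True x in \<open>auto simp: indicator_def\<close>)
      then show ?thesis by (simp only: mult.assoc)
    next
      case False
      have "r \<notin> {0<..<t - t / 2 ^ Suc n}" for n
      proof -
        have "0 < t / 2 ^ Suc n" using t by simp
        then show ?thesis using False by (auto simp del: power_Suc)
      qed
      then show ?thesis using False by simp
    qed
  qed measurable
  moreover have "K (t / 2 ^ Suc n) \<le> P" for n
  proof (rule K)
    have "1 < (2::real) ^ Suc n" by (rule one_less_power) auto
    then show "t / 2 ^ Suc n < t" using t by (simp add: pos_divide_less_eq del: power_Suc)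
  qed (use t in simp)
  ultimately have "(\<integral>\<^sup>+r. indicator {0<..<t} r * (ennreal (x / r) * q r (- x)) \<partial>lborel) \<le> P"
    by (intro LIMSEQ_le_const2) auto
  then show ?thesis unfolding nn_integral_low_density_UNIV P_def .
qed

text \<open>Two measures, one below the other and of at least the same finite mass, coincide.\<close>

theorem emeasure_INF_chapman_kolmogorov:
  assumes nsub: "\<not> subordinator M X" and t: "0 < t" and x: "0 < x" and B [measurable]: "B \<in> sets borel"
  shows "emeasure M {\<omega>\<in>space M. (INF u\<in>{0..t}. X u \<omega>) < - x \<and> X t \<omega> \<in> B} = (\<integral>\<^sup>+z. low_density t x z * indicator B z \<partial>lborel)"
proof (rule antisym)
  have [measurable]: "X t \<in> borel_measurable M" "(\<lambda>\<omega>. INF u\<in>{0..t}. X u \<omega>) \<in> borel_measurable M"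
    using t by (auto intro!: X_measurable INF_measurable)
  define a where "a B = emeasure M {\<omega>\<in>space M. (INF u\<in>{0..t}. X u \<omega>) < - x \<and> X t \<omega> \<in> B}" for B
  define d where "d B = (\<integral>\<^sup>+z. low_density t x z * indicator B z \<partial>lborel)" for B
  have le: "a B \<le> d B" if "B \<in> sets borel" for B
    unfolding a_def d_def by (rule low_prob_le_density[OF ck t x that])
  show "a B \<le> d B" by (rule le[OF B])
  have "d B + d (- B) = (\<integral>\<^sup>+z. low_density t x z * indicator B z + low_density t x z * indicator (- B) z \<partial>lborel)"
    unfolding d_def by (rule nn_integral_add[symmetric]) measurable
  also have "\<dots> = (\<integral>\<^sup>+z. low_density t x z \<partial>lborel)" by (rule nn_integral_cong) (auto simp: indicator_def)
  also have "\<dots> \<le> emeasure M {\<omega>\<in>space M. (INF u\<in>{0..t}. X u \<omega>) < - x}"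
    by (rule low_density_mass_le[OF nsub t x])
  also have "\<dots> = a B + a (- B)"
    unfolding a_def by (subst plus_emeasure) (auto intro!: arg_cong[where f = "emeasure M"])
  also have "\<dots> \<le> a B + d (- B)" by (intro add_left_mono le) simp
  finally have *: "d B + d (- B) \<le> a B + d (- B)" .
  have "d (- B) \<le> (\<integral>\<^sup>+z. low_density t x z \<partial>lborel)"
    unfolding d_def by (rule nn_integral_mono) (auto simp: indicator_def)
  also have "\<dots> \<le> 1" using low_density_mass_le[OF nsub t x] emeasure_le_1 by (rule order_trans)
  finally have "d (- B) \<noteq> \<infinity>" by (auto simp: top_unique)
  then show "d B \<le> a B" using * by (simp add: ennreal_add_left_cancel_le add.commute[of _ "d (- B)"])
qed

text \<open>After a short time \<open>e\<close> the remaining level is \<open>x - X e\<close>. It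
  has a density, hence almost surely satisfies the formula even if \<open>x\<close> itself is
  exceptional, and the Chapman-Kolmogorov equation absorbs the initial run. As \<open>e\<close>
  decreases to 0, the maximum over \<open>[e, t]\<close> recovers the one over
  \<open>[0, t]\<close>.\<close>

theorem emeasure_SUP_chapman_kolmogorov:
  assumes t: "0 < t" and x: "0 \<le> x" and B [measurable]: "B \<in> sets borel" and Bx: "B \<subseteq> {..<x}"
  shows "(\<integral>\<^sup>+\<omega>. (if (SUP u\<in>{0..t}. X u \<omega>) > x \<and> X t \<omega> \<in> B then 1 else 0) \<partial>M) =
    (\<integral>\<^sup>+z. indicator B z * low_density t (x - z) z \<partial>lborel)"
proof -
  have [measurable]: "X t \<in> borel_measurable M" "(\<lambda>\<omega>. SUP u\<in>{0..t}. X u \<omega>) \<in> borel_measurable M"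
    using t by (auto intro!: X_measurable SUP_measurable)
  \<comment> \<open>The successor in the exponent keeps \<open>e n\<close> strictly below
    \<open>t\<close>, so that time remains after the run.\<close>
  define e where "e n = t / 2 ^ Suc n" for n
  have e: "0 < e n" "e n < t" for n
  proof -
    have "1 < (2::real) ^ Suc n" by (rule one_less_power) auto
    then show "0 < e n" "e n < t" using t unfolding e_def by (simp_all add: pos_divide_less_eq del: power_Suc)
  qed
  define H where "H n \<omega> = (if X (e n) \<omega> + (SUP u\<in>{0..t - e n}. X (e n + u) \<omega> - X (e n) \<omega>) > x \<and>
      X (e n) \<omega> + (X (e n + (t - e n)) \<omega> - X (e n) \<omega>) \<in> B then 1 else (0::ennreal))" for n \<omega>
  define D where "D n = (\<integral>\<^sup>+z. indicator B z * (\<integral>\<^sup>+s. indicator {0<..<t - e n} s * (ennreal ((x - z) / s) * q s (- (x - z)) * q (t - s) x) \<partial>lborel) \<partial>lborel)" for n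
  have HD: "(\<integral>\<^sup>+\<omega>. H n \<omega> \<partial>M) = D n" for n
  proof -
    define r where "r = t - e n"
    have r: "0 < r" using e[of n] by (simp add: r_def)
    have [measurable]: "X r \<in> borel_measurable M" "(\<lambda>\<omega>. SUP u\<in>{0..r}. X u \<omega>) \<in> borel_measurable M"
      using r by (auto intro!: X_measurable SUP_measurable)
    define f where "f = (\<lambda>(y, m, d). if y + m > x \<and> y + d \<in> B then 1 else (0::ennreal))"
    have fm: "f \<in> borel_measurable (borel \<Otimes>\<^sub>M (borel \<Otimes>\<^sub>M borel))" unfolding f_def by measurable
    define J where "J w = (\<integral>\<^sup>+\<omega>'. (if w + (SUP u\<in>{0..r}. X u \<omega>') > x \<and> w + X r \<omega>' \<in> B then 1 else 0) \<partial>M)" for w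
    have [measurable]: "J \<in> borel_measurable borel" unfolding J_def by measurable
    have "(\<integral>\<^sup>+\<omega>. H n \<omega> \<partial>M) = (\<integral>\<^sup>+\<omega>. J (X (e n) \<omega>) \<partial>M)"
      using nn_integral_markov_SUP[OF _ _ fm, of "e n" r] e[of n] r
      unfolding H_def J_def f_def r_def by simp
    also have "\<dots> = (\<integral>\<^sup>+w. q (e n) w * J w \<partial>lborel)"
      by (rule nn_integral_X[OF e(1)]) measurable
    also have "\<dots> = (\<integral>\<^sup>+w. q (e n) w * (\<integral>\<^sup>+z. indicator B z * low_density r (x - z) (z - w) \<partial>lborel) \<partial>lborel)"
    proof (rule nn_integral_cong_AE)
      show "AE w in lborel. q (e n) w * J w = q (e n) w * (\<integral>\<^sup>+z. indicator B z * low_density r (x - z) (z - w) \<partial>lborel)"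
        using AE_lborel_reflect[OF AE_regular'[OF r], of x]
      proof eventually_elim
        case (elim w)
        \<comment> \<open>The event restarted at \<open>w\<close>: the final position is measured
          from \<open>w\<close>, and \<open>B\<close> below \<open>x\<close> becomes
          \<open>C\<close> below \<open>x - w\<close>.\<close>
        define C where "C = (\<lambda>z. w + z) -` B"
        have [measurable]: "C \<in> sets borel" unfolding C_def by (rule measurable_sets_borel[of _ borel]) auto
        have "J w = (\<integral>\<^sup>+\<omega>'. (if (SUP u\<in>{0..r}. X u \<omega>') > x - w \<and> X r \<omega>' \<in> C then 1 else 0) \<partial>M)"
          unfolding J_def C_def by (intro nn_integral_cong) auto
        also have "\<dots> = (\<integral>\<^sup>+z. indicator C z * low_density r (x - w - z) z \<partial>lborel)"
        proof (rule regular'_SUP[OF elim r])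
          show "C \<subseteq> {..<x - w}" using Bx by (auto simp: C_def)
        qed measurable
        also have "\<dots> = (\<integral>\<^sup>+z. indicator C (z - w) * low_density r (x - w - (z - w)) (z - w) \<partial>lborel)"
          using nn_integral_real_affine[of "\<lambda>z. indicator C z * low_density r (x - w - z) z" 1 "- w"] by simp
        also have "\<dots> = (\<integral>\<^sup>+z. indicator B z * low_density r (x - z) (z - w) \<partial>lborel)"
          by (rule nn_integral_cong) (simp add: C_def indicator_def)
        finally show ?case by simp
      qed
    qed
    also have "\<dots> = (\<integral>\<^sup>+w. \<integral>\<^sup>+z. q (e n) w * (indicator B z * low_density r (x - z) (z - w)) \<partial>lborel \<partial>lborel)"
      by (intro nn_integral_cong nn_integral_cmult[symmetric]) measurable
    also have "\<dots> = (\<integral>\<^sup>+z. \<integral>\<^sup>+w. q (e n) w * (indicator B z * low_density r (x - z) (z - w)) \<partial>lborel \<partial>lborel)"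
      by (rule lborel_pair.Fubini') measurable
    also have "\<dots> = D n" unfolding D_def
    proof (rule nn_integral_cong)
      fix z :: real
      define g where "g s = ennreal ((x - z) / s) * q s (- (x - z))" for s
      have [measurable]: "g \<in> borel_measurable borel" unfolding g_def by measurable
      have "(\<integral>\<^sup>+w. q (e n) w * (indicator B z * low_density r (x - z) (z - w)) \<partial>lborel) =
        (\<integral>\<^sup>+w. indicator B z * (q (e n) w * low_density r (x - z) (z - w)) \<partial>lborel)"
        by (simp only: mult_ac)
      also have "\<dots> = indicator B z * (\<integral>\<^sup>+w. q (e n) w * low_density r (x - z) (z - w) \<partial>lborel)"
        by (rule nn_integral_cmult) measurable
      also have "(\<integral>\<^sup>+w. q (e n) w * low_density r (x - z) (z - w) \<partial>lborel) =
        (\<integral>\<^sup>+w. \<integral>\<^sup>+s. q (e n) w * (indicator {0<..<r} s * (g s * q (r - s) (x - w))) \<partial>lborel \<partial>lborel)"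
        unfolding low_density_def g_def by (subst nn_integral_cmult) (auto simp: algebra_simps)
      also have "\<dots> = (\<integral>\<^sup>+s. \<integral>\<^sup>+w. q (e n) w * (indicator {0<..<r} s * (g s * q (r - s) (x - w))) \<partial>lborel \<partial>lborel)"
        by (rule lborel_pair.Fubini') measurable
      also have "\<dots> = (\<integral>\<^sup>+s. indicator {0<..<r} s * (g s * q (t - s) x) \<partial>lborel)"
      proof (rule nn_integral_cong)
        fix s
        have "(\<integral>\<^sup>+w. q (e n) w * (indicator {0<..<r} s * (g s * q (r - s) (x - w))) \<partial>lborel) =
          (\<integral>\<^sup>+w. indicator {0<..<r} s * g s * (q (e n) w * q (r - s) (x - w)) \<partial>lborel)"
          by (simp only: mult_ac)
        also have "\<dots> = indicator {0<..<r} s * g s * (\<integral>\<^sup>+w. q (e n) w * q (r - s) (x - w) \<partial>lborel)"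
          by (rule nn_integral_cmult) measurable
        also have "\<dots> = indicator {0<..<r} s * (g s * q (t - s) x)"
        proof (cases "s \<in> {0<..<r}")
          case True
          then have "0 < r - s" by simp
          \<comment> \<open>Since \<open>e n + (r - s) = t - s\<close>, integrating out the position
            after the run leaves \<open>q (t - s) x\<close>.\<close>
          from q_chapman_kolmogorov[OF ck e(1) this, of n x] show ?thesis by (simp add: r_def mult.assoc)
        qed simp
        finally show "(\<integral>\<^sup>+w. q (e n) w * (indicator {0<..<r} s * (g s * q (r - s) (x - w))) \<partial>lborel) = indicator {0<..<r} s * (g s * q (t - s) x)" .
      qed
      finally show "(\<integral>\<^sup>+w. q (e n) w * (indicator B z * low_density r (x - z) (z - w)) \<partial>lborel) =
        indicator B z * (\<integral>\<^sup>+s. indicator {0<..<t - e n} s * (ennreal ((x - z) / s) * q s (- (x - z)) * q (t - s) x) \<partial>lborel)"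
        unfolding g_def r_def .
    qed
    finally show ?thesis .
  qed
  have limD: "D \<longlonglongrightarrow> (\<integral>\<^sup>+z. indicator B z * low_density t (x - z) z \<partial>lborel)"
    unfolding D_def
  proof (rule nn_integral_LIMSEQ)
    show "incseq (\<lambda>n z. indicator B z * (\<integral>\<^sup>+s. indicator {0<..<t - e n} s * (ennreal ((x - z) / s) * q s (- (x - z)) * q (t - s) x) \<partial>lborel))"
      unfolding e_def
      by (intro incseq_SucI le_funI mult_left_mono nn_integral_mono mult_right_mono indicator_shrinking_mono[OF t]) auto
    fix z
    have "(\<lambda>n. \<integral>\<^sup>+s. indicator {0<..<t - e n} s * (ennreal ((x - z) / s) * q s (- (x - z)) * q (t - s) x) \<partial>lborel)
      \<longlonglongrightarrow> (\<integral>\<^sup>+s. indicator {0<..<t} s * (ennreal ((x - z) / s) * q s (- (x - z)) * q (t - s) x) \<partial>lborel)"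
    proof (rule nn_integral_LIMSEQ)
      show "incseq (\<lambda>n s. indicator {0<..<t - e n} s * (ennreal ((x - z) / s) * q s (- (x - z)) * q (t - s) x))"
        unfolding e_def
        by (intro incseq_SucI le_funI mult_right_mono indicator_shrinking_mono[OF t]) auto
      fix s
      show "(\<lambda>n. indicator {0<..<t - e n} s * (ennreal ((x - z) / s) * q s (- (x - z)) * q (t - s) x))
        \<longlonglongrightarrow> indicator {0<..<t} s * (ennreal ((x - z) / s) * q s (- (x - z)) * q (t - s) x)"
      proof (cases "s \<in> {0<..<t}")
        case True
        then show ?thesis unfolding e_def
          by (intro tendsto_mult_ennreal[OF indicator_shrinking_LIMSEQ[OF t] tendsto_const]) auto
      next
        case False
        then have "s \<notin> {0<..<t - e n}" for n using e(1)[of n] by auto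
        then show ?thesis using False by simp
      qed
    qed measurable
    then show "(\<lambda>n. indicator B z * (\<integral>\<^sup>+s. indicator {0<..<t - e n} s * (ennreal ((x - z) / s) * q s (- (x - z)) * q (t - s) x) \<partial>lborel))
      \<longlonglongrightarrow> indicator B z * low_density t (x - z) z"
      unfolding low_density_def by (cases "z \<in> B") auto
  qed measurable
  have limH: "(\<lambda>n. \<integral>\<^sup>+\<omega>. H n \<omega> \<partial>M) \<longlonglongrightarrow> (\<integral>\<^sup>+\<omega>. (if (SUP u\<in>{0..t}. X u \<omega>) > x \<and> X t \<omega> \<in> B then 1 else 0) \<partial>M)"
  proof (rule nn_integral_dominated_convergence[where w = "\<lambda>_. 1"])
    show "H n \<in> borel_measurable M" for n
    proof -
      interpret N: levy M "\<lambda>t \<omega>. - X t \<omega>" by (rule uminus)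
      have [measurable]: "X (e n) \<in> borel_measurable M" "X (e n + (t - e n)) \<in> borel_measurable M"
        using e[of n] by (auto intro!: X_measurable)
      have "(\<lambda>\<omega>. - (INF u\<in>{0..t - e n}. - X (e n + u) \<omega> - - X (e n) \<omega>)) \<in> borel_measurable M"
      proof -
        have "0 \<le> e n" "0 \<le> t - e n" using e(1)[of n] e(2)[of n] by linarith+
        from N.INF_shift_measurable[OF this] show ?thesis by (rule borel_measurable_uminus)
      qed
      moreover have "- (INF u\<in>{0..t - e n}. - X (e n + u) \<omega> - - X (e n) \<omega>) = (SUP u\<in>{0..t - e n}. X (e n + u) \<omega> - X (e n) \<omega>)" for \<omega>
        using INF_uminus_real[of "\<lambda>u. X (e n + u) \<omega> - X (e n) \<omega>" "{0..t - e n}"] by simp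
      ultimately have [measurable]: "(\<lambda>\<omega>. SUP u\<in>{0..t - e n}. X (e n + u) \<omega> - X (e n) \<omega>) \<in> borel_measurable M"
        by (simp only:)
      show ?thesis unfolding H_def by measurable
    qed
    show "AE \<omega> in M. (\<lambda>n. H n \<omega>) \<longlonglongrightarrow> (if (SUP u\<in>{0..t}. X u \<omega>) > x \<and> X t \<omega> \<in> B then 1 else 0)"
      using X_0 AE_space
    proof eventually_elim
      case (elim \<omega>)
      have Hiff: "H n \<omega> = (if (\<exists>u\<in>{e n..t}. X u \<omega> > x) \<and> X t \<omega> \<in> B then 1 else 0)" for n
      proof -
        have "X (e n) \<omega> + (SUP u\<in>{0..t - e n}. X (e n + u) \<omega> - X (e n) \<omega>) > x \<longleftrightarrow>
          (SUP u\<in>{0..t - e n}. X (e n + u) \<omega> - X (e n) \<omega>) > x - X (e n) \<omega>" by auto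
        also have "\<dots> \<longleftrightarrow> (\<exists>u\<in>{0..t - e n}. X (e n + u) \<omega> - X (e n) \<omega> > x - X (e n) \<omega>)"
        proof -
          have e0: "0 \<le> e n" "0 \<le> t - e n" using e(1)[of n] e(2)[of n] by linarith+
          show ?thesis
            by (rule less_cSUP_iff) (use e0(2) cadlag_bdd(2)[OF cadlag_shift[OF path[OF elim(2)] e0(1)]] in auto)
        qed
        also have "\<dots> \<longleftrightarrow> (\<exists>u\<in>{e n..t}. X u \<omega> > x)"
        proof
          assume "\<exists>u\<in>{e n..t}. X u \<omega> > x"
          then obtain u where "u \<in> {e n..t}" "X u \<omega> > x" by auto
          then show "\<exists>u\<in>{0..t - e n}. X (e n + u) \<omega> - X (e n) \<omega> > x - X (e n) \<omega>"
            by (intro bexI[of _ "u - e n"]) auto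
        next
          assume "\<exists>u\<in>{0..t - e n}. X (e n + u) \<omega> - X (e n) \<omega> > x - X (e n) \<omega>"
          then obtain u where "u \<in> {0..t - e n}" "X (e n + u) \<omega> > x" by auto
          then show "\<exists>u\<in>{e n..t}. X u \<omega> > x" by (intro bexI[of _ "e n + u"]) auto
        qed
        finally show ?thesis unfolding H_def by simp
      qed
      have Siff: "(SUP u\<in>{0..t}. X u \<omega>) > x \<longleftrightarrow> (\<exists>u\<in>{0..t}. X u \<omega> > x)"
        using t by (intro less_cSUP_iff cadlag_bdd path elim) auto
      show ?case
      proof (cases "\<exists>u\<in>{0..t}. X u \<omega> > x")
        case True
        then obtain u where u: "0 \<le> u" "u \<le> t" "X u \<omega> > x" by auto
        \<comment> \<open>As \<open>X 0 = 0\<close> and \<open>x \<ge> 0\<close>, the level is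
          exceeded at a positive time, which sufficiently short runs do not reach.\<close>
        then have "0 < u" using elim x by (cases "u = 0") auto
        have "(\<lambda>n. e n) \<longlonglongrightarrow> 0"
          unfolding e_def by (rule LIMSEQ_Suc) (rule LIMSEQ_divide_realpow_zero, simp)
        then have "\<forall>\<^sub>F n in sequentially. e n < u" using \<open>0 < u\<close> by (rule order_tendstoD)
        then have "\<forall>\<^sub>F n in sequentially. (if (SUP u\<in>{0..t}. X u \<omega>) > x \<and> X t \<omega> \<in> B then 1 else 0) = H n \<omega>"
        proof eventually_elim
          case (elim n)
          then have "\<exists>u\<in>{e n..t}. X u \<omega> > x" using u by (intro bexI[of _ u]) auto
          then show ?case unfolding Hiff Siff using True by auto
        qed
        then show ?thesis by (rule Lim_transform_eventually[OF tendsto_const])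
      next
        case False
        have "\<not> (\<exists>u\<in>{e n..t}. X u \<omega> > x)" for n using False e(1)[of n] by fastforce
        then have "H n \<omega> = 0" for n unfolding Hiff using \<open>\<And>n. \<not> (\<exists>u\<in>{e n..t}. X u \<omega> > x)\<close>[of n] by argo
        then show ?thesis unfolding Siff using False by simp
      qed
    qed
  qed (auto simp: H_def emeasure_space_1)
  show ?thesis using LIMSEQ_unique[OF limH] limD unfolding HD by blast
qed

end

end

section \<open>Jumps and variation of paths\<close>

lemma jump_bounds:
  assumes f: "cadlag f" and mono: "mono_on {0..} f" and s: "0 < s"
  shows "0 \<le> jump f s" and "0 \<le> r \<Longrightarrow> r < s \<Longrightarrow> jump f s \<le> f s - f r"
proof -
  obtain l where l: "(f \<longlongrightarrow> l) (at_left s)" using f s by (auto simp: cadlag_def)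
  have nb: "at_left s \<noteq> bot" by (simp add: trivial_limit_at_left_real)
  have j: "jump f s = f s - l" using tendsto_Lim[OF nb l] by (simp add: jump_def)
  have "\<forall>\<^sub>F u in at_left s. f u \<le> f s"
    using eventually_at_left_real[OF s] by eventually_elim (use s in \<open>auto intro!: mono_onD[OF mono]\<close>)
  then show "0 \<le> jump f s" using tendsto_upperbound[OF l _ nb] j by simp
  assume r: "0 \<le> r" "r < s"
  have "\<forall>\<^sub>F u in at_left s. f r \<le> f u"
    using eventually_at_left_real[OF r(2)] by eventually_elim (use r in \<open>auto intro!: mono_onD[OF mono]\<close>)
  then show "jump f s \<le> f s - f r" using tendsto_lowerbound[OF l _ nb] j by simp
qed

lemma sum_jumps_le:
  assumes f: "cadlag f" and mono: "mono_on {0..} f" and "finite F" and a: "0 \<le> a"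
  shows "F \<subseteq> {a<..b} \<Longrightarrow> a \<le> b \<Longrightarrow> (\<Sum>s\<in>F. jump f s) \<le> f b - f a"
  using \<open>finite F\<close>
proof (induction F arbitrary: b rule: finite_linorder_max_induct)
  case empty
  then show ?case using mono_onD[OF mono, of a b] a by simp
next
  case (insert s F)
  define r where "r = (if F = {} then a else Max F)"
  have "s \<in> {a<..b}" using insert.prems by auto
  then have s: "a < s" "s \<le> b" "0 < s" using a by auto
  have r: "a \<le> r" "r < s" "F \<subseteq> {a<..r}"
  proof -
    have "F \<noteq> {} \<Longrightarrow> Max F \<in> F" using insert.hyps by simp
    then have m: "F \<noteq> {} \<Longrightarrow> a < Max F \<and> Max F < s"
      using insert.hyps(2) insert.prems(1) by (metis greaterThanAtMost_iff insertI2 subsetD)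
    show "a \<le> r" "r < s" using m s unfolding r_def by (smt (verit))+
    show "F \<subseteq> {a<..r}" using insert.hyps insert.prems by (auto simp: r_def)
  qed
  have "(\<Sum>s\<in>F. jump f s) \<le> f r - f a" by (rule insert.IH[OF r(3,1)])
  moreover have "jump f s \<le> f s - f r" using jump_bounds(2)[OF f mono s(3)] r a by simp
  moreover have "f s \<le> f b" using mono_onD[OF mono, of s b] s by simp
  moreover have "s \<notin> F" using insert.hyps by auto
  ultimately show ?case using insert.hyps by simp
qed

text \<open>A cell that contains a point of \<open>F\<close> costs at most \<open>e\<close>; any
  other cell costs at most its increment. The latter increments add up to no more than what remains
  of the total after the jumps in \<open>F\<close> are removed.\<close>

lemma truncated_sum_le:
  assumes f: "cadlag f" and mono: "mono_on {0..} f" and a: "0 \<le> a" and h: "0 \<le> h" and e: "0 \<le> e" and F: "finite F"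
  shows "(\<Sum>k<n. min (f (a + real (Suc k) * h) - f (a + real k * h)) e) \<le>
    real (card (F \<inter> {a<..a + real n * h})) * e + (f (a + real n * h) - f a - (\<Sum>s\<in>F \<inter> {a<..a + real n * h}. jump f s))"
proof (induction n)
  case (Suc n)
  define u v where "u = a + real n * h" and "v = a + real (Suc n) * h"
  have uv: "a \<le> u" "u \<le> v" using h by (auto simp: u_def v_def algebra_simps)
  define F1 F2 where "F1 = F \<inter> {a<..u}" and "F2 = F \<inter> {u<..v}"
  have F12: "F \<inter> {a<..v} = F1 \<union> F2" "F1 \<inter> F2 = {}" "finite F1" "finite F2"
    using uv F by (auto simp: F1_def F2_def)
  have "(\<Sum>s\<in>F2. jump f s) \<le> f v - f u"
    using uv a F12 by (intro sum_jumps_le[OF f mono]) (auto simp: F2_def)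
  moreover have "min (f v - f u) e \<le> real (card F2) * e + (f v - f u - (\<Sum>s\<in>F2. jump f s))"
  proof (cases "F2 = {}")
    case False
    then have "1 \<le> card F2" using F12 by (simp add: Suc_leI card_gt_0_iff)
    then have "1 * e \<le> real (card F2) * e" using e by (intro mult_right_mono) auto
    then show ?thesis using calculation by linarith
  qed simp
  moreover have "real (card (F1 \<union> F2)) * e = real (card F1) * e + real (card F2) * e"
    using F12 by (simp add: card_Un_disjoint algebra_simps)
  moreover have "(\<Sum>s\<in>F1 \<union> F2. jump f s) = (\<Sum>s\<in>F1. jump f s) + (\<Sum>s\<in>F2. jump f s)"
    using F12 by (intro sum.union_disjoint) auto
  moreover have "(\<Sum>k<Suc n. min (f (a + real (Suc k) * h) - f (a + real k * h)) e) =
      (\<Sum>k<n. min (f (a + real (Suc k) * h) - f (a + real k * h)) e) + min (f v - f u) e"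
    unfolding u_def v_def by (rule sum.lessThan_Suc)
  moreover have "(\<Sum>k<n. min (f (a + real (Suc k) * h) - f (a + real k * h)) e) \<le>
      real (card F1) * e + (f u - f a - (\<Sum>s\<in>F1. jump f s))"
    using Suc.IH unfolding u_def F1_def .
  ultimately show ?case unfolding v_def[symmetric] F12(1) by linarith
qed simp

text \<open>Around each point the path oscillates little on either side, so a short interval has a
  large increment only if it crosses the centre of its neighbourhood, and the excess is the jump
  there.\<close>

lemma mono_increments_le_jumps:
  assumes f: "cadlag f" and mono: "mono_on {0..} f" and a: "0 \<le> a" "a \<le> b" and e: "0 < e"
  obtains G d where "finite G" "G \<subseteq> {a<..b}" "d > 0"
    "\<And>s u. a \<le> s \<Longrightarrow> s \<le> u \<Longrightarrow> u \<le> b \<Longrightarrow> u - s < d \<Longrightarrow> f u - f s \<le> e + (\<Sum>x\<in>G \<inter> {s<..u}. jump f x)"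
proof -
  have "\<exists>d>0. \<forall>s u. a \<le> s \<longrightarrow> s \<le> u \<longrightarrow> x - d < s \<longrightarrow> u < x + d \<longrightarrow> f u - f s \<le> e + (if s < x \<and> x \<le> u then jump f x else 0)"
    if x: "x \<in> {a..b}" for x
  proof -
    obtain l d where d: "d > 0" "\<And>u. x \<le> u \<Longrightarrow> u < x + d \<Longrightarrow> \<bar>f u - f x\<bar> < e/2"
      "\<And>u. 0 \<le> u \<Longrightarrow> x - d < u \<Longrightarrow> u < x \<Longrightarrow> \<bar>f u - l\<bar> < e/2"
      and l: "x > 0 \<Longrightarrow> (f \<longlongrightarrow> l) (at_left x)"
      using cadlag_local[OF f, of x "e/2"] x e a by (smt (verit) atLeastAtMost_iff half_gt_zero)
    have lx: "x > 0 \<Longrightarrow> jump f x = f x - l"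
      using tendsto_Lim[OF _ l] by (auto simp: jump_def trivial_limit_at_left_real)
    show ?thesis
    proof (intro exI[of _ d] conjI allI impI d(1))
      fix s u assume su: "a \<le> s" "s \<le> u" "x - d < s" "u < x + d"
      consider "x \<le> s" | "s < x" "x \<le> u" | "u < x" by linarith
      then show "f u - f s \<le> e + (if s < x \<and> x \<le> u then jump f x else 0)"
      proof cases
        case 1
        then have "f u - f s \<le> e" using d(2)[of s] d(2)[of u] su by linarith
        then show ?thesis using 1 by simp
      next
        case 2
        then have "f u - f s \<le> e + jump f x" using d(3)[of s] d(2)[of u] su lx a by linarith
        then show ?thesis using 2 by simp
      next
        case 3
        then have "f u - f s \<le> e" using d(3)[of s] d(3)[of u] su a by linarith
        then show ?thesis using 3 by simp
      qed
    qed
  qed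
  then obtain d where d: "\<And>x. x \<in> {a..b} \<Longrightarrow> d x > 0"
    "\<And>x s u. x \<in> {a..b} \<Longrightarrow> a \<le> s \<Longrightarrow> s \<le> u \<Longrightarrow> x - d x < s \<Longrightarrow> u < x + d x \<Longrightarrow>
       f u - f s \<le> e + (if s < x \<and> x \<le> u then jump f x else 0)"
    by metis
  \<comment> \<open>A finite subcover is taken before the Lebesgue number, so that the centres form
    a finite set, which becomes \<open>G\<close>.\<close>
  obtain C where C: "C \<subseteq> {a..b}" "finite C" "{a..b} \<subseteq> (\<Union>x\<in>C. ball x (d x))"
  proof (rule compactE_image[of "{a..b}" "{a..b}" "\<lambda>x. ball x (d x)"])
    show "{a..b} \<subseteq> (\<Union>x\<in>{a..b}. ball x (d x))" using d(1) by force
  qed (use that in auto)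
  obtain \<delta> where \<delta>: "0 < \<delta>"
    "\<And>T. \<lbrakk>T \<subseteq> {a..b}; diameter T < \<delta>\<rbrakk> \<Longrightarrow> \<exists>B \<in> (\<lambda>x. ball x (d x)) ` C. T \<subseteq> B"
  proof (rule Lebesgue_number_lemma[of "{a..b}" "(\<lambda>x. ball x (d x)) ` C"])
    show "(\<lambda>x. ball x (d x)) ` C \<noteq> {}" using C(3) a by auto
  qed (use C in auto)
  show ?thesis
  proof (rule that[of "C \<inter> {a<..b}" \<delta>])
    fix s u assume su: "a \<le> s" "s \<le> u" "u \<le> b" "u - s < \<delta>"
    have "diameter {s..u} < \<delta>" using su by (simp add: diameter_closed_interval)
    then obtain x where x: "x \<in> C" "{s..u} \<subseteq> ball x (d x)"
      using \<delta>(2)[of "{s..u}"] su by auto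
    then have "s \<in> ball x (d x)" "u \<in> ball x (d x)" using su by auto
    then have "x - d x < s" "u < x + d x" by (auto simp: dist_real_def)
    moreover have "x \<in> {a..b}" using x(1) C(1) by auto
    ultimately have le: "f u - f s \<le> e + (if s < x \<and> x \<le> u then jump f x else 0)"
      using d(2)[OF _ su(1,2)] by blast
    have nn: "0 \<le> jump f y" if "y \<in> C \<inter> {a<..b} \<inter> {s<..u}" for y
      using that a by (intro jump_bounds(1)[OF f mono]) auto
    show "f u - f s \<le> e + (\<Sum>x\<in>C \<inter> {a<..b} \<inter> {s<..u}. jump f x)"
    proof (cases "s < x \<and> x \<le> u")
      case True
      then have "jump f x \<le> (\<Sum>x\<in>C \<inter> {a<..b} \<inter> {s<..u}. jump f x)"
        using x su C nn by (intro member_le_sum) auto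
      then show ?thesis using le True by simp
    next
      case False
      have "0 \<le> (\<Sum>x\<in>C \<inter> {a<..b} \<inter> {s<..u}. jump f x)" using nn by (intro sum_nonneg) auto
      then show ?thesis using le False by simp
    qed
  qed (use C \<delta> in auto)
qed

text \<open>For a nondecreasing \<open>f\<close>, the increment of the continuous component in its
  decomposition into a continuous part and a sum of jumps. For a subordinator it is to become the
  drift times the length of the interval.\<close>

definition cont_part :: "(real \<Rightarrow> real) \<Rightarrow> real \<Rightarrow> real \<Rightarrow> real" where
  "cont_part f a b = f b - f a - infsum (jump f) {a<..b}"

section \<open>The continuous part of a nondecreasing path\<close>

context
  fixes f :: "real \<Rightarrow> real"
  assumes f: "cadlag f" and mono: "mono_on {0..} f"
begin

lemma jumps_summable:
  assumes "0 \<le> a" "a \<le> b"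
  shows "jump f summable_on {a<..b}"
proof (rule nonneg_bdd_above_summable_on)
  show "0 \<le> jump f x" if "x \<in> {a<..b}" for x using that assms by (intro jump_bounds(1)[OF f mono]) auto
  show "bdd_above (sum (jump f) ` {F. F \<subseteq> {a<..b} \<and> finite F})"
    using sum_jumps_le[OF f mono _ assms(1) _ assms(2)] by (intro bdd_aboveI[of _ "f b - f a"]) auto
qed

lemma jumps_infsum_SUP:
  assumes "0 \<le> a" "a \<le> b"
  shows "infsum (jump f) {a<..b} = (SUP F\<in>{F. finite F \<and> F \<subseteq> {a<..b}}. sum (jump f) F)"
  using assms by (intro infsum_nonneg_is_SUPREMUM_real jumps_summable) (auto intro!: jump_bounds(1)[OF f mono])

lemma cont_part_nonneg:
  assumes "0 \<le> a" "a \<le> b"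
  shows "0 \<le> cont_part f a b"
proof -
  have "infsum (jump f) {a<..b} \<le> f b - f a"
    unfolding jumps_infsum_SUP[OF assms]
    by (rule cSUP_least) (use sum_jumps_le[OF f mono _ assms(1) _ assms(2)] in auto)
  then show ?thesis by (simp add: cont_part_def)
qed

lemma cont_part_add:
  assumes "0 \<le> a" "a \<le> b" "b \<le> c"
  shows "cont_part f a c = cont_part f a b + cont_part f b c"
proof -
  have "{a<..c} = {a<..b} \<union> {b<..c}" using assms by auto
  then have "infsum (jump f) {a<..c} = infsum (jump f) {a<..b} + infsum (jump f) {b<..c}"
    using assms by (simp only:) (rule infsum_Un_disjoint, auto intro: jumps_summable)
  then show ?thesis by (simp add: cont_part_def)
qed

lemma cont_part_refl: "cont_part f a a = 0"
  by (simp add: cont_part_def)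

lemma cont_part_le_increment:
  assumes "0 \<le> a" "a \<le> b"
  shows "cont_part f a b \<le> f b - f a"
  unfolding cont_part_def using assms by (auto intro!: infsum_nonneg jump_bounds(1)[OF f mono])

text \<open>Uniform continuity: on short intervals finitely many jumps account for all but
  \<open>e\<close> of the increment, and the full sum of jumps removes at least these.\<close>

lemma cont_part_small:
  assumes "0 \<le> a" "a \<le> b" "0 < e"
  obtains d where "d > 0" "\<And>s u. a \<le> s \<Longrightarrow> s \<le> u \<Longrightarrow> u \<le> b \<Longrightarrow> u - s < d \<Longrightarrow> cont_part f s u \<le> e"
proof -
  obtain G d where G: "finite G" "G \<subseteq> {a<..b}" "d > 0"
    "\<And>s u. a \<le> s \<Longrightarrow> s \<le> u \<Longrightarrow> u \<le> b \<Longrightarrow> u - s < d \<Longrightarrow> f u - f s \<le> e + (\<Sum>x\<in>G \<inter> {s<..u}. jump f x)"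
    using mono_increments_le_jumps[OF f mono assms] by metis
  show ?thesis
  proof (rule that[OF G(3)])
    fix s u assume su: "a \<le> s" "s \<le> u" "u \<le> b" "u - s < d"
    have "(\<Sum>x\<in>G \<inter> {s<..u}. jump f x) = infsum (jump f) (G \<inter> {s<..u})" using G by simp
    also have "\<dots> \<le> infsum (jump f) {s<..u}"
      using su assms G by (intro infsum_mono_neutral jumps_summable summable_on_finite) (auto intro!: jump_bounds(1)[OF f mono])
    finally show "cont_part f s u \<le> e" using G(4)[OF su] by (simp add: cont_part_def)
  qed
qed

text \<open>On a fine grid the continuous part of each cell is at most \<open>e\<close>, and it is
  always at most the increment; hence it is at most the truncated increment, and the continuous
  parts add up.\<close>

lemma truncated_sum_ge:
  assumes "0 \<le> a" "0 < \<tau>" "0 < e"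
  shows "\<forall>\<^sub>F m in sequentially. cont_part f a (a + \<tau>) \<le>
    (\<Sum>k<2 ^ m. min (f (a + real (Suc k) * \<tau> / 2 ^ m) - f (a + real k * \<tau> / 2 ^ m)) e)"
proof -
  obtain d where d: "d > 0" "\<And>s u. a \<le> s \<Longrightarrow> s \<le> u \<Longrightarrow> u \<le> a + \<tau> \<Longrightarrow> u - s < d \<Longrightarrow> cont_part f s u \<le> e"
    using cont_part_small[of a "a + \<tau>" e] assms by (metis add.commute add_increasing less_imp_le le_add_same_cancel1)
  have "(\<lambda>m. \<tau> / 2 ^ m) \<longlonglongrightarrow> 0" by (rule LIMSEQ_divide_realpow_zero) simp
  then have "\<forall>\<^sub>F m in sequentially. \<tau> / 2 ^ m < d" using d(1) by (rule order_tendstoD)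
  then show ?thesis
  proof eventually_elim
    case (elim m)
    define g where "g k = a + real k * \<tau> / 2 ^ m" for k :: nat
    have g: "a \<le> g k" "g k \<le> g (Suc k)" "g (Suc k) - g k < d" for k
      using assms elim by (auto simp: g_def field_simps)
    have gt: "g k \<le> a + \<tau>" if "k \<le> 2 ^ m" for k
    proof -
      have "real k \<le> 2 ^ m" using that by (metis of_nat_le_iff of_nat_numeral of_nat_power)
      then show ?thesis using assms by (simp add: g_def pos_divide_le_eq mult_right_mono mult.commute)
    qed
    have "cont_part f a (g n) \<le> (\<Sum>k<n. min (f (g (Suc k)) - f (g k)) e)" if "n \<le> 2 ^ m" for n
      using that
    proof (induction n)
      case 0
      then show ?case by (simp add: g_def cont_part_refl)
    next
      case (Suc n)
      have "cont_part f a (g (Suc n)) = cont_part f a (g n) + cont_part f (g n) (g (Suc n))"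
        using assms g by (intro cont_part_add) auto
      moreover have "cont_part f (g n) (g (Suc n)) \<le> e"
        using g gt[OF Suc.prems] by (intro d(2)) auto
      moreover have "cont_part f (g n) (g (Suc n)) \<le> f (g (Suc n)) - f (g n)"
        using assms g(1)[of n] g(2)[of n] by (intro cont_part_le_increment) auto
      ultimately show ?case using Suc by simp
    qed
    from this[of "2 ^ m"] show ?case by (simp add: g_def)
  qed
qed

text \<open>Finitely many jumps exhaust the sum of all jumps up to \<open>\<eta>\<close>, and
  \<open>N\<close> is their number. It depends on the path and on \<open>\<eta>\<close> only, so
  \<open>e\<close> may tend to 0 uniformly in \<open>m\<close>.\<close>

lemma truncated_sum_le_cont_part:
  assumes "0 \<le> a" "0 \<le> \<tau>" "0 < \<eta>"
  obtains N where "\<And>m e. 0 \<le> e \<Longrightarrow>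
    (\<Sum>k<2 ^ m. min (f (a + real (Suc k) * \<tau> / 2 ^ m) - f (a + real k * \<tau> / 2 ^ m)) e) \<le> real N * e + cont_part f a (a + \<tau>) + \<eta>"
proof -
  have b: "a \<le> a + \<tau>" using assms by simp
  have "infsum (jump f) {a<..a + \<tau>} - \<eta> < (SUP F\<in>{F. finite F \<and> F \<subseteq> {a<..a + \<tau>}}. sum (jump f) F)"
    using assms by (simp flip: jumps_infsum_SUP[OF assms(1) b])
  moreover have "bdd_above (sum (jump f) ` {F. finite F \<and> F \<subseteq> {a<..a + \<tau>}})"
    using sum_jumps_le[OF f mono _ assms(1) _ b] by (intro bdd_aboveI[of _ "f (a + \<tau>) - f a"]) auto
  ultimately obtain F where F: "finite F" "F \<subseteq> {a<..a + \<tau>}" "infsum (jump f) {a<..a + \<tau>} - \<eta> < sum (jump f) F"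
    by (subst (asm) less_cSUP_iff) auto
  show ?thesis
  proof (rule that[of "card F"])
    fix m :: nat and e :: real assume e: "0 \<le> e"
    have "a + real (2 ^ m) * (\<tau> / 2 ^ m) = a + \<tau>" by simp
    moreover have "F \<inter> {a<..a + \<tau>} = F" using F by auto
    ultimately show "(\<Sum>k<2 ^ m. min (f (a + real (Suc k) * \<tau> / 2 ^ m) - f (a + real k * \<tau> / 2 ^ m)) e) \<le> real (card F) * e + cont_part f a (a + \<tau>) + \<eta>"
      using truncated_sum_le[OF f mono assms(1) _ e F(1), of "\<tau> / 2 ^ m" "2 ^ m"] F(3) assms(2)
      by (simp add: cont_part_def)
  qed
qed

end

lemma jump_add_linear:
  assumes f: "cadlag f" and s: "0 < s"
  shows "jump (\<lambda>u. f u + k * u) s = jump f s"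
proof -
  obtain l where l: "(f \<longlongrightarrow> l) (at_left s)" using f s by (auto simp: cadlag_def)
  have nb: "at_left s \<noteq> bot" by (simp add: trivial_limit_at_left_real)
  have "((\<lambda>u. f u + k * u) \<longlongrightarrow> l + k * s) (at_left s)"
    by (intro tendsto_add l tendsto_mult tendsto_const tendsto_ident_at)
  from tendsto_Lim[OF nb this] tendsto_Lim[OF nb l] show ?thesis by (simp add: jump_def)
qed

lemma cadlag_add_linear:
  assumes f: "cadlag f"
  shows "cadlag (\<lambda>u. f u + k * u)"
  unfolding cadlag_def
proof (intro conjI allI impI)
  fix t :: real assume "0 \<le> t"
  then show "continuous (at_right t) (\<lambda>u. f u + k * u)"
    using f by (intro continuous_add continuous_mult continuous_const continuous_ident) (auto simp: cadlag_def)
next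
  fix t :: real assume "0 < t"
  then obtain l where l: "(f \<longlongrightarrow> l) (at_left t)" using f by (auto simp: cadlag_def)
  have "((\<lambda>u. f u + k * u) \<longlongrightarrow> l + k * t) (at_left t)"
    by (intro tendsto_add l tendsto_mult tendsto_const tendsto_ident_at)
  then show "\<exists>l. ((\<lambda>u. f u + k * u) \<longlongrightarrow> l) (at_left t)" by blast
qed

section \<open>Negative parts of increments\<close>

definition neg_part :: "real \<Rightarrow> real" where "neg_part x = max 0 (- x)"

lemma neg_part_nonneg [simp]: "0 \<le> neg_part x"
  by (simp add: neg_part_def)

text \<open>The negative part is subadditive, so refining a partition can only increase the
  sum.\<close>

lemma sum_neg_part_subsequence:
  fixes S :: "nat \<Rightarrow> real"
  assumes "\<And>i. j i \<le> j (Suc i)" "j n \<le> N"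
  shows "(\<Sum>i<n. neg_part (S (j (Suc i)) - S (j i))) \<le> (\<Sum>k<N. neg_part (S (Suc k) - S k))"
proof -
  have step: "neg_part (S b - S a) \<le> (\<Sum>k\<in>{a..<b}. neg_part (S (Suc k) - S k))" if "a \<le> b" for a b
    using that
  proof (induction b rule: dec_induct)
    case (step b)
    have "neg_part (S (Suc b) - S a) \<le> neg_part (S b - S a) + neg_part (S (Suc b) - S b)"
      by (simp add: neg_part_def)
    then show ?case using step by simp
  qed (simp add: neg_part_def)
  have "(\<Sum>i<n. neg_part (S (j (Suc i)) - S (j i))) \<le> (\<Sum>k\<in>{j 0..<j n}. neg_part (S (Suc k) - S k))"
  proof (induction n)
    case (Suc n)
    have "j 0 \<le> j n" using assms(1) by (induction n) (auto intro: order_trans)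
    then have "{j 0..<j (Suc n)} = {j 0..<j n} \<union> {j n..<j (Suc n)}" using assms(1)[of n] by auto
    then have "(\<Sum>k\<in>{j 0..<j (Suc n)}. neg_part (S (Suc k) - S k)) =
      (\<Sum>k\<in>{j 0..<j n}. neg_part (S (Suc k) - S k)) + (\<Sum>k\<in>{j n..<j (Suc n)}. neg_part (S (Suc k) - S k))"
      by (simp only:) (rule sum.union_disjoint, auto)
    then show ?case using Suc step[OF assms(1)[of n]] by simp
  qed simp
  also have "\<dots> \<le> (\<Sum>k<N. neg_part (S (Suc k) - S k))"
    using assms(2) by (intro sum_mono2) auto
  finally show ?thesis .
qed

lemma ceiling_grid_LIMSEQ:
  fixes x t :: real
  assumes "0 \<le> x" "0 < t"
  defines "a \<equiv> \<lambda>m. real (nat \<lceil>x / (t / 2 ^ m)\<rceil>) * t / 2 ^ m"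
  shows "a \<longlonglongrightarrow> x" and "x \<le> a m"
proof -
  have b: "x \<le> a m \<and> a m \<le> x + t / 2 ^ m" for m
  proof -
    define k where "k = nat \<lceil>x / (t / 2 ^ m)\<rceil>"
    have n: "0 \<le> x / (t / 2 ^ m)" using assms by simp
    have "x / (t / 2 ^ m) \<le> real k" "real k \<le> x / (t / 2 ^ m) + 1"
      unfolding k_def using n real_nat_ceiling_ge[of "x / (t / 2 ^ m)"] of_int_ceiling_le_add_one[of "x / (t / 2 ^ m)"]
      by (simp_all del: divide_divide_eq_right)
    then have "x * 2 ^ m / t \<le> real k" "real k - 1 \<le> x * 2 ^ m / t" by auto
    then have "x * 2 ^ m \<le> real k * t" "(real k - 1) * t \<le> x * 2 ^ m"
      using assms by (simp_all only: pos_divide_le_eq pos_le_divide_eq)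
    then show ?thesis unfolding a_def k_def[symmetric] by (auto simp: field_simps)
  qed
  then show "x \<le> a m" by simp
  have "(\<lambda>m. x + t / 2 ^ m) \<longlonglongrightarrow> x + 0"
    by (intro tendsto_add tendsto_const LIMSEQ_divide_realpow_zero) simp
  then show "a \<longlonglongrightarrow> x"
    by (intro tendsto_sandwich[of "\<lambda>_. x" a sequentially "\<lambda>m. x + t / 2 ^ m"]) (use b in auto)
qed

text \<open>An absolute value is the number itself plus twice its negative part. The first terms
  telescope and are bounded with the path, so only negative parts need control. Right continuity
  moves an arbitrary partition onto the grids.\<close>

lemma bounded_variation_of_dyadic:
  assumes f: "cadlag f" and t: "0 < t"
    and C: "\<And>m. (\<Sum>k<2 ^ m. neg_part (f (real (Suc k) * t / 2 ^ m) - f (real k * t / 2 ^ m))) \<le> C"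
  shows "bounded_variation_on 0 t f"
proof -
  obtain K where K: "\<And>u. 0 \<le> u \<Longrightarrow> u \<le> t \<Longrightarrow> \<bar>f u\<bar> \<le> K" using cadlag_bounded[OF f] by metis
  show ?thesis unfolding bounded_variation_on_def
  proof (intro exI allI impI)
    fix n :: nat and u :: "nat \<Rightarrow> real" assume u: "incseq u \<and> range u \<subseteq> {0..t}"
    then have u0: "0 \<le> u i" "u i \<le> t" for i by (auto simp: image_subset_iff)
    define j where "j m i = nat \<lceil>u i / (t / 2 ^ m)\<rceil>" for m i
    have "(\<Sum>i<n. neg_part (f (real (j m (Suc i)) * t / 2 ^ m) - f (real (j m i) * t / 2 ^ m))) \<le> C" for m
    proof (rule order_trans[OF _ C[of m]], rule sum_neg_part_subsequence[of "j m" n "2 ^ m" "\<lambda>k. f (real k * t / 2 ^ m)"])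
      show "j m i \<le> j m (Suc i)" for i
        unfolding j_def using u t by (intro nat_mono ceiling_mono divide_right_mono) (auto simp: incseq_Suc_iff)
      have "u n / (t / 2 ^ m) \<le> 2 ^ m" using u0[of n] t by (simp add: field_simps)
      then show "j m n \<le> 2 ^ m" unfolding j_def by (simp add: nat_le_iff ceiling_le_iff)
    qed
    moreover have "(\<lambda>m. \<Sum>i<n. neg_part (f (real (j m (Suc i)) * t / 2 ^ m) - f (real (j m i) * t / 2 ^ m)))
      \<longlonglongrightarrow> (\<Sum>i<n. neg_part (f (u (Suc i)) - f (u i)))"
      unfolding neg_part_def j_def
      by (intro tendsto_sum tendsto_max tendsto_const tendsto_minus tendsto_diff cadlag_right_tendsto[OF f] ceiling_grid_LIMSEQ u0 t)
    ultimately have le: "(\<Sum>i<n. neg_part (f (u (Suc i)) - f (u i))) \<le> C"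
      by (intro LIMSEQ_le_const2) auto
    have "(\<Sum>i<n. \<bar>f (u (Suc i)) - f (u i)\<bar>) = (\<Sum>i<n. (f (u (Suc i)) - f (u i)) + 2 * neg_part (f (u (Suc i)) - f (u i)))"
      by (intro sum.cong) (auto simp: neg_part_def abs_if max_def)
    also have "\<dots> = f (u n) - f (u 0) + 2 * (\<Sum>i<n. neg_part (f (u (Suc i)) - f (u i)))"
      by (simp add: sum.distrib sum_lessThan_telescope[of "\<lambda>i. f (u i)"] sum_distrib_left)
    also have "\<dots> \<le> 2 * K + 2 * C"
      using le K[OF u0[of n]] K[OF u0[of 0]] by linarith
    finally show "(\<Sum>i<n. \<bar>f (u (Suc i)) - f (u i)\<bar>) \<le> 2 * K + 2 * C" .
  qed
qed

section \<open>Processes with drift\<close>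

context levy
begin

text \<open>The case \<open>k = n\<close> of the descent identity, with the walk reversed in time.\<close>

lemma nn_integral_negative_maximum:
  assumes t: "0 < t" and n: "0 < n" and g [measurable]: "g \<in> borel_measurable borel"
  shows "(\<integral>\<^sup>+\<omega>. ennreal (neg_part (Max ((\<lambda>j. X (real j * (t / real n)) \<omega>) ` {1..n}))) * g (X t \<omega>) \<partial>M) =
    (\<integral>\<^sup>+\<omega>. ennreal (neg_part (X t \<omega>) / real n) * g (X t \<omega>) \<partial>M)"
proof -
  define h where "h = t / real n"
  have h: "0 \<le> h" "real n * h = t" using t n by (auto simp: h_def)
  define P where "P v j = (\<Sum>i<j. v i :: real)" for v and j :: nat
  have [measurable]: "(\<lambda>v. P v j) \<in> borel_measurable (seqs n)" if "j \<le> n" for j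
    unfolding P_def using that by (rule psum_measurable)
  have [measurable]: "(\<lambda>v. Min ((\<lambda>j. P v j) ` {..<n})) \<in> borel_measurable (seqs n)"
    by (intro borel_measurable_Min) auto
  have [measurable]: "(\<lambda>v. P v n) \<in> borel_measurable (seqs n)" by simp
  define F where "F v = ennreal (descent (P v) n) * g (P v n)" for v
  have [measurable]: "F \<in> borel_measurable (seqs n)" unfolding F_def descent_def by measurable
  define V where "V = incs 0 h n"
  define R where "R \<omega> = (\<lambda>k\<in>{..<n}. V \<omega> (n - 1 - k))" for \<omega>
  have PV: "AE \<omega> in M. \<forall>j\<le>n. P (V \<omega>) j = X (real j * h) \<omega>"
    using X_0
  proof eventually_elim
    case (elim \<omega>)
    then show ?case using sum_incs[of _ n 0 h \<omega>] by (simp add: P_def V_def)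
  qed
  have PR: "P (R \<omega>) k = P (V \<omega>) n - P (V \<omega>) (n - k)" if "k \<le> n" for k \<omega>
  proof -
    have "P (R \<omega>) k = (\<Sum>i<k. V \<omega> (n - 1 - i))" unfolding P_def R_def using that by (intro sum.cong) auto
    then show ?thesis using sum_reversed[OF that, of "V \<omega>"] by (simp add: P_def)
  qed
  \<comment> \<open>The reversed walk has the values \<open>P n - P (n - k)\<close>. Its last
    descent compares \<open>P n\<close> with those for \<open>k < n\<close>, that is
    \<open>j = n - k\<close> from 1 to \<open>n\<close>, so the maximum leaves out the starting
    point.\<close>
  have dR: "descent (P (R \<omega>)) n = neg_part (Max (P (V \<omega>) ` {1..n}))" for \<omega>
  proof -
    have im: "P (R \<omega>) ` {..<n} = (\<lambda>y. P (V \<omega>) n - y) ` (P (V \<omega>) ` {1..n})"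
    proof -
      have "P (R \<omega>) ` {..<n} = (\<lambda>k. P (V \<omega>) n - P (V \<omega>) (n - k)) ` {..<n}"
        using PR by (intro image_cong) auto
      also have "\<dots> = (\<lambda>j. P (V \<omega>) n - P (V \<omega>) j) ` ((\<lambda>k. n - k) ` {..<n})" by (simp add: image_image)
      also have "(\<lambda>k. n - k) ` {..<n} = {1..n}"
      proof (intro set_eqI iffI)
        fix j assume "j \<in> {1..n}"
        then show "j \<in> (\<lambda>k. n - k) ` {..<n}" by (intro image_eqI[of _ _ "n - j"]) auto
      qed auto
      finally show ?thesis by (simp add: image_image)
    qed
    have "Min (P (R \<omega>) ` {..<n}) = P (V \<omega>) n - Max (P (V \<omega>) ` {1..n})"
      unfolding im
    proof (rule Min_eqI)
      show "P (V \<omega>) n - Max (P (V \<omega>) ` {1..n}) \<le> y" if "y \<in> (\<lambda>y. P (V \<omega>) n - y) ` P (V \<omega>) ` {1..n}" for y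
        using that by (auto intro!: Max_ge)
      have "Max (P (V \<omega>) ` {1..n}) \<in> P (V \<omega>) ` {1..n}" using n by (intro Max_in) auto
      then show "P (V \<omega>) n - Max (P (V \<omega>) ` {1..n}) \<in> (\<lambda>y. P (V \<omega>) n - y) ` P (V \<omega>) ` {1..n}" by blast
    qed auto
    moreover have "P (R \<omega>) n = P (V \<omega>) n" using PR[of n \<omega>] by (simp add: P_def)
    ultimately show ?thesis by (simp add: descent_def neg_part_def)
  qed
  have "(\<integral>\<^sup>+\<omega>. ennreal (neg_part (Max ((\<lambda>j. X (real j * h) \<omega>) ` {1..n}))) * g (X t \<omega>) \<partial>M) = (\<integral>\<^sup>+\<omega>. F (R \<omega>) \<partial>M)"
  proof (rule nn_integral_cong_AE)
    show "AE \<omega> in M. ennreal (neg_part (Max ((\<lambda>j. X (real j * h) \<omega>) ` {1..n}))) * g (X t \<omega>) = F (R \<omega>)"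
      using PV
    proof eventually_elim
      case (elim \<omega>)
      have "(\<lambda>j. X (real j * h) \<omega>) ` {1..n} = P (V \<omega>) ` {1..n}" using elim by (intro image_cong) auto
      moreover have "P (R \<omega>) n = X t \<omega>" using PR[of n \<omega>] elim h by (simp add: P_def)
      ultimately show ?case by (simp add: F_def dR)
    qed
  qed
  also have "\<dots> = (\<integral>\<^sup>+\<omega>. F (V \<omega>) \<partial>M)"
    unfolding R_def V_def by (rule nn_integral_incs_perm[OF order.refl h(1) n bij_betw_reverse]) measurable
  also have "\<dots> = (\<integral>\<^sup>+\<omega>. ennreal (descent (\<lambda>j. X (real j * h) \<omega>) n) * (\<lambda>S. g (S n)) (\<lambda>j. X (real j * h) \<omega>) \<partial>M)"
  proof (rule nn_integral_cong_AE)
    show "AE \<omega> in M. F (V \<omega>) = ennreal (descent (\<lambda>j. X (real j * h) \<omega>) n) * (\<lambda>S. g (S n)) (\<lambda>j. X (real j * h) \<omega>)"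
      using PV
    proof eventually_elim
      case (elim \<omega>)
      then have "P (V \<omega>) ` {..<n} = (\<lambda>j. X (real j * h) \<omega>) ` {..<n}" by (intro image_cong) auto
      then show ?case using elim by (simp add: F_def descent_def)
    qed
  qed
  also have "\<dots> = (\<integral>\<^sup>+\<omega>. ennreal (max 0 (- X (real n * h) \<omega>) / real n) * (\<lambda>S. g (S n)) (\<lambda>j. X (real j * h) \<omega>) \<partial>M)"
  proof (rule nn_integral_descent[OF n order.refl h(1)])
    show "(\<lambda>v. (\<lambda>S. g (S n)) (\<lambda>j. \<Sum>i<j. v i)) \<in> borel_measurable (seqs n)"
      using psum_measurable[of n n] by measurable
  qed auto
  also have "\<dots> = (\<integral>\<^sup>+\<omega>. ennreal (neg_part (X t \<omega>) / real n) * g (X t \<omega>) \<partial>M)"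
    by (simp add: h neg_part_def)
  finally show ?thesis unfolding h_def .
qed

lemma SUP_ge_0: "AE \<omega> in M. \<forall>r\<ge>0. 0 \<le> (SUP u\<in>{0..r}. X u \<omega>)"
  using X_0 AE_space
proof eventually_elim
  case (elim \<omega>)
  show ?case
    using cSUP_upper[OF _ cadlag_bdd(2)[OF path[OF elim(2)]], of 0] elim by fastforce
qed

text \<open>If the path stays below its position at the first grid time, this position is the maximum.\<close>

lemma first_step_bound:
  assumes t: "0 < t" and n: "0 < n" and [measurable]: "A \<in> sets borel" "C \<in> sets borel" "G \<in> sets borel"
    and G: "\<And>x y. x \<in> A \<Longrightarrow> y \<in> C \<Longrightarrow> x + y \<in> G"
  defines "h \<equiv> t / real n"
  shows "(\<integral>\<^sup>+\<omega>. ennreal (neg_part (X h \<omega>)) * indicator A (X h \<omega>) \<partial>M) *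
      emeasure M {\<omega>\<in>space M. (SUP u\<in>{0..t - h}. X u \<omega>) \<le> 0 \<and> X (t - h) \<omega> \<in> C} \<le>
    (\<integral>\<^sup>+\<omega>. ennreal (neg_part (X t \<omega>) / real n) * indicator G (X t \<omega>) \<partial>M)"
proof -
  have h: "0 < h" "h \<le> t" "0 \<le> t - h" using t n by (auto simp: h_def field_simps)
  note [measurable] = SUP_measurable[OF h(3)] X_measurable[OF h(3)]
  have [measurable]: "X h \<in> borel_measurable M" using h by (simp add: X_measurable)
  define p where "p = emeasure M {\<omega>\<in>space M. (SUP u\<in>{0..t - h}. X u \<omega>) \<le> 0 \<and> X (t - h) \<omega> \<in> C}"
  define f :: "real \<times> real \<times> real \<Rightarrow> ennreal" where "f = (\<lambda>(y, m, d). ennreal (neg_part y) * indicator A y * (if m \<le> 0 \<and> d \<in> C then 1 else 0))"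
  have fm: "f \<in> borel_measurable (borel \<Otimes>\<^sub>M (borel \<Otimes>\<^sub>M borel))" unfolding f_def neg_part_def by measurable
  have p: "p = (\<integral>\<^sup>+\<omega>. (if (SUP u\<in>{0..t - h}. X u \<omega>) \<le> 0 \<and> X (t - h) \<omega> \<in> C then 1 else 0) \<partial>M)"
  proof -
    have "p = (\<integral>\<^sup>+\<omega>. indicator {\<omega>\<in>space M. (SUP u\<in>{0..t - h}. X u \<omega>) \<le> 0 \<and> X (t - h) \<omega> \<in> C} \<omega> \<partial>M)"
      unfolding p_def by (rule nn_integral_indicator[symmetric]) measurable
    also have "\<dots> = (\<integral>\<^sup>+\<omega>. (if (SUP u\<in>{0..t - h}. X u \<omega>) \<le> 0 \<and> X (t - h) \<omega> \<in> C then 1 else 0) \<partial>M)"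
      by (rule nn_integral_cong) (auto simp: indicator_def)
    finally show ?thesis .
  qed
  have "(\<integral>\<^sup>+\<omega>. ennreal (neg_part (X h \<omega>)) * indicator A (X h \<omega>) \<partial>M) * p =
    (\<integral>\<^sup>+\<omega>. ennreal (neg_part (X h \<omega>)) * indicator A (X h \<omega>) * p \<partial>M)"
    unfolding neg_part_def by (rule nn_integral_multc[symmetric]) measurable
  also have "\<dots> = (\<integral>\<^sup>+\<omega>. \<integral>\<^sup>+\<omega>'. f (X h \<omega>, (SUP u\<in>{0..t - h}. X u \<omega>', X (t - h) \<omega>')) \<partial>M \<partial>M)"
    unfolding p f_def prod.case by (intro nn_integral_cong nn_integral_cmult[symmetric]) measurable
  also have "\<dots> = (\<integral>\<^sup>+\<omega>. f (X h \<omega>, (SUP u\<in>{0..t - h}. X (h + u) \<omega> - X h \<omega>, X (h + (t - h)) \<omega> - X h \<omega>)) \<partial>M)"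
    using h by (intro nn_integral_markov_SUP[symmetric] fm) auto
  also have "\<dots> \<le> (\<integral>\<^sup>+\<omega>. ennreal (neg_part (Max ((\<lambda>j. X (real j * (t / real n)) \<omega>) ` {1..n}))) * indicator G (X t \<omega>) \<partial>M)"
  proof (rule nn_integral_mono)
    fix \<omega> assume \<omega>: "\<omega> \<in> space M"
    show "f (X h \<omega>, (SUP u\<in>{0..t - h}. X (h + u) \<omega> - X h \<omega>, X (h + (t - h)) \<omega> - X h \<omega>)) \<le>
      ennreal (neg_part (Max ((\<lambda>j. X (real j * (t / real n)) \<omega>) ` {1..n}))) * indicator G (X t \<omega>)"
    proof (cases "X h \<omega> \<in> A \<and> (SUP u\<in>{0..t - h}. X (h + u) \<omega> - X h \<omega>) \<le> 0 \<and> X (h + (t - h)) \<omega> - X h \<omega> \<in> C")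
      case True
      have bdd: "bdd_above ((\<lambda>u. X (h + u) \<omega> - X h \<omega>) ` {0..t - h})"
        using h(1) by (intro cadlag_bdd(2) cadlag_shift path \<omega>) simp
      have below: "X u \<omega> \<le> X h \<omega>" if u: "h \<le> u" "u \<le> t" for u
      proof -
        have "X (h + (u - h)) \<omega> - X h \<omega> \<le> (SUP u\<in>{0..t - h}. X (h + u) \<omega> - X h \<omega>)"
          by (rule cSUP_upper[OF _ bdd]) (use u in auto)
        then show ?thesis using True by simp
      qed
      have "Max ((\<lambda>j. X (real j * (t / real n)) \<omega>) ` {1..n}) \<le> X h \<omega>"
      proof (rule Max.boundedI)
        fix y assume "y \<in> (\<lambda>j. X (real j * (t / real n)) \<omega>) ` {1..n}"
        then obtain j where j: "j \<in> {1..n}" "y = X (real j * (t / real n)) \<omega>" by (rule imageE)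
        have "1 * h \<le> real j * h" using j(1) h(1) by (intro mult_right_mono) auto
        moreover have "real j * h \<le> real n * h" using j(1) h(1) by (intro mult_right_mono) auto
        moreover have "real n * h = t" using n by (simp add: h_def)
        ultimately have "X (real j * h) \<omega> \<le> X h \<omega>" by (intro below) linarith+
        then show "y \<le> X h \<omega>" unfolding j(2) h_def .
      qed (use n in auto)
      then have "neg_part (X h \<omega>) \<le> neg_part (Max ((\<lambda>j. X (real j * (t / real n)) \<omega>) ` {1..n}))"
        by (simp add: neg_part_def)
      moreover have "X t \<omega> \<in> G" using G[of "X h \<omega>" "X t \<omega> - X h \<omega>"] True by simp
      ultimately show ?thesis using True by (simp add: f_def ennreal_leI)
    qed (auto simp: f_def)
  qed
  also have "\<dots> = (\<integral>\<^sup>+\<omega>. ennreal (neg_part (X t \<omega>) / real n) * indicator G (X t \<omega>) \<partial>M)"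
    by (rule nn_integral_negative_maximum[OF t n]) measurable
  finally show ?thesis unfolding p_def .
qed

text \<open>Two independent negative increments add up to a negative one. Read backwards, a null
  probability at time \<open>2 * h\<close> is inherited by time \<open>h\<close>, hence by
  arbitrarily short dyadic times.\<close>

lemma prob_neg_double:
  assumes h: "0 \<le> h"
  shows "emeasure M {\<omega>\<in>space M. X h \<omega> < 0} * emeasure M {\<omega>\<in>space M. X h \<omega> < 0} \<le> emeasure M {\<omega>\<in>space M. X (2 * h) \<omega> < 0}"
proof -
  note [measurable] = X_measurable[OF h]
  have [measurable]: "X (2 * h) \<in> borel_measurable M" using h by (simp add: X_measurable)
  have ind: "emeasure M {\<omega>\<in>space M. X h \<omega> < 0} = (\<integral>\<^sup>+\<omega>. (if X h \<omega> < 0 then 1 else 0) \<partial>M)"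
  proof -
    have "emeasure M {\<omega>\<in>space M. X h \<omega> < 0} = (\<integral>\<^sup>+\<omega>. indicator {\<omega>\<in>space M. X h \<omega> < 0} \<omega> \<partial>M)" by simp
    also have "\<dots> = (\<integral>\<^sup>+\<omega>. (if X h \<omega> < 0 then 1 else 0) \<partial>M)" by (rule nn_integral_cong) (auto simp: indicator_def)
    finally show ?thesis .
  qed
  define f :: "real \<times> real \<times> real \<Rightarrow> ennreal" where "f = (\<lambda>(y, m, d). (if y < 0 then 1 else 0) * (if d < 0 then 1 else 0))"
  have fm: "f \<in> borel_measurable (borel \<Otimes>\<^sub>M (borel \<Otimes>\<^sub>M borel))" unfolding f_def by measurable
  have "emeasure M {\<omega>\<in>space M. X h \<omega> < 0} * emeasure M {\<omega>\<in>space M. X h \<omega> < 0} =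
    (\<integral>\<^sup>+\<omega>. (if X h \<omega> < 0 then 1 else 0) * (\<integral>\<^sup>+\<omega>'. (if X h \<omega>' < 0 then 1 else 0) \<partial>M) \<partial>M)"
    unfolding ind by (rule nn_integral_multc[symmetric]) measurable
  also have "\<dots> = (\<integral>\<^sup>+\<omega>. \<integral>\<^sup>+\<omega>'. f (X h \<omega>, (SUP u\<in>{0..h}. X u \<omega>', X h \<omega>')) \<partial>M \<partial>M)"
    unfolding f_def prod.case by (intro nn_integral_cong nn_integral_cmult[symmetric]) measurable
  also have "\<dots> = (\<integral>\<^sup>+\<omega>. f (X h \<omega>, (SUP u\<in>{0..h}. X (h + u) \<omega> - X h \<omega>, X (h + h) \<omega> - X h \<omega>)) \<partial>M)"
    by (rule nn_integral_markov_SUP[OF h h fm, symmetric])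
  also have "\<dots> \<le> (\<integral>\<^sup>+\<omega>. indicator {\<omega>\<in>space M. X (2 * h) \<omega> < 0} \<omega> \<partial>M)"
  proof (rule nn_integral_mono)
    fix \<omega> assume "\<omega> \<in> space M"
    then show "f (X h \<omega>, (SUP u\<in>{0..h}. X (h + u) \<omega> - X h \<omega>, X (h + h) \<omega> - X h \<omega>)) \<le> indicator {\<omega>\<in>space M. X (2 * h) \<omega> < 0} \<omega>"
    proof (cases "X h \<omega> < 0 \<and> X (h + h) \<omega> - X h \<omega> < 0")
      case True
      then have "X (2 * h) \<omega> < 0" unfolding mult_2 by linarith
      then show ?thesis using True \<open>\<omega> \<in> space M\<close> by (simp add: f_def)
    next
      case False
      then have "f (X h \<omega>, (SUP u\<in>{0..h}. X (h + u) \<omega> - X h \<omega>, X (h + h) \<omega> - X h \<omega>)) = 0"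
        unfolding f_def prod.case by (simp only: mult_eq_0_iff de_Morgan_conj if_False simp_thms) (metis (full_types))
      then show ?thesis by simp
    qed
  qed
  also have "\<dots> = emeasure M {\<omega>\<in>space M. X (2 * h) \<omega> < 0}" by simp
  finally show ?thesis .
qed

section \<open>The drift as a rate at small times\<close>

context
  fixes c :: real
  assumes drift: "has_drift M X (- c)" and c: "0 < c"
begin

text \<open>The subordinator in \<open>has_drift\<close> agrees with \<open>X t + c * t\<close> for
  \<open>t \<ge> 0\<close>, hence also has the same jumps at positive times; that it is the sum of
  its jumps says that the continuous part vanishes.\<close>

lemma drift_paths:
  "AE \<omega> in M. mono_on {0..} (\<lambda>t. X t \<omega> + c * t) \<and> (\<forall>t\<ge>0. cont_part (\<lambda>t. X t \<omega> + c * t) 0 t = 0)"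
proof -
  obtain Y where Y: "driftless_subordinator M Y" "AE \<omega> in M. \<forall>t\<ge>0. X t \<omega> = Y t \<omega> + - c * t"
    using drift by (auto simp: has_drift_def)
  have "AE \<omega> in M. mono_on {0..} (\<lambda>t. Y t \<omega>)" "AE \<omega> in M. \<forall>t\<ge>0. (jump (\<lambda>u. Y u \<omega>) has_sum Y t \<omega>) {0<..t}"
    using Y(1) by (auto simp: driftless_subordinator_def subordinator_def)
  with Y(2) X_0 AE_space show ?thesis
  proof eventually_elim
    case (elim \<omega>)
    have Yeq: "Y t \<omega> = X t \<omega> + c * t" if "0 \<le> t" for t using elim(1) that by simp
    have jmp: "jump (\<lambda>u. Y u \<omega>) s = jump (\<lambda>t. X t \<omega> + c * t) s" if s: "0 < s" for s
    proof -
      have "\<forall>\<^sub>F u in at_left s. Y u \<omega> = X u \<omega> + c * u"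
        using eventually_at_left_real[OF s] by eventually_elim (use Yeq in auto)
      then have "((\<lambda>u. Y u \<omega>) \<longlongrightarrow> l) (at_left s) \<longleftrightarrow> ((\<lambda>u. X u \<omega> + c * u) \<longlongrightarrow> l) (at_left s)" for l
        by (rule tendsto_cong)
      then show ?thesis unfolding jump_def Topological_Spaces.Lim_def using Yeq[of s] s by simp
    qed
    show ?case
    proof (intro conjI allI impI)
      show "mono_on {0..} (\<lambda>t. X t \<omega> + c * t)"
        using elim(4) Yeq by (auto simp: mono_on_def)
      fix t :: real assume t: "0 \<le> t"
      have "(jump (\<lambda>u. Y u \<omega>) has_sum Y t \<omega>) {0<..t}" using elim t by simp
      then have "(jump (\<lambda>t. X t \<omega> + c * t) has_sum Y t \<omega>) {0<..t}"
        by (rule has_sum_cong[THEN iffD1, rotated]) (use jmp in auto)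
      then have "infsum (jump (\<lambda>t. X t \<omega> + c * t)) {0<..t} = Y t \<omega>" by (rule infsumI)
      then show "cont_part (\<lambda>t. X t \<omega> + c * t) 0 t = 0" using Yeq[OF t] elim(2) by (simp add: cont_part_def)
    qed
  qed
qed

lemma X_ge: "AE \<omega> in M. \<forall>t\<ge>0. - c * t \<le> X t \<omega>"
  using drift_paths X_0
proof eventually_elim
  case (elim \<omega>)
  show ?case
  proof (intro allI impI)
    fix t :: real assume "0 \<le> t"
    then have "X 0 \<omega> + c * 0 \<le> X t \<omega> + c * t" using elim(1) by (auto dest!: mono_onD[of _ _ 0 t])
    then show "- c * t \<le> X t \<omega>" using elim(2) by simp
  qed
qed

lemma nn_integral_neg_part_increment:
  assumes "0 \<le> s" "0 \<le> h"
  shows "(\<integral>\<^sup>+\<omega>. ennreal (neg_part (X (s + h) \<omega> - X s \<omega>)) \<partial>M) = (\<integral>\<^sup>+\<omega>. ennreal (neg_part (X h \<omega>)) \<partial>M)"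
proof -
  have [measurable]: "X (s + h) \<in> borel_measurable M" "X s \<in> borel_measurable M" "X h \<in> borel_measurable M"
    using assms by (auto intro!: X_measurable)
  have [measurable]: "(\<lambda>x. ennreal (neg_part x)) \<in> borel_measurable borel" unfolding neg_part_def by measurable
  have "(\<integral>\<^sup>+\<omega>. ennreal (neg_part (X (s + h) \<omega> - X s \<omega>)) \<partial>M) = (\<integral>\<^sup>+x. ennreal (neg_part x) \<partial>distr M borel (\<lambda>\<omega>. X (s + h) \<omega> - X s \<omega>))"
    by (rule nn_integral_distr[symmetric]) measurable
  also have "\<dots> = (\<integral>\<^sup>+\<omega>. ennreal (neg_part (X h \<omega>)) \<partial>M)"
    unfolding stationary[OF assms] by (rule nn_integral_distr) measurable
  finally show ?thesis .
qed

text \<open>Over a cell of length \<open>h\<close> the negative part of the increment of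
  \<open>X\<close> is \<open>c * h\<close> minus the increment of \<open>X t + c * t\<close>
  truncated at \<open>c * h\<close>. The truncated increments add up to something that tends to 0,
  because that path has no continuous part. By stationarity the expected sum is the number of cells
  times one expectation.\<close>

lemma neg_part_rate:
  assumes t: "0 < t"
  shows "(\<lambda>m. ennreal (2 ^ m) * (\<integral>\<^sup>+\<omega>. ennreal (neg_part (X (t / 2 ^ m) \<omega>)) \<partial>M)) \<longlonglongrightarrow> ennreal (c * t)"
proof -
  define h where "h m = t / 2 ^ m" for m :: nat
  have h: "0 < h m" for m using t by (simp add: h_def)
  define D where "D m k \<omega> = X (real k * h m + h m) \<omega> - X (real k * h m) \<omega>" for m k \<omega>
  have [measurable]: "D m k \<in> borel_measurable M" for m k
    unfolding D_def using h[of m] by (intro borel_measurable_diff X_measurable) (auto intro!: add_nonneg_nonneg mult_nonneg_nonneg less_imp_le)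
  have [measurable]: "(\<lambda>\<omega>. neg_part (D m k \<omega>)) \<in> borel_measurable M" for m k unfolding neg_part_def by measurable
  have eq: "ennreal (2 ^ m) * (\<integral>\<^sup>+\<omega>. ennreal (neg_part (X (h m) \<omega>)) \<partial>M) = (\<integral>\<^sup>+\<omega>. ennreal (\<Sum>k<2 ^ m. neg_part (D m k \<omega>)) \<partial>M)" for m
  proof -
    have "(\<integral>\<^sup>+\<omega>. ennreal (\<Sum>k<2 ^ m. neg_part (D m k \<omega>)) \<partial>M) = (\<integral>\<^sup>+\<omega>. (\<Sum>k<2 ^ m. ennreal (neg_part (D m k \<omega>))) \<partial>M)"
      by (intro nn_integral_cong sum_ennreal[symmetric]) simp
    also have "\<dots> = (\<Sum>k<(2::nat) ^ m. \<integral>\<^sup>+\<omega>. ennreal (neg_part (D m k \<omega>)) \<partial>M)"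
      by (rule nn_integral_sum) measurable
    also have "\<dots> = (\<Sum>k<(2::nat) ^ m. \<integral>\<^sup>+\<omega>. ennreal (neg_part (X (h m) \<omega>)) \<partial>M)"
      unfolding D_def using h[of m] by (intro sum.cong refl nn_integral_neg_part_increment) auto
    also have "\<dots> = ennreal (2 ^ m) * (\<integral>\<^sup>+\<omega>. ennreal (neg_part (X (h m) \<omega>)) \<partial>M)"
      by (simp flip: ennreal_of_nat_eq_real_of_nat add: ennreal_power[symmetric])
    finally show ?thesis by simp
  qed
  have paths: "AE \<omega> in M. (\<forall>m. (\<Sum>k<2 ^ m. neg_part (D m k \<omega>)) \<le> c * t) \<and> (\<lambda>m. \<Sum>k<2 ^ m. neg_part (D m k \<omega>)) \<longlonglongrightarrow> c * t"
    using drift_paths AE_space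
  proof eventually_elim
    case (elim \<omega>)
    define f where "f = (\<lambda>u. X u \<omega> + c * u)"
    have f: "cadlag f" "mono_on {0..} f" "cont_part f 0 t = 0"
      using elim t by (auto simp: f_def intro!: cadlag_add_linear path)
    define G where "G m = (\<Sum>k<2 ^ m. min (f (0 + real (Suc k) * t / 2 ^ m) - f (0 + real k * t / 2 ^ m)) (c * h m))" for m :: nat
    have D: "D m k \<omega> = f (0 + real (Suc k) * t / 2 ^ m) - f (0 + real k * t / 2 ^ m) - c * h m" for m k
    proof -
      have "real k * h m + h m = real (Suc k) * t / 2 ^ m" "real k * h m = real k * t / 2 ^ m" by (auto simp: h_def field_simps)
      then show ?thesis unfolding D_def f_def by (simp add: h_def field_simps)
    qed
    have fD: "0 \<le> f (0 + real (Suc k) * t / 2 ^ m) - f (0 + real k * t / 2 ^ m)" for m k :: nat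
    proof -
      have "real k * t / 2 ^ m \<le> real (Suc k) * t / 2 ^ m" using t by (intro divide_right_mono mult_right_mono) auto
      then show ?thesis using mono_onD[OF f(2), of "real k * t / 2 ^ m" "real (Suc k) * t / 2 ^ m"] t by simp
    qed
    have sum: "(\<Sum>k<2 ^ m. neg_part (D m k \<omega>)) = c * t - G m" for m
    proof -
      have "neg_part (D m k \<omega>) = c * h m - min (f (0 + real (Suc k) * t / 2 ^ m) - f (0 + real k * t / 2 ^ m)) (c * h m)" for k
        unfolding D by (simp add: neg_part_def min_def max_def)
      then have "(\<Sum>k<2 ^ m. neg_part (D m k \<omega>)) = (\<Sum>k<(2::nat) ^ m. c * h m) - G m"
        unfolding G_def by (simp add: sum_subtractf)
      then show ?thesis by (simp add: h_def)
    qed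
    have G0: "0 \<le> G m" for m unfolding G_def using fD h[of m] c by (intro sum_nonneg) (auto intro!: mult_nonneg_nonneg less_imp_le)
    \<comment> \<open>The truncation level is \<open>c * h m\<close>: the finitely many jumps
      counted by \<open>N\<close> cost \<open>N * (c * h m)\<close>, which vanishes, the continuous
      part is 0, and the remaining jumps cost at most \<open>r / 2\<close>.\<close>
    have "G \<longlonglongrightarrow> 0"
    proof (rule LIMSEQ_I)
      fix r :: real assume r: "0 < r"
      obtain N where N: "\<And>m e. 0 \<le> e \<Longrightarrow>
        (\<Sum>k<2 ^ m. min (f (0 + real (Suc k) * t / 2 ^ m) - f (0 + real k * t / 2 ^ m)) e) \<le> real N * e + cont_part f 0 (0 + t) + r / 2"
        by (rule truncated_sum_le_cont_part[OF f(1,2), of 0 t "r / 2"]) (use t r in auto)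
      have "(\<lambda>m. real N * (c * (t / 2 ^ m))) \<longlonglongrightarrow> real N * (c * 0)"
        by (intro tendsto_mult tendsto_const LIMSEQ_divide_realpow_zero) simp
      then have "\<forall>\<^sub>F m in sequentially. real N * (c * h m) < r / 2"
        using r unfolding h_def by (intro order_tendstoD(2)) auto
      then have "\<forall>\<^sub>F m in sequentially. norm (G m - 0) < r"
      proof eventually_elim
        case (elim m)
        have "G m \<le> real N * (c * h m) + cont_part f 0 (0 + t) + r / 2"
          unfolding G_def using h[of m] c by (intro N) auto
        then show ?case using elim f(3) G0[of m] by simp
      qed
      then show "\<exists>no. \<forall>m\<ge>no. norm (G m - 0) < r" unfolding eventually_sequentially .
    qed
    then have "(\<lambda>m. c * t - G m) \<longlonglongrightarrow> c * t - 0" by (intro tendsto_diff tendsto_const)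
    then show ?case using G0 by (simp add: sum)
  qed
  have "(\<lambda>m. \<integral>\<^sup>+\<omega>. ennreal (\<Sum>k<2 ^ m. neg_part (D m k \<omega>)) \<partial>M) \<longlonglongrightarrow> (\<integral>\<^sup>+\<omega>. ennreal (c * t) \<partial>M)"
  proof (rule nn_integral_dominated_convergence[where w = "\<lambda>_. ennreal (c * t)"])
    show "AE \<omega> in M. ennreal (\<Sum>k<2 ^ m. neg_part (D m k \<omega>)) \<le> ennreal (c * t)" for m
      using paths by eventually_elim (auto intro!: ennreal_leI)
    show "AE \<omega> in M. (\<lambda>m. ennreal (\<Sum>k<2 ^ m. neg_part (D m k \<omega>))) \<longlonglongrightarrow> ennreal (c * t)"
      using paths by eventually_elim (auto intro!: tendsto_ennrealI)
  qed (auto simp: emeasure_space_1)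
  then show ?thesis unfolding eq[symmetric] h_def by (simp add: emeasure_space_1)
qed

end


section \<open>The law on the event that the path never exceeds 0\<close>

lemma emeasure_SUP_eq_0_reversal:
  assumes t: "0 \<le> t" and B: "B \<in> sets borel"
  shows "emeasure M {\<omega>\<in>space M. (SUP u\<in>{0..t}. X u \<omega>) = 0 \<and> X t \<omega> \<in> B} =
    emeasure M {\<omega>\<in>space M. (INF u\<in>{0..t}. X u \<omega>) = X t \<omega> \<and> X t \<omega> \<in> B}"
proof -
  note [measurable] = X_measurable[OF t] INF_measurable[OF t] SUP_measurable[OF t]
  have 1: "{0::real} \<times> B \<in> sets (borel \<Otimes>\<^sub>M borel)" using B by (intro pair_measureI) auto
  have "emeasure M {\<omega>\<in>space M. (SUP u\<in>{0..t}. X u \<omega>) = 0 \<and> X t \<omega> \<in> B} =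
    emeasure (distr M (borel \<Otimes>\<^sub>M borel) (\<lambda>\<omega>. (SUP u\<in>{0..t}. X u \<omega>, X t \<omega>))) ({0} \<times> B)"
    by (subst emeasure_distr[OF _ 1]) (auto intro!: arg_cong2[where f = emeasure])
  also have "\<dots> = emeasure M {\<omega>\<in>space M. (INF u\<in>{0..t}. X u \<omega>) = X t \<omega> \<and> X t \<omega> \<in> B}"
    unfolding time_reversal[OF t]
    by (subst emeasure_distr[OF _ 1]) (auto intro!: arg_cong2[where f = emeasure])
  finally show ?thesis .
qed

lemma nonpositive_at_dyadics_imp_SUP_le_0:
  assumes \<omega>: "\<omega> \<in> space M" "X 0 \<omega> = 0" and t: "0 \<le> t"
    and le: "\<And>m j. j \<in> {1..2 ^ m} \<Longrightarrow> X (real j * t / 2 ^ m) \<omega> \<le> 0"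
  shows "(SUP u\<in>{0..t}. X u \<omega>) \<le> 0"
proof (rule ccontr)
  assume "\<not> (SUP u\<in>{0..t}. X u \<omega>) \<le> 0"
  then have "(INF u\<in>{0..t}. - X u \<omega>) < 0" by (simp add: INF_uminus_real)
  then obtain m k :: nat where "k \<le> 2 ^ m" "- X (real k * t / 2 ^ m) \<omega> < 0"
    using INF_less_dyadic_iff[OF cadlag_uminus[OF path[OF \<omega>(1)]] t] by blast
  then show False using le[of k m] \<omega>(2) by (cases "k = 0") auto
qed

context
  fixes c :: real
  assumes drift: "has_drift M X (- c)" and c: "0 < c"
begin

text \<open>The maximum over the grid is at least \<open>X h\<close>, which is at least
  \<open>- c * h\<close>. So its negative part is at most \<open>c * h\<close>, and it is positive
  only if all grid positions are negative. The number of steps is \<open>t / h\<close>, and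
  \<open>h\<close> cancels.\<close>

lemma neg_part_le_prob_SUP_eq_0:
  assumes t: "0 < t" and [measurable]: "B \<in> sets borel"
  shows "(\<integral>\<^sup>+\<omega>. ennreal (neg_part (X t \<omega>) / t) * indicator B (X t \<omega>) \<partial>M) \<le>
    ennreal c * emeasure M {\<omega>\<in>space M. (SUP u\<in>{0..t}. X u \<omega>) = 0 \<and> X t \<omega> \<in> B}"
proof -
  note [measurable] = X_measurable[OF less_imp_le[OF t]] SUP_measurable[OF less_imp_le[OF t]]
  define E where "E m = {\<omega>\<in>space M. (\<forall>j\<in>{1..2 ^ m}. X (real j * t / 2 ^ m) \<omega> < 0) \<and> X t \<omega> \<in> B}" for m :: nat
  have [measurable]: "X (real j * t / 2 ^ m) \<in> borel_measurable M" for j m :: nat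
    using t by (intro X_measurable) auto
  have E [measurable]: "E m \<in> sets M" for m unfolding E_def by measurable
  define a where "a = (\<integral>\<^sup>+\<omega>. ennreal (neg_part (X t \<omega>) / t) * indicator B (X t \<omega>) \<partial>M)"
  have le: "a \<le> ennreal c * emeasure M (E m)" for m
  proof -
    define h where "h = t / 2 ^ m"
    have h: "0 < h" using t by (simp add: h_def)
    have "a = (\<integral>\<^sup>+\<omega>. ennreal (1 / h) * (ennreal (neg_part (X t \<omega>) / real (2 ^ m)) * indicator B (X t \<omega>)) \<partial>M)"
      unfolding a_def
    proof (rule nn_integral_cong)
      fix \<omega>
      have "neg_part (X t \<omega>) / t = 1 / h * (neg_part (X t \<omega>) / real (2 ^ m))" by (simp add: h_def)
      then have "ennreal (neg_part (X t \<omega>) / t) = ennreal (1 / h) * ennreal (neg_part (X t \<omega>) / real (2 ^ m))"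
        using h by (simp only: ennreal_mult' divide_nonneg_pos)
      then show "ennreal (neg_part (X t \<omega>) / t) * indicator B (X t \<omega>) =
        ennreal (1 / h) * (ennreal (neg_part (X t \<omega>) / real (2 ^ m)) * indicator B (X t \<omega>))"
        by (simp only: mult.assoc)
    qed
    also have "\<dots> = ennreal (1 / h) * (\<integral>\<^sup>+\<omega>. ennreal (neg_part (X t \<omega>) / real (2 ^ m)) * indicator B (X t \<omega>) \<partial>M)"
      unfolding neg_part_def by (rule nn_integral_cmult) measurable
    also have "(\<integral>\<^sup>+\<omega>. ennreal (neg_part (X t \<omega>) / real (2 ^ m)) * indicator B (X t \<omega>) \<partial>M) =
      (\<integral>\<^sup>+\<omega>. ennreal (neg_part (Max ((\<lambda>j. X (real j * (t / real (2 ^ m))) \<omega>) ` {1..2 ^ m}))) * indicator B (X t \<omega>) \<partial>M)"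
      by (rule nn_integral_negative_maximum[OF t, symmetric]) auto
    also have "\<dots> \<le> (\<integral>\<^sup>+\<omega>. ennreal (c * h) * indicator (E m) \<omega> \<partial>M)"
    proof (rule nn_integral_mono_AE)
      show "AE \<omega> in M. ennreal (neg_part (Max ((\<lambda>j. X (real j * (t / real (2 ^ m))) \<omega>) ` {1..2 ^ m}))) * indicator B (X t \<omega>)
        \<le> ennreal (c * h) * indicator (E m) \<omega>"
        using X_ge[OF drift c] AE_space
      proof eventually_elim
        case (elim \<omega>)
        define mx where "mx = Max ((\<lambda>j. X (real j * (t / real (2 ^ m))) \<omega>) ` {1..2 ^ m})"
        have mx: "X (real j * (t / real (2 ^ m))) \<omega> \<le> mx" if "j \<in> {1..2 ^ m}" for j
          unfolding mx_def using that by (intro Max_ge) auto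
        show ?case
          unfolding mx_def[symmetric]
        proof (cases "mx < 0 \<and> X t \<omega> \<in> B")
          case True
          have "X (real j * t / 2 ^ m) \<omega> < 0" if "j \<in> {1..2 ^ m}" for j
            using mx[OF that] True by simp
          then have "\<omega> \<in> E m" using True elim unfolding E_def by blast
          moreover have "neg_part mx \<le> c * h"
          proof -
            have "- c * h \<le> X h \<omega>" using elim(1) h by simp
            moreover have "X h \<omega> \<le> mx" using mx[of 1] by (simp add: h_def)
            ultimately show ?thesis using c h by (simp add: neg_part_def)
          qed
          ultimately show "ennreal (neg_part mx) * indicator B (X t \<omega>) \<le> ennreal (c * h) * indicator (E m) \<omega>"
            using True by (simp add: ennreal_leI)
        next
          case False
          then have "ennreal (neg_part mx) * indicator B (X t \<omega>) = 0"
            by (cases "X t \<omega> \<in> B") (simp_all add: neg_part_def)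
          then show "ennreal (neg_part mx) * indicator B (X t \<omega>) \<le> ennreal (c * h) * indicator (E m) \<omega>"
            by (rule ord_eq_le_trans) simp
        qed
      qed
    qed
    also have "\<dots> = ennreal (c * h) * emeasure M (E m)" by (simp add: nn_integral_cmult)
    finally have "a \<le> ennreal (1 / h) * (ennreal (c * h) * emeasure M (E m))" by (simp add: mult_left_mono)
    also have "\<dots> = ennreal (1 / h * (c * h)) * emeasure M (E m)"
      using h c by (simp add: mult.assoc[symmetric] ennreal_mult''[symmetric])
    also have "1 / h * (c * h) = c" using h by simp
    finally show ?thesis .
  qed
  have "decseq E"
  proof (rule decseq_SucI, rule subsetI)
    fix m \<omega> assume w: "\<omega> \<in> E (Suc m)"
    have "X (real j * t / 2 ^ m) \<omega> < 0" if j: "j \<in> {1..2 ^ m}" for j :: nat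
    proof -
      have "2 * j \<in> {1..2 ^ Suc m}" using j by auto
      then have "X (real (2 * j) * t / 2 ^ Suc m) \<omega> < 0" using w unfolding E_def by blast
      then show ?thesis by simp
    qed
    then show "\<omega> \<in> E m" using w unfolding E_def by blast
  qed
  then have "(\<lambda>m. emeasure M (E m)) \<longlonglongrightarrow> emeasure M (\<Inter>m. E m)"
    by (intro Lim_emeasure_decseq) (auto simp: emeasure_eq_measure)
  then have "(\<lambda>m. ennreal c * emeasure M (E m)) \<longlonglongrightarrow> ennreal c * emeasure M (\<Inter>m. E m)"
    by (intro tendsto_mult_ennreal tendsto_const) (auto simp: emeasure_eq_measure)
  then have "a \<le> ennreal c * emeasure M (\<Inter>m. E m)" using le by (intro LIMSEQ_le_const) auto
  also have "emeasure M (\<Inter>m. E m) \<le> emeasure M {\<omega>\<in>space M. (SUP u\<in>{0..t}. X u \<omega>) = 0 \<and> X t \<omega> \<in> B}"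
  proof (rule emeasure_mono_AE)
    show "AE \<omega> in M. \<omega> \<in> (\<Inter>m. E m) \<longrightarrow> \<omega> \<in> {\<omega>\<in>space M. (SUP u\<in>{0..t}. X u \<omega>) = 0 \<and> X t \<omega> \<in> B}"
      using SUP_ge_0 X_0 AE_space
    proof eventually_elim
      case (elim \<omega>)
      show ?case
      proof
        assume w: "\<omega> \<in> (\<Inter>m. E m)"
        have "(SUP u\<in>{0..t}. X u \<omega>) \<le> 0"
        proof (rule nonpositive_at_dyadics_imp_SUP_le_0)
          fix m j :: nat assume "j \<in> {1..2 ^ m}"
          then show "X (real j * t / 2 ^ m) \<omega> \<le> 0" using w unfolding E_def by (blast intro: less_imp_le)
        qed (use elim t in auto)
        then show "\<omega> \<in> {\<omega>\<in>space M. (SUP u\<in>{0..t}. X u \<omega>) = 0 \<and> X t \<omega> \<in> B}"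
          using elim t w unfolding E_def by (auto intro!: antisym)
      qed
    qed
  qed measurable
  finally show ?thesis unfolding a_def by (simp add: mult_left_mono)
qed

text \<open>The reverse inequality, for the total mass only: in \<open>first_step_bound\<close>
  without restrictions, the expected negative part of the first step times the number of steps tends
  to \<open>c * t\<close>.\<close>

lemma prob_SUP_eq_0_le_neg_part:
  assumes t: "0 < t"
  shows "ennreal c * emeasure M {\<omega>\<in>space M. (SUP u\<in>{0..t}. X u \<omega>) = 0} \<le> (\<integral>\<^sup>+\<omega>. ennreal (neg_part (X t \<omega>) / t) \<partial>M)"
proof -
  note [measurable] = X_measurable[OF less_imp_le[OF t]] SUP_measurable[OF less_imp_le[OF t]]
  define P where "P = emeasure M {\<omega>\<in>space M. (SUP u\<in>{0..t}. X u \<omega>) = 0}"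
  define J where "J = (\<integral>\<^sup>+\<omega>. ennreal (neg_part (X t \<omega>)) \<partial>M)"
  have scale: "(\<integral>\<^sup>+\<omega>. ennreal (neg_part (X t \<omega>) / r) \<partial>M) = ennreal (1 / r) * J" if "0 < r" for r
  proof -
    have "ennreal (1 / r * neg_part x) = ennreal (1 / r) * ennreal (neg_part x)" for x
      using that by (intro ennreal_mult) (auto simp: neg_part_def)
    then have "(\<integral>\<^sup>+\<omega>. ennreal (neg_part (X t \<omega>) / r) \<partial>M) = (\<integral>\<^sup>+\<omega>. ennreal (1 / r) * ennreal (neg_part (X t \<omega>)) \<partial>M)" by (simp add: field_simps)
    also have "\<dots> = ennreal (1 / r) * J" unfolding J_def neg_part_def by (rule nn_integral_cmult) measurable
    finally show ?thesis .
  qed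
  have "ennreal (2 ^ m) * (\<integral>\<^sup>+\<omega>. ennreal (neg_part (X (t / 2 ^ m) \<omega>)) \<partial>M) * P \<le> J" for m
  proof -
    define h where "h = t / 2 ^ m"
    have h: "0 < h" "h \<le> t" using t by (auto simp: h_def field_simps)
    have [measurable]: "(\<lambda>\<omega>. SUP u\<in>{0..t - h}. X u \<omega>) \<in> borel_measurable M"
      using h by (intro SUP_measurable) simp
    have "P \<le> emeasure M {\<omega>\<in>space M. (SUP u\<in>{0..t - h}. X u \<omega>) \<le> 0 \<and> X (t - h) \<omega> \<in> UNIV}"
      unfolding P_def
    proof (rule emeasure_mono)
      show "{\<omega>\<in>space M. (SUP u\<in>{0..t - h}. X u \<omega>) \<le> 0 \<and> X (t - h) \<omega> \<in> UNIV} \<in> sets M"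
        using h by simp
      show "{\<omega>\<in>space M. (SUP u\<in>{0..t}. X u \<omega>) = 0} \<subseteq> {\<omega>\<in>space M. (SUP u\<in>{0..t - h}. X u \<omega>) \<le> 0 \<and> X (t - h) \<omega> \<in> UNIV}"
      proof
        fix \<omega> assume w: "\<omega> \<in> {\<omega>\<in>space M. (SUP u\<in>{0..t}. X u \<omega>) = 0}"
        then have "(SUP u\<in>{0..t - h}. X u \<omega>) \<le> (SUP u\<in>{0..t}. X u \<omega>)"
          using h by (intro cSUP_subset_mono cadlag_bdd path) auto
        then show "\<omega> \<in> {\<omega>\<in>space M. (SUP u\<in>{0..t - h}. X u \<omega>) \<le> 0 \<and> X (t - h) \<omega> \<in> UNIV}" using w by simp
      qed
    qed
    then have "(\<integral>\<^sup>+\<omega>. ennreal (neg_part (X h \<omega>)) \<partial>M) * P \<le> (\<integral>\<^sup>+\<omega>. ennreal (neg_part (X h \<omega>)) \<partial>M) *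
        emeasure M {\<omega>\<in>space M. (SUP u\<in>{0..t - h}. X u \<omega>) \<le> 0 \<and> X (t - h) \<omega> \<in> UNIV}"
      by (rule mult_left_mono) simp
    also have "\<dots> \<le> (\<integral>\<^sup>+\<omega>. ennreal (neg_part (X t \<omega>) / real (2 ^ m)) \<partial>M)"
      using first_step_bound[OF t, of "2 ^ m" UNIV UNIV UNIV] by (simp add: h_def)
    also have "\<dots> = ennreal (1 / 2 ^ m) * J" by (subst scale) auto
    finally have "ennreal (2 ^ m) * ((\<integral>\<^sup>+\<omega>. ennreal (neg_part (X h \<omega>)) \<partial>M) * P) \<le> ennreal (2 ^ m) * (ennreal (1 / 2 ^ m) * J)"
      by (rule mult_left_mono) simp
    also have "\<dots> = ennreal (2 ^ m * (1 / 2 ^ m)) * J" by (simp only: mult.assoc[symmetric] ennreal_mult'' zero_le_divide_1_iff zero_le_power zero_le_numeral)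
    finally show ?thesis by (simp add: h_def mult.assoc)
  qed
  moreover have "(\<lambda>m. ennreal (2 ^ m) * (\<integral>\<^sup>+\<omega>. ennreal (neg_part (X (t / 2 ^ m) \<omega>)) \<partial>M) * P) \<longlonglongrightarrow> ennreal (c * t) * P"
    by (intro tendsto_mult_ennreal neg_part_rate[OF drift c t] tendsto_const) (auto simp: P_def emeasure_eq_measure)
  ultimately have "ennreal (c * t) * P \<le> J" by (intro LIMSEQ_le_const2) auto
  then have "ennreal (1 / t) * (ennreal (c * t) * P) \<le> ennreal (1 / t) * J" by (rule mult_left_mono) simp
  moreover have "ennreal (1 / t) * (ennreal (c * t) * P) = ennreal (1 / t * (c * t)) * P"
    using t c by (simp add: mult.assoc[symmetric] ennreal_mult''[symmetric])
  moreover have "1 / t * (c * t) = c" using t by simp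
  ultimately show ?thesis unfolding scale[OF t] P_def by simp
qed

text \<open>One inequality holds for \<open>B\<close> and for its complement, the opposite one for
  their union. The masses are finite, so a strict inequality on either set is impossible.\<close>

lemma prob_SUP_eq_0:
  assumes t: "0 < t" and B [measurable]: "B \<in> sets borel"
  shows "ennreal c * emeasure M {\<omega>\<in>space M. (SUP u\<in>{0..t}. X u \<omega>) = 0 \<and> X t \<omega> \<in> B} =
    (\<integral>\<^sup>+\<omega>. ennreal (neg_part (X t \<omega>) / t) * indicator B (X t \<omega>) \<partial>M)"
proof (rule antisym)
  note [measurable] = X_measurable[OF less_imp_le[OF t]] SUP_measurable[OF less_imp_le[OF t]]
  define d where "d B = ennreal c * emeasure M {\<omega>\<in>space M. (SUP u\<in>{0..t}. X u \<omega>) = 0 \<and> X t \<omega> \<in> B}" for B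
  define a where "a B = (\<integral>\<^sup>+\<omega>. ennreal (neg_part (X t \<omega>) / t) * indicator B (X t \<omega>) \<partial>M)" for B
  have "d B + d (- B) = ennreal c * emeasure M {\<omega>\<in>space M. (SUP u\<in>{0..t}. X u \<omega>) = 0}"
    unfolding d_def distrib_left[symmetric]
    by (subst plus_emeasure) (auto intro!: arg_cong2[where f = "(*)"] arg_cong2[where f = emeasure])
  also have "\<dots> \<le> (\<integral>\<^sup>+\<omega>. ennreal (neg_part (X t \<omega>) / t) \<partial>M)" by (rule prob_SUP_eq_0_le_neg_part[OF t])
  also have "\<dots> = a B + a (- B)"
    unfolding a_def neg_part_def
    by (subst nn_integral_add[symmetric]) (auto intro!: nn_integral_cong simp: indicator_def)
  also have "\<dots> \<le> a B + d (- B)"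
    unfolding a_def d_def by (intro add_left_mono neg_part_le_prob_SUP_eq_0 t) simp
  finally have "d (- B) + d B \<le> d (- B) + a B" by (simp add: add.commute)
  moreover have "d (- B) \<noteq> \<top>" unfolding d_def by (auto simp: emeasure_eq_measure ennreal_mult_eq_top_iff)
  ultimately have "d B \<le> a B" by (simp add: ennreal_add_left_cancel_le)
  then show "ennreal c * emeasure M {\<omega>\<in>space M. (SUP u\<in>{0..t}. X u \<omega>) = 0 \<and> X t \<omega> \<in> B} \<le>
    (\<integral>\<^sup>+\<omega>. ennreal (neg_part (X t \<omega>) / t) * indicator B (X t \<omega>) \<partial>M)" unfolding a_def d_def .
qed (rule neg_part_le_prob_SUP_eq_0[OF assms])

text \<open>If \<open>X t\<close> were almost surely nonnegative, so would be \<open>X\<close> at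
  all times \<open>t / 2 ^ m\<close>, and the limit in \<open>neg_part_rate\<close> would be 0
  instead of \<open>c * t\<close>.\<close>

lemma prob_neg_positive:
  assumes t: "0 < t"
  shows "emeasure M {\<omega>\<in>space M. X t \<omega> < 0} \<noteq> 0"
proof
  assume 0: "emeasure M {\<omega>\<in>space M. X t \<omega> < 0} = 0"
  have null: "emeasure M {\<omega>\<in>space M. X (t / 2 ^ m) \<omega> < 0} = 0" for m
  proof (induction m)
    case (Suc m)
    have "2 * (t / 2 ^ Suc m) = t / 2 ^ m" by simp
    then show ?case using prob_neg_double[of "t / 2 ^ Suc m"] Suc t by (simp del: power_Suc)
  qed (use 0 in simp)
  have "(\<integral>\<^sup>+\<omega>. ennreal (neg_part (X (t / 2 ^ m) \<omega>)) \<partial>M) = 0" for m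
  proof -
    have [measurable]: "X (t / 2 ^ m) \<in> borel_measurable M" using t by (intro X_measurable) simp
    have "AE \<omega> in M. \<not> X (t / 2 ^ m) \<omega> < 0"
      by (rule AE_I[OF _ null[of m]]) auto
    then have "(\<integral>\<^sup>+\<omega>. ennreal (neg_part (X (t / 2 ^ m) \<omega>)) \<partial>M) = (\<integral>\<^sup>+\<omega>. 0 \<partial>M)"
    proof (intro nn_integral_cong_AE, eventually_elim)
      case (elim \<omega>)
      then show ?case by (simp add: neg_part_def)
    qed
    then show ?thesis by simp
  qed
  then have "(\<lambda>m::nat. 0) \<longlonglongrightarrow> ennreal (c * t)" using neg_part_rate[OF drift c t] by simp
  then have "ennreal (c * t) = 0" by (rule LIMSEQ_unique[OF _ tendsto_const])
  then show False using c t by simp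
qed

lemma prob_SUP_eq_0_positive:
  assumes t: "0 \<le> t"
  shows "0 < emeasure M {\<omega>\<in>space M. (SUP u\<in>{0..t}. X u \<omega>) = 0}"
proof (cases "t = 0")
  case True
  have "{\<omega>\<in>space M. X 0 \<omega> = 0} \<in> sets M" using X_measurable[of 0] by measurable
  then have "emeasure M {\<omega>\<in>space M. X 0 \<omega> = 0} = 1" using X_0 by (intro emeasure_eq_1_AE) auto
  then show ?thesis using True by simp
next
  case False
  then have t: "0 < t" using t by simp
  note [measurable] = X_measurable[OF less_imp_le[OF t]]
  have "(\<integral>\<^sup>+\<omega>. ennreal (neg_part (X t \<omega>) / t) * indicator UNIV (X t \<omega>) \<partial>M) \<noteq> 0"
  proof
    assume "(\<integral>\<^sup>+\<omega>. ennreal (neg_part (X t \<omega>) / t) * indicator UNIV (X t \<omega>) \<partial>M) = 0"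
    then have "AE \<omega> in M. ennreal (neg_part (X t \<omega>) / t) * indicator UNIV (X t \<omega>) = 0"
      by (subst (asm) nn_integral_0_iff_AE) (auto simp: neg_part_def)
    then have "AE \<omega> in M. \<not> X t \<omega> < 0"
    proof eventually_elim
      case (elim \<omega>)
      then show ?case using t by (auto simp: neg_part_def divide_le_0_iff max_def split: if_splits)
    qed
    then have "emeasure M {\<omega>\<in>space M. X t \<omega> < 0} = 0" by (intro emeasure_eq_0_AE)
    then show False using prob_neg_positive[OF t] by simp
  qed
  then have "emeasure M {\<omega>\<in>space M. (SUP u\<in>{0..t}. X u \<omega>) = 0 \<and> X t \<omega> \<in> UNIV} \<noteq> 0"
    using prob_SUP_eq_0[OF t, of UNIV] by auto
  then show ?thesis by (simp add: zero_less_iff_neq_zero)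
qed

end

end

section \<open>Bounded variation\<close>

text \<open>A linear upper bound on \<open>[0, e]\<close> whose slope tends to the true slope
  \<open>-1\<close> as \<open>e\<close> shrinks. It lets expectations of small summands control
  their Laplace transforms.\<close>

lemma exp_le_one_minus:
  fixes x e :: real
  assumes "0 \<le> x" "x \<le> e"
  shows "exp (- x) \<le> 1 - x / (1 + e)"
proof -
  have "exp (- x) \<le> 1 / (1 + x)"
    using exp_ge_add_one_self[of x] assms by (simp add: exp_minus field_simps)
  also have "\<dots> = 1 - x / (1 + x)" using assms by (simp add: field_simps)
  also have "\<dots> \<le> 1 - x / (1 + e)" using assms by (simp add: frac_le)
  finally show ?thesis .
qed

lemma exp_eq_add_one_iff: "exp x = 1 + x \<longleftrightarrow> x = (0::real)"
proof
  assume "exp x = 1 + x"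
  then have "ln (exp x) = exp x - 1" using ln_exp[of x] by linarith
  then have "exp x = 1" by (intro ln_eq_minus_one) auto
  then show "x = 0" by simp
qed simp

text \<open>Equality in Jensen's inequality for \<open>exp (- x)\<close>: the graph lies above its
  tangent at the mean and touches it only there.\<close>

lemma (in prob_space) AE_eq_expectation_of_exp:
  assumes [measurable]: "D \<in> borel_measurable M" and nonneg: "AE \<omega> in M. 0 \<le> D \<omega>"
    and D: "(\<integral>\<^sup>+\<omega>. ennreal (D \<omega>) \<partial>M) = ennreal r" and r: "0 \<le> r"
    and le: "(\<integral>\<^sup>+\<omega>. ennreal (exp (- D \<omega>)) \<partial>M) \<le> ennreal (exp (- r))"
  shows "AE \<omega> in M. D \<omega> = r"
proof -
  have iD: "integrable M D"
    using D nonneg by (intro integrableI_nonneg) auto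
  have ED: "expectation D = r"
    using D nonneg r by (intro integral_eq_nn_integral[THEN trans]) auto
  have iE: "integrable M (\<lambda>\<omega>. exp (- D \<omega>))"
    using le by (intro integrableI_nonneg) (auto simp: less_top[symmetric] top_unique)
  have EE: "expectation (\<lambda>\<omega>. exp (- D \<omega>)) \<le> exp (- r)"
    using le by (subst integral_eq_nn_integral) (auto intro!: enn2real_leI)
  \<comment> \<open>The distance of \<open>exp (- D)\<close> from the tangent at \<open>r\<close>;
    it is nonnegative, and the hypotheses make its expectation at most 0.\<close>
  define G where "G \<omega> = exp (- D \<omega>) - exp (- r) * (1 + (r - D \<omega>))" for \<omega>
  have GE: "G \<omega> = exp (- r) * (exp (r - D \<omega>) - (1 + (r - D \<omega>)))" for \<omega>
    by (simp add: G_def algebra_simps flip: exp_add)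
  have G0: "0 \<le> G \<omega>" for \<omega>
    unfolding GE using exp_ge_add_one_self[of "r - D \<omega>"] by (intro mult_nonneg_nonneg) auto
  have iG: "integrable M G"
    unfolding G_def using iD iE by auto
  have "expectation G = expectation (\<lambda>\<omega>. exp (- D \<omega>)) - exp (- r)"
    unfolding G_def using iD iE by (simp add: ED prob_space)
  then have "expectation G \<le> 0" using EE by simp
  moreover have "0 \<le> expectation G" using G0 by simp
  ultimately have "AE \<omega> in M. G \<omega> = 0"
    using integral_nonneg_eq_0_iff_AE[OF iG] G0 by simp
  then show ?thesis
  proof eventually_elim
    case (elim \<omega>)
    then show ?case using exp_eq_add_one_iff[of "r - D \<omega>"] by (simp add: GE)
  qed
qed

section \<open>Sums over the increments of a grid and their Laplace transforms\<close>

context levy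
begin

definition vsum :: "(real \<Rightarrow> real) \<Rightarrow> real \<Rightarrow> real \<Rightarrow> nat \<Rightarrow> 'a \<Rightarrow> real" where
  "vsum \<phi> a \<tau> m \<omega> = (\<Sum>k<2 ^ m. \<phi> (X (a + real (Suc k) * \<tau> / 2 ^ m) \<omega> - X (a + real k * \<tau> / 2 ^ m) \<omega>))"

text \<open>The value of \<open>E[exp (- vsum)]\<close>, by independence a power of a one-step
  transform. It is written without the left end point \<open>a\<close>, on which it does not
  depend.\<close>

definition laplace :: "(real \<Rightarrow> real) \<Rightarrow> real \<Rightarrow> nat \<Rightarrow> ennreal" where
  "laplace \<phi> \<tau> m = (\<integral>\<^sup>+\<omega>. ennreal (exp (- \<phi> (X (\<tau> / 2 ^ m) \<omega>))) \<partial>M) ^ (2 ^ m)"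

lemma vsum_measurable [measurable]:
  assumes [measurable]: "\<phi> \<in> borel_measurable borel" and "0 \<le> a" "0 \<le> \<tau>"
  shows "vsum \<phi> a \<tau> m \<in> borel_measurable M"
proof -
  have [measurable]: "X (a + real k * \<tau> / 2 ^ m) \<in> borel_measurable M" for k :: nat
    using assms by (intro X_measurable) auto
  show ?thesis unfolding vsum_def by measurable
qed

lemma nn_integral_exp_vsum:
  assumes [measurable]: "\<phi> \<in> borel_measurable borel" and a: "0 \<le> a" and \<tau>: "0 \<le> \<tau>"
  shows "(\<integral>\<^sup>+\<omega>. ennreal (exp (- vsum \<phi> a \<tau> m \<omega>)) \<partial>M) = laplace \<phi> \<tau> m"
proof -
  define h where "h = \<tau> / 2 ^ m"
  have h: "0 \<le> h" using \<tau> by (simp add: h_def)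
  define \<Delta> where "\<Delta> k \<omega> = X (a + real (Suc k) * h) \<omega> - X (a + real k * h) \<omega>" for k \<omega>
  have "(\<integral>\<^sup>+\<omega>. ennreal (exp (- vsum \<phi> a \<tau> m \<omega>)) \<partial>M) = (\<integral>\<^sup>+\<omega>. (\<Prod>k<2 ^ m. ennreal (exp (- \<phi> (\<Delta> k \<omega>)))) \<partial>M)"
    by (intro nn_integral_cong) (simp add: vsum_def \<Delta>_def h_def prod_ennreal exp_sum sum_negf[symmetric] del: of_nat_Suc)
  also have "\<dots> = (\<Prod>k<2 ^ m. \<integral>\<^sup>+\<omega>. ennreal (exp (- \<phi> (\<Delta> k \<omega>))) \<partial>M)"
  proof (rule indep_vars_nn_integral)
    show "indep_vars (\<lambda>_. borel) (\<lambda>k \<omega>. ennreal (exp (- \<phi> (\<Delta> k \<omega>)))) {..<2 ^ m}"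
      unfolding \<Delta>_def by (rule indep_vars_compose2[OF indep_incs[OF a h], where Y = "\<lambda>_ x. ennreal (exp (- \<phi> x))"]) measurable
  qed auto
  also have "\<dots> = (\<Prod>k<(2::nat) ^ m. \<integral>\<^sup>+\<omega>. ennreal (exp (- \<phi> (X h \<omega>))) \<partial>M)"
  proof (rule prod.cong[OF refl])
    fix k :: nat
    have k: "0 \<le> a + real k * h" using a h by simp
    have [measurable]: "X (a + real k * h) \<in> borel_measurable M" "X (a + real k * h + h) \<in> borel_measurable M" "X h \<in> borel_measurable M"
      using k h by (auto intro!: X_measurable)
    have "(\<integral>\<^sup>+\<omega>. ennreal (exp (- \<phi> (\<Delta> k \<omega>))) \<partial>M) = (\<integral>\<^sup>+\<omega>. ennreal (exp (- \<phi> (X (a + real k * h + h) \<omega> - X (a + real k * h) \<omega>))) \<partial>M)"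
      by (simp add: \<Delta>_def algebra_simps)
    also have "\<dots> = (\<integral>\<^sup>+x. ennreal (exp (- \<phi> x)) \<partial>distr M borel (\<lambda>\<omega>. X (a + real k * h + h) \<omega> - X (a + real k * h) \<omega>))"
      by (rule nn_integral_distr[symmetric]) measurable
    also have "\<dots> = (\<integral>\<^sup>+\<omega>. ennreal (exp (- \<phi> (X h \<omega>))) \<partial>M)"
      unfolding stationary[OF k h] by (rule nn_integral_distr) measurable
    finally show "(\<integral>\<^sup>+\<omega>. ennreal (exp (- \<phi> (\<Delta> k \<omega>))) \<partial>M) = (\<integral>\<^sup>+\<omega>. ennreal (exp (- \<phi> (X h \<omega>))) \<partial>M)" .
  qed
  also have "\<dots> = laplace \<phi> \<tau> m" by (simp add: laplace_def h_def)
  finally show ?thesis .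
qed

lemma nn_integral_vsum:
  assumes [measurable]: "\<phi> \<in> borel_measurable borel" and a: "0 \<le> a" and \<tau>: "0 \<le> \<tau>" and \<phi>: "\<And>x. 0 \<le> \<phi> x"
  shows "(\<integral>\<^sup>+\<omega>. ennreal (vsum \<phi> a \<tau> m \<omega>) \<partial>M) = ennreal (2 ^ m) * (\<integral>\<^sup>+\<omega>. ennreal (\<phi> (X (\<tau> / 2 ^ m) \<omega>)) \<partial>M)"
proof -
  define h where "h = \<tau> / 2 ^ m"
  have h: "0 \<le> h" using \<tau> by (simp add: h_def)
  have [measurable]: "X (a + real k * h) \<in> borel_measurable M" for k :: nat
    using a h by (intro X_measurable) auto
  have "(\<integral>\<^sup>+\<omega>. ennreal (vsum \<phi> a \<tau> m \<omega>) \<partial>M) =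
      (\<integral>\<^sup>+\<omega>. (\<Sum>k<2 ^ m. ennreal (\<phi> (X (a + real (Suc k) * h) \<omega> - X (a + real k * h) \<omega>))) \<partial>M)"
    using \<phi> by (intro nn_integral_cong) (simp add: vsum_def h_def sum_ennreal del: of_nat_Suc)
  also have "\<dots> = (\<Sum>k<(2::nat) ^ m. \<integral>\<^sup>+\<omega>. ennreal (\<phi> (X (a + real (Suc k) * h) \<omega> - X (a + real k * h) \<omega>)) \<partial>M)"
    by (rule nn_integral_sum) measurable
  also have "\<dots> = (\<Sum>k<(2::nat) ^ m. \<integral>\<^sup>+\<omega>. ennreal (\<phi> (X h \<omega>)) \<partial>M)"
  proof (rule sum.cong[OF refl])
    fix k :: nat
    have k: "0 \<le> a + real k * h" using a h by simp
    have [measurable]: "X (a + real k * h + h) \<in> borel_measurable M" "X h \<in> borel_measurable M"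
      using k h by (auto intro!: X_measurable)
    have "(\<integral>\<^sup>+\<omega>. ennreal (\<phi> (X (a + real (Suc k) * h) \<omega> - X (a + real k * h) \<omega>)) \<partial>M) =
      (\<integral>\<^sup>+\<omega>. ennreal (\<phi> (X (a + real k * h + h) \<omega> - X (a + real k * h) \<omega>)) \<partial>M)"
      by (simp add: algebra_simps)
    also have "\<dots> = (\<integral>\<^sup>+x. ennreal (\<phi> x) \<partial>distr M borel (\<lambda>\<omega>. X (a + real k * h + h) \<omega> - X (a + real k * h) \<omega>))"
      by (rule nn_integral_distr[symmetric]) measurable
    also have "\<dots> = (\<integral>\<^sup>+\<omega>. ennreal (\<phi> (X h \<omega>)) \<partial>M)"
      unfolding stationary[OF k h] by (rule nn_integral_distr) measurable
    finally show "(\<integral>\<^sup>+\<omega>. ennreal (\<phi> (X (a + real (Suc k) * h) \<omega> - X (a + real k * h) \<omega>)) \<partial>M) = (\<integral>\<^sup>+\<omega>. ennreal (\<phi> (X h \<omega>)) \<partial>M)" .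
  qed
  also have "\<dots> = ennreal (2 ^ m) * (\<integral>\<^sup>+\<omega>. ennreal (\<phi> (X h \<omega>)) \<partial>M)"
    by (simp flip: ennreal_of_nat_eq_real_of_nat add: ennreal_power[symmetric])
  finally show ?thesis by (simp add: h_def)
qed

text \<open>For one summand, \<open>exp (- x)\<close> is at most \<open>1 - x / (1 + e)\<close>;
  after taking expectations, \<open>1 - y\<close> is at most \<open>exp (- y)\<close>. Raising this
  to the number of steps rebuilds the expectation of the whole sum in the exponent.\<close>

lemma laplace_le:
  assumes [measurable]: "\<phi> \<in> borel_measurable borel" and a: "0 \<le> a" and \<tau>: "0 \<le> \<tau>"
    and \<phi>: "\<And>x. 0 \<le> \<phi> x" "\<And>x. \<phi> x \<le> e" and r: "0 \<le> r" "ennreal r \<le> (\<integral>\<^sup>+\<omega>. ennreal (vsum \<phi> a \<tau> m \<omega>) \<partial>M)"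
  shows "laplace \<phi> \<tau> m \<le> ennreal (exp (- r / (1 + e)))"
proof -
  define Z where "Z \<omega> = \<phi> (X (\<tau> / 2 ^ m) \<omega>)" for \<omega>
  have e: "0 \<le> e" using \<phi>(1,2)[of 0] by linarith
  have [measurable]: "X (\<tau> / 2 ^ m) \<in> borel_measurable M" using \<tau> by (intro X_measurable) simp
  have Zm [measurable]: "Z \<in> borel_measurable M" unfolding Z_def by measurable
  have Z: "0 \<le> Z \<omega>" "Z \<omega> \<le> e" for \<omega> using \<phi> by (auto simp: Z_def)
  have iZ: "integrable M Z" using Z by (intro integrable_const_bound[where B = e]) auto
  have "ennreal r \<le> ennreal (2 ^ m) * ennreal (expectation Z)"
    using r(2) Z unfolding nn_integral_vsum[OF assms(1) a \<tau> \<phi>(1)] Z_def[symmetric] by (simp add: nn_integral_eq_integral[OF iZ])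
  then have rle: "r \<le> 2 ^ m * expectation Z"
    using Z by (simp add: ennreal_mult''[symmetric] ennreal_le_iff)
  have "expectation (\<lambda>\<omega>. exp (- Z \<omega>)) \<le> expectation (\<lambda>\<omega>. 1 - Z \<omega> / (1 + e))"
  proof (rule integral_mono)
    show "integrable M (\<lambda>\<omega>. exp (- Z \<omega>))" using Z by (intro integrable_const_bound[where B = 1]) auto
    show "integrable M (\<lambda>\<omega>. 1 - Z \<omega> / (1 + e))" using iZ by auto
  qed (rule exp_le_one_minus[OF Z])
  also have "\<dots> = 1 - expectation Z / (1 + e)" using iZ by (simp add: prob_space)
  also have "\<dots> \<le> exp (- (expectation Z / (1 + e)))" using exp_ge_add_one_self[of "- (expectation Z / (1 + e))"] by simp
  finally have "expectation (\<lambda>\<omega>. exp (- Z \<omega>)) \<le> exp (- (expectation Z / (1 + e)))" .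
  then have "(\<integral>\<^sup>+\<omega>. ennreal (exp (- Z \<omega>)) \<partial>M) \<le> ennreal (exp (- (expectation Z / (1 + e))))"
    using Z by (subst nn_integral_eq_integral) (auto intro!: integrable_const_bound[where B = 1] ennreal_leI)
  then have "laplace \<phi> \<tau> m \<le> ennreal (exp (- (expectation Z / (1 + e)))) ^ (2 ^ m)"
    unfolding laplace_def Z_def by (rule power_mono) simp
  also have "\<dots> = ennreal (exp (- (expectation Z / (1 + e))) ^ (2 ^ m))" by (simp add: ennreal_power)
  also have "exp (- (expectation Z / (1 + e))) ^ (2 ^ m) = exp (real (2 ^ m) * (- (expectation Z / (1 + e))))"
    by (rule exp_of_nat_mult[symmetric])
  also have "ennreal \<dots> \<le> ennreal (exp (- r / (1 + e)))"
  proof (intro ennreal_leI, subst exp_le_cancel_iff)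
    have "r / (1 + e) \<le> 2 ^ m * expectation Z / (1 + e)" using rle e by (intro divide_right_mono) auto
    then show "real (2 ^ m) * (- (expectation Z / (1 + e))) \<le> - r / (1 + e)" by simp
  qed
  finally show ?thesis .
qed

text \<open>Expressed through \<open>laplace\<close> alone, so that two blocks of equal length
  visibly have the same constant. Lower limits are used because they exist without any convergence
  being known.\<close>

definition rate :: "(nat \<Rightarrow> real \<Rightarrow> real) \<Rightarrow> real \<Rightarrow> real" where
  "rate \<phi> \<tau> = - ln (enn2real (liminf (\<lambda>k. liminf (\<lambda>m. laplace (\<phi> k) \<tau> m))))"

text \<open>Since the summands are small, the Laplace transform of a sum is almost bounded by the exponential of minus its
  expectation, so that the limit is an equality case of Jensen's inequality. The constant depends on the law of the
  increments only, hence not on the left end \<open>a\<close> of the block.\<close>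

lemma limit_of_small_sums_constant:
  fixes \<phi> :: "nat \<Rightarrow> real \<Rightarrow> real" and D :: "'a \<Rightarrow> real"
  assumes \<phi>m [measurable]: "\<And>k. \<phi> k \<in> borel_measurable borel"
    and \<phi>: "\<And>k x. 0 \<le> \<phi> k x" "\<And>k x. \<phi> k x \<le> 1 / (real k + 1)"
    and a: "0 \<le> a" and \<tau>: "0 \<le> \<tau>" and D0: "AE \<omega> in M. 0 \<le> D \<omega>"
    and lower: "AE \<omega> in M. \<forall>k. \<forall>\<eta>>0. \<forall>\<^sub>F m in sequentially. D \<omega> - \<eta> \<le> vsum (\<phi> k) a \<tau> m \<omega>"
    and upper: "AE \<omega> in M. \<forall>\<eta>>0. \<exists>N. \<forall>k m. vsum (\<phi> k) a \<tau> m \<omega> \<le> real N / (real k + 1) + D \<omega> + \<eta>"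
  shows "AE \<omega> in M. D \<omega> = rate \<phi> \<tau>"
proof -
  note [measurable] = vsum_measurable[OF \<phi>m a \<tau>]
  define Dk where "Dk k \<omega> = liminf (\<lambda>m. ennreal (vsum (\<phi> k) a \<tau> m \<omega>))" for k \<omega>
  \<comment> \<open>No measurability of \<open>D\<close> is assumed; integrals are taken of this
    version, which is almost surely equal to it.\<close>
  define D' where "D' \<omega> = enn2real (liminf (\<lambda>k. Dk k \<omega>))" for \<omega>
  have [measurable]: "Dk k \<in> borel_measurable M" for k unfolding Dk_def by measurable
  have D'm [measurable]: "D' \<in> borel_measurable M" unfolding D'_def by measurable
  \<comment> \<open>An infimum over \<open>m\<close>, so that its integral is below
    \<open>laplace (\<phi> k) \<tau> m\<close> for every \<open>m\<close>, while for large
    \<open>k\<close> it is still close to \<open>exp (- D)\<close> from below.\<close>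
  define G where "G k \<omega> = (INF m. ennreal (exp (- vsum (\<phi> k) a \<tau> m \<omega>)))" for k \<omega>
  have [measurable]: "G k \<in> borel_measurable M" for k unfolding G_def by measurable
  have path: "AE \<omega> in M. D' \<omega> = D \<omega> \<and> 0 \<le> D' \<omega> \<and> (\<forall>k. ennreal (D \<omega>) \<le> Dk k \<omega>) \<and> ennreal (exp (- D \<omega>)) \<le> liminf (\<lambda>k. G k \<omega>)"
    using D0 lower upper
  proof eventually_elim
    case (elim \<omega>)
    have small: "\<forall>\<^sub>F k in sequentially. \<forall>m. vsum (\<phi> k) a \<tau> m \<omega> \<le> D \<omega> + \<eta>" if \<eta>: "0 < \<eta>" for \<eta>
    proof -
      obtain N where N: "\<And>k m. vsum (\<phi> k) a \<tau> m \<omega> \<le> real N / (real k + 1) + D \<omega> + \<eta> / 2"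
        using elim(3) \<eta> by (meson half_gt_zero)
      have "(\<lambda>k. real N / (real k + 1)) \<longlonglongrightarrow> 0" by real_asymp
      then have "\<forall>\<^sub>F k in sequentially. real N / (real k + 1) < \<eta> / 2" using \<eta> by (intro order_tendstoD(2)) auto
      then show ?thesis
      proof eventually_elim
        case (elim k)
        show ?case
        proof
          fix m show "vsum (\<phi> k) a \<tau> m \<omega> \<le> D \<omega> + \<eta>" using N[of k m] elim by linarith
        qed
      qed
    qed
    have Dk: "ennreal (D \<omega>) \<le> Dk k \<omega>" for k
      unfolding Dk_def le_Liminf_iff
    proof (intro allI impI)
      fix y assume y: "y < ennreal (D \<omega>)"
      then obtain s where s: "y = ennreal s" "0 \<le> s" by (cases y) auto
      then have sD: "s < D \<omega>" using y by (simp add: ennreal_less_iff)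
      have "\<forall>\<^sub>F m in sequentially. D \<omega> - (D \<omega> - s) / 2 \<le> vsum (\<phi> k) a \<tau> m \<omega>" using elim(2) sD by simp
      then show "\<forall>\<^sub>F m in sequentially. y < ennreal (vsum (\<phi> k) a \<tau> m \<omega>)"
      proof eventually_elim
        case (elim m)
        then have "s < vsum (\<phi> k) a \<tau> m \<omega>" using sD by (simp add: field_simps)
        then show ?case using s by (simp add: ennreal_less_iff)
      qed
    qed
    have "liminf (\<lambda>k. Dk k \<omega>) \<le> ennreal (D \<omega>)"
    proof (rule ennreal_le_epsilon)
      fix \<eta> :: real assume \<eta>: "0 < \<eta>"
      have "\<forall>\<^sub>F k in sequentially. Dk k \<omega> \<le> ennreal (D \<omega>) + ennreal \<eta>"
        using small[OF \<eta>]
      proof eventually_elim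
        case (elim k)
        then show ?case unfolding Dk_def
          using \<eta> \<open>0 \<le> D \<omega>\<close> by (intro Liminf_le) (auto simp flip: ennreal_plus intro!: always_eventually ennreal_leI)
      qed
      then show "liminf (\<lambda>k. Dk k \<omega>) \<le> ennreal (D \<omega>) + ennreal \<eta>" by (intro Liminf_le) auto
    qed
    moreover have "ennreal (D \<omega>) \<le> liminf (\<lambda>k. Dk k \<omega>)" using Dk by (intro Liminf_bounded) auto
    ultimately have "liminf (\<lambda>k. Dk k \<omega>) = ennreal (D \<omega>)" by (rule antisym)
    then have D': "D' \<omega> = D \<omega>" using elim by (simp add: D'_def)
    have lim: "(\<lambda>k. ennreal (exp (- (D \<omega> + 1 / (real k + 1))))) \<longlonglongrightarrow> ennreal (exp (- (D \<omega> + 0)))"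
      by (intro tendsto_ennrealI tendsto_exp tendsto_minus tendsto_add tendsto_const) real_asymp
    have "ennreal (exp (- (D \<omega> + 1 / (real j + 1)))) \<le> liminf (\<lambda>k. G k \<omega>)" for j
    proof (rule Liminf_bounded)
      have "0 < 1 / (real j + 1)" by simp
      from small[OF this]
      show "\<forall>\<^sub>F k in sequentially. ennreal (exp (- (D \<omega> + 1 / (real j + 1)))) \<le> G k \<omega>"
      proof eventually_elim
        case (elim k)
        show ?case unfolding G_def
        proof (rule INF_greatest)
          fix m
          show "ennreal (exp (- (D \<omega> + 1 / (real j + 1)))) \<le> ennreal (exp (- vsum (\<phi> k) a \<tau> m \<omega>))"
            using elim[rule_format, of m] by (intro ennreal_leI) simp
        qed
      qed
    qed
    then have "ennreal (exp (- (D \<omega> + 0))) \<le> liminf (\<lambda>k. G k \<omega>)"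
      by (intro LIMSEQ_le_const2[OF lim]) blast
    then show ?case using D' Dk elim by simp
  qed
  have p1: "AE \<omega> in M. D' \<omega> = D \<omega>" using path by eventually_elim blast
  have p2: "AE \<omega> in M. 0 \<le> D' \<omega>" using path by eventually_elim blast
  have p3: "AE \<omega> in M. ennreal (exp (- D' \<omega>)) \<le> liminf (\<lambda>k. G k \<omega>)" using path by eventually_elim metis
  have p4: "AE \<omega> in M. ennreal (D' \<omega>) \<le> Dk k \<omega>" for k using path by eventually_elim metis
  define lap where "lap = liminf (\<lambda>k. liminf (\<lambda>m. laplace (\<phi> k) \<tau> m))"
  have "(\<integral>\<^sup>+\<omega>. ennreal (exp (- D' \<omega>)) \<partial>M) \<le> (\<integral>\<^sup>+\<omega>. liminf (\<lambda>k. G k \<omega>) \<partial>M)"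
    by (rule nn_integral_mono_AE[OF p3])
  also have "\<dots> \<le> liminf (\<lambda>k. \<integral>\<^sup>+\<omega>. G k \<omega> \<partial>M)" by (rule nn_integral_liminf) measurable
  also have "\<dots> \<le> lap"
    unfolding lap_def
  proof (intro Liminf_mono always_eventually allI Liminf_bounded)
    fix k m
    show "(\<integral>\<^sup>+\<omega>. G k \<omega> \<partial>M) \<le> laplace (\<phi> k) \<tau> m"
      unfolding nn_integral_exp_vsum[OF \<phi>m a \<tau>, symmetric] G_def by (intro nn_integral_mono INF_lower) auto
  qed
  finally have exp_le: "(\<integral>\<^sup>+\<omega>. ennreal (exp (- D' \<omega>)) \<partial>M) \<le> lap" .
  \<comment> \<open>Stated for any \<open>r\<close> up to the expectation, so that it applies to the
    expectation itself and also, with \<open>r\<close> unbounded, to exclude an infinite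
    one.\<close>
  have lap_le: "lap \<le> ennreal (exp (- r))" if r: "0 \<le> r" "ennreal r \<le> (\<integral>\<^sup>+\<omega>. ennreal (D' \<omega>) \<partial>M)" for r
  proof -
    have "liminf (\<lambda>m. laplace (\<phi> k) \<tau> m) \<le> ennreal (exp (- (r * real k / (real k + 2))))" for k
    proof (rule Liminf_le)
      \<comment> \<open>Strictly below \<open>r\<close> when \<open>r > 0\<close>, so that Fatou's
        lemma gives the bound for all large \<open>m\<close>. This loss and the factor
        \<open>1 + 1 / (k + 1)\<close> from \<open>laplace_le\<close> combine to
        \<open>k / (k + 2)\<close>, which tends to 1.\<close>
      define s where "s = r * real k / (real k + 1)"
      have s: "0 \<le> s" using r by (simp add: s_def)
      have "\<forall>\<^sub>F m in sequentially. ennreal s \<le> (\<integral>\<^sup>+\<omega>. ennreal (vsum (\<phi> k) a \<tau> m \<omega>) \<partial>M)"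
      proof (cases "s = 0")
        case False
        then have "0 < r" "0 < s" using r s by (auto simp: s_def)
        then have "s < r" by (simp add: s_def field_simps)
        then have "ennreal s < (\<integral>\<^sup>+\<omega>. ennreal (D' \<omega>) \<partial>M)"
          using r(2) s by (meson ennreal_lessI less_le_trans less_imp_le le_less_trans)
        also have "\<dots> \<le> (\<integral>\<^sup>+\<omega>. Dk k \<omega> \<partial>M)"
          by (rule nn_integral_mono_AE[OF p4])
        also have "\<dots> \<le> liminf (\<lambda>m. \<integral>\<^sup>+\<omega>. ennreal (vsum (\<phi> k) a \<tau> m \<omega>) \<partial>M)"
          unfolding Dk_def by (rule nn_integral_liminf) measurable
        finally show ?thesis by (rule eventually_mono[OF less_LiminfD]) simp
      qed simp
      then show "\<forall>\<^sub>F m in sequentially. laplace (\<phi> k) \<tau> m \<le> ennreal (exp (- (r * real k / (real k + 2))))"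
      proof eventually_elim
        case (elim m)
        have "laplace (\<phi> k) \<tau> m \<le> ennreal (exp (- s / (1 + 1 / (real k + 1))))"
          by (rule laplace_le[OF \<phi>m a \<tau> \<phi>(1) \<phi>(2) s elim])
        also have "1 + 1 / (real k + 1) = (real k + 2) / (real k + 1)" by (simp add: field_simps)
        also have "- s / ((real k + 2) / (real k + 1)) = - (r * real k / (real k + 2))" by (simp add: s_def)
        finally show ?case .
      qed
    qed simp
    then have "lap \<le> liminf (\<lambda>k. ennreal (exp (- (r * real k / (real k + 2)))))"
      unfolding lap_def by (intro Liminf_mono always_eventually allI)
    also have "\<dots> = ennreal (exp (- r))"
    proof (intro lim_imp_Liminf tendsto_ennrealI tendsto_exp tendsto_minus)
      show "(\<lambda>k. r * real k / (real k + 2)) \<longlonglongrightarrow> r" by real_asymp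
    qed simp
    finally show ?thesis .
  qed
  \<comment> \<open>An infinite expectation would force \<open>lap = 0\<close>, hence
    \<open>exp (- D') = 0\<close> almost surely.\<close>
  have fin: "(\<integral>\<^sup>+\<omega>. ennreal (D' \<omega>) \<partial>M) \<noteq> \<top>"
  proof
    assume "(\<integral>\<^sup>+\<omega>. ennreal (D' \<omega>) \<partial>M) = \<top>"
    then have "lap \<le> ennreal (exp (- real n))" for n by (intro lap_le) auto
    moreover have "(\<lambda>n. ennreal (exp (- real n))) \<longlonglongrightarrow> ennreal 0"
      by (intro tendsto_ennrealI) real_asymp
    ultimately have "lap \<le> ennreal 0" by (intro LIMSEQ_le_const[of _ "ennreal 0" lap]) auto
    then have "(\<integral>\<^sup>+\<omega>. ennreal (exp (- D' \<omega>)) \<partial>M) = 0" using exp_le by simp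
    then have "AE \<omega> in M. False" by (subst (asm) nn_integral_0_iff_AE) auto
    then show False by simp
  qed
  then obtain r where r: "0 \<le> r" "(\<integral>\<^sup>+\<omega>. ennreal (D' \<omega>) \<partial>M) = ennreal r"
    by (cases "\<integral>\<^sup>+\<omega>. ennreal (D' \<omega>) \<partial>M") auto
  have lapr: "lap \<le> ennreal (exp (- r))" using r by (intro lap_le) auto
  have const: "AE \<omega> in M. D' \<omega> = r"
    by (rule AE_eq_expectation_of_exp[OF D'm p2 r(2,1) order_trans[OF exp_le lapr]])
  have "ennreal (exp (- r)) = (\<integral>\<^sup>+\<omega>. ennreal (exp (- r)) \<partial>M)" by (simp add: emeasure_space_1)
  also have "\<dots> = (\<integral>\<^sup>+\<omega>. ennreal (exp (- D' \<omega>)) \<partial>M)"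
  proof (rule nn_integral_cong_AE)
    show "AE \<omega> in M. ennreal (exp (- r)) = ennreal (exp (- D' \<omega>))" using const by eventually_elim simp
  qed
  finally have "lap = ennreal (exp (- r))" using exp_le lapr by (intro antisym) auto
  then have "rate \<phi> \<tau> = r" unfolding rate_def lap_def[symmetric] by simp
  then show ?thesis using AE_conjI[OF const p1] by (auto elim: eventually_mono)
qed

end

section \<open>Negative variation along dyadic partitions\<close>

definition dyadic_sum :: "(real \<Rightarrow> real) \<Rightarrow> (real \<Rightarrow> real) \<Rightarrow> real \<Rightarrow> real \<Rightarrow> nat \<Rightarrow> real" where
  "dyadic_sum \<phi> f a \<tau> m = (\<Sum>k<2 ^ m. \<phi> (f (a + real (Suc k) * \<tau> / 2 ^ m) - f (a + real k * \<tau> / 2 ^ m)))"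

lemma dyadic_sum_blocks:
  "dyadic_sum \<phi> f a \<tau> (l + m) = (\<Sum>i<2 ^ l. dyadic_sum \<phi> f (a + real i * \<tau> / 2 ^ l) (\<tau> / 2 ^ l) m)"
proof -
  define g where "g k = \<phi> (f (a + real (Suc k) * \<tau> / 2 ^ (l + m)) - f (a + real k * \<tau> / 2 ^ (l + m)))" for k
  have "dyadic_sum \<phi> f a \<tau> (l + m) = sum g {..<2 ^ l * 2 ^ m}"
    by (simp add: dyadic_sum_def g_def power_add)
  also have "\<dots> = (\<Sum>i<2 ^ l. sum g {i * 2 ^ m..<i * 2 ^ m + 2 ^ m})" by (rule sum.nat_group[symmetric])
  also have "\<dots> = (\<Sum>i<2 ^ l. dyadic_sum \<phi> f (a + real i * \<tau> / 2 ^ l) (\<tau> / 2 ^ l) m)"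
  proof (rule sum.cong[OF refl])
    fix i :: nat
    have p: "a + real i * \<tau> / 2 ^ l + real j * (\<tau> / 2 ^ l) / 2 ^ m = a + real (i * 2 ^ m + j) * \<tau> / 2 ^ (l + m)" for j
      by (simp add: power_add field_simps)
    have "sum g {i * 2 ^ m..<i * 2 ^ m + 2 ^ m} = (\<Sum>j<2 ^ m. g (i * 2 ^ m + j))"
      by (simp add: sum.atLeastLessThan_shift_0 atLeast0LessThan)
    then show "sum g {i * 2 ^ m..<i * 2 ^ m + 2 ^ m} = dyadic_sum \<phi> f (a + real i * \<tau> / 2 ^ l) (\<tau> / 2 ^ l) m"
      unfolding dyadic_sum_def p g_def by simp
  qed
  finally show ?thesis .
qed

text \<open>Halving a cell can only increase the sum, since the negative part is
  subadditive.\<close>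

lemma incseq_dyadic_sum_neg_part: "incseq (dyadic_sum neg_part f a \<tau>)"
proof (rule incseq_SucI)
  fix m
  have "dyadic_sum neg_part f a \<tau> m \<le> (\<Sum>i<2 ^ m. dyadic_sum neg_part f (a + real i * \<tau> / 2 ^ m) (\<tau> / 2 ^ m) 1)"
    unfolding dyadic_sum_def[of _ _ a \<tau>]
  proof (rule sum_mono)
    fix i :: nat
    have e: "a + real (Suc i) * \<tau> / 2 ^ m = a + real i * \<tau> / 2 ^ m + \<tau> / 2 ^ m" by (simp add: field_simps)
    define b where "b = a + real i * \<tau> / 2 ^ m"
    show "neg_part (f (a + real (Suc i) * \<tau> / 2 ^ m) - f (a + real i * \<tau> / 2 ^ m)) \<le>
        dyadic_sum neg_part f (a + real i * \<tau> / 2 ^ m) (\<tau> / 2 ^ m) 1"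
      unfolding e b_def[symmetric] dyadic_sum_def by (simp add: lessThan_Suc numeral_2_eq_2 neg_part_def)
  qed
  also have "\<dots> = dyadic_sum neg_part f a \<tau> (m + 1)" by (rule dyadic_sum_blocks[symmetric])
  finally show "dyadic_sum neg_part f a \<tau> m \<le> dyadic_sum neg_part f a \<tau> (Suc m)" by simp
qed

text \<open>A limit over dyadic partitions of the block. The sums increase, so for paths of bounded
  variation it exists and bounds all of them.\<close>

definition neg_variation :: "(real \<Rightarrow> real) \<Rightarrow> real \<Rightarrow> real \<Rightarrow> real" where
  "neg_variation f a \<tau> = lim (dyadic_sum neg_part f a \<tau>)"

lemma neg_variation_LIMSEQ:
  assumes bv: "bounded_variation_on 0 (a + \<tau>) f" and a: "0 \<le> a" and \<tau>: "0 \<le> \<tau>"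
  shows "dyadic_sum neg_part f a \<tau> \<longlonglongrightarrow> neg_variation f a \<tau>" "dyadic_sum neg_part f a \<tau> m \<le> neg_variation f a \<tau>"
proof -
  have inc: "incseq (dyadic_sum neg_part f a \<tau>)" by (rule incseq_dyadic_sum_neg_part)
  obtain K where K: "\<And>n u. incseq u \<Longrightarrow> range u \<subseteq> {0..a + \<tau>} \<Longrightarrow> (\<Sum>i<n. \<bar>f (u (Suc i)) - f (u i)\<bar>) \<le> K"
    using bv unfolding bounded_variation_on_def by blast
  have "dyadic_sum neg_part f a \<tau> m \<le> K" for m
  proof -
    define u where "u i = a + real (min i (2 ^ m)) * \<tau> / 2 ^ m" for i
    have "dyadic_sum neg_part f a \<tau> m \<le> (\<Sum>i<2 ^ m. \<bar>f (u (Suc i)) - f (u i)\<bar>)"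
      unfolding dyadic_sum_def
    proof (rule sum_mono)
      fix i :: nat assume "i \<in> {..<2 ^ m}"
      then have "min (Suc i) (2 ^ m) = Suc i" "min i (2 ^ m) = i" by auto
      then show "neg_part (f (a + real (Suc i) * \<tau> / 2 ^ m) - f (a + real i * \<tau> / 2 ^ m)) \<le> \<bar>f (u (Suc i)) - f (u i)\<bar>"
        unfolding u_def by (simp add: neg_part_def del: of_nat_Suc)
    qed
    also have "\<dots> \<le> K"
    proof (rule K)
      show "incseq u" unfolding u_def incseq_def using \<tau> by (auto intro!: add_left_mono divide_right_mono mult_right_mono)
      show "range u \<subseteq> {0..a + \<tau>}"
      proof
        fix x assume "x \<in> range u"
        then obtain i where i: "x = u i" by auto
        have "real (min i (2 ^ m)) \<le> 2 ^ m" by (simp add: min_le_iff_disj)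
        then have "real (min i (2 ^ m)) * \<tau> \<le> 2 ^ m * \<tau>" using \<tau> by (rule mult_right_mono)
        then have "real (min i (2 ^ m)) * \<tau> / 2 ^ m \<le> \<tau>" by (simp add: divide_le_eq mult.commute)
        moreover have "0 \<le> real (min i (2 ^ m)) * \<tau> / 2 ^ m" using \<tau> by simp
        ultimately show "x \<in> {0..a + \<tau>}" using a unfolding i u_def by simp
      qed
    qed
    finally show ?thesis .
  qed
  then obtain L where L: "dyadic_sum neg_part f a \<tau> \<longlonglongrightarrow> L" "\<forall>m. dyadic_sum neg_part f a \<tau> m \<le> L"
    using incseq_convergent[OF inc] by blast
  then show "dyadic_sum neg_part f a \<tau> \<longlonglongrightarrow> neg_variation f a \<tau>" "dyadic_sum neg_part f a \<tau> m \<le> neg_variation f a \<tau>"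
    unfolding neg_variation_def by (auto simp: limI)
qed

lemma neg_variation_blocks:
  assumes bv: "\<And>t. 0 \<le> t \<Longrightarrow> bounded_variation_on 0 t f"
  shows "neg_variation f 0 1 = (\<Sum>i<2 ^ l. neg_variation f (real i / 2 ^ l) (1 / 2 ^ l))"
proof (rule LIMSEQ_unique)
  show "(\<lambda>m. dyadic_sum neg_part f 0 1 (m + l)) \<longlonglongrightarrow> neg_variation f 0 1"
    by (intro LIMSEQ_ignore_initial_segment neg_variation_LIMSEQ bv) auto
  have "dyadic_sum neg_part f 0 1 (m + l) = (\<Sum>i<2 ^ l. dyadic_sum neg_part f (real i / 2 ^ l) (1 / 2 ^ l) m)" for m
    using dyadic_sum_blocks[of neg_part f 0 1 l m] by (simp add: add.commute)
  then show "(\<lambda>m. dyadic_sum neg_part f 0 1 (m + l)) \<longlonglongrightarrow> (\<Sum>i<2 ^ l. neg_variation f (real i / 2 ^ l) (1 / 2 ^ l))"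
    by (auto intro!: tendsto_sum neg_variation_LIMSEQ bv)
qed

text \<open>On a fine grid no drop exceeds \<open>e\<close>, because there are no negative jumps. So
  truncation, which makes the summands small enough for \<open>limit_of_small_sums_constant\<close>,
  does not change the limit.\<close>

lemma dyadic_sum_neg_part_truncated:
  assumes f: "cadlag f" and jmp: "\<And>s. 0 < s \<Longrightarrow> 0 \<le> jump f s" and a: "0 \<le> a" and \<tau>: "0 \<le> \<tau>" and e: "0 < e"
  shows "\<forall>\<^sub>F m in sequentially. dyadic_sum (\<lambda>x. min (neg_part x) e) f a \<tau> m = dyadic_sum neg_part f a \<tau> m"
proof -
  obtain d where d: "0 < d" "\<And>s u. 0 \<le> s \<Longrightarrow> s \<le> u \<Longrightarrow> u \<le> a + \<tau> \<Longrightarrow> u - s < d \<Longrightarrow> f s - e \<le> f u"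
    by (rule no_negative_jump_imp_small_drops[OF f, of "a + \<tau>" e]) (use jmp e in auto)
  have "(\<lambda>m. \<tau> / 2 ^ m) \<longlonglongrightarrow> 0" by (rule LIMSEQ_divide_realpow_zero) simp
  then have "\<forall>\<^sub>F m in sequentially. \<tau> / 2 ^ m < d" using d(1) by (rule order_tendstoD(2))
  then show ?thesis
  proof eventually_elim
    case (elim m)
    show ?case
      unfolding dyadic_sum_def
    proof (rule sum.cong[OF refl])
      fix k :: nat assume k: "k \<in> {..<2 ^ m}"
      define s where "s = a + real k * \<tau> / 2 ^ m"
      have u: "a + real (Suc k) * \<tau> / 2 ^ m = s + \<tau> / 2 ^ m" by (simp add: s_def field_simps)
      have "real (Suc k) \<le> real (2 ^ m)" using k by (intro of_nat_mono) auto
      then have "real (Suc k) * \<tau> \<le> 2 ^ m * \<tau>" using \<tau> by (intro mult_right_mono) auto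
      then have "real (Suc k) * \<tau> / 2 ^ m \<le> \<tau>" by (simp add: divide_le_eq mult.commute)
      then have "f s - e \<le> f (s + \<tau> / 2 ^ m)"
        using elim a \<tau> u by (intro d) (auto simp: s_def)
      then show "min (neg_part (f (a + real (Suc k) * \<tau> / 2 ^ m) - f (a + real k * \<tau> / 2 ^ m))) e =
        neg_part (f (a + real (Suc k) * \<tau> / 2 ^ m) - f (a + real k * \<tau> / 2 ^ m))"
        unfolding u s_def[symmetric] using e by (simp add: neg_part_def)
    qed
  qed
qed

section \<open>Bounded variation gives a drift\<close>

context levy
begin

lemma vsum_eq_dyadic_sum: "vsum \<phi> a \<tau> m \<omega> = dyadic_sum \<phi> (\<lambda>t. X t \<omega>) a \<tau> m"
  by (simp add: vsum_def dyadic_sum_def)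

lemma add_linear: "levy M (\<lambda>t \<omega>. X t \<omega> + c * t)"
proof
  show "levy_process M (\<lambda>t \<omega>. X t \<omega> + c * t)"
    unfolding levy_process_def
  proof (intro conjI allI impI ballI)
    show "prob_space M" by (rule prob_space_axioms)
    show "AE \<omega> in M. X 0 \<omega> + c * 0 = 0" using X_0 by simp
    show "cadlag (\<lambda>t. X t \<omega> + c * t)" if "\<omega> \<in> space M" for \<omega> using path[OF that] by (rule cadlag_add_linear)
    show "(\<lambda>\<omega>. X t \<omega> + c * t) \<in> borel_measurable M" if "0 \<le> t" for t using that by measurable
  next
    fix n and u :: "nat \<Rightarrow> real" assume u: "incseq u \<and> 0 \<le> u 0"
    have "indep_vars (\<lambda>_. borel) (\<lambda>i \<omega>. (X (u (Suc i)) \<omega> - X (u i) \<omega>) + (c * u (Suc i) - c * u i)) {..<n}"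
      using u by (intro indep_vars_compose2[OF indep_increments, where Y = "\<lambda>i x. x + (c * u (Suc i) - c * u i)"]) auto
    then show "indep_vars (\<lambda>_. borel) (\<lambda>i \<omega>. X (u (Suc i)) \<omega> + c * u (Suc i) - (X (u i) \<omega> + c * u i)) {..<n}"
      by (simp add: algebra_simps)
  next
    fix s h :: real assume sh: "0 \<le> s" "0 \<le> h"
    have [measurable]: "X (s + h) \<in> borel_measurable M" "X s \<in> borel_measurable M" "X h \<in> borel_measurable M"
      using sh by (auto intro!: X_measurable)
    have e: "X (s + h) \<omega> + c * (s + h) - (X s \<omega> + c * s) = X (s + h) \<omega> - X s \<omega> + c * h" for \<omega>
      by (simp add: algebra_simps)
    have "distr M borel (\<lambda>\<omega>. X (s + h) \<omega> + c * (s + h) - (X s \<omega> + c * s)) =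
      distr (distr M borel (\<lambda>\<omega>. X (s + h) \<omega> - X s \<omega>)) borel (\<lambda>x. x + c * h)"
      unfolding e by (subst distr_distr) (auto simp: comp_def)
    also have "\<dots> = distr (distr M borel (X h)) borel (\<lambda>x. x + c * h)" by (simp only: stationary[OF sh])
    also have "\<dots> = distr M borel (\<lambda>\<omega>. X h \<omega> + c * h)" by (subst distr_distr) (auto simp: comp_def)
    finally show "distr M borel (\<lambda>\<omega>. X (s + h) \<omega> + c * (s + h) - (X s \<omega> + c * s)) = distr M borel (\<lambda>\<omega>. X h \<omega> + c * h)" .
  qed
qed

text \<open>The negative variation over a block is a constant depending on its length only; being
  additive, it is \<open>c / 2 ^ l\<close> on blocks of length \<open>1 / 2 ^ l\<close>. It
  dominates the drop over the block, which the term \<open>c * t\<close> therefore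
  compensates.\<close>

lemma bounded_variation_imp_mono:
  assumes jmp: "AE \<omega> in M. \<forall>t>0. 0 \<le> jump (\<lambda>u. X u \<omega>) t" and bv: "bounded_variation M X"
  shows "\<exists>c. AE \<omega> in M. mono_on {0..} (\<lambda>t. X t \<omega> + c * t)"
proof -
  define \<phi> where "\<phi> k x = min (neg_part x) (1 / (real k + 1))" for k :: nat and x
  have bv': "AE \<omega> in M. \<forall>t\<ge>0. bounded_variation_on 0 t (\<lambda>s. X s \<omega>)" using bv by (simp add: bounded_variation_def)
  have const: "AE \<omega> in M. neg_variation (\<lambda>t. X t \<omega>) a \<tau> = rate \<phi> \<tau>" if a: "0 \<le> a" and \<tau>: "0 \<le> \<tau>" for a \<tau>
  proof (rule limit_of_small_sums_constant[OF _ _ _ a \<tau>])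
    show "\<phi> k \<in> borel_measurable borel" for k unfolding \<phi>_def neg_part_def by measurable
    show "0 \<le> \<phi> k x" "\<phi> k x \<le> 1 / (real k + 1)" for k x by (auto simp: \<phi>_def)
    have le: "AE \<omega> in M. \<forall>m. dyadic_sum neg_part (\<lambda>t. X t \<omega>) a \<tau> m \<le> neg_variation (\<lambda>t. X t \<omega>) a \<tau>"
      using bv' by eventually_elim (use a \<tau> in \<open>auto intro!: neg_variation_LIMSEQ(2)\<close>)
    show "AE \<omega> in M. 0 \<le> neg_variation (\<lambda>t. X t \<omega>) a \<tau>"
      using le
    proof eventually_elim
      case (elim \<omega>)
      have "0 \<le> dyadic_sum neg_part (\<lambda>t. X t \<omega>) a \<tau> 0" unfolding dyadic_sum_def by (intro sum_nonneg) simp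
      also have "\<dots> \<le> neg_variation (\<lambda>t. X t \<omega>) a \<tau>" using elim by blast
      finally show ?case .
    qed
    show "AE \<omega> in M. \<forall>k. \<forall>\<eta>>0. \<forall>\<^sub>F m in sequentially. neg_variation (\<lambda>t. X t \<omega>) a \<tau> - \<eta> \<le> vsum (\<phi> k) a \<tau> m \<omega>"
      using bv' jmp AE_space
    proof eventually_elim
      case (elim \<omega>)
      show ?case
      proof (intro allI impI)
        fix k :: nat and \<eta> :: real assume \<eta>: "0 < \<eta>"
        have "dyadic_sum neg_part (\<lambda>t. X t \<omega>) a \<tau> \<longlonglongrightarrow> neg_variation (\<lambda>t. X t \<omega>) a \<tau>"
          using elim(1) a \<tau> by (intro neg_variation_LIMSEQ) auto
        then have "\<forall>\<^sub>F m in sequentially. neg_variation (\<lambda>t. X t \<omega>) a \<tau> - \<eta> < dyadic_sum neg_part (\<lambda>t. X t \<omega>) a \<tau> m"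
          using \<eta> by (intro order_tendstoD(1)) auto
        moreover have "\<forall>\<^sub>F m in sequentially. dyadic_sum (\<phi> k) (\<lambda>t. X t \<omega>) a \<tau> m = dyadic_sum neg_part (\<lambda>t. X t \<omega>) a \<tau> m"
          unfolding \<phi>_def using elim(2) by (intro dyadic_sum_neg_part_truncated path elim(3) a \<tau>) auto
        ultimately show "\<forall>\<^sub>F m in sequentially. neg_variation (\<lambda>t. X t \<omega>) a \<tau> - \<eta> \<le> vsum (\<phi> k) a \<tau> m \<omega>"
          by eventually_elim (simp add: vsum_eq_dyadic_sum)
      qed
    qed
    show "AE \<omega> in M. \<forall>\<eta>>0. \<exists>N. \<forall>k m. vsum (\<phi> k) a \<tau> m \<omega> \<le> real N / (real k + 1) + neg_variation (\<lambda>t. X t \<omega>) a \<tau> + \<eta>"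
      using le
    proof eventually_elim
      case (elim \<omega>)
      have "vsum (\<phi> k) a \<tau> m \<omega> \<le> neg_variation (\<lambda>t. X t \<omega>) a \<tau>" for k m
      proof -
        have "vsum (\<phi> k) a \<tau> m \<omega> \<le> dyadic_sum neg_part (\<lambda>t. X t \<omega>) a \<tau> m"
          unfolding vsum_eq_dyadic_sum dyadic_sum_def by (intro sum_mono) (simp add: \<phi>_def)
        then show ?thesis using elim by (meson order_trans)
      qed
      then show ?case by (intro allI impI exI[of _ 0]) (simp add: add_increasing2)
    qed
  qed
  have all: "AE \<omega> in M. \<forall>l i. neg_variation (\<lambda>t. X t \<omega>) (real i / 2 ^ l) (1 / 2 ^ l) = rate \<phi> (1 / 2 ^ l)"
    unfolding AE_all_countable by (intro allI const) auto
  define c where "c = rate \<phi> 1"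
  have block: "AE \<omega> in M. \<forall>l. c = 2 ^ l * rate \<phi> (1 / 2 ^ l)"
    using all bv'
  proof eventually_elim
    case (elim \<omega>)
    have "neg_variation (\<lambda>t. X t \<omega>) 0 1 = c" using elim(1)[rule_format, of 0 0] by (simp add: c_def)
    then show ?case using neg_variation_blocks[of "\<lambda>t. X t \<omega>"] elim by simp
  qed
  have "AE \<omega> in M. mono_on {0..} (\<lambda>t. X t \<omega> + c * t)"
    using all block bv' AE_space
  proof eventually_elim
    case (elim \<omega>)
    show ?case
    proof (rule mono_on_of_dyadic[of _ 1])
      show "cadlag (\<lambda>t. X t \<omega> + c * t)" using elim by (intro cadlag_add_linear path)
      fix k m :: nat
      \<comment> \<open>At refinement 0 the sum has one term, the drop over the whole block.\<close>
      have "dyadic_sum neg_part (\<lambda>t. X t \<omega>) (real k / 2 ^ m) (1 / 2 ^ m) 0 \<le> neg_variation (\<lambda>t. X t \<omega>) (real k / 2 ^ m) (1 / 2 ^ m)"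
        using elim by (intro neg_variation_LIMSEQ) auto
      also have "\<dots> = c / 2 ^ m" using elim(1,2) by (simp add: field_simps)
      finally have "neg_part (X (real k / 2 ^ m + 1 / 2 ^ m) \<omega> - X (real k / 2 ^ m) \<omega>) \<le> c / 2 ^ m"
        by (simp add: dyadic_sum_def)
      moreover have "real k / 2 ^ m + 1 / 2 ^ m = real (Suc k) * 1 / 2 ^ m" by (simp add: field_simps)
      ultimately have "X (real k / 2 ^ m) \<omega> - X (real (Suc k) * 1 / 2 ^ m) \<omega> \<le> c / 2 ^ m"
        by (simp add: neg_part_def)
      moreover have "c * (real (Suc k) * 1 / 2 ^ m) = c * (real k * 1 / 2 ^ m) + c / 2 ^ m" by (simp add: field_simps)
      ultimately show "X (real k * 1 / 2 ^ m) \<omega> + c * (real k * 1 / 2 ^ m) \<le> X (real (Suc k) * 1 / 2 ^ m) \<omega> + c * (real (Suc k) * 1 / 2 ^ m)"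
        by simp
    qed simp
  qed
  then show ?thesis by blast
qed

text \<open>The continuous part over a block is the limit of truncated sums, hence almost surely a
  constant depending on the length only. Additivity makes it linear on dyadic points of one common
  set of paths, and monotonicity extends this to all times.\<close>

lemma mono_imp_cont_part_linear:
  assumes mono: "AE \<omega> in M. mono_on {0..} (\<lambda>t. X t \<omega>)"
  shows "\<exists>b. AE \<omega> in M. \<forall>t\<ge>0. cont_part (\<lambda>t. X t \<omega>) 0 t = b * t"
proof -
  define \<phi> where "\<phi> k x = min (max 0 x) (1 / (real k + 1))" for k :: nat and x :: real
  have vs: "vsum (\<phi> k) a \<tau> m \<omega> =
    (\<Sum>i<2 ^ m. min (X (a + real (Suc i) * \<tau> / 2 ^ m) \<omega> - X (a + real i * \<tau> / 2 ^ m) \<omega>) (1 / (real k + 1)))"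
    if mono: "mono_on {0..} (\<lambda>t. X t \<omega>)" and a: "0 \<le> a" and \<tau>: "0 \<le> \<tau>" for k a \<tau> m \<omega>
    unfolding vsum_def
  proof (rule sum.cong[OF refl])
    fix i :: nat
    have "X (a + real i * \<tau> / 2 ^ m) \<omega> \<le> X (a + real (Suc i) * \<tau> / 2 ^ m) \<omega>"
      using a \<tau> by (intro mono_onD[OF mono]) (auto intro!: divide_right_mono mult_right_mono)
    then show "\<phi> k (X (a + real (Suc i) * \<tau> / 2 ^ m) \<omega> - X (a + real i * \<tau> / 2 ^ m) \<omega>) =
      min (X (a + real (Suc i) * \<tau> / 2 ^ m) \<omega> - X (a + real i * \<tau> / 2 ^ m) \<omega>) (1 / (real k + 1))"
      by (simp add: \<phi>_def)
  qed
  have const: "AE \<omega> in M. cont_part (\<lambda>t. X t \<omega>) a (a + \<tau>) = rate \<phi> \<tau>" if a: "0 \<le> a" and \<tau>: "0 < \<tau>" for a \<tau>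
  proof (rule limit_of_small_sums_constant[OF _ _ _ a less_imp_le[OF \<tau>]])
    show "\<phi> k \<in> borel_measurable borel" for k unfolding \<phi>_def by measurable
    show "0 \<le> \<phi> k x" "\<phi> k x \<le> 1 / (real k + 1)" for k x by (auto simp: \<phi>_def)
    show "AE \<omega> in M. 0 \<le> cont_part (\<lambda>t. X t \<omega>) a (a + \<tau>)"
      using mono AE_space by eventually_elim (use a \<tau> in \<open>auto intro!: cont_part_nonneg path\<close>)
    show "AE \<omega> in M. \<forall>k. \<forall>\<eta>>0. \<forall>\<^sub>F m in sequentially. cont_part (\<lambda>t. X t \<omega>) a (a + \<tau>) - \<eta> \<le> vsum (\<phi> k) a \<tau> m \<omega>"
      using mono AE_space
    proof eventually_elim
      case (elim \<omega>)
      show ?case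
      proof (intro allI impI)
        fix k :: nat and \<eta> :: real assume \<eta>: "0 < \<eta>"
        have "0 < 1 / (real k + 1)" by simp
        from truncated_sum_ge[OF path[OF elim(2)] elim(1) a \<tau> this]
        show "\<forall>\<^sub>F m in sequentially. cont_part (\<lambda>t. X t \<omega>) a (a + \<tau>) - \<eta> \<le> vsum (\<phi> k) a \<tau> m \<omega>"
          unfolding vs[OF elim(1) a less_imp_le[OF \<tau>]]
          by eventually_elim (use \<eta> in linarith)
      qed
    qed
    show "AE \<omega> in M. \<forall>\<eta>>0. \<exists>N. \<forall>k m. vsum (\<phi> k) a \<tau> m \<omega> \<le> real N / (real k + 1) + cont_part (\<lambda>t. X t \<omega>) a (a + \<tau>) + \<eta>"
      using mono AE_space
    proof eventually_elim
      case (elim \<omega>)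
      show ?case
      proof (intro allI impI)
        fix \<eta> :: real assume \<eta>: "0 < \<eta>"
        obtain N where N: "\<And>m e. 0 \<le> e \<Longrightarrow>
          (\<Sum>i<2 ^ m. min (X (a + real (Suc i) * \<tau> / 2 ^ m) \<omega> - X (a + real i * \<tau> / 2 ^ m) \<omega>) e)
            \<le> real N * e + cont_part (\<lambda>t. X t \<omega>) a (a + \<tau>) + \<eta>"
          by (rule truncated_sum_le_cont_part[OF path[OF elim(2)] elim(1) a less_imp_le[OF \<tau>] \<eta>]) (rule that, blast)
        show "\<exists>N. \<forall>k m. vsum (\<phi> k) a \<tau> m \<omega> \<le> real N / (real k + 1) + cont_part (\<lambda>t. X t \<omega>) a (a + \<tau>) + \<eta>"
        proof (intro exI[of _ N] allI)
          fix k m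
          show "vsum (\<phi> k) a \<tau> m \<omega> \<le> real N / (real k + 1) + cont_part (\<lambda>t. X t \<omega>) a (a + \<tau>) + \<eta>"
            unfolding vs[OF elim(1) a less_imp_le[OF \<tau>]] using N[of "1 / (real k + 1)" m] by simp
        qed
      qed
    qed
  qed
  define b where "b = rate \<phi> 1"
  have all: "AE \<omega> in M. \<forall>l i. cont_part (\<lambda>t. X t \<omega>) (real i / 2 ^ l) (real i / 2 ^ l + 1 / 2 ^ l) = rate \<phi> (1 / 2 ^ l)"
    unfolding AE_all_countable by (intro allI const) auto
  have "AE \<omega> in M. \<forall>t\<ge>0. cont_part (\<lambda>t. X t \<omega>) 0 t = b * t"
    using all mono AE_space
  proof eventually_elim
    case (elim \<omega>)
    define F where "F = (\<lambda>t. X t \<omega>)"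
    note F = path[OF elim(3), folded F_def] elim(2)[folded F_def]
    have step: "cont_part F 0 (real i / 2 ^ l) = real i * rate \<phi> (1 / 2 ^ l)" for i l :: nat
    proof (induction i)
      case (Suc i)
      have "real (Suc i) / 2 ^ l = real i / 2 ^ l + 1 / 2 ^ l" by (simp add: add_divide_distrib)
      moreover have "cont_part F 0 (real i / 2 ^ l + 1 / 2 ^ l) = cont_part F 0 (real i / 2 ^ l) + cont_part F (real i / 2 ^ l) (real i / 2 ^ l + 1 / 2 ^ l)"
        by (rule cont_part_add[OF F]) auto
      ultimately show ?case using Suc elim(1) by (simp add: F_def algebra_simps)
    qed (simp add: cont_part_def)
    have b: "b = cont_part F 0 1" using step[of 1 0] by (simp add: b_def)
    have b0: "0 \<le> b" unfolding b by (rule cont_part_nonneg[OF F]) auto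
    have dyadic: "cont_part F 0 (real i / 2 ^ l) = b * (real i / 2 ^ l)" for i l :: nat
      using step[of i l] step[of "2 ^ l" l] b by (simp add: field_simps)
    show ?case
    proof (intro allI impI)
      fix t :: real assume t: "0 \<le> t"
      \<comment> \<open>The time \<open>t\<close> lies between two neighbouring dyadic points, and
        both functions are nondecreasing and agree there.\<close>
      have bound: "\<bar>cont_part F 0 t - b * t\<bar> \<le> b / 2 ^ l" for l
      proof -
        define i where "i = nat \<lfloor>t * 2 ^ l\<rfloor>"
        have i: "real i \<le> t * 2 ^ l" "t * 2 ^ l \<le> real i + 1" using t by (auto simp: i_def)
        have i': "real i / 2 ^ l \<le> t" "t \<le> real (Suc i) / 2 ^ l" using i by (auto simp: field_simps)
        have lo: "cont_part F 0 (real i / 2 ^ l) \<le> cont_part F 0 t"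
          using cont_part_add[OF F _ _ i'(1), of 0] cont_part_nonneg[OF F _ i'(1)] by simp
        have hi: "cont_part F 0 t \<le> cont_part F 0 (real (Suc i) / 2 ^ l)"
          using cont_part_add[OF F _ t i'(2)] cont_part_nonneg[OF F t i'(2)] by simp
        have "b * (real i / 2 ^ l) \<le> b * t" by (rule mult_left_mono[OF i'(1) b0])
        moreover have "b * t \<le> b * (real (Suc i) / 2 ^ l)" by (rule mult_left_mono[OF i'(2) b0])
        moreover have "b * (real (Suc i) / 2 ^ l) = b * (real i / 2 ^ l) + b / 2 ^ l" by (simp add: field_simps)
        ultimately show ?thesis using lo hi unfolding dyadic by linarith
      qed
      have "(\<lambda>l. b / 2 ^ l) \<longlonglongrightarrow> 0" by (rule LIMSEQ_divide_realpow_zero) simp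
      then have "\<bar>cont_part F 0 t - b * t\<bar> \<le> 0" using bound by (intro LIMSEQ_le_const) auto
      then show "cont_part (\<lambda>t. X t \<omega>) 0 t = b * t" by (simp add: F_def)
    qed
  qed
  then show ?thesis by blast
qed

text \<open>A subordinator plus a nonnegative drift would again be nondecreasing.\<close>

lemma has_drift_negative:
  assumes "\<not> subordinator M X" "has_drift M X (- c)"
  shows "0 < c"
proof (rule ccontr)
  assume c: "\<not> 0 < c"
  obtain Y where Y: "subordinator M Y" "AE \<omega> in M. \<forall>t\<ge>0. X t \<omega> = Y t \<omega> + - c * t"
    using assms(2) by (auto simp: has_drift_def driftless_subordinator_def)
  have "AE \<omega> in M. mono_on {0..} (\<lambda>t. Y t \<omega>)" using Y(1) by (simp add: subordinator_def)
  with Y(2) have "AE \<omega> in M. mono_on {0..} (\<lambda>t. X t \<omega>)"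
  proof eventually_elim
    case (elim \<omega>)
    show ?case
    proof (rule mono_onI)
      fix s t :: real assume st: "s \<in> {0..}" "t \<in> {0..}" "s \<le> t"
      then have "Y s \<omega> \<le> Y t \<omega>" by (intro mono_onD[OF elim(2)])
      moreover have "- c * s \<le> - c * t" using c st by (intro mult_left_mono) auto
      ultimately show "X s \<omega> \<le> X t \<omega>" using elim(1) st by simp
    qed
  qed
  then have "subordinator M X" using levy by (simp add: subordinator_def)
  then show False using assms(1) by simp
qed

text \<open>Adding \<open>c * t\<close> makes the paths nondecreasing; subtracting the linear
  continuous part \<open>b * t\<close> leaves exactly the sum of the jumps, a driftless
  subordinator. The drift is \<open>b - c\<close>, and it is negative because \<open>X\<close> is
  not a subordinator.\<close>

lemma bounded_variation_imp_has_drift: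
  assumes jmp: "AE \<omega> in M. \<forall>t>0. 0 \<le> jump (\<lambda>u. X u \<omega>) t" and bv: "bounded_variation M X" and ns: "\<not> subordinator M X"
  shows "\<exists>c>0. has_drift M X (- c)"
proof -
  obtain c where c: "AE \<omega> in M. mono_on {0..} (\<lambda>t. X t \<omega> + c * t)"
    using bounded_variation_imp_mono[OF jmp bv] by blast
  interpret Z: levy M "\<lambda>t \<omega>. X t \<omega> + c * t" by (rule add_linear)
  obtain b where b: "AE \<omega> in M. \<forall>t\<ge>0. cont_part (\<lambda>t. X t \<omega> + c * t) 0 t = b * t"
    using Z.mono_imp_cont_part_linear[OF c] by blast
  interpret Y: levy M "\<lambda>t \<omega>. X t \<omega> + (c - b) * t" by (rule add_linear)
  have paths: "AE \<omega> in M. mono_on {0..} (\<lambda>t. X t \<omega> + (c - b) * t) \<and>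
    (\<forall>t\<ge>0. (jump (\<lambda>t. X t \<omega> + (c - b) * t) has_sum X t \<omega> + (c - b) * t) {0<..t})"
    using c b X_0 AE_space
  proof eventually_elim
    case (elim \<omega>)
    define F where "F = (\<lambda>t. X t \<omega> + c * t)"
    have F: "cadlag F" "mono_on {0..} F" using elim by (auto simp: F_def intro!: cadlag_add_linear path)
    have Fc: "cont_part F 0 t = b * t" if "0 \<le> t" for t using elim(2) that by (simp add: F_def)
    have YF: "X t \<omega> + (c - b) * t = F t - b * t" for t by (simp add: F_def algebra_simps)
    show ?case
    proof (intro conjI allI impI mono_onI)
      fix s t :: real assume st: "s \<in> {0..}" "t \<in> {0..}" "s \<le> t"
      then have "cont_part F s t = b * t - b * s" using cont_part_add[OF F, of 0 s t] Fc by simp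
      then show "X s \<omega> + (c - b) * s \<le> X t \<omega> + (c - b) * t"
        unfolding YF using cont_part_le_increment[OF F, of s t] st by simp
    next
      fix t :: real assume t: "0 \<le> t"
      have "(jump F has_sum infsum (jump F) {0<..t}) {0<..t}"
        using jumps_summable[OF F, of 0 t] t by (intro has_sum_infsum) auto
      also have "infsum (jump F) {0<..t} = X t \<omega> + (c - b) * t"
        unfolding YF using Fc[OF t] elim(3) by (simp add: cont_part_def F_def)
      finally show "(jump (\<lambda>t. X t \<omega> + (c - b) * t) has_sum X t \<omega> + (c - b) * t) {0<..t}"
        by (rule has_sum_cong[THEN iffD1, rotated]) (simp add: F_def jump_add_linear path elim)
    qed
  qed
  have "subordinator M (\<lambda>t \<omega>. X t \<omega> + (c - b) * t)"
    using Y.levy paths by (auto simp: subordinator_def elim: eventually_mono)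
  then have "driftless_subordinator M (\<lambda>t \<omega>. X t \<omega> + (c - b) * t)"
    using paths by (auto simp: driftless_subordinator_def elim: eventually_mono)
  moreover have "X t \<omega> = X t \<omega> + (c - b) * t + - (c - b) * t" for t \<omega> by (simp add: algebra_simps)
  ultimately have "has_drift M X (- (c - b))" unfolding has_drift_def by blast
  then show ?thesis using has_drift_negative[OF ns] by blast
qed

end

section \<open>Staying nonpositive with positive probability gives bounded variation\<close>

lemma bounded_variation_on_subset:
  assumes "bounded_variation_on a b f" "c \<le> b"
  shows "bounded_variation_on a c f"
proof -
  have "{a..c} \<subseteq> {a..b}" using assms by auto
  then show ?thesis using assms(1) unfolding bounded_variation_on_def by (meson order_trans)
qed

context levy
begin

text \<open>If the first step and the path after it are each no lower than \<open>-K\<close>, the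
  final position is at least \<open>- 2 * K\<close>. So \<open>first_step_bound\<close> bounds the
  expected truncated drop of one step times \<open>\<kappa>\<close> by \<open>2 * K\<close> divided
  by the number of steps; summing over the steps gives \<open>2 * K / \<kappa>\<close> on every
  grid. The truncation makes the bound finite without information on moments.\<close>

lemma nn_integral_neg_increments_bounded:
  assumes t: "0 < t" and K: "0 \<le> K"
    and pos: "emeasure M {\<omega>\<in>space M. (SUP u\<in>{0..t}. X u \<omega>) \<le> 0 \<and> - K \<le> (INF u\<in>{0..t}. X u \<omega>)} \<noteq> 0"
  shows "\<exists>C::real. \<forall>m. (\<integral>\<^sup>+\<omega>. ennreal (vsum (\<lambda>x. neg_part x * indicator {- K..} x) 0 t m \<omega>) \<partial>M) \<le> ennreal C"
proof -
  define \<kappa> where "\<kappa> = measure M {\<omega>\<in>space M. (SUP u\<in>{0..t}. X u \<omega>) \<le> 0 \<and> - K \<le> (INF u\<in>{0..t}. X u \<omega>)}"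
  have \<kappa>: "0 < \<kappa>" using pos by (simp add: \<kappa>_def emeasure_eq_measure zero_less_measure_iff)
  have "(\<integral>\<^sup>+\<omega>. ennreal (vsum (\<lambda>x. neg_part x * indicator {- K..} x) 0 t m \<omega>) \<partial>M) \<le> ennreal (2 * K / \<kappa>)" for m
  proof -
    define h where "h = t / 2 ^ m"
    have h: "0 < h" "h \<le> t" using t by (auto simp: h_def field_simps)
    have [measurable]: "(\<lambda>\<omega>. SUP u\<in>{0..t - h}. X u \<omega>) \<in> borel_measurable M" "X (t - h) \<in> borel_measurable M"
      using h by (auto intro!: SUP_measurable X_measurable)
    define a where "a = (\<integral>\<^sup>+\<omega>. ennreal (neg_part (X h \<omega>)) * indicator {- K..} (X h \<omega>) \<partial>M)"
    have "ennreal \<kappa> \<le> emeasure M {\<omega>\<in>space M. (SUP u\<in>{0..t - h}. X u \<omega>) \<le> 0 \<and> X (t - h) \<omega> \<in> {- K..}}"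
      unfolding \<kappa>_def emeasure_eq_measure[symmetric]
    proof (rule emeasure_mono)
      show "{\<omega>\<in>space M. (SUP u\<in>{0..t}. X u \<omega>) \<le> 0 \<and> - K \<le> (INF u\<in>{0..t}. X u \<omega>)} \<subseteq>
        {\<omega>\<in>space M. (SUP u\<in>{0..t - h}. X u \<omega>) \<le> 0 \<and> X (t - h) \<omega> \<in> {- K..}}"
      proof
        fix \<omega> assume w: "\<omega> \<in> {\<omega>\<in>space M. (SUP u\<in>{0..t}. X u \<omega>) \<le> 0 \<and> - K \<le> (INF u\<in>{0..t}. X u \<omega>)}"
        then have "(SUP u\<in>{0..t - h}. X u \<omega>) \<le> (SUP u\<in>{0..t}. X u \<omega>)"
          using h by (intro cSUP_subset_mono cadlag_bdd path) auto
        moreover have "(INF u\<in>{0..t}. X u \<omega>) \<le> X (t - h) \<omega>"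
          using w h by (intro cINF_lower cadlag_bdd path) auto
        ultimately show "\<omega> \<in> {\<omega>\<in>space M. (SUP u\<in>{0..t - h}. X u \<omega>) \<le> 0 \<and> X (t - h) \<omega> \<in> {- K..}}"
          using w by simp
      qed
    qed measurable
    then have "a * ennreal \<kappa> \<le> a * emeasure M {\<omega>\<in>space M. (SUP u\<in>{0..t - h}. X u \<omega>) \<le> 0 \<and> X (t - h) \<omega> \<in> {- K..}}"
      by (rule mult_left_mono) simp
    also have "\<dots> \<le> (\<integral>\<^sup>+\<omega>. ennreal (neg_part (X t \<omega>) / real (2 ^ m)) * indicator {- 2 * K..} (X t \<omega>) \<partial>M)"
      using first_step_bound[OF t, of "2 ^ m" "{- K..}" "{- K..}" "{- 2 * K..}"] by (simp add: h_def a_def)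
    also have "\<dots> \<le> (\<integral>\<^sup>+\<omega>. ennreal (2 * K / 2 ^ m) \<partial>M)"
    proof (rule nn_integral_mono)
      fix \<omega>
      show "ennreal (neg_part (X t \<omega>) / real (2 ^ m)) * indicator {- 2 * K..} (X t \<omega>) \<le> ennreal (2 * K / 2 ^ m)"
        using K by (cases "- 2 * K \<le> X t \<omega>") (auto simp: neg_part_def intro!: ennreal_leI divide_right_mono)
    qed
    finally have le: "a * ennreal \<kappa> \<le> ennreal (2 * K / 2 ^ m)" by (simp add: emeasure_space_1)
    have "(\<integral>\<^sup>+\<omega>. ennreal (vsum (\<lambda>x. neg_part x * indicator {- K..} x) 0 t m \<omega>) \<partial>M) =
      ennreal (2 ^ m) * (\<integral>\<^sup>+\<omega>. ennreal (neg_part (X h \<omega>) * indicator {- K..} (X h \<omega>)) \<partial>M)"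
      unfolding h_def
    proof (rule nn_integral_vsum)
      show "(\<lambda>x. neg_part x * indicator {- K..} x) \<in> borel_measurable borel" unfolding neg_part_def by measurable
    qed (use t in auto)
    also have "(\<integral>\<^sup>+\<omega>. ennreal (neg_part (X h \<omega>) * indicator {- K..} (X h \<omega>)) \<partial>M) = a"
      unfolding a_def by (intro nn_integral_cong) (simp add: indicator_def)
    also have "a = a * ennreal \<kappa> * ennreal (1 / \<kappa>)"
      using \<kappa> by (simp add: mult.assoc ennreal_mult''[symmetric])
    also have "ennreal (2 ^ m) * \<dots> \<le> ennreal (2 ^ m) * (ennreal (2 * K / 2 ^ m) * ennreal (1 / \<kappa>))"
      by (intro mult_left_mono mult_right_mono le) auto
    also have "\<dots> = ennreal (2 ^ m * (2 * K / 2 ^ m * (1 / \<kappa>)))"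
      using K \<kappa> by (simp only: ennreal_mult zero_le_power zero_le_numeral mult_nonneg_nonneg divide_nonneg_nonneg zero_le_divide_1_iff less_imp_le)
    also have "2 ^ m * (2 * K / 2 ^ m * (1 / \<kappa>)) = 2 * K / \<kappa>" by simp
    finally show ?thesis .
  qed
  then show ?thesis by blast
qed

text \<open>By Fatou's lemma the truncated negative variation is almost surely finite along the
  grids, simultaneously for all large integers \<open>K\<close>. The increments of a given path over
  \<open>[0, t]\<close> are bounded, so for some \<open>K\<close> the truncation does nothing to
  that path.\<close>

lemma bounded_variation_on_if_prob_SUP_eq_0:
  assumes t: "0 < t" and pos: "0 < emeasure M {\<omega>\<in>space M. (SUP u\<in>{0..t}. X u \<omega>) = 0}"
  shows "AE \<omega> in M. bounded_variation_on 0 t (\<lambda>s. X s \<omega>)"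
proof -
  note [measurable] = X_measurable[OF less_imp_le[OF t]] SUP_measurable[OF less_imp_le[OF t]] INF_measurable[OF less_imp_le[OF t]]
  define E where "E K = {\<omega>\<in>space M. (SUP u\<in>{0..t}. X u \<omega>) \<le> 0 \<and> - real K \<le> (INF u\<in>{0..t}. X u \<omega>)}" for K :: nat
  have [measurable]: "E K \<in> sets M" for K unfolding E_def by measurable
  \<comment> \<open>Every path is bounded below on \<open>[0, t]\<close>, so the events
    \<open>E K\<close> exhaust the event that the supremum is 0, and one of them has positive
    probability.\<close>
  obtain K0 where K0: "emeasure M (E K0) \<noteq> 0"
  proof (rule ccontr)
    assume "\<not> thesis"
    then have "\<forall>K. emeasure M (E K) = 0" using that by blast
    then have "emeasure M (\<Union>K. E K) = 0" by (intro emeasure_UN_eq_0) auto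
    moreover have "{\<omega>\<in>space M. (SUP u\<in>{0..t}. X u \<omega>) = 0} \<subseteq> (\<Union>K. E K)"
    proof
      fix \<omega> assume w: "\<omega> \<in> {\<omega>\<in>space M. (SUP u\<in>{0..t}. X u \<omega>) = 0}"
      obtain K :: nat where "- (INF u\<in>{0..t}. X u \<omega>) \<le> real K" using real_arch_simple by blast
      then have "- real K \<le> (INF u\<in>{0..t}. X u \<omega>)" by linarith
      then show "\<omega> \<in> (\<Union>K. E K)" using w unfolding E_def by auto
    qed
    then have "emeasure M {\<omega>\<in>space M. (SUP u\<in>{0..t}. X u \<omega>) = 0} \<le> emeasure M (\<Union>K. E K)" by (rule emeasure_mono) measurable
    ultimately show False using pos by simp
  qed
  define \<psi> where "\<psi> K x = neg_part x * indicator {- real K..} x" for K :: nat and x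
  have \<psi>m: "\<psi> K \<in> borel_measurable borel" for K unfolding \<psi>_def neg_part_def by measurable
  note [measurable] = vsum_measurable[OF \<psi>m order.refl less_imp_le[OF t]]
  have "AE \<omega> in M. liminf (\<lambda>m. ennreal (vsum (\<psi> K) 0 t m \<omega>)) \<noteq> \<infinity>" if K: "K0 \<le> K" for K
  proof (rule nn_integral_PInf_AE)
    have "emeasure M (E K0) \<le> emeasure M (E K)"
      using K by (intro emeasure_mono) (auto simp: E_def)
    then have "emeasure M (E K) \<noteq> 0" using K0 by auto
    then have "\<exists>C::real. \<forall>m. (\<integral>\<^sup>+\<omega>. ennreal (vsum (\<lambda>x. neg_part x * indicator {- real K..} x) 0 t m \<omega>) \<partial>M) \<le> ennreal C"
      unfolding E_def by (rule nn_integral_neg_increments_bounded[OF t of_nat_0_le_iff])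
    moreover have "\<psi> K = (\<lambda>x. neg_part x * indicator {- real K..} x)" by (simp add: \<psi>_def fun_eq_iff)
    ultimately obtain C where C: "\<And>m. (\<integral>\<^sup>+\<omega>. ennreal (vsum (\<psi> K) 0 t m \<omega>) \<partial>M) \<le> ennreal C"
      by (simp only:) blast
    have "(\<integral>\<^sup>+\<omega>. liminf (\<lambda>m. ennreal (vsum (\<psi> K) 0 t m \<omega>)) \<partial>M) \<le> liminf (\<lambda>m. \<integral>\<^sup>+\<omega>. ennreal (vsum (\<psi> K) 0 t m \<omega>) \<partial>M)"
      by (rule nn_integral_liminf) measurable
    also have "\<dots> \<le> ennreal C" using C by (intro Liminf_le) auto
    finally show "(\<integral>\<^sup>+\<omega>. liminf (\<lambda>m. ennreal (vsum (\<psi> K) 0 t m \<omega>)) \<partial>M) \<noteq> \<infinity>" by (auto simp: top_unique)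
  qed measurable
  then have "AE \<omega> in M. \<forall>K. K0 \<le> K \<longrightarrow> liminf (\<lambda>m. ennreal (vsum (\<psi> K) 0 t m \<omega>)) \<noteq> \<infinity>"
    unfolding AE_all_countable by (auto intro!: AE_impI)
  then show ?thesis
    using AE_space
  proof eventually_elim
    case (elim \<omega>)
    obtain L where L: "\<And>u. 0 \<le> u \<Longrightarrow> u \<le> t \<Longrightarrow> \<bar>X u \<omega>\<bar> \<le> L"
      by (rule cadlag_bounded[OF path[OF elim(2)], of t]) (rule that, blast)
    \<comment> \<open>Two values in \<open>[-L, L]\<close> differ by at most \<open>2 * L\<close>,
      so truncation at such a bound is inactive.\<close>
    obtain K1 :: nat where K1: "2 * L \<le> real K1" using real_arch_simple by blast
    define K where "K = max K0 K1"
    have eq: "vsum (\<psi> K) 0 t m \<omega> = dyadic_sum neg_part (\<lambda>s. X s \<omega>) 0 t m" for m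
      unfolding vsum_eq_dyadic_sum dyadic_sum_def
    proof (rule sum.cong[OF refl])
      fix k :: nat assume k: "k \<in> {..<2 ^ m}"
      have in_range: "0 + real j * t / 2 ^ m \<le> t" if "j \<le> 2 ^ m" for j :: nat
      proof -
        have "real j \<le> real (2 ^ m)" using that by (rule of_nat_mono)
        then have "real j * t \<le> 2 ^ m * t" using t by (intro mult_right_mono) auto
        then show ?thesis by (simp add: divide_le_eq mult.commute)
      qed
      have "\<bar>X (0 + real (Suc k) * t / 2 ^ m) \<omega>\<bar> \<le> L" "\<bar>X (0 + real k * t / 2 ^ m) \<omega>\<bar> \<le> L"
        using k t by (intro L in_range; simp)+
      then have "- real K \<le> X (0 + real (Suc k) * t / 2 ^ m) \<omega> - X (0 + real k * t / 2 ^ m) \<omega>"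
        using K1 unfolding K_def by linarith
      then show "\<psi> K (X (0 + real (Suc k) * t / 2 ^ m) \<omega> - X (0 + real k * t / 2 ^ m) \<omega>) =
        neg_part (X (0 + real (Suc k) * t / 2 ^ m) \<omega> - X (0 + real k * t / 2 ^ m) \<omega>)"
        by (simp add: \<psi>_def)
    qed
    define l where "l = liminf (\<lambda>m. ennreal (vsum (\<psi> K) 0 t m \<omega>))"
    have "l \<noteq> \<infinity>" unfolding l_def using elim(1) by (simp add: K_def)
    then obtain C where C: "0 \<le> C" "l = ennreal C" by (cases l) auto
    \<comment> \<open>The dyadic sums increase with \<open>m\<close>, so a finite lower limit bounds
      them all.\<close>
    have "dyadic_sum neg_part (\<lambda>s. X s \<omega>) 0 t m \<le> C" for m
    proof -
      have "ennreal (dyadic_sum neg_part (\<lambda>s. X s \<omega>) 0 t m) \<le> l"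
        unfolding l_def eq
      proof (rule Liminf_bounded, rule eventually_sequentiallyI[of m])
        fix m' assume "m \<le> m'"
        then show "ennreal (dyadic_sum neg_part (\<lambda>s. X s \<omega>) 0 t m) \<le> ennreal (dyadic_sum neg_part (\<lambda>s. X s \<omega>) 0 t m')"
          by (intro ennreal_leI incseqD[OF incseq_dyadic_sum_neg_part])
      qed
      then show ?thesis using C by simp
    qed
    then show "bounded_variation_on 0 t (\<lambda>s. X s \<omega>)"
      by (intro bounded_variation_of_dyadic[OF path[OF elim(2)] t, of C]) (simp add: dyadic_sum_def)
  qed
qed

lemma bounded_variation_if_prob_SUP_eq_0:
  assumes "\<And>t. 0 < t \<Longrightarrow> 0 < emeasure M {\<omega>\<in>space M. (SUP u\<in>{0..t}. X u \<omega>) = 0}"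
  shows "bounded_variation M X"
proof -
  have "AE \<omega> in M. \<forall>n. bounded_variation_on 0 (real (Suc n)) (\<lambda>s. X s \<omega>)"
    unfolding AE_all_countable using assms by (intro allI bounded_variation_on_if_prob_SUP_eq_0) auto
  then show ?thesis
    unfolding bounded_variation_def
  proof eventually_elim
    case (elim \<omega>)
    show ?case
    proof (intro allI impI)
      fix t :: real assume "0 \<le> t"
      obtain n :: nat where "t \<le> real n" using real_arch_simple by blast
      then have "t \<le> real (Suc n)" by simp
      then show "bounded_variation_on 0 t (\<lambda>s. X s \<omega>)" using elim bounded_variation_on_subset by blast
    qed
  qed
qed

end

section \<open>The formulas in terms of the given densities\<close>

context spectrally_positive_levy
begin

lemma low_density_eq:
  "low_density t y z = (\<integral>\<^sup>+ s\<in>{0<..<t}. ennreal (y / s) * p s (- y) * p (t - s) (y + z) \<partial>lborel)"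
  unfolding low_density_def
proof (rule nn_integral_cong)
  fix s
  show "indicator {0<..<t} s * (ennreal (y / s) * q s (- y) * q (t - s) (y + z)) =
    ennreal (y / s) * p s (- y) * p (t - s) (y + z) * indicator {0<..<t} s"
    by (cases "s \<in> {0<..<t}") (simp_all add: q_def)
qed

lemma emeasure_SUP:
  assumes t: "0 < t" and x: "regular' t x \<or> chapman_kolmogorov p \<and> 0 \<le> x"
    and B [measurable]: "B \<in> sets borel" "B \<subseteq> {..<x}"
  shows "emeasure M {\<omega>\<in>space M. (SUP u\<in>{0..t}. X u \<omega>) > x \<and> X t \<omega> \<in> B} =
    (\<integral>\<^sup>+z. low_density t (x - z) z * indicator B z \<partial>lborel)"
proof -
  note [measurable] = X_measurable[OF less_imp_le[OF t]] SUP_measurable[OF less_imp_le[OF t]]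
  have "emeasure M {\<omega>\<in>space M. (SUP u\<in>{0..t}. X u \<omega>) > x \<and> X t \<omega> \<in> B} =
    (\<integral>\<^sup>+\<omega>. indicator {\<omega>\<in>space M. (SUP u\<in>{0..t}. X u \<omega>) > x \<and> X t \<omega> \<in> B} \<omega> \<partial>M)"
    by (rule nn_integral_indicator[symmetric]) measurable
  also have "\<dots> = (\<integral>\<^sup>+\<omega>. (if (SUP u\<in>{0..t}. X u \<omega>) > x \<and> X t \<omega> \<in> B then 1 else 0) \<partial>M)"
    by (rule nn_integral_cong) (auto simp: indicator_def)
  also have "\<dots> = (\<integral>\<^sup>+z. indicator B z * low_density t (x - z) z \<partial>lborel)"
    using x regular'_SUP[OF _ t B] emeasure_SUP_chapman_kolmogorov[OF _ t _ B] by blast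
  finally show ?thesis by (simp add: mult.commute)
qed

text \<open>Almost every level satisfies the formula for the infimum and the one for the supremum,
  so one null set serves both. Under the Chapman-Kolmogorov equation the formulas hold at every
  level and the empty set can be taken.\<close>

lemma passage_laws:
  assumes t: "0 < t" and ns: "\<not> subordinator M X"
  shows "\<exists>N\<in>null_sets lborel. (chapman_kolmogorov p \<longrightarrow> N = {}) \<and>
        (\<forall>x. x \<notin> N \<and> x > 0 \<longrightarrow> (\<forall>B\<in>sets borel. B \<subseteq> {-x..} \<longrightarrow>
           emeasure M {\<omega> \<in> space M. (INF u\<in>{0..t}. X u \<omega>) < -x \<and> X t \<omega> \<in> B} =
           (\<integral>\<^sup>+ z\<in>B. (\<integral>\<^sup>+ s\<in>{0<..<t}. ennreal (x / s) * p s (-x) * p (t - s) (x + z) \<partial>lborel) \<partial>lborel))) \<and>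
        (\<forall>x. x \<notin> N \<and> x \<ge> 0 \<longrightarrow> (\<forall>B\<in>sets borel. B \<subseteq> {..<x} \<longrightarrow>
           emeasure M {\<omega> \<in> space M. (SUP u\<in>{0..t}. X u \<omega>) > x \<and> X t \<omega> \<in> B} =
           (\<integral>\<^sup>+ z\<in>B. (\<integral>\<^sup>+ s\<in>{0<..<t}. ennreal ((x - z) / s) * p s (z - x) * p (t - s) x \<partial>lborel) \<partial>lborel)))"
proof -
  have "AE x in lborel. (0 < x \<longrightarrow> regular t x) \<and> regular' t x"
    by (intro AE_conjI AE_regular AE_regular' t)
  then obtain N0 where N0: "{x\<in>space lborel. \<not> ((0 < x \<longrightarrow> regular t x) \<and> regular' t x)} \<subseteq> N0"
    "emeasure lborel N0 = 0" "N0 \<in> sets lborel"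
    by (rule AE_E)
  define N where "N = (if chapman_kolmogorov p then {} else N0)"
  have N: "N \<in> null_sets lborel" using N0 by (auto simp: N_def null_setsI)
  have INF: "emeasure M {\<omega>\<in>space M. (INF u\<in>{0..t}. X u \<omega>) < - x \<and> X t \<omega> \<in> B} =
      (\<integral>\<^sup>+ z\<in>B. (\<integral>\<^sup>+ s\<in>{0<..<t}. ennreal (x / s) * p s (-x) * p (t - s) (x + z) \<partial>lborel) \<partial>lborel)"
    if x: "x \<notin> N" "0 < x" and B: "B \<in> sets borel" for x B
  proof (cases "chapman_kolmogorov p")
    case True
    then show ?thesis using emeasure_INF_chapman_kolmogorov[OF True ns t x(2) B] by (simp add: low_density_eq)
  next
    case False
    then have "regular t x" using x N0 by (auto simp: N_def)
    then show ?thesis using regular_emeasure[OF _ t B] by (simp add: low_density_eq)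
  qed
  have SUP: "emeasure M {\<omega>\<in>space M. (SUP u\<in>{0..t}. X u \<omega>) > x \<and> X t \<omega> \<in> B} =
      (\<integral>\<^sup>+ z\<in>B. (\<integral>\<^sup>+ s\<in>{0<..<t}. ennreal ((x - z) / s) * p s (z - x) * p (t - s) x \<partial>lborel) \<partial>lborel)"
    if x: "x \<notin> N" "0 \<le> x" and B: "B \<in> sets borel" "B \<subseteq> {..<x}" for x B
  proof -
    have "regular' t x \<or> chapman_kolmogorov p \<and> 0 \<le> x"
      using x N0 by (auto simp: N_def split: if_splits)
    from emeasure_SUP[OF t this B] show ?thesis by (simp add: low_density_eq)
  qed
  show ?thesis using N INF SUP by (intro bexI[of _ N]) (auto simp: N_def)
qed

lemma emeasure_SUP_eq_0:
  assumes d: "has_drift M X (- c)" "0 < c" and t: "0 < t" and B: "B \<in> sets borel"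
  shows "emeasure M {\<omega>\<in>space M. (SUP u\<in>{0..t}. X u \<omega>) = 0 \<and> X t \<omega> \<in> B} =
    (\<integral>\<^sup>+ z\<in>B. ennreal (neg_part z / (c * t)) * p t z \<partial>lborel)"
proof -
  note [measurable] = X_measurable[OF less_imp_le[OF t]] B
  have [measurable]: "neg_part \<in> borel_measurable borel" unfolding neg_part_def[abs_def] by measurable
  define P where "P = emeasure M {\<omega>\<in>space M. (SUP u\<in>{0..t}. X u \<omega>) = 0 \<and> X t \<omega> \<in> B}"
  have "P = ennreal (1 / c) * (ennreal c * P)"
    using d(2) by (simp add: mult.assoc[symmetric] ennreal_mult''[symmetric])
  also have "ennreal c * P = (\<integral>\<^sup>+\<omega>. ennreal (neg_part (X t \<omega>) / t) * indicator B (X t \<omega>) \<partial>M)"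
    unfolding P_def by (rule prob_SUP_eq_0[OF d t B])
  also have "\<dots> = (\<integral>\<^sup>+z. q t z * (ennreal (neg_part z / t) * indicator B z) \<partial>lborel)"
    by (rule nn_integral_X[OF t]) measurable
  also have "ennreal (1 / c) * \<dots> = (\<integral>\<^sup>+z. ennreal (1 / c) * (q t z * (ennreal (neg_part z / t) * indicator B z)) \<partial>lborel)"
    by (rule nn_integral_cmult[symmetric]) measurable
  also have "\<dots> = (\<integral>\<^sup>+ z\<in>B. ennreal (neg_part z / (c * t)) * p t z \<partial>lborel)"
  proof (rule nn_integral_cong)
    fix z
    have "ennreal (neg_part z / (c * t)) = ennreal (1 / c * (neg_part z / t))" by simp
    also have "\<dots> = ennreal (1 / c) * ennreal (neg_part z / t)" using d(2) t by (intro ennreal_mult) auto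
    finally show "ennreal (1 / c) * (q t z * (ennreal (neg_part z / t) * indicator B z)) =
      ennreal (neg_part z / (c * t)) * p t z * indicator B z" using t by (simp add: q_def mult_ac)
  qed
  finally show ?thesis unfolding P_def .
qed

end

theorem theorem3:
  fixes M :: "'a measure"
    and X :: "real \<Rightarrow> 'a \<Rightarrow> real"
    and p :: "real \<Rightarrow> real \<Rightarrow> ennreal"
  assumes "levy_process M X"
    and "spectrally_positive M X"
    and "\<not> subordinator M X"
    and "transition_density M X p"
  shows
    "(\<forall>t>0. \<exists>N\<in>null_sets lborel. (chapman_kolmogorov p \<longrightarrow> N = {}) \<and>
        (\<forall>x. x \<notin> N \<and> x > 0 \<longrightarrow> (\<forall>B\<in>sets borel. B \<subseteq> {-x..} \<longrightarrow>
           emeasure M {\<omega> \<in> space M. (INF u\<in>{0..t}. X u \<omega>) < -x \<and> X t \<omega> \<in> B} =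
           (\<integral>\<^sup>+ z\<in>B. (\<integral>\<^sup>+ s\<in>{0<..<t}. ennreal (x / s) * p s (-x) * p (t - s) (x + z) \<partial>lborel) \<partial>lborel))) \<and>
        (\<forall>x. x \<notin> N \<and> x \<ge> 0 \<longrightarrow> (\<forall>B\<in>sets borel. B \<subseteq> {..<x} \<longrightarrow>
           emeasure M {\<omega> \<in> space M. (SUP u\<in>{0..t}. X u \<omega>) > x \<and> X t \<omega> \<in> B} =
           (\<integral>\<^sup>+ z\<in>B. (\<integral>\<^sup>+ s\<in>{0<..<t}. ennreal ((x - z) / s) * p s (z - x) * p (t - s) x \<partial>lborel) \<partial>lborel))))
     \<and>
     (bounded_variation M X \<longleftrightarrow>
        (\<forall>t\<ge>0. measure M {\<omega> \<in> space M. (SUP u\<in>{0..t}. X u \<omega>) = 0} > 0 \<and>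
               measure M {\<omega> \<in> space M. (INF u\<in>{0..t}. X u \<omega>) = X t \<omega>} > 0))
     \<and>
     (bounded_variation M X \<longrightarrow>
        (\<exists>c>0. has_drift M X (-c)) \<and>
        (\<forall>c. has_drift M X (-c) \<longrightarrow> (\<forall>t>0. \<forall>B\<in>sets borel. B \<subseteq> {..<0} \<longrightarrow>
           emeasure M {\<omega> \<in> space M. (SUP u\<in>{0..t}. X u \<omega>) = 0 \<and> X t \<omega> \<in> B} =
             (\<integral>\<^sup>+ z\<in>B. ennreal (- z / (c * t)) * p t z \<partial>lborel) \<and>
           emeasure M {\<omega> \<in> space M. (INF u\<in>{0..t}. X u \<omega>) = X t \<omega> \<and> X t \<omega> \<in> B} =
             (\<integral>\<^sup>+ z\<in>B. ennreal (- z / (c * t)) * p t z \<partial>lborel))))"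
proof -
  interpret spectrally_positive_levy M X p
    by unfold_locales (fact assms)+
  note ns = assms(3)
  have drift: "\<exists>c>0. has_drift M X (- c)" if "bounded_variation M X"
    using bounded_variation_imp_has_drift[OF jumps that ns] .
  have bv: "bounded_variation M X \<longleftrightarrow>
        (\<forall>t\<ge>0. measure M {\<omega> \<in> space M. (SUP u\<in>{0..t}. X u \<omega>) = 0} > 0 \<and>
               measure M {\<omega> \<in> space M. (INF u\<in>{0..t}. X u \<omega>) = X t \<omega>} > 0)"
  proof
    assume "bounded_variation M X"
    then obtain c where c: "0 < c" "has_drift M X (- c)" using drift by blast
    show "\<forall>t\<ge>0. measure M {\<omega> \<in> space M. (SUP u\<in>{0..t}. X u \<omega>) = 0} > 0 \<and>
               measure M {\<omega> \<in> space M. (INF u\<in>{0..t}. X u \<omega>) = X t \<omega>} > 0"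
    proof (intro allI impI)
      fix t :: real assume t: "0 \<le> t"
      have "0 < emeasure M {\<omega> \<in> space M. (SUP u\<in>{0..t}. X u \<omega>) = 0}" by (rule prob_SUP_eq_0_positive[OF c(2,1) t])
      moreover have "emeasure M {\<omega> \<in> space M. (SUP u\<in>{0..t}. X u \<omega>) = 0} = emeasure M {\<omega> \<in> space M. (INF u\<in>{0..t}. X u \<omega>) = X t \<omega>}"
        using emeasure_SUP_eq_0_reversal[OF t, of UNIV] by simp
      ultimately show "measure M {\<omega> \<in> space M. (SUP u\<in>{0..t}. X u \<omega>) = 0} > 0 \<and>
               measure M {\<omega> \<in> space M. (INF u\<in>{0..t}. X u \<omega>) = X t \<omega>} > 0"
        by (simp add: emeasure_eq_measure)
    qed
  next
    assume pos: "\<forall>t\<ge>0. measure M {\<omega> \<in> space M. (SUP u\<in>{0..t}. X u \<omega>) = 0} > 0 \<and>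
               measure M {\<omega> \<in> space M. (INF u\<in>{0..t}. X u \<omega>) = X t \<omega>} > 0"
    show "bounded_variation M X"
      by (rule bounded_variation_if_prob_SUP_eq_0) (use pos in \<open>simp add: emeasure_eq_measure\<close>)
  qed
  \<comment> \<open>The drift \<open>-c\<close> is arbitrary here; \<open>c\<close> is positive by
    \<open>has_drift_negative\<close>. The law for the infimum is carried over from the supremum by
    time reversal.\<close>
  have laws: "emeasure M {\<omega> \<in> space M. (SUP u\<in>{0..t}. X u \<omega>) = 0 \<and> X t \<omega> \<in> B} =
             (\<integral>\<^sup>+ z\<in>B. ennreal (- z / (c * t)) * p t z \<partial>lborel) \<and>
           emeasure M {\<omega> \<in> space M. (INF u\<in>{0..t}. X u \<omega>) = X t \<omega> \<and> X t \<omega> \<in> B} =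
             (\<integral>\<^sup>+ z\<in>B. ennreal (- z / (c * t)) * p t z \<partial>lborel)"
    if c: "has_drift M X (- c)" and t: "0 < t" and B: "B \<in> sets borel" "B \<subseteq> {..<0}" for c t B
  proof -
    have "(\<integral>\<^sup>+ z\<in>B. ennreal (neg_part z / (c * t)) * p t z \<partial>lborel) = (\<integral>\<^sup>+ z\<in>B. ennreal (- z / (c * t)) * p t z \<partial>lborel)"
      using B(2) by (intro nn_integral_cong) (auto simp: neg_part_def indicator_def subset_eq)
    then have "emeasure M {\<omega> \<in> space M. (SUP u\<in>{0..t}. X u \<omega>) = 0 \<and> X t \<omega> \<in> B} =
             (\<integral>\<^sup>+ z\<in>B. ennreal (- z / (c * t)) * p t z \<partial>lborel)"
      using emeasure_SUP_eq_0[OF c has_drift_negative[OF ns c] t B(1)] by simp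
    then show ?thesis using emeasure_SUP_eq_0_reversal[OF less_imp_le[OF t] B(1)] by simp
  qed
  have passage: "\<forall>t>0. \<exists>N\<in>null_sets lborel. (chapman_kolmogorov p \<longrightarrow> N = {}) \<and>
        (\<forall>x. x \<notin> N \<and> x > 0 \<longrightarrow> (\<forall>B\<in>sets borel. B \<subseteq> {-x..} \<longrightarrow>
           emeasure M {\<omega> \<in> space M. (INF u\<in>{0..t}. X u \<omega>) < -x \<and> X t \<omega> \<in> B} =
           (\<integral>\<^sup>+ z\<in>B. (\<integral>\<^sup>+ s\<in>{0<..<t}. ennreal (x / s) * p s (-x) * p (t - s) (x + z) \<partial>lborel) \<partial>lborel))) \<and>
        (\<forall>x. x \<notin> N \<and> x \<ge> 0 \<longrightarrow> (\<forall>B\<in>sets borel. B \<subseteq> {..<x} \<longrightarrow>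
           emeasure M {\<omega> \<in> space M. (SUP u\<in>{0..t}. X u \<omega>) > x \<and> X t \<omega> \<in> B} =
           (\<integral>\<^sup>+ z\<in>B. (\<integral>\<^sup>+ s\<in>{0<..<t}. ennreal ((x - z) / s) * p s (z - x) * p (t - s) x \<partial>lborel) \<partial>lborel)))"
    by (intro allI impI passage_laws ns)
  show ?thesis
  proof (rule conjI[OF passage conjI[OF bv impI]], rule conjI)
    show "\<exists>c>0. has_drift M X (- c)" if "bounded_variation M X" using that by (rule drift)
  qed (intro allI impI ballI laws)
qed

end
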